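(* Let $0<a<b<\infty$, let $\mathbb{X}=\{x\in\mathbb{R}^2: a<|x|<b\}$ and let $k\in\mathbb{Z}$. Then there exists $u=u(x;k)\in A_k$ such that $$\mathbb{F}[u;\mathbb{X}]=\inf_{v\in A_k}\mathbb{F}[v;\mathbb{X}].$$ Furthermore, for each such minimiser $u$ there exists $\delta=\delta(u)>0$ such that $\mathbb{F}[u;\mathbb{X}]\le\mathbb{F}[v;\mathbb{X}]$ for all $v\in\mathcal{A}_\phi(\mathbb{X})$ satisfying $\|u-v\|_{L^1(\mathbb{X})}<\delta$.
   Context: The energy is $\mathbb{F}[u;\mathbb{X}]=\frac12\int_{\mathbb{X}}\frac{|\nabla u|^2}{|u|^2}\,dx$, where $|\nabla u|$ is the Hilbert-Schmidt norm. The admissible class is $\mathcal{A}_\phi(\mathbb{X})=\{u\in W^{1,2}(\mathbb{X},\mathbb{R}^2):\det\nabla u=1\text{ a.e. in }\mathbb{X},\ u(x)=x\text{ on }\partial\mathbb{X}\text{ in the sense of traces}\}$. It is known that every $u\in\mathcal{A}_\phi(\mathbb{X})$ has a representative (again denoted $u$) that is a continuous map of $\overline{\mathbb{X}}$ into $\overline{\mathbb{X}}$ and equals the identity on $\partial\mathbb{X}$. For a continuous $f:\overline{\mathbb{X}}\to\overline{\mathbb{X}}$ equal to the identity on $\partial\mathbb{X}$, $\mathbf{deg}(f|f|^{-1})\in\mathbb{Z}$ is the winding number about the origin of the closed curve $[a,b]\ni r\mapsto f/|f|$ evaluated at the point with polar coordinates $(r,\theta)$, for fixed $\theta$ (independent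 of $\theta$). For $k\in\mathbb{Z}$ the homotopy class is $A_k=\{u\in\mathcal{A}_\phi(\mathbb{X}):\mathbf{deg}(u|u|^{-1})=k\}$. *)

theory Defs
  imports "HOL-Analysis.Analysis" "HOL-Complex_Analysis.Complex_Analysis"
begin

section \<open>Smooth functions and test functions\<close>

text \<open>\<open>Ck k f\<close>: \<open>f\<close> is \<open>k\<close> times continuously differentiable on the whole space.\<close>

primrec Ck :: "nat \<Rightarrow> ('a::euclidean_space \<Rightarrow> 'b::real_normed_vector) \<Rightarrow> bool" where
  "Ck 0 f \<longleftrightarrow> continuous_on UNIV f"
| "Ck (Suc k) f \<longleftrightarrow>
     (\<forall>x. f differentiable (at x)) \<and> (\<forall>h. Ck k (\<lambda>x. frechet_derivative f (at x) h))"

definition smooth :: "('a::euclidean_space \<Rightarrow> 'b::real_normed_vector) \<Rightarrow> bool" where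
  "smooth f \<longleftrightarrow> (\<forall>k. Ck k f)"

definition test_function :: "'a::euclidean_space set \<Rightarrow> ('a \<Rightarrow> real) \<Rightarrow> bool" where
  "test_function X \<phi> \<longleftrightarrow>
     smooth \<phi> \<and> compact (closure {x. \<phi> x \<noteq> 0}) \<and> closure {x. \<phi> x \<noteq> 0} \<subseteq> X"


section \<open>The Sobolev space of square integrable functions with square integrable gradient\<close>

definition square_integrable ::
    "'a::euclidean_space set \<Rightarrow> ('a \<Rightarrow> 'b::euclidean_space) \<Rightarrow> bool" where
  "square_integrable X f \<longleftrightarrow>
     f \<in> borel_measurable (lebesgue_on X) \<and> integrable (lebesgue_on X) (\<lambda>x. (norm (f x))\<^sup>2)"

definition L2_dist_sq ::
    "'a measure \<Rightarrow> ('a \<Rightarrow> 'b::real_normed_vector) \<Rightarrow> ('a \<Rightarrow> 'b) \<Rightarrow> ennreal" where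
  "L2_dist_sq M f g = (\<integral>\<^sup>+x. ennreal ((norm (f x - g x))\<^sup>2) \<partial>M)"

definition L1_dist ::
    "'a measure \<Rightarrow> ('a \<Rightarrow> 'b::real_normed_vector) \<Rightarrow> ('a \<Rightarrow> 'b) \<Rightarrow> ennreal" where
  "L1_dist M f g = (\<integral>\<^sup>+x. ennreal (norm (f x - g x)) \<partial>M)"

text \<open>The matrix field \<open>G\<close> is a weak gradient of \<open>u\<close>: the entry \<open>G x $ i $ j\<close> is the weak
  \<open>j\<close>-th partial derivative of the \<open>i\<close>-th component of \<open>u\<close>.\<close>

definition has_weak_gradient ::
    "(real^'n) set \<Rightarrow> (real^'n \<Rightarrow> real^'m) \<Rightarrow> (real^'n \<Rightarrow> real^'n^'m) \<Rightarrow> bool" where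
  "has_weak_gradient X u G \<longleftrightarrow>
     (\<forall>K. compact K \<and> K \<subseteq> X \<longrightarrow> u absolutely_integrable_on K \<and> G absolutely_integrable_on K) \<and>
     (\<forall>i j \<phi>. test_function X \<phi> \<longrightarrow>
        (LINT x|lebesgue_on X. u x $ i * frechet_derivative \<phi> (at x) (axis j 1)) =
        - (LINT x|lebesgue_on X. G x $ i $ j * \<phi> x))"

text \<open>Weak gradients on an open set are unique up to null sets, so the choice below is immaterial
  wherever the gradient occurs only under integrals or almost-everywhere quantifiers.\<close>

definition weak_gradient ::
    "(real^'n) set \<Rightarrow> (real^'n \<Rightarrow> real^'m) \<Rightarrow> real^'n \<Rightarrow> real^'n^'m" where
  "weak_gradient X u = (SOME G. has_weak_gradient X u G)"

definition W12 :: "(real^'n) set \<Rightarrow> (real^'n \<Rightarrow> real^'m) set" where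
  "W12 X = {u. square_integrable X u \<and> (\<exists>G. has_weak_gradient X u G) \<and>
               square_integrable X (weak_gradient X u)}"


section \<open>The annulus, boundary traces and the admissible class\<close>

definition annulus :: "real \<Rightarrow> real \<Rightarrow> (real^2) set" where
  "annulus a b = {x. a < norm x \<and> norm x < b}"

definition polar :: "real \<Rightarrow> real \<Rightarrow> real^2" where
  "polar r \<theta> = vector [r * cos \<theta>, r * sin \<theta>]"

text \<open>The trace operator is the continuous extension, from the \<open>W12\<close> norm on the annulus to the
  \<open>L2\<close> norm on its boundary, of the restriction map defined on smooth functions on the closure.
  Accordingly \<open>g\<close> is the trace of \<open>u\<close> iff the boundary values of some smooth sequence converging
  to \<open>u\<close> in \<open>W12\<close> converge to \<open>g\<close> in \<open>L2\<close>. The boundary consists of two circles, which are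
  parametrised by the angle; the constant arc length density does not affect convergence.\<close>

definition has_trace ::
    "real \<Rightarrow> real \<Rightarrow> (real^2 \<Rightarrow> real^'m) \<Rightarrow> (real^2 \<Rightarrow> real^'m) \<Rightarrow> bool" where
  "has_trace a b u g \<longleftrightarrow> (\<exists>w :: nat \<Rightarrow> real^2 \<Rightarrow> real^'m.
     (\<forall>n. smooth (w n)) \<and>
     (\<lambda>n. L2_dist_sq (lebesgue_on (annulus a b)) (w n) u) \<longlonglongrightarrow> 0 \<and>
     (\<lambda>n. L2_dist_sq (lebesgue_on (annulus a b))
            (\<lambda>x. jacobian (w n) (at x)) (weak_gradient (annulus a b) u)) \<longlonglongrightarrow> 0 \<and>
     (\<forall>r \<in> {a, b}.
        (\<lambda>n. L2_dist_sq (lebesgue_on {0..2*pi})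
               (\<lambda>\<theta>. w n (polar r \<theta>)) (\<lambda>\<theta>. g (polar r \<theta>))) \<longlonglongrightarrow> 0))"

definition admissible :: "real \<Rightarrow> real \<Rightarrow> (real^2 \<Rightarrow> real^2) set" where
  "admissible a b = {u \<in> W12 (annulus a b).
     (AE x in lebesgue_on (annulus a b). det (weak_gradient (annulus a b) u x) = 1) \<and>
     has_trace a b u (\<lambda>x. x)}"


section \<open>The energy\<close>

text \<open>The norm on \<open>real^2^2\<close> is the Hilbert-Schmidt norm. The quotient is taken in \<open>ennreal\<close>, so a
  nonzero gradient at a zero of \<open>u\<close> gives an infinite integrand.\<close>

definition energy :: "(real^2) set \<Rightarrow> (real^2 \<Rightarrow> real^2) \<Rightarrow> ennreal" where
  "energy X u =
     (\<integral>\<^sup>+x. ennreal ((norm (weak_gradient X u x))\<^sup>2) / ennreal ((norm (u x))\<^sup>2) \<partial>lebesgue_on X) / 2"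


section \<open>Degree and homotopy classes\<close>

definition continuous_rep :: "real \<Rightarrow> real \<Rightarrow> (real^2 \<Rightarrow> real^2) \<Rightarrow> (real^2 \<Rightarrow> real^2) \<Rightarrow> bool" where
  "continuous_rep a b u f \<longleftrightarrow>
     (AE x in lebesgue_on (annulus a b). f x = u x) \<and>
     continuous_on (closure (annulus a b)) f \<and>
     f ` closure (annulus a b) \<subseteq> closure (annulus a b) \<and>
     (\<forall>x \<in> frontier (annulus a b). f x = x)"

definition to_complex :: "real^2 \<Rightarrow> complex" where
  "to_complex x = Complex (x $ 1) (x $ 2)"

text \<open>The closed curve \<open>r \<mapsto> f/|f|\<close> along the ray of angle \<open>\<theta>\<close>, with \<open>[a,b]\<close> rescaled to \<open>[0,1]\<close> as
  the library's paths require. The library's winding number is complex valued.\<close>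

definition radial_curve :: "real \<Rightarrow> real \<Rightarrow> (real^2 \<Rightarrow> real^2) \<Rightarrow> real \<Rightarrow> real \<Rightarrow> complex" where
  "radial_curve a b f \<theta> t =
     (let y = f (polar (a + t * (b - a)) \<theta>) in to_complex (y /\<^sub>R norm y))"

definition degree_on_ray :: "real \<Rightarrow> real \<Rightarrow> (real^2 \<Rightarrow> real^2) \<Rightarrow> real \<Rightarrow> complex" where
  "degree_on_ray a b f \<theta> = winding_number (radial_curve a b f \<theta>) 0"

text \<open>The continuous representative is unique on the closed annulus, and its degree does not depend
  on the angle, so the two quantifiers below do not matter.\<close>

definition homotopy_class :: "real \<Rightarrow> real \<Rightarrow> int \<Rightarrow> (real^2 \<Rightarrow> real^2) set" where
  "homotopy_class a b k = {u \<in> admissible a b.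
     \<exists>f. continuous_rep a b u f \<and> (\<forall>\<theta>. degree_on_ray a b f \<theta> = of_int k)}"

end

theory Submission
  imports Defs
begin

text \<open>In polar coordinates write a map of the annulus as \<open>V(r, t)\<close>, with values in \<open>\<complex>\<close>. The constraint
  \<open>det = 1\<close> bounds \<open>1 / |V|\<^sup>2\<close> by the energy density, so finite energy makes \<open>1 / |V|\<^sup>2\<close> integrable;
  Stokes' theorem for the angular form of \<open>V\<close> then shows that the logarithmic change
  \<open>\<integral> V\<^sub>r / V dr\<close> along a ray is the same for almost every ray, namely
  \<open>ln (b / a) + 2 \<pi> \<i> k\<close> with \<open>k\<close> the degree, and that on almost every circle \<open>\<integral> V\<^sub>t / V dt = 2 \<pi> \<i>\<close>.
  The energy is the integral of \<open>r |V\<^sub>r / V|\<^sup>2 + |V\<^sub>t / V|\<^sup>2 / r\<close>, up to the factor \<open>1 / 2\<close>, and expanding the square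
  around the (constant multiple of \<open>1 / r\<close>) logarithmic derivative of a rigid twist bounds it below by
  a number which the twist of degree \<open>k\<close> attains.

  For the stability, a map \<open>v\<close> with less energy than \<open>u\<close> that is close to \<open>u\<close> in \<open>L\<^sup>1\<close> has the same degree
  as \<open>u\<close>: were the degrees different, the phase difference of the two maps would sweep a full circle
  along almost every ray, which bounds the \<open>L\<^sup>1\<close> distance from below in terms of the energies.
  So \<open>v\<close> satisfies the same lower bound as \<open>u\<close>, a contradiction.\<close>

text \<open>The angular form is singular at 0, and the smooth maps supplied by the trace may vanish,
  so the argument runs with the denominator \<open>|z|^2 + e\<close>. The exterior derivative is
  then no longer zero, but \<open>2 e det / (|z|^2 + e)^2\<close>. Two limits are taken in a fixed
  order: first the approximations tend to the map at fixed \<open>e\<close>, under bounds that blow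
  up with \<open>1 / e\<close>; then \<open>e\<close> tends to 0, under bounds by the energy
  density. A second obstacle is that a trace gives boundary values only in \<open>L^2\<close>,
  whereas an argument on almost every single ray needs exact end points. The approximations are
  therefore glued to the identity in thin collars along the two circles. The degree of a competitor
  is read off its weak derivatives along almost every ray, so that stability is proved for arbitrary
  admissible maps. To turn a small distance into a small angle, one of the two maps compared has to
  stay away from 0. The minimiser does, since its continuous representative takes values in the
  closed annulus.\<close>

section \<open>Calculus of maps with continuous derivatives up to a given order\<close>

lemma Ck_SucD: "Ck (Suc k) f \<Longrightarrow> Ck k f"
proof (induction k arbitrary: f)
  case 0
  then show ?case
    by (auto simp: continuous_on_eq_continuous_at differentiable_imp_continuous_within)
next
  case (Suc k)
  then show ?case by (metis Ck.simps(2))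
qed

text \<open>Trades the chosen \<open>frechet_derivative\<close> for any explicit derivative; the two
  agree because derivatives on the whole space are unique.\<close>

lemma Ck_SucI:
  assumes "\<And>x. (f has_derivative f' x) (at x)" "\<And>h. Ck k (\<lambda>x. f' x h)"
  shows "Ck (Suc k) f"
proof -
  have "frechet_derivative f (at x) = f' x" for x
    using frechet_derivative_at[OF assms(1)] by simp
  then show ?thesis using assms by (auto simp: differentiable_def)
qed

lemma Ck_Suc_has_derivative:
  assumes "Ck (Suc k) f"
  shows "(f has_derivative frechet_derivative f (at x)) (at x)"
  using assms by (simp flip: frechet_derivative_works)

lemma Ck_Suc_derivative: "Ck (Suc k) f \<Longrightarrow> Ck k (\<lambda>x. frechet_derivative f (at x) h)"
  by simp

lemma Ck_const: "Ck k (\<lambda>_. c)"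
proof (induction k arbitrary: c)
  case (Suc k)
  show ?case by (rule Ck_SucI[where f' = "\<lambda>_ _. 0"]) (auto intro: Suc)
qed auto

lemma Ck_bounded_linear_compose:
  "bounded_linear L \<Longrightarrow> Ck k f \<Longrightarrow> Ck k (\<lambda>x. L (f x))"
proof (induction k arbitrary: f)
  case 0
  then show ?case
    by (auto intro: bounded_linear.continuous_on)
next
  case (Suc k)
  show ?case
    by (rule Ck_SucI[where f' = "\<lambda>x h. L (frechet_derivative f (at x) h)"])
       (use Suc Ck_Suc_has_derivative[OF Suc(3)] in \<open>auto intro!: bounded_linear.has_derivative[OF Suc(2)]\<close>)
qed

lemma Ck_ident: "Ck k (\<lambda>x. x)"
proof (cases k)
  case (Suc n)
  show ?thesis unfolding Suc
    by (rule Ck_SucI[where f' = "\<lambda>_ h. h"]) (auto intro: Ck_const)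
qed auto

lemma Ck_bounded_linear: "bounded_linear L \<Longrightarrow> Ck k L"
  using Ck_bounded_linear_compose[OF _ Ck_ident] .

lemma Ck_add: "Ck k f \<Longrightarrow> Ck k g \<Longrightarrow> Ck k (\<lambda>x. f x + g x)"
proof (induction k arbitrary: f g)
  case 0
  then show ?case by (auto intro: continuous_intros)
next
  case (Suc k)
  show ?case
    by (rule Ck_SucI[where f' = "\<lambda>x h. frechet_derivative f (at x) h + frechet_derivative g (at x) h"])
       (use Suc Ck_Suc_has_derivative[OF Suc(2)] Ck_Suc_has_derivative[OF Suc(3)]
        in \<open>auto intro!: has_derivative_add\<close>)
qed

lemma Ck_mult:
  fixes f g :: "'a::euclidean_space \<Rightarrow> real"
  shows "Ck k f \<Longrightarrow> Ck k g \<Longrightarrow> Ck k (\<lambda>x. f x * g x)"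
proof (induction k arbitrary: f g)
  case 0
  then show ?case by (auto intro: continuous_intros)
next
  case (Suc k)
  show ?case
  proof (rule Ck_SucI)
    show "((\<lambda>x. f x * g x) has_derivative
       (\<lambda>h. f x * frechet_derivative g (at x) h + frechet_derivative f (at x) h * g x)) (at x)" for x
      by (rule has_derivative_mult; rule Ck_Suc_has_derivative; fact Suc)
    show "Ck k (\<lambda>x. f x * frechet_derivative g (at x) h + frechet_derivative f (at x) h * g x)" for h
      by (intro Ck_add Suc.IH Ck_Suc_derivative Suc.prems Ck_SucD)
  qed
qed

text \<open>\<open>F\<close> lists the successive derivatives of one function. Differentiating
  \<open>F m\<close> after \<open>f\<close> produces \<open>F (Suc m)\<close>, so the induction on
  \<open>k\<close> has to run for all \<open>m\<close> at once.\<close>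

lemma Ck_compose_real:
  fixes F :: "nat \<Rightarrow> real \<Rightarrow> real"
  assumes F: "\<And>m t. (F m has_real_derivative F (Suc m) t) (at t)"
  shows "Ck k f \<Longrightarrow> Ck k (\<lambda>x. F m (f x))"
proof (induction k arbitrary: m)
  case 0
  have "continuous_on UNIV (F m)"
    by (rule DERIV_continuous_on[OF F])
  then show ?case using 0
    by (auto intro: continuous_on_compose2)
next
  case (Suc k)
  show ?case
  proof (rule Ck_SucI)
    show "((\<lambda>x. F m (f x)) has_derivative (\<lambda>h. F (Suc m) (f x) * frechet_derivative f (at x) h)) (at x)" for x
      using has_derivative_compose[OF Ck_Suc_has_derivative[OF Suc(2), of x] F[of m "f x", unfolded has_field_derivative_def]] .
    show "Ck k (\<lambda>x. F (Suc m) (f x) * frechet_derivative f (at x) h)" for h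
      by (intro Ck_mult Suc.IH Ck_Suc_derivative Suc.prems Ck_SucD)
  qed
qed

text \<open>Differentiating a cosine shifts its phase by \<open>pi / 2\<close>, so all derivatives
  belong to one explicit family; the sine is its member of index 3.\<close>

lemma Ck_cos_sin:
  fixes f :: "'a::euclidean_space \<Rightarrow> real"
  assumes "Ck k f"
  shows Ck_cos: "Ck k (\<lambda>x. cos (f x))" and Ck_sin: "Ck k (\<lambda>x. sin (f x))"
proof -
  have F: "\<And>m t. ((\<lambda>t. cos (t + real m * (pi/2))) has_real_derivative cos (t + real (Suc m) * (pi/2))) (at t)"
  proof -
    fix m :: nat and t :: real
    have "cos (t + real (Suc m) * (pi/2)) = cos ((t + real m * (pi/2)) + pi/2)"
      by (simp add: algebra_simps add_divide_distrib)
    also have "\<dots> = - sin (t + real m * (pi/2))"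
      by (simp add: cos_add)
    finally show "((\<lambda>t. cos (t + real m * (pi/2))) has_real_derivative cos (t + real (Suc m) * (pi/2))) (at t)"
      by (auto intro!: derivative_eq_intros)
  qed
  show "Ck k (\<lambda>x. cos (f x))"
    using Ck_compose_real[where F="\<lambda>m t. cos (t + real m * (pi/2))" and m=0, OF F assms] by simp
  have "sin t = cos (t + real 3 * (pi/2))" for t
  proof -
    have "t + real 3 * (pi/2) = t + pi + pi/2" by simp
    then show ?thesis by (simp only: cos_add sin_add) simp
  qed
  then show "Ck k (\<lambda>x. sin (f x))"
    using Ck_compose_real[where F="\<lambda>m t. cos (t + real m * (pi/2))" and m=3, OF F assms] by simp
qed

lemma Ck_sum: "(\<And>i. i \<in> I \<Longrightarrow> Ck k (f i)) \<Longrightarrow> Ck k (\<lambda>x. \<Sum>i\<in>I. f i x)"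
  by (induction I rule: infinite_finite_induct) (auto intro: Ck_const Ck_add)

lemma Ck_prod:
  fixes f :: "'i \<Rightarrow> 'a::euclidean_space \<Rightarrow> real"
  shows "(\<And>i. i \<in> I \<Longrightarrow> Ck k (f i)) \<Longrightarrow> Ck k (\<lambda>x. \<Prod>i\<in>I. f i x)"
  by (induction I rule: infinite_finite_induct) (auto intro: Ck_const Ck_mult)

lemma Ck_power:
  fixes f :: "'a::euclidean_space \<Rightarrow> real"
  shows "Ck k f \<Longrightarrow> Ck k (\<lambda>x. f x ^ n)"
  by (induction n) (auto intro: Ck_const Ck_mult)

lemma Ck_vec:
  fixes f :: "'a::euclidean_space \<Rightarrow> real^'n"
  assumes "\<And>i. Ck k (\<lambda>x. f x $ i)"
  shows "Ck k f"
proof -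
  have "Ck k (\<lambda>x. \<Sum>i\<in>UNIV. f x $ i *\<^sub>R (axis i 1 :: real^'n))"
    by (rule Ck_sum) (rule Ck_bounded_linear_compose[OF bounded_linear_scaleR_left assms])
  moreover have "(\<lambda>x. \<Sum>i\<in>UNIV. f x $ i *\<^sub>R (axis i 1 :: real^'n)) = f"
    by (simp add: fun_eq_iff vec_eq_iff axis_def sum.delta if_distrib cong: if_cong)
  ultimately show ?thesis by simp
qed

lemma smooth_has_derivative: "smooth f \<Longrightarrow> (f has_derivative frechet_derivative f (at x)) (at x)"
  using Ck_Suc_has_derivative unfolding smooth_def by blast

lemma smooth_derivative: "smooth f \<Longrightarrow> smooth (\<lambda>x. frechet_derivative f (at x) h)"
  using Ck_Suc_derivative unfolding smooth_def by blast

lemma smooth_continuous_on: "smooth f \<Longrightarrow> continuous_on S f"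
  unfolding smooth_def by (metis Ck.simps(1) continuous_on_subset top_greatest)

section \<open>Bump functions\<close>

text \<open>The derivatives of \<open>exp (- 1 / t)\<close> are polynomials in \<open>1 / t\<close>
  times that function. Admitting an arbitrary polynomial factor gives a family closed under
  differentiation.\<close>

definition exp_bump :: "real poly \<Rightarrow> real \<Rightarrow> real" where
  "exp_bump p t = (if t > 0 then poly p (1/t) * exp (- (1/t)) else 0)"

lemma poly_mult_exp_tendsto_0: "((\<lambda>s. poly p s * exp (- s)) \<longlongrightarrow> 0) at_top" for p :: "real poly"
proof (induction p)
  case (pCons c p)
  have *: "((\<lambda>s. s ^ n * exp (- s)) \<longlongrightarrow> (0::real)) at_top" for n :: nat
    using tendsto_power_div_exp_0[of n] by (simp only: exp_minus divide_inverse)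
  have "((\<lambda>s. \<Sum>i\<le>degree q. coeff q i * (s ^ i * exp (-s))) \<longlongrightarrow> (\<Sum>i\<le>degree q. coeff q i * 0)) at_top"
    for q :: "real poly"
    by (intro tendsto_intros *)
  from this[of "pCons c p"] show ?case
    unfolding poly_altdef by (simp add: sum_distrib_right mult.assoc)
qed simp

text \<open>With \<open>s = 1 / t\<close> one has \<open>ds/dt = - s^2\<close>, whence the factor
  \<open>[:0,0,1:]\<close>, the polynomial \<open>X^2\<close>. The delicate point is
  \<open>t = 0\<close>, where exponential decay beats every power of \<open>1 / t\<close>.\<close>

lemma exp_bump_has_derivative:
  "(exp_bump p has_real_derivative exp_bump ([:0,0,1:] * (p - pderiv p)) t) (at t)"
proof -
  consider "t > 0" | "t < 0" | "t = 0" by linarith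
  then show ?thesis
  proof cases
    case 1
    have "((\<lambda>t. poly p (1/t) * exp (- (1/t))) has_real_derivative exp_bump ([:0,0,1:] * (p - pderiv p)) t) (at t)"
      using 1
      by (auto intro!: derivative_eq_intros DERIV_chain2[OF poly_DERIV, of "\<lambda>t. 1/t"]
          simp: exp_bump_def field_simps power2_eq_square)
    moreover have "\<forall>\<^sub>F x in nhds t. poly p (1/x) * exp (- (1/x)) = exp_bump p x"
      using eventually_nhds_in_open[of "{0<..}" t] 1 by (auto elim!: eventually_mono simp: exp_bump_def)
    ultimately show ?thesis
      by (subst DERIV_cong_ev[OF refl _ refl, of _ "\<lambda>t. poly p (1/t) * exp (- (1/t))"])
         (auto elim: eventually_mono)
  next
    case 2
    have "((\<lambda>_. 0) has_real_derivative exp_bump ([:0,0,1:] * (p - pderiv p)) t) (at t)"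
      using 2 by (simp add: exp_bump_def)
    moreover have "\<forall>\<^sub>F x in nhds t. 0 = exp_bump p x"
      using eventually_nhds_in_open[of "{..<0}" t] 2 by (auto elim!: eventually_mono simp: exp_bump_def)
    ultimately show ?thesis
      by (subst DERIV_cong_ev[OF refl _ refl, of _ "\<lambda>t. 0"]) (auto elim: eventually_mono)
  next
    case 3
    have l: "((\<lambda>h. exp_bump p h / h) \<longlongrightarrow> 0) (at_left 0)"
      by (rule Lim_transform_eventually[OF tendsto_const])
         (auto simp: exp_bump_def eventually_at_filter)
    \<comment> \<open>For \<open>h > 0\<close> and \<open>s = 1 / h\<close> the difference quotient
      at 0 is \<open>s p(s) exp (- s)\<close>, and \<open>pCons 0 p\<close> is the polynomial
      \<open>X p\<close>.\<close>
    have "((\<lambda>s. poly (pCons 0 p) s * exp (- s)) \<longlongrightarrow> 0) at_top"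
      by (rule poly_mult_exp_tendsto_0)
    then have "((\<lambda>h. poly (pCons 0 p) (inverse h) * exp (- inverse h)) \<longlongrightarrow> 0) (at_right 0)"
      by (rule filterlim_compose[OF _ filterlim_inverse_at_top_right])
    then have r: "((\<lambda>h. exp_bump p h / h) \<longlongrightarrow> 0) (at_right 0)"
      by (rule Lim_transform_eventually)
         (auto simp: exp_bump_def eventually_at_filter divide_inverse mult_ac)
    show ?thesis
      using filterlim_split_at[OF l r] 3 by (simp add: DERIV_def exp_bump_def)
  qed
qed

fun exp_bump_poly :: "nat \<Rightarrow> real poly" where
  "exp_bump_poly 0 = 1"
| "exp_bump_poly (Suc n) = [:0,0,1:] * (exp_bump_poly n - pderiv (exp_bump_poly n))"

lemma Ck_exp_bump: "Ck k f \<Longrightarrow> Ck k (\<lambda>x. exp_bump 1 (f x))"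
  using Ck_compose_real[where F="\<lambda>m. exp_bump (exp_bump_poly m)" and m=0] exp_bump_has_derivative by simp

text \<open>The dilation by \<open>n\<close> makes these functions converge to the indicator function of \<open>box c d\<close>.\<close>

definition box_bump :: "'a::euclidean_space \<Rightarrow> 'a \<Rightarrow> nat \<Rightarrow> 'a \<Rightarrow> real" where
  "box_bump c d n x =
     (\<Prod>i\<in>Basis. exp_bump 1 (real n * (x \<bullet> i - c \<bullet> i)) * exp_bump 1 (real n * (d \<bullet> i - x \<bullet> i)))"

lemma exp_bump_bounds: "0 \<le> exp_bump 1 t" "exp_bump 1 t \<le> 1"
  by (auto simp: exp_bump_def)

lemma smooth_box_bump: "smooth (box_bump c d n)"
proof -
  have 1: "Ck k (\<lambda>x. real n * (x \<bullet> i - c \<bullet> i))" for k i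
    using Ck_add[OF Ck_bounded_linear[of "\<lambda>x. real n * (x \<bullet> i)"] Ck_const[of _ "- real n * (c \<bullet> i)"]]
    by (simp add: algebra_simps bounded_linear_mult_right bounded_linear_inner_left
        bounded_linear_compose[OF bounded_linear_mult_right bounded_linear_inner_left])
  have 2: "Ck k (\<lambda>x. real n * (d \<bullet> i - x \<bullet> i))" for k i
    using Ck_add[OF Ck_bounded_linear[of "\<lambda>x. - real n * (x \<bullet> i)"] Ck_const[of _ "real n * (d \<bullet> i)"]]
    by (simp add: algebra_simps bounded_linear_mult_right bounded_linear_inner_left
        bounded_linear_compose[OF bounded_linear_mult_right bounded_linear_inner_left]
        bounded_linear_minus)
  show ?thesis
    unfolding smooth_def box_bump_def by (intro allI Ck_prod Ck_mult Ck_exp_bump 1 2)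
qed

lemma box_bump_eq_0: "x \<notin> box c d \<Longrightarrow> box_bump c d n x = 0"
proof -
  assume "x \<notin> box c d"
  then obtain i where "i \<in> Basis" "\<not> (c \<bullet> i < x \<bullet> i \<and> x \<bullet> i < d \<bullet> i)"
    unfolding mem_box by blast
  then show ?thesis
    unfolding box_bump_def by (intro prod_zero) (auto simp: exp_bump_def zero_less_mult_iff)
qed

lemma box_bump_bounds: "0 \<le> box_bump c d n x" "box_bump c d n x \<le> 1"
  unfolding box_bump_def using exp_bump_bounds
  by (auto intro!: prod_nonneg prod_le_1 mult_le_one)

lemma test_function_box_bump: "cbox c d \<subseteq> X \<Longrightarrow> test_function X (box_bump c d n)"
proof -
  assume X: "cbox c d \<subseteq> X"
  have *: "closure {x. box_bump c d n x \<noteq> 0} \<subseteq> cbox c d"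
    using box_bump_eq_0[of _ c d n] box_subset_cbox by (intro closure_minimal) auto
  then have "compact (closure {x. box_bump c d n x \<noteq> 0})"
    by (meson bounded_cbox bounded_subset closed_closure compact_eq_bounded_closed)
  then show ?thesis unfolding test_function_def using * X smooth_box_bump by blast
qed

lemma box_bump_tendsto: "(\<lambda>n. box_bump c d n x) \<longlonglongrightarrow> indicator (box c d) x"
proof (cases "x \<in> box c d")
  case True
  have *: "(\<lambda>n. exp_bump 1 (real n * s)) \<longlonglongrightarrow> 1" if "s > 0" for s
  proof -
    have "(\<lambda>n. exp (- (inverse (real n) * inverse s))) \<longlonglongrightarrow> exp (- (0 * inverse s))"
      by (intro tendsto_intros lim_inverse_n)
    then have "(\<lambda>n. exp (- (inverse (real n) * inverse s))) \<longlonglongrightarrow> 1" by simp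
    then show ?thesis
      by (rule Lim_transform_eventually)
        (use that in \<open>auto intro!: eventually_mono[OF eventually_gt_at_top[of 0]] simp: exp_bump_def field_simps\<close>)
  qed
  have "(\<lambda>n. box_bump c d n x) \<longlonglongrightarrow> (\<Prod>i\<in>(Basis::'a set). 1 * 1)"
    unfolding box_bump_def using True by (intro tendsto_intros *) (auto simp: mem_box)
  then show ?thesis using True by simp
qed (simp add: box_bump_eq_0)

section \<open>The fundamental lemma of the calculus of variations\<close>

text \<open>Boxes form an intersection-stable generator of the Borel sets, so the vanishing of the
  integral spreads from boxes to all Borel sets; the total integral takes care of complements. The
  sets where \<open>h\<close> is positive and where it is negative then give the claim.\<close>

lemma AE_zero_if_integral_boxes_zero:
  fixes h :: "'a::euclidean_space \<Rightarrow> real"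
  assumes h: "integrable lborel h" and tot: "(LINT x|lborel. h x) = 0"
    and box: "\<And>c d. (LINT x|lborel. indicator (box c d) x * h x) = 0"
  shows "AE x in lborel. h x = 0"
proof -
  have [measurable]: "h \<in> borel_measurable borel" using h by auto
  have Z: "(LINT x|lborel. indicator A x * h x) = 0" if A: "A \<in> sets borel" for A :: "'a set"
  proof -
    have "Int_stable (range (\<lambda>(a, b). box a b :: 'a set))"
      by (auto simp: Int_stable_def box_Int_box)
    moreover have "(range (\<lambda>(a, b). box a b)) \<subseteq> Pow (UNIV :: 'a set)"
      by auto
    moreover have "A \<in> sigma_sets UNIV (range (\<lambda>(a, b). box a b))"
      using A unfolding borel_eq_box by simp
    ultimately show ?thesis
    proof (induction rule: sigma_sets_induct_disjoint)
      case (basic A) then show ?case using box by auto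
    next
      case empty then show ?case by simp
    next
      case (compl A)
      then have [measurable]: "A \<in> sets borel" by (simp add: borel_eq_box)
      have "(LINT x|lborel. indicator (UNIV - A) x * h x) = (LINT x|lborel. h x - indicator A x * h x)"
        by (intro Bochner_Integration.integral_cong) (auto split: split_indicator)
      also have "\<dots> = 0"
        using compl tot h by (subst Bochner_Integration.integral_diff) (auto simp: integrable_mult_indicator[where 'b=real, simplified])
      finally show ?case .
    next
      case (union F)
      then have [measurable]: "F i \<in> sets borel" for i by (simp add: borel_eq_box subset_eq)
      have "integrable lborel (\<lambda>x. indicator (\<Union> (range F)) x *\<^sub>R h x)"
        by (rule integrable_mult_indicator[OF _ h]) measurable
      then have "(LINT x:(\<Union>i. F i)|lborel. h x) = (\<Sum>i. LINT x:(F i)|lborel. h x)"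
        using union by (intro lebesgue_integral_countable_add)
          (auto simp: disjoint_family_on_def set_integrable_def)
      then show ?case using union by (simp add: set_lebesgue_integral_def)
    qed
  qed
  have "integrable lborel (\<lambda>x. indicator A x * h x)" if "A \<in> sets borel" for A
    using integrable_mult_indicator[OF _ h, of A] that by simp
  then have I: "integrable lborel (\<lambda>x. indicator {x. h x > 0} x * h x)" "integrable lborel (\<lambda>x. indicator {x. h x < 0} x * h x)"
    by measurable
  have "AE x in lborel. indicator {x. h x > 0} x * h x = 0"
    using Z[of "{x. h x > 0}"] by (intro integral_nonneg_eq_0_iff_AE[THEN iffD1, OF I(1)]) (auto split: split_indicator)
  moreover have "AE x in lborel. - (indicator {x. h x < 0} x * h x) = 0"
    using Z[of "{x. h x < 0}"]
    by (intro integral_nonneg_eq_0_iff_AE[THEN iffD1, OF Bochner_Integration.integrable_minus[OF I(2)]])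
       (auto split: split_indicator)
  ultimately show ?thesis by eventually_elim (auto split: split_indicator_asm)
qed

text \<open>Box bumps converge boundedly to indicators of boxes, so \<open>g\<close> has integral
  zero over every box whose closure lies in \<open>X\<close>. As \<open>g\<close> is only locally
  integrable, the argument is confined to one closed box at a time; countably many of them cover
  \<open>X\<close>.\<close>

lemma AE_zero_if_integral_test_zero:
  fixes g :: "'a::euclidean_space \<Rightarrow> real"
  assumes X: "open X" and g: "\<And>K. compact K \<Longrightarrow> K \<subseteq> X \<Longrightarrow> g absolutely_integrable_on K"
    and Z: "\<And>\<phi>. test_function X \<phi> \<Longrightarrow> (LINT x|lebesgue_on X. g x * \<phi> x) = 0"
  shows "AE x in lebesgue_on X. g x = 0"
proof -
  have Xm: "X \<in> sets lebesgue" using X by auto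
  have B: "(LINT x|lebesgue. indicator (box c d) x * g x) = 0" if cd: "cbox c d \<subseteq> X" for c d
  proof -
    have i: "integrable lebesgue (\<lambda>x. indicator (cbox c d) x * g x)"
      using g[of "cbox c d"] cd by (auto simp: set_integrable_def)
    have m: "box_bump c d n \<in> borel_measurable lebesgue" for n
      by (rule measurable_completion) (simp add: borel_measurable_continuous_onI smooth_continuous_on smooth_box_bump)
    have e: "(indicator (cbox c d) x * g x) * indicator (box c d) x = indicator (box c d) x * g x" for x
      using box_subset_cbox[of c d] by (auto split: split_indicator)
    have "(\<lambda>n. LINT x|lebesgue. (indicator (cbox c d) x * g x) * box_bump c d n x) \<longlonglongrightarrow>
        (LINT x|lebesgue. (indicator (cbox c d) x * g x) * indicator (box c d) x)"
    proof (rule integral_dominated_convergence)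
      show "AE x in lebesgue. norm (indicator (cbox c d) x * g x * box_bump c d n x)
           \<le> norm (indicator (cbox c d) x * g x)" for n
        using box_bump_bounds[of c d n] by (auto simp: abs_mult intro!: mult_left_le)
      show "(\<lambda>x. indicator (cbox c d) x * g x * box_bump c d n x) \<in> borel_measurable lebesgue" for n
        by (rule borel_measurable_times[OF borel_measurable_integrable[OF i] m])
      show "(\<lambda>x. indicator (cbox c d) x * g x * indicator (box c d) x) \<in> borel_measurable lebesgue"
        by (rule borel_measurable_times[OF borel_measurable_integrable[OF i] borel_measurable_indicator]) auto
      show "integrable lebesgue (\<lambda>x. norm (indicator (cbox c d) x * g x))"
        using i by (rule integrable_norm)
      show "AE x in lebesgue. (\<lambda>n. indicator (cbox c d) x * g x * box_bump c d n x) \<longlonglongrightarrow>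
          indicator (cbox c d) x * g x * indicator (box c d) x"
        by (auto intro!: tendsto_intros box_bump_tendsto)
    qed
    moreover have "(LINT x|lebesgue. (indicator (cbox c d) x * g x) * box_bump c d n x) = 0" for n
    proof -
      have "(LINT x|lebesgue. (indicator (cbox c d) x * g x) * box_bump c d n x)
          = (LINT x|lebesgue. indicator X x *\<^sub>R (g x * box_bump c d n x))"
        using cd box_bump_eq_0 subsetD[OF box_subset_cbox[of c d]]
        by (intro Bochner_Integration.integral_cong) (auto split: split_indicator, blast)
      also have "\<dots> = (LINT x|lebesgue_on X. g x * box_bump c d n x)"
        using Xm by (subst integral_restrict_space) auto
      finally show ?thesis using Z[OF test_function_box_bump[OF cd]] by simp
    qed
    ultimately show ?thesis using LIMSEQ_unique[OF _ tendsto_const] by (simp add: e)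
  qed
  have C: "AE x in lebesgue. x \<in> cbox c d \<longrightarrow> g x = 0" if cd: "cbox c d \<subseteq> X" for c d
  proof -
    define h where "h = (\<lambda>x. indicator (box c d) x * g x)"
    have "integrable lebesgue (\<lambda>x. indicator (cbox c d) x * g x)"
      using g[of "cbox c d"] cd by (auto simp: set_integrable_def)
    then have "integrable lebesgue (\<lambda>x. indicator (box c d) x *\<^sub>R (indicator (cbox c d) x * g x))"
      by (intro integrable_mult_indicator) auto
    moreover have "(\<lambda>x. indicator (box c d) x *\<^sub>R (indicator (cbox c d) x * g x)) = h"
      unfolding h_def using subsetD[OF box_subset_cbox[of c d]] by (auto simp: fun_eq_iff split: split_indicator)
    ultimately have hi: "integrable lebesgue h" by auto
    \<comment> \<open>The criterion on boxes concerns functions integrable for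
      \<open>lborel\<close>, so \<open>h\<close> is replaced by a Borel function that equals it
      almost everywhere.\<close>
    obtain h' where [measurable]: "h' \<in> borel_measurable lborel" and hh': "AE x in lborel. h x = h' x"
      using completion_ex_borel_measurable_real[OF borel_measurable_integrable[OF hi]] by auto
    then have hh'': "AE x in lebesgue. h x = h' x" by (simp add: AE_completion)
    have c: "(LINT x|lborel. indicator (box p q) x * h' x) = 0" for p q
    proof -
      have "(LINT x|lborel. indicator (box p q) x * h' x) = (LINT x|lebesgue. indicator (box p q) x * h' x)"
        by (subst integral_completion) auto
      also have "\<dots> = (LINT x|lebesgue. indicator (box p q) x * h x)"
        using hh'' by (intro integral_cong_AE borel_measurable_times borel_measurable_indicator
            measurable_completion[OF \<open>h' \<in> _\<close>] borel_measurable_integrable[OF hi]) auto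
      also have "\<dots> = (LINT x|lebesgue. indicator (box p q \<inter> box c d) x * g x)"
        unfolding h_def by (intro Bochner_Integration.integral_cong) (auto split: split_indicator)
      also obtain p' q' where pq: "box p q \<inter> box c d = box p' q'"
        using box_Int_box[of p q c d] by blast
      have "(LINT x|lebesgue. indicator (box p q \<inter> box c d) x * g x) = 0"
      proof (cases "box p' q' = {}")
        case False
        then have "cbox p' q' \<subseteq> cbox c d"
          using closure_mono[of "box p' q'" "cbox c d"] pq box_subset_cbox[of c d]
          by (auto simp: closure_box)
        then show ?thesis unfolding pq using B[of p' q'] cd by auto
      qed (simp add: pq)
      finally show ?thesis .
    qed
    have "integrable lebesgue h'"
      by (rule Bochner_Integration.integrable_cong_AE_imp[OF hi]) (use hh'' in \<open>auto intro: measurable_completion\<close>)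
    then have hi': "integrable lborel h'" by (simp add: integrable_completion)
    have "(LINT x|lborel. h' x) = (LINT x|lborel. indicator (box c d) x * h' x)"
      using hh' by (intro integral_cong_AE) (auto simp: h_def elim!: eventually_mono split: split_indicator)
    then have "AE x in lborel. h' x = 0"
      using AE_zero_if_integral_boxes_zero[OF hi'] c by simp
    then have "AE x in lebesgue. h x = 0"
      using hh' by (subst AE_completion_iff) (auto elim: eventually_elim2)
    \<comment> \<open>\<open>h\<close> says nothing about \<open>g\<close> on the faces of the box,
      which form a null set.\<close>
    moreover have "AE x in lebesgue. x \<notin> cbox c d - box c d"
      by (rule AE_not_in) (use negligible_frontier_interval negligible_iff_null_sets in blast)
    ultimately show ?thesis
      by eventually_elim (auto simp: h_def split: split_indicator_asm)
  qed
  obtain \<D> where D: "countable \<D>" "\<D> \<subseteq> Pow X" "\<And>Y. Y \<in> \<D> \<Longrightarrow> \<exists>a b. Y = cbox a b" "\<Union>\<D> = X"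
    using open_countable_Union_open_cbox[OF X] by metis
  have "AE x in lebesgue. \<forall>Y\<in>\<D>. x \<in> Y \<longrightarrow> g x = 0"
    using D(1) by (subst AE_ball_countable) (use D(2,3) C in blast)+
  then show ?thesis
    using Xm D(4) by (subst AE_restrict_space_iff) (auto elim!: eventually_mono)
qed

section \<open>Test functions and uniqueness of weak gradients\<close>

lemma test_functionD:
  fixes \<phi> :: "'a::euclidean_space \<Rightarrow> real"
  assumes "test_function X \<phi>"
  obtains K where "compact K" "K \<subseteq> X" "\<And>x. x \<notin> K \<Longrightarrow> \<phi> x = 0"
    "\<And>x. x \<notin> K \<Longrightarrow> frechet_derivative \<phi> (at x) h = 0" "smooth \<phi>"
proof
  let ?K = "closure {x. \<phi> x \<noteq> 0}"
  show "compact ?K" "?K \<subseteq> X" "smooth \<phi>" using assms by (auto simp: test_function_def)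
  have K0: "\<phi> x = 0" if "x \<notin> ?K" for x using that closure_subset[of "{x. \<phi> x \<noteq> 0}"] by blast
  then show "\<phi> x = 0" if "x \<notin> ?K" for x using that .
  show "frechet_derivative \<phi> (at x) h = 0" if "x \<notin> ?K" for x
  proof -
    have "(\<phi> has_derivative (\<lambda>_. 0)) (at x)"
    proof (rule has_derivative_transform_within_open[where s="- ?K", OF has_derivative_const[of 0]])
      show "0 = \<phi> y" if "y \<in> - ?K" for y using that by (metis ComplD K0)
    qed (use that in blast)+
    then show ?thesis using frechet_derivative_at by metis
  qed
qed

lemma bounded_of_continuous_compact_support:
  fixes f :: "'a::euclidean_space \<Rightarrow> real"
  assumes "continuous_on K f" "compact K" "\<And>x. x \<notin> K \<Longrightarrow> f x = 0"
  obtains B where "B > 0" "\<And>x. \<bar>f x\<bar> \<le> B"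
proof -
  have "bounded (f ` K)" using assms compact_continuous_image compact_imp_bounded by blast
  then obtain B where "B > 0" "\<And>x. x \<in> K \<Longrightarrow> \<bar>f x\<bar> \<le> B" unfolding bounded_pos by auto
  then show ?thesis using assms(3) that[of B] by (metis abs_0 less_eq_real_def)
qed

lemma integrable_mult_compact_support:
  fixes f g :: "'a::euclidean_space \<Rightarrow> real"
  assumes X: "open X" and f: "f absolutely_integrable_on K"
    and g: "continuous_on UNIV g" "compact K" "K \<subseteq> X" "\<And>x. x \<notin> K \<Longrightarrow> g x = 0"
  shows "integrable (lebesgue_on X) (\<lambda>x. f x * g x)"
proof -
  obtain B where B: "B > 0" "\<And>x. \<bar>g x\<bar> \<le> B"
    using bounded_of_continuous_compact_support[of K g] g continuous_on_subset by blast
  have i: "integrable lebesgue (\<lambda>x. indicator K x * f x)" using f by (simp add: set_integrable_def)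
  have "integrable lebesgue (\<lambda>x. (indicator K x * f x) * g x)"
  proof (rule Bochner_Integration.integrable_bound[OF integrable_mult_left[OF i, of B]])
    show "(\<lambda>x. indicator K x * f x * g x) \<in> borel_measurable lebesgue"
      by (rule borel_measurable_times[OF borel_measurable_integrable[OF i]])
         (rule measurable_completion, simp add: borel_measurable_continuous_onI g)
    show "AE x in lebesgue. norm (indicator K x * f x * g x) \<le> norm (indicator K x * f x * B)"
      using B by (auto simp: abs_mult intro!: mult_left_mono)
  qed
  moreover have "(\<lambda>x. (indicator K x * f x) * g x) = (\<lambda>x. indicator X x *\<^sub>R (f x * g x))"
    using g(3,4) by (auto simp: fun_eq_iff split: split_indicator)
  ultimately show ?thesis using X by (subst integrable_restrict_space) auto
qed

text \<open>\<open>weak_gradient\<close> is a choice; this identifies it, up to null sets, with the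
  classical Jacobian of a twist. The difference of two weak gradients is orthogonal to all test
  functions.\<close>

lemma weak_gradient_unique:
  fixes G H :: "real^'a \<Rightarrow> real^'a^'b"
  assumes X: "open X" and G: "has_weak_gradient X u G" and H: "has_weak_gradient X u H"
  shows "AE x in lebesgue_on X. G x = H x"
proof -
  have "AE x in lebesgue_on X. G x $ i $ j - H x $ i $ j = 0" for i j
  proof (rule AE_zero_if_integral_test_zero[OF X])
    have c: "(\<lambda>x. F x $ i $ j) absolutely_integrable_on K" if "compact K" "K \<subseteq> X" "has_weak_gradient X u F" for K and F :: "real^'a \<Rightarrow> real^'a^'b"
      using absolutely_integrable_linear[where f=F and s=K and h="\<lambda>M. M $ i $ j"] that
      by (auto simp: has_weak_gradient_def o_def intro!: bounded_linear_compose[OF bounded_linear_vec_nth bounded_linear_vec_nth])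
    show "(\<lambda>x. G x $ i $ j - H x $ i $ j) absolutely_integrable_on K" if "compact K" "K \<subseteq> X" for K
      using c[OF that G] c[OF that H] by (rule set_integral_diff(1))
    show "(LINT x|lebesgue_on X. (G x $ i $ j - H x $ i $ j) * \<phi> x) = 0" if t: "test_function X \<phi>" for \<phi>
    proof -
      obtain K where K: "compact K" "K \<subseteq> X" "\<And>x. x \<notin> K \<Longrightarrow> \<phi> x = 0" "smooth \<phi>"
        using test_functionD[OF t] by metis
      have "integrable (lebesgue_on X) (\<lambda>x. F x $ i $ j * \<phi> x)" if "has_weak_gradient X u F"
        for F :: "real^'a \<Rightarrow> real^'a^'b"
        by (intro integrable_mult_compact_support[OF X c[OF K(1,2) that]] smooth_continuous_on K)
      then have "(LINT x|lebesgue_on X. (G x $ i $ j - H x $ i $ j) * \<phi> x)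
          = (LINT x|lebesgue_on X. G x $ i $ j * \<phi> x) - (LINT x|lebesgue_on X. H x $ i $ j * \<phi> x)"
        using G H by (simp add: left_diff_distrib)
      also have "\<dots> = 0" using G H t unfolding has_weak_gradient_def by fastforce
      finally show ?thesis .
    qed
  qed
  then have "AE x in lebesgue_on X. \<forall>i\<in>UNIV. \<forall>j\<in>UNIV. G x $ i $ j - H x $ i $ j = 0"
    by (intro AE_finite_allI) auto
  then show ?thesis by eventually_elim (auto simp: vec_eq_iff)
qed

section \<open>Classical derivatives are weak derivatives\<close>

text \<open>The difference quotients of \<open>F\<close> have integral zero by translation invariance.\<close>

lemma integral_derivative_compact_support:
  fixes F g :: "'a::euclidean_space \<Rightarrow> real"
  assumes F: "\<And>x. (F has_derivative F' x) (at x)" and g: "\<And>x. F' x h = g x"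
    and K: "compact K" "\<And>x. x \<notin> K \<Longrightarrow> F x = 0" and B: "\<And>x. \<bar>g x\<bar> \<le> B"
  shows "(LINT x|lborel. g x) = 0"
proof -
  have Fc: "continuous_on S F" for S
    using F has_derivative_continuous by (blast intro: continuous_at_imp_continuous_on)
  have [measurable]: "F \<in> borel_measurable borel" by (rule borel_measurable_continuous_onI[OF Fc])
  define s where "s n = 1 / real (Suc n)" for n
  have s: "0 < s n" "s n \<le> 1" for n by (auto simp: s_def)
  define Q where "Q n x = (F (x + s n *\<^sub>R h) - F x) / s n" for n x
  have Fi: "integrable lborel F"
  proof -
    have "integrable lborel (\<lambda>x. indicator K x *\<^sub>R F x)" by (rule borel_integrable_compact[OF K(1) Fc])
    moreover have "(\<lambda>x. indicator K x *\<^sub>R F x) = F" using K(2) by (auto simp: fun_eq_iff split: split_indicator)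
    ultimately show ?thesis by simp
  qed
  have Ft: "integrable lborel (\<lambda>x. F (x + v)) \<and> (LINT x|lborel. F (x + v)) = (LINT x|lborel. F x)" for v
  proof -
    have "integrable (distr lborel borel ((+) v)) F" using Fi by (simp add: lborel_distr_plus)
    then have "integrable lborel (\<lambda>x. F (v + x))" by (subst (asm) integrable_distr_eq) auto
    moreover have "(LINT x|distr lborel borel ((+) v). F x) = (LINT x|lborel. F (v + x))"
      by (subst integral_distr) auto
    ultimately show ?thesis by (simp add: lborel_distr_plus add.commute)
  qed
  have Q0: "(LINT x|lborel. Q n x) = 0" for n
    unfolding Q_def using Ft[of "s n *\<^sub>R h"] Fi by simp
  have line: "((\<lambda>t. F (x + t *\<^sub>R h)) has_real_derivative g (x + t *\<^sub>R h)) (at t)" for x t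
  proof -
    have "((\<lambda>t. F (x + t *\<^sub>R h)) has_derivative (\<lambda>d. F' (x + t *\<^sub>R h) (d *\<^sub>R h))) (at t)"
      by (rule has_derivative_compose[OF _ F]) (auto intro!: derivative_eq_intros)
    moreover have "F' (x + t *\<^sub>R h) (d *\<^sub>R h) = d * g (x + t *\<^sub>R h)" for d
      using linear_scale[OF has_derivative_linear[OF F]] g by simp
    moreover have "(\<lambda>d. F' (x + t *\<^sub>R h) (d *\<^sub>R h)) = (*) (g (x + t *\<^sub>R h))"
      using calculation(2) by (simp add: fun_eq_iff)
    ultimately show ?thesis unfolding has_field_derivative_def by metis
  qed
  have lim: "(\<lambda>n. Q n x) \<longlonglongrightarrow> g x" for x
  proof -
    have "((\<lambda>t. (F (x + t *\<^sub>R h) - F x) / t) \<longlongrightarrow> g x) (at 0)"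
      using line[of x 0] by (simp add: DERIV_def)
    moreover have "filterlim s (at 0) sequentially"
      unfolding filterlim_at using s by (auto simp: less_imp_neq s_def[abs_def] simp flip: inverse_eq_divide of_nat_Suc intro!: LIMSEQ_inverse_real_of_nat)
    ultimately show ?thesis unfolding Q_def by (rule filterlim_compose)
  qed
  have bd: "\<bar>Q n x\<bar> \<le> B" for n x
  proof -
    obtain z where "F (x + s n *\<^sub>R h) - F (x + 0 *\<^sub>R h) = (s n - 0) * g (x + z *\<^sub>R h)"
      using MVT2[OF s(1)[of n], of "\<lambda>t. F (x + t *\<^sub>R h)" "\<lambda>t. g (x + t *\<^sub>R h)"] line by metis
    then show ?thesis unfolding Q_def using B[of "x + z *\<^sub>R h"] s(1)[of n] by simp
  qed
  \<comment> \<open>All difference quotients vanish outside this compact set, the support moved back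
    along \<open>h\<close> by at most 1, since \<open>s n\<close> is at most 1. It carries the
    integrable bound for dominated convergence.\<close>
  define K' where "K' = (\<lambda>(x, t). x - t *\<^sub>R h) ` (K \<times> {0..1})"
  have K': "compact K'" unfolding K'_def
    by (intro compact_continuous_image compact_Times K continuous_intros | simp add: split_beta)+
  have supp: "Q n x = 0" if "x \<notin> K'" for n x
  proof -
    have "x \<notin> K" using that unfolding K'_def by (force intro: image_eqI[of _ _ "(x, 0)"])
    moreover have "x + s n *\<^sub>R h \<notin> K"
      using that s[of n] unfolding K'_def by (force intro: image_eqI[of _ _ "(x + s n *\<^sub>R h, s n)"])
    ultimately show ?thesis by (simp add: Q_def K)
  qed
  have [measurable]: "Q n \<in> borel_measurable borel" for n unfolding Q_def by measurable
  have [measurable]: "g \<in> borel_measurable borel"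
    by (rule borel_measurable_LIMSEQ_real[OF lim]) simp
  have "(\<lambda>n. LINT x|lborel. Q n x) \<longlonglongrightarrow> (LINT x|lborel. g x)"
  proof (rule integral_dominated_convergence)
    show "integrable lborel (\<lambda>x. indicator K' x *\<^sub>R B)"
      by (rule borel_integrable_compact[OF K']) auto
    show "AE x in lborel. norm (Q n x) \<le> indicator K' x *\<^sub>R B" for n
      using bd supp by (auto split: split_indicator)
  qed (use lim in auto)
  then show ?thesis using Q0 LIMSEQ_unique[OF _ tendsto_const] by auto
qed

lemma absolutely_integrable_on_compact_continuous:
  fixes f :: "'a::euclidean_space \<Rightarrow> 'b::euclidean_space"
  assumes "compact K" "continuous_on K f"
  shows "f absolutely_integrable_on K"
proof -
  have "integrable lborel (\<lambda>x. indicator K x *\<^sub>R f x)" by (rule borel_integrable_compact[OF assms])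
  then show ?thesis
    unfolding set_integrable_def by (subst integrable_completion) (auto simp: borel_measurable_integrable)
qed

text \<open>The product of a component of \<open>w\<close> with a test function is differentiable on
  the whole space and has compact support, so the integral of its \<open>j\<close>-th partial
  derivative is zero. Expanding that derivative gives the integration by parts formula.\<close>

lemma has_weak_gradient_C1:
  fixes w :: "real^'n \<Rightarrow> real^'m" and G :: "real^'n \<Rightarrow> real^'n^'m"
  assumes X: "open X" and w: "\<And>x. x \<in> X \<Longrightarrow> (w has_derivative (\<lambda>h. G x *v h)) (at x)"
    and G: "continuous_on X G"
  shows "has_weak_gradient X w G"
  unfolding has_weak_gradient_def
proof (intro conjI allI impI)
  have wc: "continuous_on X w"
    using w has_derivative_continuous by (blast intro: continuous_at_imp_continuous_on)
  fix K assume K: "compact K \<and> K \<subseteq> X"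
  then show "w absolutely_integrable_on K" "G absolutely_integrable_on K"
    by (auto intro!: absolutely_integrable_on_compact_continuous continuous_on_subset[OF wc] continuous_on_subset[OF G])
next
  have wc: "continuous_on X w"
    using w has_derivative_continuous by (blast intro: continuous_at_imp_continuous_on)
  fix i :: 'm and j :: 'n and \<phi> :: "real^'n \<Rightarrow> real"
  assume t: "test_function X \<phi>"
  obtain K where K: "compact K" "K \<subseteq> X" "\<And>x. x \<notin> K \<Longrightarrow> \<phi> x = 0"
    "\<And>x. x \<notin> K \<Longrightarrow> frechet_derivative \<phi> (at x) (axis j 1) = 0" "smooth \<phi>"
    using test_functionD[OF t] by metis
  note d\<phi> = smooth_has_derivative[OF K(5)]
  define F where "F x = w x $ i * \<phi> x" for x
  \<comment> \<open>Outside \<open>X\<close> the map \<open>w\<close> is arbitrary, but there the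
    product vanishes in a neighbourhood of every point.\<close>
  define F' where "F' x h = (if x \<in> X then w x $ i * frechet_derivative \<phi> (at x) h + (G x *v h) $ i * \<phi> x else 0)" for x h
  define g where "g x = indicator X x * (w x $ i * frechet_derivative \<phi> (at x) (axis j 1) + G x $ i $ j * \<phi> x)" for x
  have comp: "(G x *v axis j 1) $ i = G x $ i $ j" for x
    by (simp add: matrix_vector_mult_basis column_def)
  have F: "(F has_derivative F' x) (at x)" for x
  proof (cases "x \<in> X")
    case True
    have "((\<lambda>x. w x $ i) has_derivative (\<lambda>h. (G x *v h) $ i)) (at x)"
      by (rule bounded_linear.has_derivative[OF bounded_linear_vec_nth w[OF True]])
    from has_derivative_mult[OF this d\<phi>] show ?thesis using True by (simp add: F_def[abs_def] F'_def[abs_def])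
  next
    case False
    then have "x \<in> - K" "open (- K)" using K(1,2) compact_imp_closed by auto
    then have "(F has_derivative (\<lambda>_. 0)) (at x)"
      by (intro has_derivative_transform_within_open[where s="- K", OF has_derivative_const[of 0]])
         (auto simp: F_def K)
    then show ?thesis using False by (simp add: F'_def[abs_def])
  qed
  have gF: "F' x (axis j 1) = g x" for x by (simp add: F'_def g_def comp)
  have Gij: "continuous_on S (\<lambda>x. G x $ i $ j)" if "S \<subseteq> X" for S
    using continuous_on_subset[OF G that] by (intro continuous_intros)
  have wi: "continuous_on S (\<lambda>x. w x $ i)" if "S \<subseteq> X" for S
    using continuous_on_subset[OF wc that] by (intro continuous_intros)
  have c1: "continuous_on S \<phi>" "continuous_on S (\<lambda>x. frechet_derivative \<phi> (at x) (axis j 1))" for S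
    by (intro smooth_continuous_on smooth_derivative K)+
  have "continuous_on K g"
  proof (rule continuous_on_eq)
    show "continuous_on K (\<lambda>x. w x $ i * frechet_derivative \<phi> (at x) (axis j 1) + G x $ i $ j * \<phi> x)"
      using K(2) by (intro continuous_intros wi Gij c1)
  qed (use K(2) in \<open>auto simp: g_def subset_eq\<close>)
  moreover have "g x = 0" if "x \<notin> K" for x by (simp add: g_def K that)
  ultimately obtain B where B: "\<And>x. \<bar>g x\<bar> \<le> B"
    using bounded_of_continuous_compact_support[of K g] K(1) by metis
  have "(LINT x|lborel. g x) = 0"
    by (rule integral_derivative_compact_support[OF F gF K(1) _ B]) (simp add: F_def K)
  moreover have "g \<in> borel_measurable borel"
  proof -
    have "g = (\<lambda>x. indicator K x *\<^sub>R g x)" using K by (auto simp: g_def fun_eq_iff split: split_indicator)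
    then show ?thesis
      using borel_integrable_compact[OF K(1) \<open>continuous_on K g\<close>] borel_measurable_integrable by (metis measurable_lborel2)
  qed
  ultimately have 0: "(LINT x|lebesgue. g x) = 0" by (simp add: integral_completion)
  have Xs: "X \<inter> space lebesgue \<in> sets lebesgue" using X by auto
  have "(LINT x|lebesgue_on X. w x $ i * frechet_derivative \<phi> (at x) (axis j 1) + G x $ i $ j * \<phi> x) = 0"
    unfolding integral_restrict_space[OF Xs] using 0 by (simp add: g_def)
  moreover have "integrable (lebesgue_on X) (\<lambda>x. w x $ i * frechet_derivative \<phi> (at x) (axis j 1))"
    by (rule integrable_mult_compact_support[OF X _ _ K(1,2,4)])
       (use K wi c1 in \<open>auto intro!: absolutely_integrable_on_compact_continuous\<close>)
  moreover have "integrable (lebesgue_on X) (\<lambda>x. G x $ i $ j * \<phi> x)"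
    by (rule integrable_mult_compact_support[OF X _ _ K(1,2,3)])
       (use K Gij c1 in \<open>auto intro!: absolutely_integrable_on_compact_continuous\<close>)
  ultimately show "(LINT x|lebesgue_on X. w x $ i * frechet_derivative \<phi> (at x) (axis j 1)) =
        - (LINT x|lebesgue_on X. G x $ i $ j * \<phi> x)"
    by simp
qed

section \<open>Polar coordinates\<close>

lemma vector_2_eq: "(vector [x, y] :: real^2) = x *\<^sub>R axis 1 1 + y *\<^sub>R axis 2 1"
  by (simp add: vec_eq_iff forall_2 axis_def)

lemma has_derivative_vector_2:
  assumes "(f has_derivative f') F" "(g has_derivative g') F"
  shows "((\<lambda>x. vector [f x, g x] :: real^2) has_derivative (\<lambda>h. vector [f' h, g' h])) F"
  unfolding vector_2_eq by (intro derivative_intros assms)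

lemma borel_measurable_vector_2 [measurable]:
  assumes [measurable]: "f \<in> borel_measurable M" "g \<in> borel_measurable M"
  shows "(\<lambda>x. vector [f x, g x] :: real^2) \<in> borel_measurable M"
  unfolding vector_2_eq by measurable

lemma borel_measurable_vec_nth [measurable]: "(\<lambda>x :: real^'n. x $ i) \<in> borel_measurable borel"
  by (intro borel_measurable_continuous_onI continuous_intros)

lemma borel_measurable_fst_snd [measurable]:
  "(fst :: 'a::second_countable_topology \<times> 'b::second_countable_topology \<Rightarrow> 'a) \<in> borel_measurable borel"
  "(snd :: 'a::second_countable_topology \<times> 'b::second_countable_topology \<Rightarrow> 'b) \<in> borel_measurable borel"
  by (intro borel_measurable_continuous_onI continuous_intros)+

lemma norm_vec_2: "norm (x :: real^2) = sqrt ((x $ 1)\<^sup>2 + (x $ 2)\<^sup>2)"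
  by (simp add: norm_vec_def L2_set_def sum_2)

lemma norm_to_complex: "norm (to_complex x) = norm x"
  by (simp add: to_complex_def cmod_def norm_vec_2)

lemma to_complex_inject: "to_complex x = to_complex y \<longleftrightarrow> x = y"
  by (auto simp: to_complex_def vec_eq_iff forall_2)

lemma bounded_linear_to_complex: "bounded_linear to_complex"
proof (rule bounded_linear_intro[where K=1])
  show "norm (to_complex x) \<le> norm x * 1" for x by (simp add: norm_to_complex)
qed (auto simp: to_complex_def complex_eq_iff)

lemma to_complex_polar: "to_complex (polar r t) = of_real r * cis t"
  by (simp add: to_complex_def polar_def complex_eq_iff)

lemma norm_polar: "norm (polar r t) = \<bar>r\<bar>"
  by (simp add: norm_to_complex[symmetric] to_complex_polar norm_mult)

lemma polar_measurable [measurable]: "(\<lambda>z. polar (fst z) (snd z)) \<in> borel_measurable borel"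
  unfolding polar_def vector_2_eq by (intro borel_measurable_continuous_onI continuous_intros)

lemma polar_inject:
  assumes "0 < r" "0 < r'" "0 < t" "t < 2*pi" "0 < t'" "t' < 2*pi" "polar r t = polar r' t'"
  shows "r = r' \<and> t = t'"
proof -
  have "of_real r * exp (\<i> * of_real t) = to_complex (polar r t)"
    "of_real r' * exp (\<i> * of_real t') = to_complex (polar r' t')"
    by (simp_all add: to_complex_polar cis_conv_exp)
  then have "Arg2pi (to_complex (polar r t)) = t" "Arg2pi (to_complex (polar r' t')) = t'"
    using Arg2pi_unique[of r t "to_complex (polar r t)"] Arg2pi_unique[of r' t' "to_complex (polar r' t')"] assms(1-6)
    by auto
  moreover have "r = r'" using norm_polar[of r t] norm_polar[of r' t'] assms by simp
  ultimately show ?thesis using assms(7) by metis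
qed

lemma polar_surj:
  assumes "x \<noteq> 0"
  obtains t where "0 \<le> t" "t < 2*pi" "x = polar (norm x) t"
proof
  let ?z = "to_complex x"
  show "0 \<le> Arg2pi ?z" "Arg2pi ?z < 2*pi" by (auto simp: Arg2pi)
  have "to_complex x = to_complex (polar (norm x) (Arg2pi ?z))"
    using Arg2pi_eq[of ?z] by (simp add: to_complex_polar norm_to_complex cis_conv_exp)
  then show "x = polar (norm x) (Arg2pi ?z)" by (simp add: to_complex_inject)
qed

lemma emeasure_prod_line:
  "emeasure (lborel :: (real \<times> real) measure) ({c} \<times> UNIV) = 0"
  "emeasure (lborel :: (real \<times> real) measure) (UNIV \<times> {c}) = 0"
  unfolding lborel_prod[symmetric] by (subst lborel.emeasure_pair_measure_Times; simp)+

lemma AE_lborel_prod_neq: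
  "AE z in (lborel :: (real \<times> real) measure). fst z \<noteq> c"
  "AE z in (lborel :: (real \<times> real) measure). snd z \<noteq> c"
  by (rule AE_I[of _ _ "{c} \<times> UNIV"] AE_I[of _ _ "UNIV \<times> {c}"];
      auto simp: emeasure_prod_line intro!: borel_Times)+

text \<open>The bridge between \<open>real^2\<close>, where images under differentiable maps are
  measured, and pairs of reals, where Fubini's theorem is applied.\<close>

lemma lborel_vector_2: "distr lborel borel (\<lambda>z. vector [fst z, snd z] :: real^2) = lborel"
proof (rule lborel_eqI[symmetric])
  fix l u :: "real^2" assume le: "\<And>b. b \<in> Basis \<Longrightarrow> l \<bullet> b \<le> u \<bullet> b"
  have B: "Basis = {axis 1 1, axis 2 1 :: real^2}" by (auto simp: Basis_vec_def UNIV_2)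
  have ne: "axis 1 1 \<noteq> (axis 2 1 :: real^2)" by (simp add: axis_eq_axis)
  have le': "l $ 1 \<le> u $ 1" "l $ 2 \<le> u $ 2" using le[of "axis 1 1"] le[of "axis 2 1"] by (auto simp: B inner_axis)
  have pre: "(\<lambda>z. vector [fst z, snd z] :: real^2) -` box l u = {l$1<..<u$1} \<times> {l$2<..<u$2}"
    by (auto simp: mem_box_cart forall_2)
  have "emeasure (distr lborel borel (\<lambda>z. vector [fst z, snd z])) (box l u)
      = emeasure (lborel \<Otimes>\<^sub>M lborel) ({l$1<..<u$1} \<times> {l$2<..<u$2})"
    unfolding lborel_prod pre[symmetric] vector_2_eq
    by (intro emeasure_distr[THEN trans]) (auto intro!: borel_measurable_continuous_onI continuous_intros)
  also have "\<dots> = ennreal (u$1 - l$1) * ennreal (u$2 - l$2)"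
    using le' by (subst lborel.emeasure_pair_measure_Times) auto
  also have "\<dots> = ennreal (\<Prod>b\<in>Basis. (u - l) \<bullet> b)"
    using le' ne by (simp add: B inner_axis ennreal_mult)
  finally show "emeasure (distr lborel borel (\<lambda>z. vector [fst z, snd z])) (box l u) = ennreal (\<Prod>b\<in>Basis. (u - l) \<bullet> b)" .
qed simp

text \<open>Borel rather than Lebesgue measurable sets: integrals over a product of two such
  segments are then integrals for \<open>lborel\<close> on the plane over a rectangle.\<close>

abbreviation seg :: "real \<Rightarrow> real \<Rightarrow> real measure" where
  "seg a b \<equiv> restrict_space lborel {a..b}"

abbreviation polar_rect :: "real \<Rightarrow> real \<Rightarrow> (real \<times> real) measure" where
  "polar_rect a b \<equiv> seg a b \<Otimes>\<^sub>M seg 0 (2 * pi)"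

lemma finite_measure_seg: "finite_measure (seg a b)"
  by (rule finite_measureI) (simp add: space_restrict_space emeasure_restrict_space emeasure_lborel_Icc_eq)

lemma pair_sigma_finite_seg: "pair_sigma_finite (seg a b) (seg c d)"
  unfolding pair_sigma_finite_def
  by (auto intro: finite_measure.axioms(1) finite_measure_seg)

lemma measurable_polar_rect:
  "f \<in> borel_measurable borel \<Longrightarrow> f \<in> borel_measurable (seg a b \<Otimes>\<^sub>M seg c d)"
proof -
  assume f: "f \<in> borel_measurable borel"
  have "(\<lambda>z. (fst z, snd z)) \<in> measurable (seg a b \<Otimes>\<^sub>M seg c d) (borel \<Otimes>\<^sub>M borel)"
    by (intro measurable_Pair measurable_compose[OF measurable_fst] measurable_compose[OF measurable_snd]
        measurable_restrict_space1) auto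
  then have "id \<in> measurable (seg a b \<Otimes>\<^sub>M seg c d) borel" by (simp add: borel_prod id_def)
  from measurable_compose[OF this f] show ?thesis by simp
qed

lemma nn_integral_polar_rect:
  assumes [measurable]: "f \<in> borel_measurable borel"
  shows "(\<integral>\<^sup>+z. f z \<partial>(seg a b \<Otimes>\<^sub>M seg c d)) = (\<integral>\<^sup>+z. f z * indicator ({a..b} \<times> {c..d}) z \<partial>lborel)"
proof -
  interpret pair_sigma_finite "seg a b" "seg c d" by (rule pair_sigma_finite_seg)
  have m: "f \<in> borel_measurable (lborel \<Otimes>\<^sub>M lborel)" by (simp add: lborel_prod)
  have "(\<integral>\<^sup>+z. f z \<partial>(seg a b \<Otimes>\<^sub>M seg c d)) = (\<integral>\<^sup>+x. (\<integral>\<^sup>+y. f (x, y) \<partial>seg c d) \<partial>seg a b)"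
    by (rule M2.nn_integral_fst[symmetric]) (rule measurable_polar_rect, fact)
  also have "\<dots> = (\<integral>\<^sup>+x. (\<integral>\<^sup>+y. f (x, y) * indicator {c..d} y \<partial>lborel) * indicator {a..b} x \<partial>lborel)"
    by (simp add: nn_integral_restrict_space)
  also have "\<dots> = (\<integral>\<^sup>+x. (\<integral>\<^sup>+y. f (x, y) * indicator ({a..b} \<times> {c..d}) (x, y) \<partial>lborel) \<partial>lborel)"
  proof (rule nn_integral_cong)
    fix x
    show "(\<integral>\<^sup>+y. f (x, y) * indicator {c..d} y \<partial>lborel) * indicator {a..b} x
        = (\<integral>\<^sup>+y. f (x, y) * indicator ({a..b} \<times> {c..d}) (x, y) \<partial>lborel)"
      by (cases "x \<in> {a..b}") (auto intro!: nn_integral_cong split: split_indicator)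
  qed
  also have "\<dots> = (\<integral>\<^sup>+z. f z * indicator ({a..b} \<times> {c..d}) z \<partial>(lborel \<Otimes>\<^sub>M lborel))"
    by (rule lborel.nn_integral_fst) (use m in \<open>auto intro!: borel_measurable_times_ennreal borel_measurable_indicator simp: lborel_prod borel_Times\<close>)
  finally show ?thesis by (simp add: lborel_prod)
qed

lemma has_derivative_polar:
  "((\<lambda>y :: real^2. polar (y$1) (y$2)) has_derivative
     (\<lambda>h. vector [h$1 * cos (y$2) - y$1 * sin (y$2) * h$2, h$1 * sin (y$2) + y$1 * cos (y$2) * h$2])) (at y within S)"
  unfolding polar_def
  by (rule has_derivative_eq_rhs, rule has_derivative_vector_2)
     (auto intro!: derivative_eq_intros bounded_linear.has_derivative[OF bounded_linear_vec_nth] simp: fun_eq_iff algebra_simps)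

lemma annulus_measurable [measurable]: "annulus a b \<in> sets borel"
  unfolding annulus_def by measurable

lemma open_annulus: "open (annulus a b)"
proof -
  have "annulus a b = norm -` {a<..<b}" by (auto simp: annulus_def)
  then show ?thesis by (auto intro!: open_vimage continuous_intros)
qed

text \<open>Change of variables on the open parameter rectangle, where the polar map is injective
  with Jacobian determinant \<open>r\<close>. The ray of angle 0, which is left out, is a null
  set.\<close>

lemma emeasure_annulus_polar:
  assumes ab: "0 < a" "a < b" and [measurable]: "A \<in> sets borel"
  shows "emeasure lborel (A \<inter> annulus a b) =
    (\<integral>\<^sup>+z. ennreal (fst z) * indicator A (polar (fst z) (snd z)) \<partial>polar_rect a b)"
proof -
  define g where "g y = polar (y$1) (y$2)" for y :: "real^2"
  define g' :: "real^2 \<Rightarrow> real^2 \<Rightarrow> real^2" where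
    "g' y h = vector [h$1 * cos (y$2) - y$1 * sin (y$2) * h$2, h$1 * sin (y$2) + y$1 * cos (y$2) * h$2]" for y h
  define S where "S = {y :: real^2. a < y$1 \<and> y$1 < b \<and> 0 < y$2 \<and> y$2 < 2*pi \<and> g y \<in> A}"
  have [measurable]: "g \<in> borel_measurable borel" unfolding g_def polar_def by measurable
  have Sb [measurable]: "S \<in> sets borel" unfolding S_def by measurable
  have dg: "(g has_derivative g' y) (at y within S)" for y
    using has_derivative_polar unfolding g_def[abs_def] g'_def .
  have detg: "\<bar>det (matrix (g' y))\<bar> = y$1" if "y \<in> S" for y
  proof -
    have "det (matrix (g' y)) = y$1 * (cos (y$2) * cos (y$2)) + y$1 * (sin (y$2) * sin (y$2))"
      by (simp add: det_2 matrix_def g'_def axis_def algebra_simps)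
    also have "\<dots> = y$1 * ((cos (y$2))\<^sup>2 + (sin (y$2))\<^sup>2)"
      by (simp only: power2_eq_square distrib_left)
    finally show ?thesis using that ab by (simp add: S_def)
  qed
  have inj: "inj_on g S"
  proof (rule inj_onI)
    fix x y assume "x \<in> S" "y \<in> S" "g x = g y"
    then have "x$1 = y$1 \<and> x$2 = y$2"
      using ab by (intro polar_inject) (auto simp: S_def g_def)
    then show "x = y" by (simp add: vec_eq_iff forall_2)
  qed
  \<comment> \<open>A line that contains the omitted ray.\<close>
  define N where "N = {x :: real^2. x$2 = 0}"
  have N: "N \<in> null_sets lborel"
  proof -
    have "N = {x. x \<bullet> axis 2 1 = 0}" by (simp add: N_def inner_axis)
    then have "negligible N" using negligible_standard_hyperplane[of "axis 2 1 :: real^2" 0]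
      by (auto simp: Basis_vec_def)
    moreover have "N \<in> sets borel" unfolding N_def by measurable
    ultimately show ?thesis by (simp add: negligible_iff_null_sets null_sets_completion_iff)
  qed
  have sub1: "g ` S \<subseteq> A \<inter> annulus a b"
    using ab by (auto simp: S_def g_def annulus_def norm_polar)
  have sub2: "A \<inter> annulus a b \<subseteq> g ` S \<union> N"
  proof
    fix x assume x: "x \<in> A \<inter> annulus a b"
    then have "x \<noteq> 0" using ab by (auto simp: annulus_def)
    then obtain t where t: "0 \<le> t" "t < 2*pi" "x = polar (norm x) t" by (rule polar_surj)
    show "x \<in> g ` S \<union> N"
    proof (cases "t = 0")
      case True
      then have "x $ 2 = 0" by (subst t(3)) (simp add: polar_def)
      then show ?thesis by (simp add: N_def)
    next
      case False
      then have "vector [norm x, t] \<in> S" using t x by (auto simp: S_def g_def annulus_def)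
      moreover have "g (vector [norm x, t]) = x" using t(3) by (simp add: g_def)
      ultimately show ?thesis by (metis UnI1 image_eqI)
    qed
  qed
  have fin: "emeasure lborel (A \<inter> annulus a b) < \<infinity>"
    by (rule emeasure_bounded_finite) (auto simp: annulus_def intro!: boundedI[of _ b])
  \<comment> \<open>The image differs from a bounded Borel set by a null set, so it is Lebesgue
    measurable with finite measure.\<close>
  have gSl: "g ` S \<in> lmeasurable"
  proof -
    have "(A \<inter> annulus a b) - g ` S \<subseteq> N" using sub2 by auto
    then have "(A \<inter> annulus a b) - g ` S \<in> null_sets lebesgue"
      using N null_sets_completion_subset by (metis null_sets_completionI)
    then have "(A \<inter> annulus a b) - ((A \<inter> annulus a b) - g ` S) \<in> lmeasurable"
      using fin by (intro fmeasurable_Diff) (auto simp: fmeasurable_def null_setsD2)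
    moreover have "(A \<inter> annulus a b) - ((A \<inter> annulus a b) - g ` S) = g ` S" using sub1 by auto
    ultimately show ?thesis by simp
  qed
  have eq1: "emeasure lborel (A \<inter> annulus a b) = emeasure lebesgue (g ` S)"
  proof -
    have "emeasure lebesgue (A \<inter> annulus a b) \<le> emeasure lebesgue (g ` S \<union> N)"
      using gSl N by (intro emeasure_mono sub2) (auto simp: fmeasurable_def intro: null_setsD2)
    also have "\<dots> = emeasure lebesgue (g ` S)"
      using gSl N by (intro emeasure_Un_null_set) (auto simp: fmeasurable_def null_sets_completionI)
    finally have "emeasure lebesgue (A \<inter> annulus a b) \<le> emeasure lebesgue (g ` S)" .
    moreover have "emeasure lebesgue (g ` S) \<le> emeasure lebesgue (A \<inter> annulus a b)"
      by (intro emeasure_mono sub1) auto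
    ultimately show ?thesis by simp
  qed
  have "((\<lambda>y. \<bar>det (matrix (g' y))\<bar>) has_integral measure lebesgue (g ` S)) S"
    using has_measure_differentiable_image[OF _ dg inj, of "measure lebesgue (g ` S)"] gSl by auto
  then have "((\<lambda>y. y$1) has_integral measure lebesgue (g ` S)) S"
    by (rule has_integral_eq[rotated]) (simp add: detg)
  then have "((\<lambda>y. indicator S y * y$1) has_integral measure lebesgue (g ` S)) UNIV"
    by (subst (asm) has_integral_restrict_UNIV[symmetric]) (simp add: indicator_def of_bool_def if_distrib if_distribR cong: if_cong)
  then have "(\<integral>\<^sup>+y. ennreal (indicator S y * y$1) \<partial>lborel) = ennreal (measure lebesgue (g ` S))"
    by (intro nn_integral_has_integral_lborel) (use ab in \<open>auto simp: S_def split: split_indicator\<close>)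
  also have "\<dots> = emeasure lebesgue (g ` S)"
    by (rule emeasure_eq_measure2[OF gSl, symmetric])
  finally have "emeasure lebesgue (g ` S) = (\<integral>\<^sup>+y. ennreal (indicator S y * y$1) \<partial>lborel)" by simp
  also have "\<dots> = (\<integral>\<^sup>+z. ennreal (indicator S (vector [fst z, snd z]) * fst z) \<partial>lborel)"
    unfolding lborel_vector_2[symmetric]
    by (subst nn_integral_distr) (auto simp: vector_2_eq axis_def intro!: borel_measurable_continuous_onI continuous_intros)
  also have "\<dots> = (\<integral>\<^sup>+z. ennreal (fst z) * indicator A (polar (fst z) (snd z)) * indicator ({a..b} \<times> {0..2*pi}) z \<partial>lborel)"
  proof (rule nn_integral_cong_AE)
    show "AE z in lborel. ennreal (indicator S (vector [fst z, snd z]) * fst z) =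
      ennreal (fst z) * indicator A (polar (fst z) (snd z)) * indicator ({a..b} \<times> {0..2*pi}) z"
      using AE_lborel_prod_neq(1)[of a] AE_lborel_prod_neq(1)[of b] AE_lborel_prod_neq(2)[of 0] AE_lborel_prod_neq(2)[of "2*pi"]
      by eventually_elim (auto simp: S_def g_def split: split_indicator)
  qed
  also have "\<dots> = (\<integral>\<^sup>+z. ennreal (fst z) * indicator A (polar (fst z) (snd z)) \<partial>polar_rect a b)"
    by (subst nn_integral_polar_rect) auto
  finally show ?thesis using eq1 by simp
qed

text \<open>The formula for sets is an equality of measures: area on the annulus is the image of
  \<open>r dr dt\<close> under the polar map. Hence the formula for all Borel functions.\<close>

lemma nn_integral_annulus_polar:
  assumes ab: "0 < a" "a < b" and [measurable]: "F \<in> borel_measurable borel"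
  shows "(\<integral>\<^sup>+x. F x \<partial>lebesgue_on (annulus a b)) =
    (\<integral>\<^sup>+z. ennreal (fst z) * F (polar (fst z) (snd z)) \<partial>polar_rect a b)"
proof -
  have pm [measurable]: "(\<lambda>z. polar (fst z) (snd z)) \<in> measurable (polar_rect a b) borel"
    by (rule measurable_polar_rect) measurable
  have fm [measurable]: "fst \<in> borel_measurable (polar_rect a b)"
    by (rule measurable_polar_rect) (rule borel_measurable_continuous_onI, intro continuous_intros)
  have eq: "density lborel (indicator (annulus a b)) = distr (density (polar_rect a b) (\<lambda>z. ennreal (fst z))) borel (\<lambda>z. polar (fst z) (snd z))"
  proof (rule measure_eqI)
    fix A :: "(real^2) set" assume "A \<in> sets (density lborel (indicator (annulus a b)))"
    then have [measurable]: "A \<in> sets borel" by simp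
    have "emeasure (density lborel (indicator (annulus a b))) A = emeasure lborel (A \<inter> annulus a b)"
      by (subst emeasure_density) (auto simp: nn_integral_indicator[symmetric] simp del: nn_integral_indicator
          intro!: nn_integral_cong split: split_indicator)
    also have "\<dots> = (\<integral>\<^sup>+z. ennreal (fst z) * indicator A (polar (fst z) (snd z)) \<partial>polar_rect a b)"
      by (rule emeasure_annulus_polar) (use ab in auto)
    also have "\<dots> = (\<integral>\<^sup>+x. indicator A x \<partial>distr (density (polar_rect a b) (\<lambda>z. ennreal (fst z))) borel (\<lambda>z. polar (fst z) (snd z)))"
      by (subst nn_integral_distr, measurable) (subst nn_integral_density, auto)
    finally show "emeasure (density lborel (indicator (annulus a b))) A
        = emeasure (distr (density (polar_rect a b) (\<lambda>z. ennreal (fst z))) borel (\<lambda>z. polar (fst z) (snd z))) A"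
      by simp
  qed simp
  have "(\<integral>\<^sup>+x. F x \<partial>lebesgue_on (annulus a b)) = (\<integral>\<^sup>+x. F x * indicator (annulus a b) x \<partial>lebesgue)"
    by (subst nn_integral_restrict_space) auto
  also have "\<dots> = (\<integral>\<^sup>+x. F x * indicator (annulus a b) x \<partial>lborel)"
    by (rule nn_integral_completion)
  also have "\<dots> = (\<integral>\<^sup>+x. F x \<partial>density lborel (indicator (annulus a b)))"
    by (subst nn_integral_density) (auto simp: mult.commute)
  also have "\<dots> = (\<integral>\<^sup>+z. ennreal (fst z) * F (polar (fst z) (snd z)) \<partial>polar_rect a b)"
    unfolding eq by (subst nn_integral_distr, measurable) (subst nn_integral_density, auto)
  finally show ?thesis .
qed

lemma AE_seg: "AE x in seg a b. a \<le> x \<and> x \<le> b"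
  by (rule AE_I2) (simp add: space_restrict_space)

lemma AE_polar_rect:
  "AE z in seg a b \<Otimes>\<^sub>M seg c d. a \<le> fst z \<and> fst z \<le> b \<and> c \<le> snd z \<and> snd z \<le> d"
  by (rule AE_I2) (auto simp: space_pair_measure space_restrict_space)

lemma AE_polar_rect_neq: "AE z in polar_rect a b. fst z \<noteq> c"
proof -
  interpret pair_sigma_finite "seg a b" "seg 0 (2*pi)" by (rule pair_sigma_finite_seg)
  have "(\<integral>\<^sup>+z. indicator ({c} \<times> UNIV) z \<partial>polar_rect a b) = (\<integral>\<^sup>+z. indicator ({c} \<times> UNIV) z * indicator ({a..b} \<times> {0..2*pi}) z \<partial>lborel)"
    by (rule nn_integral_polar_rect) (auto intro!: borel_measurable_indicator borel_Times)
  also have "\<dots> = 0"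
    by (subst nn_integral_0_iff_AE)
       (use AE_lborel_prod_neq(1)[of c] in \<open>auto elim!: eventually_mono split: split_indicator intro!: borel_measurable_times_ennreal borel_measurable_indicator borel_Times\<close>)
  finally have "AE z in polar_rect a b. indicator ({c} \<times> UNIV) z = (0 :: ennreal)"
    by (subst (asm) nn_integral_0_iff_AE) (rule measurable_polar_rect, auto intro!: borel_measurable_indicator borel_Times)
  then show ?thesis by eventually_elim (auto split: split_indicator_asm)
qed

text \<open>The density \<open>r\<close> is positive on the rectangle, so null sets of the annulus
  pull back to null sets of parameters. The sides \<open>r = a\<close> and \<open>r = b\<close>,
  which map outside the open annulus, are discarded as null sets.\<close>

lemma AE_annulus_polar:
  assumes ab: "0 < a" "a < b" and "AE x in lebesgue_on (annulus a b). Q x"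
  shows "AE z in polar_rect a b. Q (polar (fst z) (snd z))"
proof -
  have "AE x in lebesgue. x \<in> annulus a b \<longrightarrow> Q x"
    using assms(3) by (subst (asm) AE_restrict_space_iff) auto
  then have "AE x in lborel. x \<in> annulus a b \<longrightarrow> Q x" by (simp add: AE_completion_iff)
  then obtain N where N: "{x. \<not> (x \<in> annulus a b \<longrightarrow> Q x)} \<subseteq> N" "emeasure lborel N = 0" "N \<in> sets lborel"
    by (auto elim!: AE_E)
  then have [measurable]: "N \<in> sets borel" by simp
  have [measurable]: "(\<lambda>z. polar (fst z) (snd z)) \<in> measurable (polar_rect a b) borel"
    by (rule measurable_polar_rect) measurable
  have [measurable]: "fst \<in> borel_measurable (polar_rect a b)"
    by (rule measurable_polar_rect) (rule borel_measurable_continuous_onI, intro continuous_intros)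
  have "emeasure lborel (N \<inter> annulus a b) \<le> emeasure lborel N" by (rule emeasure_mono) auto
  then have "emeasure lborel (N \<inter> annulus a b) = 0" using N by simp
  then have "(\<integral>\<^sup>+z. ennreal (fst z) * indicator N (polar (fst z) (snd z)) \<partial>polar_rect a b) = 0"
    using emeasure_annulus_polar[OF ab, of N] by simp
  then have AE_N: "AE z in polar_rect a b. ennreal (fst z) * indicator N (polar (fst z) (snd z)) = 0"
    by (subst (asm) nn_integral_0_iff_AE) auto
  show ?thesis
    using AE_N AE_polar_rect[of a b 0 "2*pi"] AE_polar_rect_neq[where c = a] AE_polar_rect_neq[where c = b]
  proof eventually_elim
    case (elim z)
    then have "polar (fst z) (snd z) \<in> annulus a b" using ab by (auto simp: annulus_def norm_polar)
    moreover have "polar (fst z) (snd z) \<notin> N" using elim ab by (auto split: split_indicator_asm)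
    ultimately show ?case using N(1) by blast
  qed
qed

text \<open>Pulling back to polar coordinates needs Borel functions: compositions of merely Lebesgue measurable
  functions may fail to be measurable for a product of Borel measures.\<close>

lemma borel_representative:
  fixes f :: "'a::euclidean_space \<Rightarrow> 'b::euclidean_space"
  assumes X: "X \<in> sets borel" and f: "f \<in> borel_measurable (lebesgue_on X)"
  obtains g where "g \<in> borel_measurable borel" "AE x in lebesgue_on X. f x = g x"
proof -
  have Xl: "X \<in> sets lebesgue" using X by auto
  have "\<exists>g\<in>borel_measurable lborel. AE x in lborel. indicator X x * (f x \<bullet> i) = g x" if "i \<in> Basis" for i
  proof (rule completion_ex_borel_measurable_real)
    have "(\<lambda>x. f x \<bullet> i) \<in> borel_measurable (lebesgue_on X)"
      using f by measurable
    then show "(\<lambda>x. indicator X x * (f x \<bullet> i)) \<in> borel_measurable lebesgue"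
      using Xl by (subst (asm) borel_measurable_restrict_space_iff) (auto simp: mult.commute)
  qed
  then obtain g where g: "\<And>i. i \<in> Basis \<Longrightarrow> g i \<in> borel_measurable lborel"
    "\<And>i. i \<in> Basis \<Longrightarrow> AE x in lborel. indicator X x * (f x \<bullet> i) = g i x" by metis
  show ?thesis
  proof
    show "(\<lambda>x. \<Sum>i\<in>Basis. g i x *\<^sub>R i) \<in> borel_measurable borel"
      using g(1) by (intro borel_measurable_sum borel_measurable_scaleR) auto
    have "AE x in lborel. \<forall>i\<in>Basis. indicator X x * (f x \<bullet> i) = g i x"
      using g(2) by (intro AE_finite_allI) auto
    then have "AE x in lborel. x \<in> X \<longrightarrow> f x = (\<Sum>i\<in>Basis. g i x *\<^sub>R i)"
    proof eventually_elim
      case (elim x)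
      show ?case
      proof
        assume "x \<in> X"
        then have "(\<Sum>i\<in>Basis. g i x *\<^sub>R i) = (\<Sum>i\<in>Basis. (f x \<bullet> i) *\<^sub>R i)"
          using elim by (intro sum.cong) auto
        then show "f x = (\<Sum>i\<in>Basis. g i x *\<^sub>R i)" by (simp add: euclidean_representation)
      qed
    qed
    then have "AE x in lebesgue. x \<in> X \<longrightarrow> f x = (\<Sum>i\<in>Basis. g i x *\<^sub>R i)" by (rule AE_completion)
    then show "AE x in lebesgue_on X. f x = (\<Sum>i\<in>Basis. g i x *\<^sub>R i)"
      using Xl by (subst AE_restrict_space_iff) auto
  qed
qed

section \<open>Twist maps\<close>

definition norm_sq :: "real^2 \<Rightarrow> real" where "norm_sq x = (x$1)\<^sup>2 + (x$2)\<^sup>2"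

text \<open>The angle is a function of \<open>|x|^2\<close> instead of \<open>|x|\<close>: the
  squared norm is a polynomial in the coordinates, so that a polynomial \<open>g\<close> gives a map
  that is smooth at the origin too.\<close>

definition twist :: "(real \<Rightarrow> real) \<Rightarrow> real^2 \<Rightarrow> real^2" where
  "twist g x = vector [cos (g (norm_sq x)) * x$1 - sin (g (norm_sq x)) * x$2,
                       sin (g (norm_sq x)) * x$1 + cos (g (norm_sq x)) * x$2]"

text \<open>A rotation matrix plus a rank-one term: the twisted point turned by a right angle, times
  the gradient \<open>2 g' x\<close> of the angle.\<close>

definition twist_jac :: "(real \<Rightarrow> real) \<Rightarrow> (real \<Rightarrow> real) \<Rightarrow> real^2 \<Rightarrow> real^2^2" where
  "twist_jac g g' x =
     (let s = sin (g (norm_sq x)); c = cos (g (norm_sq x)); d = 2 * g' (norm_sq x); T = twist g x in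
      vector [vector [c - T$2 * (d * x$1), - s - T$2 * (d * x$2)],
              vector [s + T$1 * (d * x$1), c + T$1 * (d * x$2)]])"

lemma norm_sq_eq: "norm_sq x = (norm x)\<^sup>2"
  by (simp add: norm_sq_def norm_vec_2)

lemma to_complex_twist: "to_complex (twist g x) = cis (g (norm_sq x)) * to_complex x"
  by (simp add: to_complex_def twist_def complex_eq_iff)

lemma norm_twist: "norm (twist g x) = norm x"
  by (simp add: norm_to_complex[symmetric] to_complex_twist norm_mult)

lemma twist_jac_entries:
  "twist_jac g g' x $ 1 $ 1 = cos (g (norm_sq x)) - twist g x $ 2 * (2 * g' (norm_sq x) * x$1)"
  "twist_jac g g' x $ 1 $ 2 = - sin (g (norm_sq x)) - twist g x $ 2 * (2 * g' (norm_sq x) * x$2)"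
  "twist_jac g g' x $ 2 $ 1 = sin (g (norm_sq x)) + twist g x $ 1 * (2 * g' (norm_sq x) * x$1)"
  "twist_jac g g' x $ 2 $ 2 = cos (g (norm_sq x)) + twist g x $ 1 * (2 * g' (norm_sq x) * x$2)"
  by (simp_all add: twist_jac_def Let_def)

lemma twist_rotate_back:
  "cos (g (norm_sq x)) * twist g x $ 1 + sin (g (norm_sq x)) * twist g x $ 2 = x$1"
  "cos (g (norm_sq x)) * twist g x $ 2 - sin (g (norm_sq x)) * twist g x $ 1 = x$2"
proof -
  let ?c = "cos (g (norm_sq x))" and ?s = "sin (g (norm_sq x))"
  have 1: "?c * ?c + ?s * ?s = 1" using sin_cos_squared_add3[of "g (norm_sq x)"] by simp
  have "?c * twist g x $ 1 + ?s * twist g x $ 2 = (?c * ?c + ?s * ?s) * x$1"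
    by (simp add: twist_def algebra_simps del: sin_cos_squared_add3)
  then show "?c * twist g x $ 1 + ?s * twist g x $ 2 = x$1" by (simp only: 1)
  have "?c * twist g x $ 2 - ?s * twist g x $ 1 = (?c * ?c + ?s * ?s) * x$2"
    by (simp add: twist_def algebra_simps del: sin_cos_squared_add3)
  then show "?c * twist g x $ 2 - ?s * twist g x $ 1 = x$2" by (simp only: 1)
qed

text \<open>After rotating back, the rank-one term contributes \<open>d (x2 x1 - x1 x2) = 0\<close>
  to the determinant: its column is tangential to the circle and its row is radial.\<close>

lemma det_twist_jac: "det (twist_jac g g' x) = 1"
proof -
  let ?c = "cos (g (norm_sq x))" and ?s = "sin (g (norm_sq x))" and ?T = "twist g x" and ?d = "2 * g' (norm_sq x)"
  have "det (twist_jac g g' x) = (?c * ?c + ?s * ?s) + ?d * x$2 * (?c * ?T$1 + ?s * ?T$2) - ?d * x$1 * (?c * ?T$2 - ?s * ?T$1)"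
    unfolding det_2 twist_jac_entries by (simp only: algebra_simps) (simp add: algebra_simps)
  then show ?thesis unfolding twist_rotate_back by simp
qed

text \<open>The rotation contributes 2 and the rank-one term the product of the squared lengths of
  its two factors. The cross term is again a multiple of \<open>x2 x1 - x1 x2\<close>.\<close>

lemma norm_twist_jac: "(norm (twist_jac g g' x))\<^sup>2 = 2 + 4 * (g' (norm_sq x))\<^sup>2 * (norm_sq x)\<^sup>2"
proof -
  let ?c = "cos (g (norm_sq x))" and ?s = "sin (g (norm_sq x))" and ?T = "twist g x" and ?d = "2 * g' (norm_sq x)"
  have T: "(?T$1)\<^sup>2 + (?T$2)\<^sup>2 = norm_sq x"
    using norm_twist[of g x] by (simp add: norm_sq_eq[symmetric] norm_sq_def[symmetric] norm_vec_2)
  have "(norm (twist_jac g g' x))\<^sup>2 = (twist_jac g g' x$1$1)\<^sup>2 + (twist_jac g g' x$1$2)\<^sup>2 + (twist_jac g g' x$2$1)\<^sup>2 + (twist_jac g g' x$2$2)\<^sup>2"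
    by (simp add: norm_vec_def L2_set_def sum_2 add_nonneg_nonneg)
  also have "\<dots> = 2 * (?c * ?c + ?s * ?s) + ?d\<^sup>2 * norm_sq x * ((?T$1)\<^sup>2 + (?T$2)\<^sup>2)
      + 2 * ?d * (x$2 * (?c * ?T$1 + ?s * ?T$2) - x$1 * (?c * ?T$2 - ?s * ?T$1))"
    unfolding twist_jac_entries norm_sq_def[of x] power2_eq_square by algebra
  also have "\<dots> = 2 + 4 * (g' (norm_sq x))\<^sup>2 * (norm_sq x)\<^sup>2"
    unfolding twist_rotate_back T by (simp add: power2_eq_square)
  finally show ?thesis .
qed

lemma twist_has_derivative:
  assumes g: "(g has_real_derivative g' (norm_sq x)) (at (norm_sq x))"
  shows "(twist g has_derivative (\<lambda>h. twist_jac g g' x *v h)) (at x)"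
proof -
  let ?c = "cos (g (norm_sq x))" and ?s = "sin (g (norm_sq x))" and ?d = "g' (norm_sq x)"
  have n: "((\<lambda>x :: real^2. x $ i) has_derivative (\<lambda>h. h $ i)) (at x)" for i
    by (rule bounded_linear_imp_has_derivative[OF bounded_linear_vec_nth])
  have q: "(norm_sq has_derivative (\<lambda>h. 2 * x$1 * h$1 + 2 * x$2 * h$2)) (at x)"
    unfolding norm_sq_def[abs_def]
    by (rule has_derivative_eq_rhs, rule has_derivative_add; (rule has_derivative_power n)?)
       (auto simp: fun_eq_iff algebra_simps intro: n)
  have G: "((\<lambda>x. g (norm_sq x)) has_derivative (\<lambda>h. ?d * (2 * x$1 * h$1 + 2 * x$2 * h$2))) (at x)"
    using has_derivative_compose[OF q g[unfolded has_field_derivative_def]] .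
  have c: "((\<lambda>x. cos (g (norm_sq x))) has_derivative (\<lambda>h. - (?s * (?d * (2 * x$1 * h$1 + 2 * x$2 * h$2))))) (at x)"
    using has_derivative_cos[OF G] by (simp add: mult.commute)
  have s: "((\<lambda>x. sin (g (norm_sq x))) has_derivative (\<lambda>h. ?c * (?d * (2 * x$1 * h$1 + 2 * x$2 * h$2)))) (at x)"
    using has_derivative_sin[OF G] by (simp add: mult.commute)
  note D = has_derivative_vector_2[OF
      has_derivative_diff[OF has_derivative_mult[OF c n[of 1]] has_derivative_mult[OF s n[of 2]]]
      has_derivative_add[OF has_derivative_mult[OF s n[of 1]] has_derivative_mult[OF c n[of 2]]]]
  show ?thesis
    unfolding twist_def[abs_def]
    by (rule has_derivative_eq_rhs[OF D])
       (simp add: fun_eq_iff vec_eq_iff forall_2 matrix_vector_mult_def sum_2 twist_jac_entries, simp add: twist_def algebra_simps)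
qed

lemma jacobian_twist:
  assumes "\<And>t. (g has_real_derivative g' t) (at t)"
  shows "jacobian (twist g) (at x) = twist_jac g g' x"
proof -
  have "frechet_derivative (twist g) (at x) = (\<lambda>h. twist_jac g g' x *v h)"
    using frechet_derivative_at[OF twist_has_derivative[of g g' x]] assms by simp
  then show ?thesis by (simp add: jacobian_def)
qed

lemma continuous_on_norm_sq [continuous_intros]: "continuous_on S norm_sq"
  unfolding norm_sq_def[abs_def] by (intro continuous_intros)

lemma continuous_on_twist:
  assumes "continuous_on (norm_sq ` S) g"
  shows "continuous_on S (twist g)"
  unfolding twist_def[abs_def] vector_2_eq
  by (intro continuous_intros continuous_on_compose2[OF assms]) auto

lemma smooth_twist_poly: "smooth (twist (poly p))"
proof -
  have b: "Ck k (\<lambda>x :: real^2. x $ i)" for k i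
    by (rule Ck_bounded_linear[OF bounded_linear_vec_nth])
  have q: "Ck k norm_sq" for k
    unfolding norm_sq_def[abs_def] by (intro Ck_add Ck_power b)
  have p: "Ck k (\<lambda>x. poly p (norm_sq x))" for k
    unfolding poly_altdef by (intro Ck_sum Ck_mult Ck_const Ck_power q)
  have m: "Ck k (\<lambda>x. - (f x))" if "Ck k f" for k and f :: "real^2 \<Rightarrow> real"
    using Ck_mult[OF Ck_const[of _ "-1"] that] by simp
  have "Ck k (twist (poly p))" for k
  proof (rule Ck_vec)
    fix i :: 2
    have "Ck k (\<lambda>x. cos (poly p (norm_sq x)) * x$1 + - (sin (poly p (norm_sq x)) * x$2))"
      "Ck k (\<lambda>x. sin (poly p (norm_sq x)) * x$1 + cos (poly p (norm_sq x)) * x$2)"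
      by (intro Ck_add Ck_mult Ck_cos Ck_sin p b m)+
    then show "Ck k (\<lambda>x. twist (poly p) x $ i)"
      using exhaust_2[of i] by (auto simp: twist_def)
  qed
  then show ?thesis by (simp add: smooth_def)
qed

lemma continuous_on_vec:
  fixes f :: "'a::topological_space \<Rightarrow> 'b::topological_space^'n"
  assumes "\<And>i. continuous_on S (\<lambda>x. f x $ i)"
  shows "continuous_on S f"
proof -
  have "continuous_on S (\<lambda>x. \<chi> i. f x $ i)" by (intro continuous_on_vec_lambda assms)
  then show ?thesis by simp
qed

lemma continuous_on_twist_jac:
  assumes g: "continuous_on (norm_sq ` S) g" and g': "continuous_on (norm_sq ` S) g'"
  shows "continuous_on S (twist_jac g g')"
proof (intro continuous_on_vec)
  fix i j :: 2
  have T: "continuous_on S (\<lambda>x. twist g x $ i)" for i using continuous_on_twist[OF g] by (intro continuous_intros)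
  have gq: "continuous_on S (\<lambda>x. g (norm_sq x))" "continuous_on S (\<lambda>x. g' (norm_sq x))"
    by (auto intro: continuous_on_compose2[OF g] continuous_on_compose2[OF g'] continuous_intros)
  show "continuous_on S (\<lambda>x. twist_jac g g' x $ i $ j)"
    using exhaust_2[of i] exhaust_2[of j]
    by (elim disjE; simp only: twist_jac_entries; intro continuous_intros T gq)
qed

lemma L2_dist_sq_tendsto_0:
  fixes f :: "nat \<Rightarrow> 'a \<Rightarrow> 'b::euclidean_space"
  assumes fin: "finite_measure M"
    and m: "\<And>n. (\<lambda>x. f n x - g x) \<in> borel_measurable M"
    and B: "\<And>n. AE x in M. norm (f n x - g x) \<le> B" and lim: "AE x in M. (\<lambda>n. f n x) \<longlonglongrightarrow> g x"
  shows "(\<lambda>n. L2_dist_sq M (f n) g) \<longlonglongrightarrow> 0"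
proof -
  have "(\<lambda>n. \<integral>\<^sup>+x. ennreal ((norm (f n x - g x))\<^sup>2) \<partial>M) \<longlonglongrightarrow> (\<integral>\<^sup>+x. 0 \<partial>M)"
  proof (rule nn_integral_dominated_convergence)
    show "AE x in M. ennreal ((norm (f n x - g x))\<^sup>2) \<le> ennreal (B\<^sup>2)" for n
      using B[of n] by eventually_elim (auto intro!: ennreal_leI power_mono)
    show "(\<integral>\<^sup>+x. ennreal (B\<^sup>2) \<partial>M) < \<infinity>"
      using finite_measure.emeasure_finite[OF fin] by (simp add: ennreal_mult_less_top less_top)
    show "AE x in M. (\<lambda>n. ennreal ((norm (f n x - g x))\<^sup>2)) \<longlonglongrightarrow> 0"
      using lim
    proof eventually_elim
      case (elim x)
      have "(\<lambda>n. (norm (f n x - g x))\<^sup>2) \<longlonglongrightarrow> (norm (g x - g x))\<^sup>2" by (intro tendsto_intros elim)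
      then have "(\<lambda>n. ennreal ((norm (f n x - g x))\<^sup>2)) \<longlonglongrightarrow> ennreal 0" by (intro tendsto_ennrealI) simp
      then show ?case by simp
    qed
  qed (use m in auto)
  then show ?thesis by (simp add: L2_dist_sq_def)
qed

lemma measurable_AE_lebesgue_on:
  fixes f g :: "'a::euclidean_space \<Rightarrow> 'b::euclidean_space"
  assumes X: "X \<in> sets lebesgue" and f: "f \<in> borel_measurable (lebesgue_on X)"
    and ae: "AE x in lebesgue_on X. f x = g x"
  shows "g \<in> borel_measurable (lebesgue_on X)"
proof -
  have "(\<lambda>x. indicator X x *\<^sub>R g x) \<in> borel_measurable lebesgue"
  proof (rule borel_measurable_AE)
    show "(\<lambda>x. indicator X x *\<^sub>R f x) \<in> borel_measurable lebesgue"
      using X f by (subst borel_measurable_restrict_space_iff[symmetric]) auto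
    show "AE x in lebesgue. indicator X x *\<^sub>R f x = indicator X x *\<^sub>R g x"
      using ae X by (subst (asm) AE_restrict_space_iff) (auto elim!: eventually_mono split: split_indicator)
  qed
  then show ?thesis using X by (subst borel_measurable_restrict_space_iff) auto
qed

lemma finite_measure_lebesgue_on_annulus: "finite_measure (lebesgue_on (annulus a b))"
proof (rule finite_measureI)
  have "emeasure lborel (annulus a b) < \<infinity>"
    by (rule emeasure_bounded_finite) (auto simp: annulus_def intro!: boundedI[of _ b])
  then show "emeasure (lebesgue_on (annulus a b)) (space (lebesgue_on (annulus a b))) \<noteq> \<infinity>"
    by (auto simp: emeasure_restrict_space space_restrict_space)
qed

lemma closure_annulus_subset: "closure (annulus a b) \<subseteq> {x. a \<le> norm x \<and> norm x \<le> b}"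
proof (rule closure_minimal)
  have "{x :: real^2. a \<le> norm x \<and> norm x \<le> b} = norm -` {a..b}" by auto
  then show "closed {x :: real^2. a \<le> norm x \<and> norm x \<le> b}"
    by (auto intro!: closed_vimage continuous_intros)
qed (auto simp: annulus_def)

lemma frontier_annulus_norm:
  assumes "x \<in> frontier (annulus a b)" shows "norm x = a \<or> norm x = b"
proof -
  have "x \<in> closure (annulus a b)" "x \<notin> annulus a b"
    using assms by (auto simp: frontier_def interior_open[OF open_annulus])
  then show ?thesis using closure_annulus_subset[of a b] by (auto simp: annulus_def)
qed

lemma closure_annulus:
  assumes "0 < a" "a < b"
  shows "closure (annulus a b) = {x. a \<le> norm x \<and> norm x \<le> b}"
proof (intro equalityI closure_annulus_subset subsetI)
  fix x :: "real^2" assume x: "x \<in> {x. a \<le> norm x \<and> norm x \<le> b}"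
  define m where "m = (a + b) / 2"
  \<comment> \<open>Starting from \<open>1 / 2\<close> keeps the weight strictly between 0 and 1, so
    that moving \<open>x\<close> towards the middle circle leads into the open annulus.\<close>
  define s where "s n = 1 / real (Suc (Suc n))" for n
  define y where "y n = ((1 - s n) + s n * (m / norm x)) *\<^sub>R x" for n
  have nx: "norm x > 0" using x assms by auto
  have s01: "0 < s n" "s n < 1" for n by (auto simp: s_def)
  have "y n \<in> annulus a b" for n
  proof -
    have "(1 - s n) + s n * (m / norm x) \<ge> 0" using s01[of n] nx assms by (simp add: m_def)
    then have "norm (y n) = (1 - s n) * norm x + s n * m"
      using nx by (simp add: y_def distrib_right)
    moreover have "(1 - s n) * norm x \<ge> (1 - s n) * a" "(1 - s n) * norm x \<le> (1 - s n) * b"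
      using x s01[of n] by (auto intro!: mult_left_mono)
    moreover have "s n * a < s n * m" "s n * m < s n * b" using s01[of n] assms by (auto simp: m_def)
    ultimately show ?thesis by (simp add: annulus_def algebra_simps)
  qed
  moreover have "y \<longlonglongrightarrow> ((1 - 0) + 0 * (m / norm x)) *\<^sub>R x"
  proof -
    have "s \<longlonglongrightarrow> 0" unfolding s_def[abs_def] using LIMSEQ_Suc[OF LIMSEQ_inverse_real_of_nat] by (simp add: inverse_eq_divide)
    then show ?thesis unfolding y_def[abs_def] by (intro tendsto_intros)
  qed
  ultimately show "x \<in> closure (annulus a b)" by (auto simp: closure_sequential)
qed

text \<open>A continuous phase \<open>p\<close> writes the normalised curve as the exponential of
  the path \<open>\<i> p\<close>, whose winding number about 0 is the increment of \<open>p\<close>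
  over \<open>2 pi\<close>.\<close>

lemma degree_on_ray_eq:
  assumes ab: "a < b" and p: "continuous_on {a..b} p"
    and f: "\<And>r. r \<in> {a..b} \<Longrightarrow> \<rho> r > 0" "\<And>r. r \<in> {a..b} \<Longrightarrow> to_complex (f (polar r t)) = of_real (\<rho> r) * cis (p r)"
  shows "degree_on_ray a b f t = of_real ((p b - p a) / (2 * pi))"
proof -
  define q where "q s = \<i> * of_real (p (a + s * (b - a)))" for s
  have seg: "a + s * (b - a) \<in> {a..b}" if "0 \<le> s" "s \<le> 1" for s
  proof -
    have "s * (b - a) \<le> 1 * (b - a)" "0 \<le> s * (b - a)"
      using that ab by (intro mult_right_mono mult_nonneg_nonneg; simp)+
    then show ?thesis unfolding atLeastAtMost_iff by auto
  qed
  have "path q" unfolding path_def q_def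
    by (intro continuous_intros continuous_on_compose2[OF p]) (use seg in auto)
  have "degree_on_ray a b f t = winding_number (exp \<circ> q) 0"
    unfolding degree_on_ray_def
  proof (rule winding_number_cong)
    fix s :: real assume s: "0 \<le> s" "s \<le> 1"
    let ?y = "f (polar (a + s * (b - a)) t)"
    have "norm ?y = \<rho> (a + s * (b - a))"
      using f[OF seg[OF s]] by (simp add: norm_to_complex[symmetric] norm_mult)
    then have "radial_curve a b f t s = to_complex ?y /\<^sub>R \<rho> (a + s * (b - a))"
      by (simp add: radial_curve_def Let_def linear_simps[OF bounded_linear_to_complex])
    also have "\<dots> = cis (p (a + s * (b - a)))"
      using f[OF seg[OF s]] by (simp add: scaleR_conv_of_real)
    finally show "radial_curve a b f t s = (exp \<circ> q) s"
      by (simp add: q_def cis_conv_exp)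
  qed
  also have "\<dots> = of_real ((p b - p a) / (2 * pi))"
  proof -
    have "pathfinish q - pathstart q = \<i> * of_real (p b - p a)"
      by (simp add: q_def pathstart_def pathfinish_def algebra_simps)
    then show ?thesis unfolding winding_number_compose_exp[OF \<open>path q\<close>] by simp
  qed
  finally show ?thesis .
qed

section \<open>The minimising twists\<close>

text \<open>Chosen so that the phase \<open>twist_rate * ln (r / a)\<close> grows by
  \<open>2 pi k\<close> from the inner to the outer circle.\<close>

definition twist_rate :: "real \<Rightarrow> real \<Rightarrow> int \<Rightarrow> real" where
  "twist_rate a b k = 2 * pi * of_int k / ln (b / a)"

text \<open>The same phase in terms of \<open>t = r^2\<close>, the argument that twists
  supply.\<close>

definition twist_angle :: "real \<Rightarrow> real \<Rightarrow> int \<Rightarrow> real \<Rightarrow> real" where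
  "twist_angle a b k t = twist_rate a b k / 2 * ln (t / a\<^sup>2)"

text \<open>Half the integral of \<open>(2 + c^2) / |x|^2\<close> over the annulus, where
  \<open>c\<close> is the rate.\<close>

definition twist_energy :: "real \<Rightarrow> real \<Rightarrow> int \<Rightarrow> real" where
  "twist_energy a b k = pi * ln (b / a) * (2 + (twist_rate a b k)\<^sup>2)"

text \<open>Taylor polynomials at \<open>b\<^sup>2\<close>, converging to the angle function on \<open>[a\<^sup>2, b\<^sup>2]\<close>: twists with
  polynomial angle are smooth on the whole plane.\<close>

definition twist_poly :: "real \<Rightarrow> real \<Rightarrow> int \<Rightarrow> nat \<Rightarrow> real poly" where
  "twist_poly a b k n = smult (twist_rate a b k / 2)
     ([:ln (b\<^sup>2 / a\<^sup>2):] - (\<Sum>i<n. smult (1 / real (Suc i)) ([:1, - 1 / b\<^sup>2:] ^ Suc i)))"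

context
  fixes a b :: real and k :: int
  assumes ab: "0 < a" "a < b"
begin

private abbreviation "\<phi> \<equiv> twist_angle a b k"
private abbreviation "\<phi>' \<equiv> (\<lambda>t. twist_rate a b k / (2 * t))"
private abbreviation "u\<^sub>k \<equiv> twist \<phi>"

lemma twist_angle_deriv: "t > 0 \<Longrightarrow> (\<phi> has_real_derivative \<phi>' t) (at t)"
  unfolding twist_angle_def[abs_def] using ab
  by (auto intro!: derivative_eq_intros simp: field_simps power2_eq_square)

text \<open>With \<open>y = 1 - t / b^2\<close>, which lies in \<open>[0, 1)\<close>, the
  polynomials contain the partial sums of the series of \<open>ln (1 - y)\<close>. Their derivatives
  are geometric sums with nonnegative terms, hence bounded by their limit; as \<open>t\<close> is at
  least \<open>a^2\<close>, the bound is uniform and later provides domination.\<close>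

lemma twist_poly_tendsto:
  assumes t: "t \<in> {a\<^sup>2..b\<^sup>2}"
  shows "(\<lambda>n. poly (twist_poly a b k n) t) \<longlonglongrightarrow> \<phi> t"
    "(\<lambda>n. poly (pderiv (twist_poly a b k n)) t) \<longlonglongrightarrow> \<phi>' t"
    "\<bar>poly (pderiv (twist_poly a b k n)) t\<bar> \<le> \<bar>twist_rate a b k\<bar> / (2 * a\<^sup>2)"
    "\<bar>\<phi>' t\<bar> \<le> \<bar>twist_rate a b k\<bar> / (2 * a\<^sup>2)"
proof -
  define y where "y = 1 - t / b\<^sup>2"
  have a2: "0 < a\<^sup>2" and b2: "0 < b\<^sup>2" using ab by auto
  have t0: "t > 0" using t a2 unfolding atLeastAtMost_iff by linarith
  have y: "0 \<le> y" "y < 1" using t t0 b2 by (auto simp: y_def)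
  have py: "poly [:1, - 1 / b\<^sup>2:] t = y" by (simp add: y_def)
  have "(\<lambda>n. - ((- (- y)) ^ n) / of_nat n) sums ln (1 + (- y))" by (rule ln_series') (use y in auto)
  then have "(\<lambda>n. - (y ^ n) / of_nat n) sums ln (t / b\<^sup>2)" by (simp add: y_def)
  \<comment> \<open>The term of index 0 is a division by zero and so has the value 0; the series may
    start at index 1.\<close>
  then have "(\<lambda>n. - (y ^ Suc n) / of_nat (Suc n)) sums (ln (t / b\<^sup>2) - (- (y ^ 0) / of_nat 0))"
    by (subst sums_Suc_iff) simp
  then have "(\<lambda>n. - (y ^ Suc n) / of_nat (Suc n)) sums ln (t / b\<^sup>2)" by simp
  then have S: "(\<lambda>n. \<Sum>i<n. - (y ^ Suc i) / of_nat (Suc i)) \<longlonglongrightarrow> ln (t / b\<^sup>2)" by (simp add: sums_def)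
  have "poly (twist_poly a b k n) t = twist_rate a b k / 2 * (ln (b\<^sup>2 / a\<^sup>2) + (\<Sum>i<n. - (y ^ Suc i) / of_nat (Suc i)))" for n
    unfolding twist_poly_def poly_smult poly_diff poly_sum poly_power py by (simp add: sum_negf)
  moreover have "(\<lambda>n. twist_rate a b k / 2 * (ln (b\<^sup>2 / a\<^sup>2) + (\<Sum>i<n. - (y ^ Suc i) / of_nat (Suc i))))
      \<longlonglongrightarrow> twist_rate a b k / 2 * (ln (b\<^sup>2 / a\<^sup>2) + ln (t / b\<^sup>2))"
    by (intro tendsto_intros S)
  moreover have "ln (b\<^sup>2 / a\<^sup>2) + ln (t / b\<^sup>2) = ln (t / a\<^sup>2)"
    using t0 a2 b2 ab by (simp add: ln_div)
  ultimately show "(\<lambda>n. poly (twist_poly a b k n) t) \<longlonglongrightarrow> \<phi> t" by (simp only: twist_angle_def)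
  have P: "poly (pderiv (twist_poly a b k n)) t = twist_rate a b k / 2 * ((\<Sum>i<n. y ^ i) / b\<^sup>2)" for n
  proof -
    have pd: "pderiv [:1, - 1 / b\<^sup>2:] = [:- 1 / b\<^sup>2:]" by (simp add: pderiv_pCons)
    have sm: "pderiv (\<Sum>i<n. smult (1 / real (Suc i)) ([:1, - 1 / b\<^sup>2:] ^ Suc i))
        = (\<Sum>i<n. pderiv (smult (1 / real (Suc i)) ([:1, - 1 / b\<^sup>2:] ^ Suc i)))"
      by (induction n) (auto simp: pderiv_add)
    have pdn: "pderiv (twist_poly a b k n) = smult (twist_rate a b k / 2)
        (pderiv [:ln (b\<^sup>2 / a\<^sup>2):] - (\<Sum>i<n. smult (1 / real (Suc i)) (smult (of_nat (Suc i)) ([:1, - 1 / b\<^sup>2:] ^ i) * [:- 1 / b\<^sup>2:])))"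
      unfolding twist_poly_def pderiv_smult pderiv_diff sm pderiv_power_Suc pd ..
    have "poly (pderiv (twist_poly a b k n)) t = twist_rate a b k / 2 * (- (\<Sum>i<n. 1 / real (Suc i) * (real (Suc i) * y ^ i * (- 1 / b\<^sup>2))))"
      unfolding pdn poly_smult poly_diff poly_sum poly_power poly_mult py by (simp add: pderiv_pCons)
    also have "(\<Sum>i<n. 1 / real (Suc i) * (real (Suc i) * y ^ i * (- 1 / b\<^sup>2))) = (\<Sum>i<n. - (y ^ i / b\<^sup>2))"
      by (intro sum.cong) auto
    finally show ?thesis by (simp add: sum_negf sum_divide_distrib)
  qed
  have ty: "1 - y = t / b\<^sup>2" by (simp add: y_def)
  have G: "(\<lambda>n. \<Sum>i<n. y ^ i) \<longlonglongrightarrow> 1 / (1 - y)" using geometric_sums[of y] y by (simp add: sums_def)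
  have "(\<lambda>n. twist_rate a b k / 2 * ((\<Sum>i<n. y ^ i) / b\<^sup>2)) \<longlonglongrightarrow> twist_rate a b k / 2 * ((1 / (1 - y)) / b\<^sup>2)"
    by (intro tendsto_intros G) (use b2 in auto)
  moreover have "(1 / (1 - y)) / b\<^sup>2 = 1 / t" unfolding ty using b2 t0 ab by simp
  ultimately show "(\<lambda>n. poly (pderiv (twist_poly a b k n)) t) \<longlonglongrightarrow> \<phi>' t" by (simp add: P)
  have "(\<Sum>i<n. y ^ i) \<le> 1 / (1 - y)"
    using sum_le_suminf[of "\<lambda>i. y ^ i" "{..<n}"] y by (simp add: suminf_geometric summable_geometric)
  then have "(\<Sum>i<n. y ^ i) / b\<^sup>2 \<le> (1 / (1 - y)) / b\<^sup>2" using b2 by (intro divide_right_mono) auto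
  also have "\<dots> = 1 / t" by fact
  also have "\<dots> \<le> 1 / a\<^sup>2" using t a2 t0 by (intro divide_left_mono mult_pos_pos) auto
  finally have le: "(\<Sum>i<n. y ^ i) / b\<^sup>2 \<le> 1 / a\<^sup>2" .
  have "0 \<le> (\<Sum>i<n. y ^ i) / b\<^sup>2" using y by (intro divide_nonneg_nonneg sum_nonneg) auto
  then have "\<bar>poly (pderiv (twist_poly a b k n)) t\<bar> = \<bar>twist_rate a b k\<bar> / 2 * ((\<Sum>i<n. y ^ i) / b\<^sup>2)"
    unfolding P abs_mult abs_of_nonneg[OF \<open>0 \<le> (\<Sum>i<n. y ^ i) / b\<^sup>2\<close>] by simp
  also have "\<dots> \<le> \<bar>twist_rate a b k\<bar> / 2 * (1 / a\<^sup>2)" by (intro mult_left_mono le) auto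
  finally show "\<bar>poly (pderiv (twist_poly a b k n)) t\<bar> \<le> \<bar>twist_rate a b k\<bar> / (2 * a\<^sup>2)" by simp
  show "\<bar>\<phi>' t\<bar> \<le> \<bar>twist_rate a b k\<bar> / (2 * a\<^sup>2)"
    using t t0 a2 by (simp add: abs_mult) (intro divide_left_mono mult_pos_pos, auto)
qed

lemma norm_sq_range: "a \<le> norm x \<Longrightarrow> norm x \<le> b \<Longrightarrow> norm_sq x \<in> {a\<^sup>2..b\<^sup>2}" "a \<le> norm x \<Longrightarrow> norm_sq x > 0"
  using ab by (auto simp: norm_sq_eq intro!: power_mono zero_less_power)

lemma continuous_twist_angle: "continuous_on {0<..} \<phi>" "continuous_on {0<..} \<phi>'"
  unfolding twist_angle_def using ab by (auto intro!: continuous_intros)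

lemma continuous_on_minimiser:
  assumes "\<And>x. x \<in> S \<Longrightarrow> a \<le> norm x"
  shows "continuous_on S u\<^sub>k" "continuous_on S (twist_jac \<phi> \<phi>')"
  using assms norm_sq_range(2)
  by (auto intro!: continuous_on_twist continuous_on_twist_jac continuous_on_subset[OF continuous_twist_angle(1)]
      continuous_on_subset[OF continuous_twist_angle(2)])

lemma has_weak_gradient_minimiser: "has_weak_gradient (annulus a b) u\<^sub>k (twist_jac \<phi> \<phi>')"
proof (rule has_weak_gradient_C1[OF open_annulus])
  show "(u\<^sub>k has_derivative (\<lambda>h. twist_jac \<phi> \<phi>' x *v h)) (at x)" if "x \<in> annulus a b" for x
    by (rule twist_has_derivative, rule twist_angle_deriv)
       (use that norm_sq_range(2)[of x] in \<open>auto simp: annulus_def\<close>)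
  show "continuous_on (annulus a b) (twist_jac \<phi> \<phi>')"
    by (rule continuous_on_minimiser) (auto simp: annulus_def)
qed

lemma weak_gradient_minimiser:
  "AE x in lebesgue_on (annulus a b). weak_gradient (annulus a b) u\<^sub>k x = twist_jac \<phi> \<phi>' x"
proof (rule weak_gradient_unique[OF open_annulus])
  show "has_weak_gradient (annulus a b) u\<^sub>k (weak_gradient (annulus a b) u\<^sub>k)"
    unfolding weak_gradient_def by (rule someI[where P = "has_weak_gradient (annulus a b) u\<^sub>k", OF has_weak_gradient_minimiser])
qed (rule has_weak_gradient_minimiser)

lemma AE_annulus: "AE x in lebesgue_on (annulus a b). a < norm x \<and> norm x < b"
  by (rule AE_I2) (simp add: space_restrict_space annulus_def)

lemma annulus_sets_lebesgue: "annulus a b \<in> sets lebesgue"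
  using annulus_measurable by auto

lemma measurable_minimiser:
  "u\<^sub>k \<in> borel_measurable (lebesgue_on (annulus a b))"
  "twist_jac \<phi> \<phi>' \<in> borel_measurable (lebesgue_on (annulus a b))"
  "weak_gradient (annulus a b) u\<^sub>k \<in> borel_measurable (lebesgue_on (annulus a b))"
proof -
  show "u\<^sub>k \<in> borel_measurable (lebesgue_on (annulus a b))"
    by (intro continuous_imp_measurable_on_sets_lebesgue continuous_on_minimiser annulus_sets_lebesgue) (auto simp: annulus_def)
  show J: "twist_jac \<phi> \<phi>' \<in> borel_measurable (lebesgue_on (annulus a b))"
    by (intro continuous_imp_measurable_on_sets_lebesgue continuous_on_minimiser annulus_sets_lebesgue) (auto simp: annulus_def)
  show "weak_gradient (annulus a b) u\<^sub>k \<in> borel_measurable (lebesgue_on (annulus a b))"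
    by (rule measurable_AE_lebesgue_on[OF annulus_sets_lebesgue J]) (use weak_gradient_minimiser in \<open>auto elim: eventually_mono\<close>)
qed

text \<open>The norm formula evaluated at the largest derivative of the angle and the largest
  radius: one bound for the twist and all its polynomial approximations.\<close>

definition "jac_bound = sqrt (2 + 4 * (\<bar>twist_rate a b k\<bar> / (2 * a\<^sup>2))\<^sup>2 * (b\<^sup>2)\<^sup>2)"

lemma norm_twist_jac_le:
  assumes "a \<le> norm x" "norm x \<le> b" "\<bar>g' (norm_sq x)\<bar> \<le> \<bar>twist_rate a b k\<bar> / (2 * a\<^sup>2)"
  shows "norm (twist_jac g g' x) \<le> jac_bound"
  unfolding jac_bound_def
proof (rule real_le_rsqrt)
  have "(g' (norm_sq x))\<^sup>2 \<le> (\<bar>twist_rate a b k\<bar> / (2 * a\<^sup>2))\<^sup>2"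
    using assms(3) by (simp add: abs_le_square_iff[symmetric])
  moreover have "(norm_sq x)\<^sup>2 \<le> (b\<^sup>2)\<^sup>2"
    using norm_sq_range(1)[OF assms(1,2)] norm_sq_range(2)[OF assms(1)] by (intro power_mono) auto
  ultimately have "(g' (norm_sq x))\<^sup>2 * (norm_sq x)\<^sup>2 \<le> (\<bar>twist_rate a b k\<bar> / (2 * a\<^sup>2))\<^sup>2 * (b\<^sup>2)\<^sup>2"
    by (intro mult_mono) auto
  then show "(norm (twist_jac g g' x))\<^sup>2 \<le> 2 + 4 * (\<bar>twist_rate a b k\<bar> / (2 * a\<^sup>2))\<^sup>2 * (b\<^sup>2)\<^sup>2"
    unfolding norm_twist_jac by simp
qed

lemma square_integrable_bounded:
  fixes f :: "real^2 \<Rightarrow> 'b::euclidean_space"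
  assumes f: "f \<in> borel_measurable (lebesgue_on (annulus a b))"
    and B: "AE x in lebesgue_on (annulus a b). norm (f x) \<le> B"
  shows "square_integrable (annulus a b) f"
proof -
  interpret finite_measure "lebesgue_on (annulus a b)" by (rule finite_measure_lebesgue_on_annulus)
  have "integrable (lebesgue_on (annulus a b)) (\<lambda>x. (norm (f x))\<^sup>2)"
    by (rule integrable_const_bound[of _ "B\<^sup>2"])
       (use B f in \<open>auto elim!: eventually_mono intro!: power_mono\<close>)
  then show ?thesis using f by (simp add: square_integrable_def)
qed

lemma minimiser_W12: "u\<^sub>k \<in> W12 (annulus a b)"
  unfolding W12_def
proof (intro CollectI conjI)
  show "square_integrable (annulus a b) u\<^sub>k"
    by (rule square_integrable_bounded[OF measurable_minimiser(1), of b])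
       (rule eventually_mono[OF AE_annulus], simp add: norm_twist)
  show "\<exists>G. has_weak_gradient (annulus a b) u\<^sub>k G" using has_weak_gradient_minimiser by blast
  show "square_integrable (annulus a b) (weak_gradient (annulus a b) u\<^sub>k)"
  proof (rule square_integrable_bounded[OF measurable_minimiser(3)])
    show "AE x in lebesgue_on (annulus a b). norm (weak_gradient (annulus a b) u\<^sub>k x) \<le> jac_bound"
      using weak_gradient_minimiser AE_annulus
    proof eventually_elim
      case (elim x)
      then show ?case
        using norm_twist_jac_le[of x \<phi>' \<phi>] twist_poly_tendsto(4)[OF norm_sq_range(1)[of x]] by auto
    qed
  qed
qed

lemma minimiser_boundary: "norm x = a \<or> norm x = b \<Longrightarrow> u\<^sub>k x = x"
proof -
  assume x: "norm x = a \<or> norm x = b"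
  have L: "ln (b / a) \<noteq> 0" using ab by simp
  have "cis (\<phi> (norm_sq x)) = 1"
  proof (cases "norm x = a")
    case True
    then show ?thesis using ab by (simp add: twist_angle_def norm_sq_eq)
  next
    case False
    have "ln ((norm x)\<^sup>2 / a\<^sup>2) = 2 * ln (b / a)"
      using x False ab by (simp add: power_divide[symmetric] ln_realpow)
    then have "\<phi> (norm_sq x) = 2 * pi * of_int k"
      using L by (simp add: twist_angle_def norm_sq_eq twist_rate_def)
    then show ?thesis by (simp add: cis_multiple_2pi)
  qed
  then have "to_complex (u\<^sub>k x) = to_complex x" by (simp add: to_complex_twist)
  then show ?thesis by (simp add: to_complex_inject)
qed

private abbreviation "w n \<equiv> twist (poly (twist_poly a b k n))"
private abbreviation "Dw n \<equiv> twist_jac (poly (twist_poly a b k n)) (poly (pderiv (twist_poly a b k n)))"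

lemma jacobian_w: "jacobian (w n) (at x) = Dw n x"
  by (rule jacobian_twist) (rule poly_DERIV)

lemma w_tendsto:
  assumes "a \<le> norm x" "norm x \<le> b"
  shows "(\<lambda>n. w n x) \<longlonglongrightarrow> u\<^sub>k x" "(\<lambda>n. Dw n x) \<longlonglongrightarrow> twist_jac \<phi> \<phi>' x"
proof -
  note P = twist_poly_tendsto(1,2)[OF norm_sq_range(1)[OF assms]]
  show w: "(\<lambda>n. w n x) \<longlonglongrightarrow> u\<^sub>k x"
    unfolding twist_def vector_2_eq by (intro tendsto_intros P)
  show "(\<lambda>n. Dw n x) \<longlonglongrightarrow> twist_jac \<phi> \<phi>' x"
  proof (intro vec_tendstoI)
    fix i j :: 2
    show "(\<lambda>n. Dw n x $ i $ j) \<longlonglongrightarrow> twist_jac \<phi> \<phi>' x $ i $ j"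
      using exhaust_2[of i] exhaust_2[of j]
      by (elim disjE; simp only: twist_jac_entries; intro tendsto_intros P w)
  qed
qed

text \<open>The polynomial twists and their Jacobians converge pointwise up to the boundary under a
  uniform bound, hence in \<open>L^2\<close>, both on the annulus and on the circles, where the
  limit is the identity.\<close>

lemma minimiser_trace: "has_trace a b u\<^sub>k (\<lambda>x. x)"
  unfolding has_trace_def
proof (intro exI[of _ w] conjI allI ballI)
  show "smooth (w n)" for n by (rule smooth_twist_poly)
  have wm: "w n \<in> borel_measurable (lebesgue_on (annulus a b))" for n
    by (intro continuous_imp_measurable_on_sets_lebesgue smooth_continuous_on smooth_twist_poly annulus_sets_lebesgue)
  have dwm: "Dw n \<in> borel_measurable (lebesgue_on (annulus a b))" for n
    by (intro continuous_imp_measurable_on_sets_lebesgue continuous_on_twist_jac continuous_on_poly annulus_sets_lebesgue continuous_on_id)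
  show "(\<lambda>n. L2_dist_sq (lebesgue_on (annulus a b)) (w n) u\<^sub>k) \<longlonglongrightarrow> 0"
  proof (rule L2_dist_sq_tendsto_0[OF finite_measure_lebesgue_on_annulus])
    show "(\<lambda>x. w n x - u\<^sub>k x) \<in> borel_measurable (lebesgue_on (annulus a b))" for n
      by (intro borel_measurable_diff wm measurable_minimiser)
    show "AE x in lebesgue_on (annulus a b). norm (w n x - u\<^sub>k x) \<le> 2 * b" for n
      using AE_annulus by eventually_elim (rule order_trans[OF norm_triangle_ineq4], simp add: norm_twist)
    show "AE x in lebesgue_on (annulus a b). (\<lambda>n. w n x) \<longlonglongrightarrow> u\<^sub>k x"
      using AE_annulus by eventually_elim (rule w_tendsto, auto)
  qed
  have "(\<lambda>n. L2_dist_sq (lebesgue_on (annulus a b)) (Dw n) (weak_gradient (annulus a b) u\<^sub>k)) \<longlonglongrightarrow> 0"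
  proof (rule L2_dist_sq_tendsto_0[OF finite_measure_lebesgue_on_annulus])
    show "(\<lambda>x. Dw n x - weak_gradient (annulus a b) u\<^sub>k x) \<in> borel_measurable (lebesgue_on (annulus a b))" for n
      by (intro borel_measurable_diff dwm measurable_minimiser)
    show "AE x in lebesgue_on (annulus a b). norm (Dw n x - weak_gradient (annulus a b) u\<^sub>k x) \<le> 2 * jac_bound" for n
      using AE_annulus weak_gradient_minimiser
    proof eventually_elim
      case (elim x)
      then have "norm (Dw n x) \<le> jac_bound" "norm (weak_gradient (annulus a b) u\<^sub>k x) \<le> jac_bound"
        using norm_twist_jac_le[of x] twist_poly_tendsto(3,4)[OF norm_sq_range(1)[of x]] by auto
      then show ?case using norm_triangle_ineq4[of "Dw n x" "weak_gradient (annulus a b) u\<^sub>k x"] by linarith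
    qed
    show "AE x in lebesgue_on (annulus a b). (\<lambda>n. Dw n x) \<longlonglongrightarrow> weak_gradient (annulus a b) u\<^sub>k x"
      using AE_annulus weak_gradient_minimiser by eventually_elim (use w_tendsto(2) in auto)
  qed
  then show "(\<lambda>n. L2_dist_sq (lebesgue_on (annulus a b)) (\<lambda>x. jacobian (w n) (at x)) (weak_gradient (annulus a b) u\<^sub>k)) \<longlonglongrightarrow> 0"
    by (simp add: jacobian_w)
  fix r assume r: "r \<in> {a, b}"
  have rn: "norm (polar r t) = r" for t using r ab by (auto simp: norm_polar)
  show "(\<lambda>n. L2_dist_sq (lebesgue_on {0..2 * pi}) (\<lambda>t. w n (polar r t)) (\<lambda>t. polar r t)) \<longlonglongrightarrow> 0"
  proof (rule L2_dist_sq_tendsto_0[where B = "2 * b"])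
    show "finite_measure (lebesgue_on {0..2 * pi})"
      by (rule finite_measureI) (simp add: emeasure_restrict_space space_restrict_space)
    have pc: "continuous_on S (polar r)" for S
      unfolding polar_def[abs_def] vector_2_eq by (intro continuous_intros)
    show "(\<lambda>t. w n (polar r t) - polar r t) \<in> borel_measurable (lebesgue_on {0..2 * pi})" for n
      by (intro continuous_imp_measurable_on_sets_lebesgue continuous_intros pc
          continuous_on_compose2[OF smooth_continuous_on[OF smooth_twist_poly] pc]) auto
    show "AE t in lebesgue_on {0..2 * pi}. norm (w n (polar r t) - polar r t) \<le> 2 * b" for n
      by (rule AE_I2, rule order_trans[OF norm_triangle_ineq4]) (use r ab in \<open>auto simp: norm_twist rn\<close>)
    have "(\<lambda>n. w n (polar r t)) \<longlonglongrightarrow> u\<^sub>k (polar r t)" for t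
      by (rule w_tendsto) (use r ab in \<open>auto simp: rn\<close>)
    moreover have "u\<^sub>k (polar r t) = polar r t" for t
      by (rule minimiser_boundary) (use r in \<open>auto simp: rn\<close>)
    ultimately show "AE t in lebesgue_on {0..2 * pi}. (\<lambda>n. w n (polar r t)) \<longlonglongrightarrow> polar r t" by simp
  qed
qed

lemma minimiser_admissible: "u\<^sub>k \<in> admissible a b"
  unfolding admissible_def
  using minimiser_W12 minimiser_trace weak_gradient_minimiser
  by (auto elim!: eventually_mono simp: det_twist_jac)

lemma minimiser_homotopy_class: "u\<^sub>k \<in> homotopy_class a b k"
  unfolding homotopy_class_def
proof (intro CollectI conjI exI[of _ "u\<^sub>k"] allI)
  show "u\<^sub>k \<in> admissible a b" by (rule minimiser_admissible)
  show "continuous_rep a b u\<^sub>k u\<^sub>k"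
    unfolding continuous_rep_def
  proof (intro conjI ballI)
    show "continuous_on (closure (annulus a b)) u\<^sub>k"
      by (rule continuous_on_minimiser) (use closure_annulus_subset in blast)
    show "u\<^sub>k ` closure (annulus a b) \<subseteq> closure (annulus a b)"
      by (auto simp: closure_annulus[OF ab] norm_twist)
    show "u\<^sub>k x = x" if "x \<in> frontier (annulus a b)" for x
      using minimiser_boundary frontier_annulus_norm[OF that] by blast
  qed auto
  fix t
  let ?p = "\<lambda>r. t + \<phi> (r\<^sup>2)"
  have "degree_on_ray a b u\<^sub>k t = of_real ((?p b - ?p a) / (2 * pi))"
  proof (rule degree_on_ray_eq[OF ab(2)])
    show "continuous_on {a..b} ?p"
      by (intro continuous_intros continuous_on_compose2[OF continuous_twist_angle(1)]) (use ab in auto)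
    show "to_complex (u\<^sub>k (polar r t)) = of_real r * cis (?p r)" if "r \<in> {a..b}" for r
      by (simp add: to_complex_twist to_complex_polar norm_sq_eq norm_polar cis_mult add.commute mult_ac)
  qed (use ab in auto)
  also have "?p b - ?p a = 2 * pi * of_int k"
  proof -
    have "ln (b\<^sup>2 / a\<^sup>2) = 2 * ln (b / a)" using ab by (simp add: power_divide[symmetric] ln_realpow)
    moreover have "ln (b / a) \<noteq> 0" using ab by simp
    ultimately show ?thesis using ab by (simp add: twist_angle_def twist_rate_def)
  qed
  finally show "degree_on_ray a b u\<^sub>k t = of_int k" by simp
qed

text \<open>The derivative \<open>c / (2 t)\<close> of the angle cancels the factor
  \<open>|x|^4\<close> in the norm of the Jacobian. The gradient thus has constant norm, and the
  integrand is \<open>(2 + c^2) / |x|^2\<close>.\<close>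

lemma energy_minimiser: "energy (annulus a b) u\<^sub>k = ennreal (twist_energy a b k)"
proof -
  let ?c = "twist_rate a b k"
  interpret pair_sigma_finite "seg a b" "seg 0 (2*pi)" by (rule pair_sigma_finite_seg)
  have [measurable]: "norm_sq \<in> borel_measurable borel"
    by (intro borel_measurable_continuous_onI continuous_intros)
  have "(\<integral>\<^sup>+x. ennreal ((norm (weak_gradient (annulus a b) u\<^sub>k x))\<^sup>2) / ennreal ((norm (u\<^sub>k x))\<^sup>2) \<partial>lebesgue_on (annulus a b))
      = (\<integral>\<^sup>+x. ennreal ((2 + ?c\<^sup>2) / norm_sq x) \<partial>lebesgue_on (annulus a b))"
  proof (rule nn_integral_cong_AE)
    show "AE x in lebesgue_on (annulus a b). ennreal ((norm (weak_gradient (annulus a b) u\<^sub>k x))\<^sup>2) / ennreal ((norm (u\<^sub>k x))\<^sup>2)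
        = ennreal ((2 + ?c\<^sup>2) / norm_sq x)"
      using weak_gradient_minimiser AE_annulus
    proof eventually_elim
      case (elim x)
      then have "norm_sq x > 0" using norm_sq_range(2)[of x] by simp
      moreover have "(norm (weak_gradient (annulus a b) u\<^sub>k x))\<^sup>2 = 2 + 4 * (?c / (2 * norm_sq x))\<^sup>2 * (norm_sq x)\<^sup>2"
        using elim norm_twist_jac[of \<phi> \<phi>' x] by simp
      moreover have "4 * (?c / (2 * norm_sq x))\<^sup>2 * (norm_sq x)\<^sup>2 = ?c\<^sup>2"
        using \<open>norm_sq x > 0\<close> by (simp add: power_divide power_mult_distrib)
      ultimately have W: "(norm (weak_gradient (annulus a b) u\<^sub>k x))\<^sup>2 = 2 + ?c\<^sup>2" by simp
      show ?case
        unfolding norm_twist norm_sq_eq[symmetric] W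
        by (rule divide_ennreal) (use \<open>norm_sq x > 0\<close> in auto)
    qed
  qed
  also have "\<dots> = (\<integral>\<^sup>+z. ennreal (fst z) * ennreal ((2 + ?c\<^sup>2) / norm_sq (polar (fst z) (snd z))) \<partial>polar_rect a b)"
    by (rule nn_integral_annulus_polar[OF ab]) measurable
  also have "\<dots> = (\<integral>\<^sup>+z. ennreal ((2 + ?c\<^sup>2) / fst z) \<partial>polar_rect a b)"
    using AE_polar_rect[of a b 0 "2 * pi"] ab
    by (intro nn_integral_cong_AE) (auto elim!: eventually_mono simp: norm_sq_eq norm_polar ennreal_mult[symmetric] power2_eq_square)
  also have "\<dots> = (\<integral>\<^sup>+r. (\<integral>\<^sup>+t. ennreal ((2 + ?c\<^sup>2) / r) \<partial>seg 0 (2 * pi)) \<partial>seg a b)"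
    by (subst M2.nn_integral_fst[symmetric]) (auto intro!: measurable_polar_rect)
  also have "\<dots> = (\<integral>\<^sup>+r. ennreal (2 * pi * (2 + ?c\<^sup>2) * (1 / r)) \<partial>seg a b)"
    by (intro nn_integral_cong)
       (use ab in \<open>auto simp: space_restrict_space emeasure_restrict_space ennreal_mult[symmetric] mult_ac\<close>)
  also have "\<dots> = (\<integral>\<^sup>+r. ennreal (2 * pi * (2 + ?c\<^sup>2) * (1 / r)) * indicator {a..b} r \<partial>lborel)"
    by (subst nn_integral_restrict_space) auto
  also have "\<dots> = ennreal (2 * pi * (2 + ?c\<^sup>2) * ln b - 2 * pi * (2 + ?c\<^sup>2) * ln a)"
    using ab by (intro nn_integral_FTC_Icc) (auto intro!: derivative_eq_intros)
  also have "2 * pi * (2 + ?c\<^sup>2) * ln b - 2 * pi * (2 + ?c\<^sup>2) * ln a = 2 * twist_energy a b k"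
    using ab by (simp add: twist_energy_def ln_div algebra_simps)
  finally have *: "energy (annulus a b) u\<^sub>k = ennreal (2 * twist_energy a b k) / 2" by (simp add: energy_def)
  have "twist_energy a b k \<ge> 0" using ab by (auto simp: twist_energy_def)
  then have "ennreal (2 * twist_energy a b k) / ennreal 2 = ennreal (twist_energy a b k)"
    by (subst divide_ennreal) auto
  then show ?thesis unfolding * by simp
qed

end

section \<open>Absolutely continuous functions on an interval as limits of smooth ones\<close>

text \<open>The primitive that vanishes at \<open>a\<close>. The indicator keeps the domain of
  integration fixed, so that limits and bounds for all \<open>r\<close> come from one measure
  space.\<close>

definition prim :: "real \<Rightarrow> real \<Rightarrow> (real \<Rightarrow> complex) \<Rightarrow> real \<Rightarrow> complex" where
  "prim a b y r = (LINT s|seg a b. indicator {a..r} s *\<^sub>R y s)"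

lemma measurable_seg_continuous:
  fixes g :: "real \<Rightarrow> 'b::euclidean_space"
  assumes "continuous_on {a..b} g"
  shows "g \<in> borel_measurable (seg a b)"
  using borel_measurable_continuous_on_restrict[OF assms]
  by (simp add: measurable_def sets_restrict_space space_restrict_space)

lemma integrable_seg_continuous:
  fixes g :: "real \<Rightarrow> 'b::euclidean_space"
  assumes "continuous_on {a..b} g"
  shows "integrable (seg a b) g" "(LINT s|seg a b. g s) = integral {a..b} g"
proof -
  have s: "set_integrable lborel {a..b} g" by (rule borel_integrable_atLeastAtMost'[OF assms])
  then show "integrable (seg a b) g"
    by (subst integrable_restrict_space) (auto simp: set_integrable_def)
  have "(LINT s|seg a b. g s) = (LINT s:{a..b}|lborel. g s)"
    by (subst integral_restrict_space) (auto simp: set_lebesgue_integral_def)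
  also have "\<dots> = integral {a..b} g" by (rule set_borel_integral_eq_integral(2)[OF s])
  finally show "(LINT s|seg a b. g s) = integral {a..b} g" .
qed

lemma integrable_seg_mult_indicator:
  fixes g :: "real \<Rightarrow> 'b::euclidean_space"
  shows "integrable (seg a b) g \<Longrightarrow> A \<in> sets borel \<Longrightarrow> integrable (seg a b) (\<lambda>s. indicator A s *\<^sub>R g s)"
proof -
  assume g: "integrable (seg a b) g" and A: "A \<in> sets borel"
  have [measurable]: "indicator A \<in> borel_measurable (seg a b)"
    by (rule measurable_restrict_space1) (use A in auto)
  have [measurable]: "g \<in> borel_measurable (seg a b)" using g by auto
  show ?thesis
    by (rule Bochner_Integration.integrable_bound[OF g]) (auto split: split_indicator)
qed

lemma LINT_seg_indicator:
  fixes g :: "real \<Rightarrow> 'b::euclidean_space"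
  assumes "continuous_on {a..b} g" "a \<le> c" "d \<le> b"
  shows "(LINT s|seg a b. indicator {c..d} s *\<^sub>R g s) = integral {c..d} g"
proof -
  have "(LINT s|seg a b. indicator {c..d} s *\<^sub>R g s) = (LINT s|lborel. indicator {a..b} s *\<^sub>R indicator {c..d} s *\<^sub>R g s)"
    by (subst integral_restrict_space) auto
  also have "\<dots> = (LINT s:{c..d}|lborel. g s)"
    unfolding set_lebesgue_integral_def using assms(2,3)
    by (intro Bochner_Integration.integral_cong) (auto split: split_indicator)
  also have "\<dots> = integral {c..d} g"
    by (intro set_borel_integral_eq_integral borel_integrable_atLeastAtMost' continuous_on_subset[OF assms(1)])
       (use assms in auto)
  finally show ?thesis .
qed

lemma prim_continuous:
  assumes "continuous_on {a..b} g" "r \<in> {a..b}"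
  shows "prim a b g r = integral {a..r} g"
  unfolding prim_def using assms by (intro LINT_seg_indicator) auto

lemma prim_has_vector_derivative:
  assumes g: "continuous_on {a..b} g" and r: "r \<in> {a..b}"
  shows "(prim a b g has_vector_derivative g r) (at r within {a..b})"
proof -
  have "((\<lambda>u. integral {a..u} g) has_vector_derivative g r) (at r within {a..b})"
    by (rule integral_has_vector_derivative[OF g r])
  then show ?thesis
    by (rule has_vector_derivative_transform[OF r, rotated]) (simp add: prim_continuous[OF g])
qed

lemma prim_tendsto:
  assumes y: "y \<in> borel_measurable (seg a b)" "\<And>n. yn n \<in> borel_measurable (seg a b)"
    and H: "integrable (seg a b) H"
    and lim: "AE r in seg a b. (\<lambda>n. yn n r) \<longlonglongrightarrow> y r \<and> (\<forall>n. norm (yn n r) \<le> H r)"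
  shows "(\<lambda>n. prim a b (yn n) r) \<longlonglongrightarrow> prim a b y r"
  unfolding prim_def
proof (rule integral_dominated_convergence[where w = H])
  have [measurable]: "indicator {a..r} \<in> borel_measurable (seg a b)"
    by (rule measurable_restrict_space1) auto
  show "(\<lambda>s. indicator {a..r} s *\<^sub>R y s) \<in> borel_measurable (seg a b)"
    "(\<lambda>s. indicator {a..r} s *\<^sub>R yn n s) \<in> borel_measurable (seg a b)" for n
    using y by measurable
  show "AE s in seg a b. (\<lambda>n. indicator {a..r} s *\<^sub>R yn n s) \<longlonglongrightarrow> indicator {a..r} s *\<^sub>R y s"
    using lim by eventually_elim (auto intro: tendsto_intros)
  show "AE s in seg a b. norm (indicator {a..r} s *\<^sub>R yn n s) \<le> H s" for n
    using lim by eventually_elim (auto split: split_indicator intro: order_trans[OF norm_ge_zero])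
qed (rule H)

lemma prim_diff_le:
  assumes "integrable (seg a b) y" "integrable (seg a b) z"
  shows "norm (prim a b y r - prim a b z r) \<le> (LINT s|seg a b. norm (y s - z s))"
proof -
  have i: "integrable (seg a b) (\<lambda>s. indicator {a..r} s *\<^sub>R y s)" "integrable (seg a b) (\<lambda>s. indicator {a..r} s *\<^sub>R z s)"
    by (intro integrable_seg_mult_indicator assms; simp)+
  have "norm (prim a b y r - prim a b z r) \<le> (LINT s|seg a b. norm (indicator {a..r} s *\<^sub>R y s - indicator {a..r} s *\<^sub>R z s))"
    unfolding prim_def Bochner_Integration.integral_diff[OF i, symmetric] by (rule integral_norm_bound)
  also have "\<dots> \<le> (LINT s|seg a b. norm (y s - z s))"
    by (rule integral_mono) (use i assms in \<open>auto split: split_indicator\<close>)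
  finally show ?thesis .
qed

text \<open>At every point the primitives differ by at most the \<open>L^1\<close> distance of the
  integrands, which dominated convergence sends to 0.\<close>

lemma prim_uniform_limit:
  assumes y: "y \<in> borel_measurable (seg a b)" "\<And>n. yn n \<in> borel_measurable (seg a b)"
    and H: "integrable (seg a b) H"
    and lim: "AE r in seg a b. (\<lambda>n. yn n r) \<longlonglongrightarrow> y r \<and> (\<forall>n. norm (yn n r) \<le> H r)"
  shows "uniform_limit S (\<lambda>n. prim a b (yn n)) (prim a b y) sequentially"
proof -
  have yi: "integrable (seg a b) (yn n)" for n
  proof (rule Bochner_Integration.integrable_bound[OF H y(2)])
    show "AE r in seg a b. norm (yn n r) \<le> norm (H r)"
      using lim by eventually_elim (auto intro: order_trans[OF _ abs_ge_self])
  qed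
  have yb: "AE r in seg a b. norm (y r) \<le> H r"
    using lim by eventually_elim (auto intro: LIMSEQ_le_const2 tendsto_norm)
  have yi': "integrable (seg a b) y"
  proof (rule Bochner_Integration.integrable_bound[OF H y(1)])
    show "AE r in seg a b. norm (y r) \<le> norm (H r)"
      using yb by eventually_elim (auto intro: order_trans[OF _ abs_ge_self])
  qed
  have "(\<lambda>n. LINT s|seg a b. norm (yn n s - y s)) \<longlonglongrightarrow> (LINT s|seg a b. norm (0::complex))"
  proof (rule integral_dominated_convergence[where w = "\<lambda>s. 2 * H s"])
    show "(\<lambda>s. norm (yn n s - y s)) \<in> borel_measurable (seg a b)" for n using y by measurable
    show "AE s in seg a b. (\<lambda>n. norm (yn n s - y s)) \<longlonglongrightarrow> norm (0::complex)"
      using lim by eventually_elim (auto intro!: tendsto_norm_zero LIM_zero)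
    show "AE s in seg a b. norm (norm (yn n s - y s)) \<le> 2 * H s" for n
      using lim yb
    proof eventually_elim
      case (elim s)
      then have "norm (yn n s) \<le> H s" by blast
      then show ?case using elim(2) norm_triangle_ineq4[of "yn n s" "y s"] by simp
    qed
  qed (use H in auto)
  then have L: "(\<lambda>n. LINT s|seg a b. norm (yn n s - y s)) \<longlonglongrightarrow> 0" by simp
  show ?thesis
    unfolding uniform_limit_iff
  proof (intro allI impI)
    fix e :: real assume "e > 0"
    with L have "\<forall>\<^sub>F n in sequentially. (LINT s|seg a b. norm (yn n s - y s)) < e"
      by (rule order_tendstoD)
    then show "\<forall>\<^sub>F n in sequentially. \<forall>x\<in>S. dist (prim a b (yn n) x) (prim a b y x) < e"
      by eventually_elim (use prim_diff_le[OF yi yi'] in \<open>auto simp: dist_norm intro: le_less_trans\<close>)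
  qed
qed

text \<open>The chain rule for the exponential of an absolutely continuous function. For continuous
  integrands it is the fundamental theorem of calculus; in the limit the primitives converge
  uniformly, so their exponentials stay bounded.\<close>

lemma exp_prim_chain:
  assumes ab: "a \<le> b" and y: "y \<in> borel_measurable (seg a b)" "\<And>n. continuous_on {a..b} (yn n)"
    and H: "integrable (seg a b) H"
    and lim: "AE r in seg a b. (\<lambda>n. yn n r) \<longlonglongrightarrow> y r \<and> (\<forall>n. norm (yn n r) \<le> H r)"
  shows "(LINT s|seg a b. exp (prim a b y s) * y s) = exp (prim a b y b) - 1"
    "continuous_on {a..b} (prim a b y)" "prim a b y a = 0"
proof -
  note ym = measurable_seg_continuous[OF y(2)]
  note P = prim_uniform_limit[OF y(1) ym H lim] and P' = prim_tendsto[OF y(1) ym H lim]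
  have c: "continuous_on {a..b} (prim a b (yn n))" for n
    by (rule continuous_on_vector_derivative[OF prim_has_vector_derivative[OF y(2)]])
  show pc: "continuous_on {a..b} (prim a b y)"
    by (rule uniform_limit_theorem[OF _ P]) (use c in auto)
  have pa: "prim a b (yn n) a = 0" for n
    by (subst prim_continuous[OF y(2)]) (use ab in auto)
  then show "prim a b y a = 0" using P'[of a] by (simp add: LIMSEQ_const_iff)
  have n: "(LINT s|seg a b. exp (prim a b (yn n) s) * yn n s) = exp (prim a b (yn n) b) - 1" for n
  proof -
    have ci: "continuous_on {a..b} (\<lambda>s. exp (prim a b (yn n) s) * yn n s)"
      by (intro continuous_intros c y)
    have "((\<lambda>s. exp (prim a b (yn n) s) * yn n s) has_integral exp (prim a b (yn n) b) - exp (prim a b (yn n) a)) {a..b}"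
    proof (rule fundamental_theorem_of_calculus[OF ab])
      fix x assume x: "x \<in> {a..b}"
      have "((exp \<circ> prim a b (yn n)) has_vector_derivative yn n x * exp (prim a b (yn n) x)) (at x within {a..b})"
        by (rule field_vector_diff_chain_within[OF prim_has_vector_derivative[OF y(2) x]])
           (auto intro: DERIV_subset[OF DERIV_exp])
      then show "((\<lambda>s. exp (prim a b (yn n) s)) has_vector_derivative exp (prim a b (yn n) x) * yn n x) (at x within {a..b})"
        by (simp add: o_def mult.commute)
    qed
    then show ?thesis
      by (subst integrable_seg_continuous(2)[OF ci]) (simp add: pa integral_unique)
  qed
  obtain B where B: "B > 0" "\<And>s. s \<in> {a..b} \<Longrightarrow> norm (prim a b y s) \<le> B"
    using compact_imp_bounded[OF compact_continuous_image[OF pc compact_Icc]] unfolding bounded_pos by auto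
  \<comment> \<open>From some index on the primitives are within 1 of their limit, hence bounded by
    \<open>B + 1\<close>, and the exponentials by \<open>exp (B + 1)\<close>.\<close>
  have "\<forall>\<^sub>F n in sequentially. \<forall>s\<in>{a..b}. dist (prim a b (yn n) s) (prim a b y s) < 1"
    using P[of "{a..b}"] unfolding uniform_limit_iff by (simp add: eventually_mono)
  then obtain N where N: "\<And>n s. n \<ge> N \<Longrightarrow> s \<in> {a..b} \<Longrightarrow> dist (prim a b (yn n) s) (prim a b y s) < 1"
    unfolding eventually_sequentially by blast
  have "(\<lambda>n. LINT s|seg a b. exp (prim a b (yn (n + N)) s) * yn (n + N) s) \<longlonglongrightarrow> (LINT s|seg a b. exp (prim a b y s) * y s)"
  proof (rule integral_dominated_convergence[where w = "\<lambda>s. exp (B + 1) * H s"])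
    show "(\<lambda>s. exp (prim a b y s) * y s) \<in> borel_measurable (seg a b)"
      by (intro borel_measurable_times y measurable_seg_continuous continuous_intros pc)
    show "(\<lambda>s. exp (prim a b (yn (n + N)) s) * yn (n + N) s) \<in> borel_measurable (seg a b)" for n
      by (intro measurable_seg_continuous continuous_intros c y)
    show "AE s in seg a b. (\<lambda>n. exp (prim a b (yn (n + N)) s) * yn (n + N) s) \<longlonglongrightarrow> exp (prim a b y s) * y s"
      using lim
    proof eventually_elim
      case (elim s)
      then have "(\<lambda>n. yn n s) \<longlonglongrightarrow> y s" by blast
      then show ?case using P'[of s]
        by (intro tendsto_intros LIMSEQ_ignore_initial_segment[of "\<lambda>n. prim a b (yn n) s"] LIMSEQ_ignore_initial_segment[of "\<lambda>n. yn n s"])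
    qed
    show "AE s in seg a b. norm (exp (prim a b (yn (n + N)) s) * yn (n + N) s) \<le> exp (B + 1) * H s" for n
      using lim AE_seg
    proof eventually_elim
      case (elim s)
      have "norm (prim a b (yn (n + N)) s) \<le> norm (prim a b y s) + norm (prim a b (yn (n + N)) s - prim a b y s)"
        by (metis add.commute diff_add_cancel norm_triangle_ineq)
      also have "\<dots> \<le> B + 1" using N[of "n + N" s] B(2)[of s] elim by (simp add: dist_norm)
      finally have "exp (norm (prim a b (yn (n + N)) s)) \<le> exp (B + 1)" by simp
      then have "norm (exp (prim a b (yn (n + N)) s)) \<le> exp (B + 1)"
        using norm_exp[of "prim a b (yn (n + N)) s"] by linarith
      moreover have "norm (yn (n + N) s) \<le> H s" using elim by blast
      ultimately show ?case unfolding norm_mult by (intro mult_mono) auto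
    qed
  qed (use H in auto)
  then have "(\<lambda>n. exp (prim a b (yn (n + N)) b) - 1) \<longlonglongrightarrow> (LINT s|seg a b. exp (prim a b y s) * y s)"
    by (simp add: n)
  moreover have "(\<lambda>n. exp (prim a b (yn (n + N)) b) - 1) \<longlonglongrightarrow> exp (prim a b y b) - 1"
    by (intro tendsto_intros LIMSEQ_ignore_initial_segment[of "\<lambda>n. prim a b (yn n) b"] P')
  ultimately show "(LINT s|seg a b. exp (prim a b y s) * y s) = exp (prim a b y b) - 1"
    by (rule LIMSEQ_unique)
qed

text \<open>The first bound does not depend on \<open>e\<close> and serves the limit
  \<open>e -> 0\<close>, for a map with integrable logarithmic derivative. The second asks for no
  lower bound on \<open>w\<close> and serves the limit of the approximations at fixed
  \<open>e\<close>.\<close>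

lemma le_regularised_norm:
  fixes z :: complex
  assumes "e > 0"
  shows "norm (cnj w * z / of_real ((norm w)\<^sup>2 + e)) * (norm w) \<le> norm z"
    "norm (cnj w * z / of_real ((norm w)\<^sup>2 + e)) \<le> norm w * norm z / e"
proof -
  have p: "(norm w)\<^sup>2 + e > 0" using assms by (simp add: add_nonneg_pos)
  have n: "norm (of_real ((norm w)\<^sup>2 + e) :: complex) = (norm w)\<^sup>2 + e" using p by (simp only: norm_of_real)
  have eq: "norm (cnj w * z / of_real ((norm w)\<^sup>2 + e)) = norm w * norm z / ((norm w)\<^sup>2 + e)"
    unfolding norm_divide norm_mult n by simp
  have "norm w * norm z * norm w \<le> norm z * ((norm w)\<^sup>2 + e)"
    using assms by (simp add: power2_eq_square algebra_simps)
  then show "norm (cnj w * z / of_real ((norm w)\<^sup>2 + e)) * (norm w) \<le> norm z"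
    unfolding eq using p by (simp add: field_simps)
  show "norm (cnj w * z / of_real ((norm w)\<^sup>2 + e)) \<le> norm w * norm z / e"
    unfolding eq using p assms by (intro divide_left_mono mult_nonneg_nonneg mult_pos_pos) auto
qed

lemma DERIV_ln_sum_squares:
  fixes x y :: "real \<Rightarrow> real"
  assumes "(x has_real_derivative x') (at s within S)" "(y has_real_derivative y') (at s within S)"
    and "(x s)\<^sup>2 + (y s)\<^sup>2 + e > 0"
  shows "((\<lambda>s. ln ((x s)\<^sup>2 + (y s)\<^sup>2 + e)) has_real_derivative
    (2 * x s * x' + 2 * y s * y') / ((x s)\<^sup>2 + (y s)\<^sup>2 + e)) (at s within S)"
  using assms by (auto intro!: derivative_eq_intros simp: field_simps)

lemma borel_measurable_cnj [measurable]: "cnj \<in> borel_measurable borel"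
  by (intro borel_measurable_continuous_onI continuous_intros)

text \<open>The quotient \<open>z' / z\<close> damped by the factor
  \<open>|z|^2 / (|z|^2 + e)\<close>, which makes it finite at \<open>z = 0\<close>. Along a curve
  its real part is half the derivative of \<open>ln (|z|^2 + e)\<close>, and its imaginary part is
  the regularised angular form.\<close>

definition reg :: "real \<Rightarrow> complex \<Rightarrow> complex \<Rightarrow> complex" where "reg e z z' = cnj z * z' / of_real ((norm z)\<^sup>2 + e)"

text \<open>A curve \<open>v\<close> with \<open>v'/v\<close> integrable cannot reach \<open>0\<close>: the regularised logarithm \<open>ln (|v|\<^sup>2 + e)\<close>
  stays bounded below uniformly in \<open>e\<close>.\<close>

locale ray =
  fixes a b :: real and w w' :: "nat \<Rightarrow> real \<Rightarrow> complex" and v v' :: "real \<Rightarrow> complex"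
    and M :: "real \<Rightarrow> real" and \<alpha> \<beta> :: complex
  assumes ab: "a < b"
    and w: "\<And>n r. r \<in> {a..b} \<Longrightarrow> (w n has_vector_derivative w' n r) (at r within {a..b})"
    and w': "\<And>n. continuous_on {a..b} (w' n)"
    and ends: "\<And>n. w n a = \<alpha>" "\<And>n. w n b = \<beta>" "\<alpha> \<noteq> 0"
    and meas: "v \<in> borel_measurable (seg a b)" "v' \<in> borel_measurable (seg a b)"
    and lim: "AE r in seg a b. (\<lambda>n. w n r) \<longlonglongrightarrow> v r \<and> (\<lambda>n. w' n r) \<longlonglongrightarrow> v' r"
    and dom: "AE r in seg a b. \<forall>n. norm (w n r) \<le> M r \<and> norm (w' n r) \<le> M r"
    and M: "integrable (seg a b) M" "integrable (seg a b) (\<lambda>r. (M r)\<^sup>2)"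
    and nz: "AE r in seg a b. v r \<noteq> 0"
    and fin: "integrable (seg a b) (\<lambda>r. v' r / v r)"
begin

text \<open>The absolutely continuous representative of \<open>v\<close> on the ray.\<close>

definition f where "f r = \<alpha> + prim a b v' r"

lemma w_cont: "continuous_on {a..b} (w n)"
  by (rule continuous_on_vector_derivative[OF w])

lemma w_eq: "r \<in> {a..b} \<Longrightarrow> w n r = \<alpha> + prim a b (w' n) r"
proof -
  assume r: "r \<in> {a..b}"
  have "(w' n has_integral w n r - w n a) {a..r}"
    by (rule fundamental_theorem_of_calculus)
       (use r in \<open>auto intro!: has_vector_derivative_within_subset[OF w]\<close>)
  then have "integral {a..r} (w' n) = w n r - w n a" by (rule integral_unique)
  then show ?thesis using ends by (simp add: prim_continuous[OF w' r])
qed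

lemma lim': "AE r in seg a b. (\<lambda>n. w' n r) \<longlonglongrightarrow> v' r \<and> (\<forall>n. norm (w' n r) \<le> M r)"
  using lim dom by eventually_elim auto

lemma w_tendsto_f: "r \<in> {a..b} \<Longrightarrow> (\<lambda>n. w n r) \<longlonglongrightarrow> f r"
  using prim_tendsto[OF meas(2) measurable_seg_continuous[OF w'] M(1) lim', of r]
  by (simp add: w_eq f_def tendsto_intros)

lemma w_uniform: "uniform_limit {a..b} w f sequentially"
  unfolding uniform_limit_iff
proof (intro allI impI)
  fix e :: real assume "e > 0"
  then have "\<forall>\<^sub>F n in sequentially. \<forall>x\<in>{a..b}. dist (prim a b (w' n) x) (prim a b v' x) < e"
    using prim_uniform_limit[OF meas(2) measurable_seg_continuous[OF w'] M(1) lim', of "{a..b}"]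
    unfolding uniform_limit_iff by blast
  then show "\<forall>\<^sub>F n in sequentially. \<forall>x\<in>{a..b}. dist (w n x) (f x) < e"
    by eventually_elim (simp add: w_eq f_def)
qed

lemma f_cont: "continuous_on {a..b} f"
  by (rule uniform_limit_theorem[OF _ w_uniform]) (simp_all add: w_cont)

lemma f_ends: "f a = \<alpha>" "f b = \<beta>"
  using w_tendsto_f[of a] w_tendsto_f[of b] ab by (auto simp: ends LIMSEQ_const_iff)

lemma f_eq_v: "AE r in seg a b. f r = v r"
  using lim AE_seg by eventually_elim (auto intro: LIMSEQ_unique[OF w_tendsto_f])

definition "m = (LINT r|seg a b. norm (v' r / v r))"

lemma reg_prim:
  assumes e: "e > 0" and r: "r \<in> {a..b}"
  shows "ln ((norm (w n r))\<^sup>2 + e) - ln ((norm \<alpha>)\<^sup>2 + e) = 2 * Re (prim a b (\<lambda>s. reg e (w n s) (w' n s)) r)"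
proof -
  have N0: "(Re z)\<^sup>2 + (Im z)\<^sup>2 + e > 0" for z using e by (intro add_nonneg_pos) auto
  then have N0': "of_real ((norm z)\<^sup>2 + e) \<noteq> (0::complex)" for z :: complex
    unfolding of_real_eq_0_iff cmod_power2 by (metis less_irrefl)
  have c: "continuous_on {a..b} (\<lambda>s. reg e (w n s) (w' n s))"
    unfolding reg_def using N0' by (intro continuous_intros w_cont w') auto
  have "((\<lambda>s. 2 * Re (reg e (w n s) (w' n s))) has_integral ln ((norm (w n r))\<^sup>2 + e) - ln ((norm (w n a))\<^sup>2 + e)) {a..r}"
  proof (rule fundamental_theorem_of_calculus)
    fix s assume s: "s \<in> {a..r}"
    then have "(w n has_vector_derivative w' n s) (at s within {a..r})"
      using r by (intro has_vector_derivative_within_subset[OF w]) auto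
    then have R: "((\<lambda>s. Re (w n s)) has_real_derivative Re (w' n s)) (at s within {a..r})"
      and I: "((\<lambda>s. Im (w n s)) has_real_derivative Im (w' n s)) (at s within {a..r})"
      by (auto simp: has_real_derivative_iff_has_vector_derivative
          intro: bounded_linear.has_vector_derivative[OF bounded_linear_Re] bounded_linear.has_vector_derivative[OF bounded_linear_Im])
    have "((\<lambda>s. ln ((Re (w n s))\<^sup>2 + (Im (w n s))\<^sup>2 + e)) has_real_derivative
        (2 * Re (w n s) * Re (w' n s) + 2 * Im (w n s) * Im (w' n s)) / ((Re (w n s))\<^sup>2 + (Im (w n s))\<^sup>2 + e)) (at s within {a..r})"
      by (rule DERIV_ln_sum_squares[OF R I N0])
    moreover have "(2 * Re (w n s) * Re (w' n s) + 2 * Im (w n s) * Im (w' n s)) / ((Re (w n s))\<^sup>2 + (Im (w n s))\<^sup>2 + e)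
        = 2 * Re (reg e (w n s) (w' n s))"
      unfolding reg_def Re_divide_of_real cmod_power2 by (simp add: field_simps)
    ultimately show "((\<lambda>s. ln ((norm (w n s))\<^sup>2 + e)) has_vector_derivative 2 * Re (reg e (w n s) (w' n s))) (at s within {a..r})"
      by (simp add: has_real_derivative_iff_has_vector_derivative cmod_power2)
  qed (use r in auto)
  then have "integral {a..r} (\<lambda>s. 2 * Re (reg e (w n s) (w' n s))) = ln ((norm (w n r))\<^sup>2 + e) - ln ((norm \<alpha>)\<^sup>2 + e)"
    by (simp only: integral_unique ends)
  moreover have "integral {a..r} (\<lambda>s. Re (reg e (w n s) (w' n s))) = Re (integral {a..r} (\<lambda>s. reg e (w n s) (w' n s)))"
    using integral_linear[OF integrable_continuous_real[OF continuous_on_subset[OF c]] bounded_linear_Re, of a r] r by (simp add: o_def)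
  ultimately show ?thesis by (simp add: prim_continuous[OF c r])
qed

text \<open>At fixed \<open>e\<close> the identity for \<open>ln (|w n|^2 + e)\<close> passes to the
  limit in \<open>n\<close>. Its right side is bounded in terms of \<open>m\<close>, independently
  of \<open>e\<close>, so letting \<open>e\<close> tend to 0 leaves a positive lower bound.\<close>

lemma f_lower: "r \<in> {a..b} \<Longrightarrow> norm (f r) \<ge> norm \<alpha> * exp (- m)"
proof -
  assume r: "r \<in> {a..b}"
  have "(norm \<alpha> * exp (- m))\<^sup>2 \<le> (norm (f r))\<^sup>2 + e" if e: "e > 0" for e
  proof -
    have p: "(norm z)\<^sup>2 + e > 0" for z :: complex using e by (simp add: add_nonneg_pos)
    have p': "of_real ((norm z)\<^sup>2 + e) \<noteq> (0 :: complex)" for z :: complex using p[of z] by (metis less_irrefl of_real_eq_0_iff)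
    note meas[measurable]
    let ?y = "\<lambda>s. reg e (v s) (v' s)"
    have ym: "?y \<in> borel_measurable (seg a b)"       unfolding reg_def by measurable
    have cn: "continuous_on {a..b} (\<lambda>s. reg e (w n s) (w' n s))" for n
      unfolding reg_def using p' by (intro continuous_intros w_cont w') auto
    have "(\<lambda>n. prim a b (\<lambda>s. reg e (w n s) (w' n s)) r) \<longlonglongrightarrow> prim a b ?y r"
    proof (rule prim_tendsto[OF ym measurable_seg_continuous[OF cn]])
      show "integrable (seg a b) (\<lambda>s. (M s)\<^sup>2 / e)" using M by simp
      show "AE s in seg a b. (\<lambda>n. reg e (w n s) (w' n s)) \<longlonglongrightarrow> ?y s \<and> (\<forall>n. norm (reg e (w n s) (w' n s)) \<le> (M s)\<^sup>2 / e)"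
        using lim dom
      proof eventually_elim
        case (elim s)
        have "(\<lambda>n. reg e (w n s) (w' n s)) \<longlonglongrightarrow> ?y s"
          unfolding reg_def using elim p' by (intro tendsto_intros) auto
        moreover have "norm (reg e (w n s) (w' n s)) \<le> (M s)\<^sup>2 / e" for n
        proof -
          have "norm (w n s) * norm (w' n s) \<le> M s * M s"
            using elim by (intro mult_mono) (auto intro: order_trans[OF norm_ge_zero])
          then show ?thesis
            using le_regularised_norm(2)[OF e, of "w n s" "w' n s"] e unfolding reg_def power2_eq_square[of "M s"]
            by (meson divide_right_mono less_imp_le order_trans)
        qed
        ultimately show ?case by blast
      qed
    qed
    then have L1: "(\<lambda>n. 2 * Re (prim a b (\<lambda>s. reg e (w n s) (w' n s)) r)) \<longlonglongrightarrow> 2 * Re (prim a b ?y r)"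
      by (intro tendsto_intros)
    have L2: "(\<lambda>n. ln ((norm (w n r))\<^sup>2 + e) - ln ((norm \<alpha>)\<^sup>2 + e)) \<longlonglongrightarrow> ln ((norm (f r))\<^sup>2 + e) - ln ((norm \<alpha>)\<^sup>2 + e)"
      using p[of "f r"] by (intro tendsto_intros w_tendsto_f r) auto
    have eq: "ln ((norm (f r))\<^sup>2 + e) - ln ((norm \<alpha>)\<^sup>2 + e) = 2 * Re (prim a b ?y r)"
      by (rule LIMSEQ_unique[OF L2[unfolded reg_prim[OF e r]] L1])
    have yb: "AE s in seg a b. norm (?y s) \<le> norm (v' s / v s)"
      using nz
    proof eventually_elim
      case (elim s)
      then show ?case using le_regularised_norm(1)[OF e, of "v s" "v' s"]
        by (simp add: reg_def norm_divide pos_le_divide_eq)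
    qed
    have yi: "integrable (seg a b) ?y"
      by (rule Bochner_Integration.integrable_bound[OF fin ym yb])
    have "norm (prim a b ?y r) \<le> m"
    proof -
      have "norm (prim a b ?y r) \<le> (LINT s|seg a b. norm (indicator {a..r} s *\<^sub>R ?y s))"
        unfolding prim_def by (rule integral_norm_bound)
      also have "\<dots> \<le> m" unfolding m_def
      proof (rule integral_mono_AE)
        show "AE s in seg a b. norm (indicator {a..r} s *\<^sub>R ?y s) \<le> norm (v' s / v s)"
          using yb by eventually_elim (auto split: split_indicator)
        show "integrable (seg a b) (\<lambda>s. norm (indicator {a..r} s *\<^sub>R ?y s))"
          by (intro integrable_norm integrable_seg_mult_indicator yi) simp
      qed (rule integrable_norm[OF fin])
      finally show ?thesis .
    qed
    then have "ln ((norm (f r))\<^sup>2 + e) \<ge> ln ((norm \<alpha>)\<^sup>2 + e) - 2 * m"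
      using eq abs_Re_le_cmod[of "prim a b ?y r"] by linarith
    then have "exp (ln ((norm \<alpha>)\<^sup>2 + e) - 2 * m) \<le> (norm (f r))\<^sup>2 + e"
      using p[of "f r"] by (simp add: ln_ge_iff)
    moreover have "exp (ln ((norm \<alpha>)\<^sup>2 + e) - 2 * m) = ((norm \<alpha>)\<^sup>2 + e) * exp (- (2 * m))"
      using p[of \<alpha>] by (simp add: exp_diff exp_minus divide_inverse)
    moreover have "(norm \<alpha> * exp (- m))\<^sup>2 \<le> ((norm \<alpha>)\<^sup>2 + e) * exp (- (2 * m))"
      using e by (simp add: power_mult_distrib exp_double[symmetric])
    ultimately show ?thesis by linarith
  qed
  then have "(norm \<alpha> * exp (- m))\<^sup>2 \<le> (norm (f r))\<^sup>2" by (rule field_le_epsilon)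
  then show ?thesis by (rule power2_le_imp_le) simp
qed

text \<open>By uniform convergence and the lower bound for \<open>f\<close>, the approximations stay
  at distance \<open>\<kappa> / 2\<close> from 0 from some index on. Their logarithmic derivatives
  are then continuous and dominated by a multiple of \<open>M\<close>, and the exponential formula
  passes to the limit. The sequence and its bound are returned because the chain rule for
  \<open>prim\<close> asks for them.\<close>

lemma lift:
  obtains yn H where "\<And>n. continuous_on {a..b} (yn n)" "integrable (seg a b) H"
    "AE r in seg a b. (\<lambda>n. yn n r) \<longlonglongrightarrow> v' r / v r \<and> (\<forall>n. norm (yn n r) \<le> H r)"
    "\<And>r. r \<in> {a..b} \<Longrightarrow> f r = \<alpha> * exp (prim a b (\<lambda>r. v' r / v r) r)"
proof -
  define \<kappa> where "\<kappa> = norm \<alpha> * exp (- m)"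
  have \<kappa>: "\<kappa> > 0" using ends by (simp add: \<kappa>_def)
  have "\<forall>\<^sub>F n in sequentially. \<forall>x\<in>{a..b}. dist (w n x) (f x) < \<kappa> / 2"
    using w_uniform \<kappa> unfolding uniform_limit_iff by (meson half_gt_zero)
  then obtain N where N: "\<And>n x. n \<ge> N \<Longrightarrow> x \<in> {a..b} \<Longrightarrow> dist (w n x) (f x) < \<kappa> / 2"
    unfolding eventually_sequentially by blast
  have lb: "norm (w (n + N) r) \<ge> \<kappa> / 2" if "r \<in> {a..b}" for n r
    using N[of "n + N" r] f_lower[OF that] that norm_triangle_ineq2[of "f r" "w (n + N) r"]
    by (simp add: dist_norm \<kappa>_def[symmetric] norm_minus_commute)
  have w0: "w (n + N) r \<noteq> 0" if "r \<in> {a..b}" for n r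
    using lb[OF that, of n] \<kappa> by auto
  define yn where "yn n r = w' (n + N) r / w (n + N) r" for n r
  have c: "continuous_on {a..b} (yn n)" for n
    unfolding yn_def using w0 by (intro continuous_intros w_cont w') auto
  have H: "integrable (seg a b) (\<lambda>r. M r * (2 / \<kappa>))" using M by simp
  have L: "AE r in seg a b. (\<lambda>n. yn n r) \<longlonglongrightarrow> v' r / v r \<and> (\<forall>n. norm (yn n r) \<le> M r * (2 / \<kappa>))"
    using lim dom nz AE_seg
  proof eventually_elim
    case (elim r)
    then have r: "r \<in> {a..b}" by simp
    have "(\<lambda>n. yn n r) \<longlonglongrightarrow> v' r / v r"
      unfolding yn_def using elim
      by (intro tendsto_intros LIMSEQ_ignore_initial_segment[of "\<lambda>n. w n r"] LIMSEQ_ignore_initial_segment[of "\<lambda>n. w' n r"]) auto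
    moreover have "norm (yn n r) \<le> M r * (2 / \<kappa>)" for n
    proof -
      have "norm (yn n r) = norm (w' (n + N) r) * (1 / norm (w (n + N) r))" by (simp add: yn_def norm_divide)
      also have "\<dots> \<le> M r * (2 / \<kappa>)"
      proof (rule mult_mono)
        show "1 / norm (w (n + N) r) \<le> 2 / \<kappa>" using lb[OF r, of n] \<kappa> w0[OF r, of n] by (simp add: field_simps)
      qed (use elim in \<open>auto intro: order_trans[OF norm_ge_zero]\<close>)
      finally show ?thesis .
    qed
    ultimately show ?case by blast
  qed
  have ym: "(\<lambda>r. v' r / v r) \<in> borel_measurable (seg a b)" using fin by auto
  have wn: "w (n + N) r = \<alpha> * exp (prim a b (yn n) r)" if r: "r \<in> {a..b}" for n r
  proof -
    \<comment> \<open>This product has derivative zero, so it keeps its value at \<open>a\<close>,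
      which is \<open>\<alpha>\<close>.\<close>
    define g where "g s = w (n + N) s * exp (- prim a b (yn n) s)" for s
    have "(g has_vector_derivative 0) (at s within {a..b})" if s: "s \<in> {a..b}" for s
    proof -
      have "((\<lambda>s. exp (- prim a b (yn n) s)) has_vector_derivative - yn n s * exp (- prim a b (yn n) s)) (at s within {a..b})"
        using field_vector_diff_chain_within[of "\<lambda>s. - prim a b (yn n) s" "- yn n s" s "{a..b}" exp "exp (- prim a b (yn n) s)"]
          has_vector_derivative_minus[OF prim_has_vector_derivative[OF c s]]
        by (auto simp: o_def intro: DERIV_subset[OF DERIV_exp])
      from has_vector_derivative_mult[OF w[OF s, of "n + N"] this]
      show ?thesis unfolding g_def using w0[OF s, of n] by (simp add: yn_def)
    qed
    then obtain c0 where "\<And>s. s \<in> {a..b} \<Longrightarrow> g s = c0"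
      using has_vector_derivative_zero_constant[of "{a..b}" g] convex_real_interval(5) by blast
    then have "g r = g a" using r ab by simp
    moreover have "prim a b (yn n) a = 0" by (subst prim_continuous[OF c]) (use ab in auto)
    ultimately have "w (n + N) r * exp (- prim a b (yn n) r) = \<alpha>" by (simp add: g_def ends)
    then show ?thesis by (simp add: exp_minus field_simps)
  qed
  have "f r = \<alpha> * exp (prim a b (\<lambda>r. v' r / v r) r)" if r: "r \<in> {a..b}" for r
  proof (rule LIMSEQ_unique)
    show "(\<lambda>n. w (n + N) r) \<longlonglongrightarrow> f r"
      using w_tendsto_f[OF r] by (rule LIMSEQ_ignore_initial_segment)
    show "(\<lambda>n. w (n + N) r) \<longlonglongrightarrow> \<alpha> * exp (prim a b (\<lambda>r. v' r / v r) r)"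
      unfolding wn[OF r] by (intro tendsto_intros prim_tendsto[OF ym measurable_seg_continuous[OF c] H L])
  qed
  then show ?thesis using that c H L by blast
qed

end

section \<open>Stokes' theorem for the regularised angular form\<close>

text \<open>The form \<open>(x dy - y dx) / (x\<^sup>2 + y\<^sup>2 + e)\<close> is smooth, and its exterior derivative
  \<open>2 e / (x\<^sup>2 + y\<^sup>2 + e)\<^sup>2 dx dy\<close> is a multiple of the area form.\<close>

lemma stokes_regularised:
  fixes x y xr yr xt yt xrt yrt :: "real \<Rightarrow> real \<Rightarrow> real"
  assumes le: "r1 \<le> r2" "t1 \<le> t2" and e: "e > 0"
    and xr: "\<And>r t. r \<in> {r1..r2} \<Longrightarrow> t \<in> {t1..t2} \<Longrightarrow> ((\<lambda>r. x r t) has_real_derivative xr r t) (at r within {r1..r2})"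
    and yr: "\<And>r t. r \<in> {r1..r2} \<Longrightarrow> t \<in> {t1..t2} \<Longrightarrow> ((\<lambda>r. y r t) has_real_derivative yr r t) (at r within {r1..r2})"
    and xt: "\<And>r t. r \<in> {r1..r2} \<Longrightarrow> t \<in> {t1..t2} \<Longrightarrow> ((\<lambda>t. x r t) has_real_derivative xt r t) (at t within {t1..t2})"
    and yt: "\<And>r t. r \<in> {r1..r2} \<Longrightarrow> t \<in> {t1..t2} \<Longrightarrow> ((\<lambda>t. y r t) has_real_derivative yt r t) (at t within {t1..t2})"
    and xrt: "\<And>r t. r \<in> {r1..r2} \<Longrightarrow> t \<in> {t1..t2} \<Longrightarrow> ((\<lambda>t. xr r t) has_real_derivative xrt r t) (at t within {t1..t2})"
    and yrt: "\<And>r t. r \<in> {r1..r2} \<Longrightarrow> t \<in> {t1..t2} \<Longrightarrow> ((\<lambda>t. yr r t) has_real_derivative yrt r t) (at t within {t1..t2})"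
    and xtr: "\<And>r t. r \<in> {r1..r2} \<Longrightarrow> t \<in> {t1..t2} \<Longrightarrow> ((\<lambda>r. xt r t) has_real_derivative xrt r t) (at r within {r1..r2})"
    and ytr: "\<And>r t. r \<in> {r1..r2} \<Longrightarrow> t \<in> {t1..t2} \<Longrightarrow> ((\<lambda>r. yt r t) has_real_derivative yrt r t) (at r within {r1..r2})"
    and cont: "\<And>h. h \<in> {x, y, xr, yr, xt, yt, xrt, yrt} \<Longrightarrow> continuous_on ({r1..r2} \<times> {t1..t2}) (\<lambda>z. h (fst z) (snd z))"
  defines "N \<equiv> \<lambda>r t. (x r t)\<^sup>2 + (y r t)\<^sup>2 + e"
  defines "At \<equiv> \<lambda>r t. (x r t * yt r t - y r t * xt r t) / N r t"
    and "Ar \<equiv> \<lambda>r t. (x r t * yr r t - y r t * xr r t) / N r t"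
    and "X \<equiv> \<lambda>r t. 2 * e * (xr r t * yt r t - yr r t * xt r t) / (N r t)\<^sup>2"
  shows "integral {t1..t2} (\<lambda>t. At r2 t - At r1 t) - integral {r1..r2} (\<lambda>r. Ar r t2 - Ar r t1)
    = integral {r1..r2} (\<lambda>r. integral {t1..t2} (X r))"
proof -
  have N: "N r t > 0" for r t unfolding N_def using e by (intro add_nonneg_pos add_nonneg_nonneg) auto
  then have N0: "N r t \<noteq> 0" for r t by (metis less_irrefl)
  \<comment> \<open>\<open>P\<close> and \<open>Q\<close> are the two cross derivatives whose
    difference is the curl, written out by the quotient rule.\<close>
  define P where "P r t = ((xr r t * yt r t + x r t * yrt r t - (yr r t * xt r t + y r t * xrt r t)) * N r t
      - (x r t * yt r t - y r t * xt r t) * (2 * x r t * xr r t + 2 * y r t * yr r t)) / (N r t * N r t)" for r t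
  define Q where "Q r t = ((xt r t * yr r t + x r t * yrt r t - (yt r t * xr r t + y r t * xrt r t)) * N r t
      - (x r t * yr r t - y r t * xr r t) * (2 * x r t * xt r t + 2 * y r t * yt r t)) / (N r t * N r t)" for r t
  let ?R = "{r1..r2}" and ?T = "{t1..t2}"
  have dP: "((\<lambda>r. At r t) has_real_derivative P r t) (at r within ?R)" if "r \<in> ?R" "t \<in> ?T" for r t
  proof -
    note num = DERIV_diff[OF DERIV_mult[OF xr[OF that] ytr[OF that]] DERIV_mult[OF yr[OF that] xtr[OF that]]]
    have den: "((\<lambda>r. N r t) has_real_derivative 2 * x r t * xr r t + 2 * y r t * yr r t) (at r within ?R)"
      unfolding N_def by (auto intro!: derivative_eq_intros xr[OF that] yr[OF that])
    show ?thesis unfolding At_def P_def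
      by (rule DERIV_cong[OF DERIV_divide[OF num den N0[of r t]]]) (simp add: algebra_simps)
  qed
  have dQ: "((\<lambda>t. Ar r t) has_real_derivative Q r t) (at t within ?T)" if "r \<in> ?R" "t \<in> ?T" for r t
  proof -
    note num = DERIV_diff[OF DERIV_mult[OF xt[OF that] yrt[OF that]] DERIV_mult[OF yt[OF that] xrt[OF that]]]
    have den: "((\<lambda>t. N r t) has_real_derivative 2 * x r t * xt r t + 2 * y r t * yt r t) (at t within ?T)"
      unfolding N_def by (auto intro!: derivative_eq_intros xt[OF that] yt[OF that])
    show ?thesis unfolding Ar_def Q_def
      by (rule DERIV_cong[OF DERIV_divide[OF num den N0[of r t]]]) (simp add: algebra_simps)
  qed
  have c: "continuous_on (?R \<times> ?T) (\<lambda>z. x (fst z) (snd z))" "continuous_on (?R \<times> ?T) (\<lambda>z. y (fst z) (snd z))"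
    "continuous_on (?R \<times> ?T) (\<lambda>z. xr (fst z) (snd z))" "continuous_on (?R \<times> ?T) (\<lambda>z. yr (fst z) (snd z))"
    "continuous_on (?R \<times> ?T) (\<lambda>z. xt (fst z) (snd z))" "continuous_on (?R \<times> ?T) (\<lambda>z. yt (fst z) (snd z))"
    "continuous_on (?R \<times> ?T) (\<lambda>z. xrt (fst z) (snd z))" "continuous_on (?R \<times> ?T) (\<lambda>z. yrt (fst z) (snd z))"
    by (rule cont, simp)+
  have cN: "continuous_on (?R \<times> ?T) (\<lambda>z. N (fst z) (snd z))" unfolding N_def by (intro continuous_intros c)
  have cP: "continuous_on (?R \<times> ?T) (\<lambda>z. P (fst z) (snd z))"
    unfolding P_def by (intro continuous_intros c cN ballI no_zero_divisors N0)
  have cQ: "continuous_on (?R \<times> ?T) (\<lambda>z. Q (fst z) (snd z))"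
    unfolding Q_def by (intro continuous_intros c cN ballI no_zero_divisors N0)
  \<comment> \<open>The mixed second derivatives cancel. What remains is twice the Jacobian times
    \<open>N - (x^2 + y^2)\<close>, and this factor is \<open>e\<close>.\<close>
  have PQ: "P r t - Q r t = X r t" for r t
  proof -
    have "(xr r t * yt r t + x r t * yrt r t - (yr r t * xt r t + y r t * xrt r t)) * N r t
      - (x r t * yt r t - y r t * xt r t) * (2 * x r t * xr r t + 2 * y r t * yr r t)
      - ((xt r t * yr r t + x r t * yrt r t - (yt r t * xr r t + y r t * xrt r t)) * N r t
      - (x r t * yr r t - y r t * xr r t) * (2 * x r t * xt r t + 2 * y r t * yt r t))
      = 2 * e * (xr r t * yt r t - yr r t * xt r t)"
      unfolding N_def by (simp add: algebra_simps power2_eq_square)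
    then show ?thesis unfolding P_def Q_def X_def diff_divide_distrib[symmetric] power2_eq_square[of "N r t"] by simp
  qed
  have row: "continuous_on ?T (\<lambda>t. h r t)" if "continuous_on (?R \<times> ?T) (\<lambda>z. h (fst z) (snd z))" "r \<in> ?R" for h :: "real \<Rightarrow> real \<Rightarrow> real" and r
  proof -
    have "(\<lambda>t. (r, t)) ` ?T \<subseteq> ?R \<times> ?T" using that(2) by auto
    from continuous_on_compose2[OF that(1) continuous_on_Pair[OF continuous_on_const continuous_on_id] this]
    show ?thesis by simp
  qed
  have iP: "integral ?R (\<lambda>r. P r t) = At r2 t - At r1 t" if "t \<in> ?T" for t
    by (intro integral_unique fundamental_theorem_of_calculus le)
       (use dP that in \<open>auto simp: has_real_derivative_iff_has_vector_derivative\<close>)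
  have iQ: "integral ?T (\<lambda>t. Q r t) = Ar r t2 - Ar r t1" if "r \<in> ?R" for r
    by (intro integral_unique fundamental_theorem_of_calculus le)
       (use dQ that in \<open>auto simp: has_real_derivative_iff_has_vector_derivative\<close>)
  have cb: "cbox (r1, t1) (r2, t2) = ?R \<times> ?T" by (simp add: cbox_Pair_eq)
  have "integral ?T (\<lambda>t. At r2 t - At r1 t) = integral ?T (\<lambda>t. integral ?R (\<lambda>r. P r t))"
    by (intro integral_cong) (simp add: iP)
  also have "\<dots> = integral ?R (\<lambda>r. integral ?T (\<lambda>t. P r t))"
    using integral_swap_continuous[of r1 t1 r2 t2 P] cP unfolding cb by (simp add: case_prod_unfold)
  finally have 1: "integral ?T (\<lambda>t. At r2 t - At r1 t) = integral ?R (\<lambda>r. integral ?T (\<lambda>t. P r t))" .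
  have 2: "integral ?R (\<lambda>r. Ar r t2 - Ar r t1) = integral ?R (\<lambda>r. integral ?T (\<lambda>t. Q r t))"
    by (intro integral_cong) (simp add: iQ)
  have ci: "continuous_on ?R (\<lambda>r. integral ?T (\<lambda>t. h r t))" if "continuous_on (?R \<times> ?T) (\<lambda>z. h (fst z) (snd z))" for h :: "real \<Rightarrow> real \<Rightarrow> real"
    using integral_continuous_on_param[of "?R" t1 t2 "\<lambda>r t. h r t"] that by (simp add: case_prod_unfold)
  have "integral ?R (\<lambda>r. integral ?T (X r)) = integral ?R (\<lambda>r. integral ?T (\<lambda>t. P r t) - integral ?T (\<lambda>t. Q r t))"
  proof (rule integral_cong)
    fix r assume r: "r \<in> ?R"
    show "integral ?T (X r) = integral ?T (\<lambda>t. P r t) - integral ?T (\<lambda>t. Q r t)"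
      by (subst Henstock_Kurzweil_Integration.integral_diff[symmetric])
         (auto intro!: integrable_continuous_real row[OF cP r] row[OF cQ r] simp: PQ)
  qed
  also have "\<dots> = integral ?R (\<lambda>r. integral ?T (\<lambda>t. P r t)) - integral ?R (\<lambda>r. integral ?T (\<lambda>t. Q r t))"
    by (intro Henstock_Kurzweil_Integration.integral_diff integrable_continuous_real ci cP cQ)
  finally show ?thesis unfolding 1 2 by simp
qed

section \<open>Slices of product measures and limits of the regularised form\<close>

lemma AE_pair_swap:
  assumes "sigma_finite_measure A" "sigma_finite_measure B" and Q: "AE z in A \<Otimes>\<^sub>M B. Q z"
  shows "AE y in B. AE x in A. Q (x, y)"
proof -
  interpret pair_sigma_finite A B using assms by (simp add: pair_sigma_finite_def)
  obtain N where N: "{z \<in> space (A \<Otimes>\<^sub>M B). \<not> Q z} \<subseteq> N" "N \<in> null_sets (A \<Otimes>\<^sub>M B)"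
    using Q by (auto simp: eventually_ae_filter)
  have Ns [measurable]: "N \<in> sets (A \<Otimes>\<^sub>M B)" using N by auto
  have "AE z in A \<Otimes>\<^sub>M B. z \<notin> N" using N(2) by (rule AE_not_in)
  then have "AE x in A. AE y in B. (x, y) \<notin> N" by (rule AE_pair)
  moreover have "{z \<in> space (A \<Otimes>\<^sub>M B). (fst z, snd z) \<notin> N} \<in> sets (A \<Otimes>\<^sub>M B)" by simp
  ultimately have "AE y in B. AE x in A. (x, y) \<notin> N"
    using AE_commute[of "\<lambda>x y. (x, y) \<notin> N"] by simp
  then show ?thesis
    using AE_space[of B]
  proof eventually_elim
    case (elim y)
    from elim(1) AE_space[of A] show ?case
      by eventually_elim (use N(1) elim(2) in \<open>auto simp: space_pair_measure\<close>)
  qed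
qed

lemma AE_integrable_slice:
  fixes f :: "'a \<times> 'b \<Rightarrow> 'c::{banach, second_countable_topology}"
  assumes "sigma_finite_measure A" "sigma_finite_measure B" and f: "integrable (A \<Otimes>\<^sub>M B) f"
  shows "AE y in B. integrable A (\<lambda>x. f (x, y))"
proof -
  interpret pair_sigma_finite A B using assms by (simp add: pair_sigma_finite_def)
  interpret Q: pair_sigma_finite B A using assms by (simp add: pair_sigma_finite_def)
  have "integrable (B \<Otimes>\<^sub>M A) (\<lambda>(x, y). f (y, x))" by (rule integrable_product_swap[OF f])
  from Q.AE_integrable_fst'[OF this] show ?thesis by simp
qed

lemma norm_sq_plus_pos: "e > 0 \<Longrightarrow> (norm (z :: complex))\<^sup>2 + e > 0"
  by (simp add: add_nonneg_pos)

lemma of_real_norm_sq_plus_neq: "e > 0 \<Longrightarrow> of_real ((norm (z :: complex))\<^sup>2 + e) \<noteq> (0 :: complex)"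
  using norm_sq_plus_pos[of e z] by (metis less_irrefl of_real_eq_0_iff)

lemma Im_reg: "Im (reg e w z) = (Re w * Im z - Im w * Re z) / ((Re w)\<^sup>2 + (Im w)\<^sup>2 + e)"
  unfolding reg_def Im_divide_of_real cmod_power2 by simp

lemma reg_measurable [measurable]:
  assumes [measurable]: "v \<in> borel_measurable N" "y \<in> borel_measurable N"
  shows "(\<lambda>s. reg e (v s) (y s)) \<in> borel_measurable N"
  unfolding reg_def by measurable

lemma continuous_on_reg:
  "e > 0 \<Longrightarrow> continuous_on S v \<Longrightarrow> continuous_on S y \<Longrightarrow> continuous_on S (\<lambda>s. reg e (v s) (y s))"
  unfolding reg_def using of_real_norm_sq_plus_neq by (intro continuous_intros) auto

text \<open>The limit of the approximations at fixed \<open>e\<close>: the integrands are at most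
  \<open>M^2 / e\<close>, whether or not the approximations vanish.\<close>

lemma LINT_reg_tendsto:
  assumes e: "e > 0"
    and m: "v \<in> borel_measurable N" "y \<in> borel_measurable N" "\<And>n. w n \<in> borel_measurable N" "\<And>n. z n \<in> borel_measurable N"
    and lim: "AE s in N. (\<lambda>n. w n s) \<longlonglongrightarrow> v s \<and> (\<lambda>n. z n s) \<longlonglongrightarrow> y s"
    and dom: "AE s in N. \<forall>n. norm (w n s) \<le> M s \<and> norm (z n s) \<le> M s"
    and M: "integrable N (\<lambda>s. (M s)\<^sup>2)"
  shows "(\<lambda>n. LINT s|N. reg e (w n s) (z n s)) \<longlonglongrightarrow> (LINT s|N. reg e (v s) (y s))"
proof (rule integral_dominated_convergence[where w = "\<lambda>s. (M s)\<^sup>2 / e"])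
  note m[measurable]
  show "(\<lambda>s. reg e (v s) (y s)) \<in> borel_measurable N" "(\<lambda>s. reg e (w n s) (z n s)) \<in> borel_measurable N" for n
    by measurable
  show "integrable N (\<lambda>s. (M s)\<^sup>2 / e)" using M by simp
  show "AE s in N. (\<lambda>n. reg e (w n s) (z n s)) \<longlonglongrightarrow> reg e (v s) (y s)"
    using lim
  proof eventually_elim
    case (elim s)
    then show ?case unfolding reg_def using of_real_norm_sq_plus_neq[OF e] by (intro tendsto_intros) auto
  qed
  show "AE s in N. norm (reg e (w n s) (z n s)) \<le> (M s)\<^sup>2 / e" for n
    using dom
  proof eventually_elim
    case (elim s)
    have "norm (w n s) * norm (z n s) \<le> M s * M s"
      using elim by (intro mult_mono) (auto intro: order_trans[OF norm_ge_zero])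
    then have "norm (w n s) * norm (z n s) / e \<le> (M s)\<^sup>2 / e"
      using e by (simp add: power2_eq_square divide_right_mono)
    then show ?case unfolding reg_def using le_regularised_norm(2)[OF e, of "w n s" "z n s"] by (rule order_trans[rotated])
  qed
qed

text \<open>The limit \<open>e -> 0\<close> for the map itself, dominated by the norm of the
  logarithmic derivative.\<close>

lemma LINT_reg_tendsto_0:
  assumes e: "\<And>j. e j > 0" "e \<longlonglongrightarrow> 0"
    and m: "v \<in> borel_measurable N" "y \<in> borel_measurable N"
    and nz: "AE s in N. v s \<noteq> 0" and i: "integrable N (\<lambda>s. y s / v s)"
  shows "(\<lambda>j. LINT s|N. reg (e j) (v s) (y s)) \<longlonglongrightarrow> (LINT s|N. y s / v s)"
proof (rule integral_dominated_convergence[where w = "\<lambda>s. norm (y s / v s)"])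
  note m[measurable]
  show "(\<lambda>s. reg (e j) (v s) (y s)) \<in> borel_measurable N" for j by measurable
  show "(\<lambda>s. y s / v s) \<in> borel_measurable N" by measurable
  show "integrable N (\<lambda>s. norm (y s / v s))" using i by (rule integrable_norm)
  show "AE s in N. (\<lambda>j. reg (e j) (v s) (y s)) \<longlonglongrightarrow> y s / v s"
    using nz
  proof eventually_elim
    case (elim s)
    have "(\<lambda>j. reg (e j) (v s) (y s)) \<longlonglongrightarrow> cnj (v s) * y s / of_real ((norm (v s))\<^sup>2 + 0)"
      unfolding reg_def using elim by (intro tendsto_intros e) auto
    moreover have "cnj (v s) * y s / of_real ((norm (v s))\<^sup>2 + 0) = y s / v s"
      using elim complex_norm_square[of "v s"] by (simp add: field_simps)
    ultimately show ?case by simp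
  qed
  show "AE s in N. norm (reg (e j) (v s) (y s)) \<le> norm (y s / v s)" for j
    using nz
  proof eventually_elim
    case (elim s)
    then show ?case using le_regularised_norm(1)[OF e(1)[of j], of "v s" "y s"]
      by (simp add: reg_def norm_divide pos_le_divide_eq)
  qed
qed

lemma finite_measure_polar_rect: "finite_measure (seg a b \<Otimes>\<^sub>M seg c d)"
  by (intro finite_measure_pair_measure finite_measure_seg)

lemma measurable_polar_rect_cont:
  fixes h :: "real \<times> real \<Rightarrow> 'c::euclidean_space"
  assumes "continuous_on ({a..b} \<times> {c..d}) h"
  shows "h \<in> borel_measurable (seg a b \<Otimes>\<^sub>M seg c d)"
proof -
  have "(\<lambda>z. indicator ({a..b} \<times> {c..d}) z *\<^sub>R h z) \<in> borel_measurable borel"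
    by (intro borel_measurable_continuous_on_indicator assms borel_closed closed_Times) auto
  then have "(\<lambda>z. indicator ({a..b} \<times> {c..d}) z *\<^sub>R h z) \<in> borel_measurable (seg a b \<Otimes>\<^sub>M seg c d)"
    by (rule measurable_polar_rect)
  then show ?thesis
    by (rule measurable_cong[THEN iffD1, rotated]) (auto simp: space_pair_measure space_restrict_space)
qed

lemma integrable_polar_rect_cont:
  fixes h :: "real \<times> real \<Rightarrow> 'c::euclidean_space"
  assumes "continuous_on ({a..b} \<times> {c..d}) h"
  shows "integrable (seg a b \<Otimes>\<^sub>M seg c d) h"
proof -
  interpret finite_measure "seg a b \<Otimes>\<^sub>M seg c d" by (rule finite_measure_polar_rect)
  have "bounded (h ` ({a..b} \<times> {c..d}))"
    by (intro compact_imp_bounded compact_continuous_image assms compact_Times) auto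
  then obtain B where "\<And>z. z \<in> {a..b} \<times> {c..d} \<Longrightarrow> norm (h z) \<le> B"
    unfolding bounded_iff by auto
  then show ?thesis
    by (intro integrable_const_bound[of _ B] measurable_polar_rect_cont assms AE_I2)
       (auto simp: space_pair_measure space_restrict_space)
qed

lemma LINT_polar_rect_cont:
  fixes h :: "real \<Rightarrow> real \<Rightarrow> real"
  assumes h: "continuous_on ({a..b} \<times> {c..d}) (\<lambda>z. h (fst z) (snd z))"
    and r: "a \<le> r1" "r2 \<le> b" and t: "c \<le> t1" "t2 \<le> d"
  shows "(LINT z|(seg a b \<Otimes>\<^sub>M seg c d). indicator ({r1..r2} \<times> {t1..t2}) z * h (fst z) (snd z))
    = integral {r1..r2} (\<lambda>r. integral {t1..t2} (h r))"
proof -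
  interpret pair_sigma_finite "seg a b" "seg c d" by (rule pair_sigma_finite_seg)
  let ?h = "\<lambda>z. indicator ({r1..r2} \<times> {t1..t2}) z * h (fst z) (snd z)"
  have [measurable]: "indicator ({r1..r2} \<times> {t1..t2}) \<in> borel_measurable (seg a b \<Otimes>\<^sub>M seg c d)"
    by (rule measurable_polar_rect) (intro borel_measurable_indicator borel_closed closed_Times; simp)
  note hi = integrable_polar_rect_cont[OF h]
  have [measurable]: "(\<lambda>z. h (fst z) (snd z)) \<in> borel_measurable (seg a b \<Otimes>\<^sub>M seg c d)" using hi by auto
  have i: "integrable (seg a b \<Otimes>\<^sub>M seg c d) ?h"
    by (rule Bochner_Integration.integrable_bound[OF hi]) (measurable, auto split: split_indicator)
  have "(LINT z|(seg a b \<Otimes>\<^sub>M seg c d). ?h z) = (LINT r|seg a b. LINT t|seg c d. ?h (r, t))"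
    by (rule integral_fst'[OF i, symmetric])
  also have "\<dots> = (LINT r|seg a b. indicator {r1..r2} r *\<^sub>R integral {t1..t2} (h r))"
  proof (rule Bochner_Integration.integral_cong[OF refl])
    fix r assume "r \<in> space (seg a b)"
    then have rab: "r \<in> {a..b}" by (simp add: space_restrict_space)
    have "(\<lambda>t. (r, t)) ` {c..d} \<subseteq> {a..b} \<times> {c..d}" using rab by auto
    from continuous_on_compose2[OF h continuous_on_Pair[OF continuous_on_const continuous_on_id] this]
    have hc: "continuous_on {c..d} (h r)" by simp
    have "(LINT t|seg c d. ?h (r, t)) = (LINT t|seg c d. indicator {r1..r2} r * (indicator {t1..t2} t *\<^sub>R h r t))"
      by (intro Bochner_Integration.integral_cong) (auto split: split_indicator)
    also have "\<dots> = indicator {r1..r2} r * integral {t1..t2} (h r)"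
      using LINT_seg_indicator[OF hc t] by simp
    finally show "(LINT t|seg c d. ?h (r, t)) = indicator {r1..r2} r *\<^sub>R integral {t1..t2} (h r)" by simp
  qed
  also have "\<dots> = integral {r1..r2} (\<lambda>r. integral {t1..t2} (h r))"
  proof (rule LINT_seg_indicator[OF _ r])
    have "continuous_on (cbox a b \<times> cbox t1 t2) (\<lambda>(r, t). h r t)"
      using continuous_on_subset[OF h Sigma_mono[of "{a..b}" "{a..b}" "\<lambda>_. {t1..t2}" "\<lambda>_. {c..d}"]] t
      by (simp add: case_prod_unfold)
    then show "continuous_on {a..b} (\<lambda>r. integral {t1..t2} (h r))"
      using integral_continuous_on_param[of "{a..b}" t1 t2 h] by simp
  qed
  finally show ?thesis .
qed

text \<open>\<open>V\<close> is a map of the annulus in polar coordinates, with values in \<open>\<complex>\<close>; \<open>Vr\<close> and \<open>Vt\<close> are its weak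
  derivatives with respect to the radius and the angle, and the \<open>W n\<close> are regular maps which
  approximate it and are the identity on the boundary.\<close>

locale polar_map =
  fixes a b :: real and V Vr Vt :: "real \<times> real \<Rightarrow> complex"
    and W Wr Wt Wrt :: "nat \<Rightarrow> real \<Rightarrow> real \<Rightarrow> complex" and M :: "real \<times> real \<Rightarrow> real"
  assumes ab: "0 < a" "a < b"
    and meas: "V \<in> borel_measurable (polar_rect a b)" "Vr \<in> borel_measurable (polar_rect a b)"
      "Vt \<in> borel_measurable (polar_rect a b)" "M \<in> borel_measurable (polar_rect a b)"
    and W_r: "\<And>n r t. r \<in> {a..b} \<Longrightarrow> ((\<lambda>r. W n r t) has_vector_derivative Wr n r t) (at r within {a..b})"
    and W_t: "\<And>n r t. r \<in> {a..b} \<Longrightarrow> ((\<lambda>t. W n r t) has_vector_derivative Wt n r t) (at t)"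
    and Wr_t: "\<And>n r t. r \<in> {a..b} \<Longrightarrow> ((\<lambda>t. Wr n r t) has_vector_derivative Wrt n r t) (at t)"
    and Wt_r: "\<And>n r t. r \<in> {a..b} \<Longrightarrow> ((\<lambda>r. Wt n r t) has_vector_derivative Wrt n r t) (at r within {a..b})"
    and cont: "\<And>n. continuous_on ({a..b} \<times> UNIV) (\<lambda>z. W n (fst z) (snd z))"
      "\<And>n. continuous_on ({a..b} \<times> UNIV) (\<lambda>z. Wr n (fst z) (snd z))"
      "\<And>n. continuous_on ({a..b} \<times> UNIV) (\<lambda>z. Wt n (fst z) (snd z))"
      "\<And>n. continuous_on ({a..b} \<times> UNIV) (\<lambda>z. Wrt n (fst z) (snd z))"
    and periodic: "\<And>n r. r \<in> {a..b} \<Longrightarrow> W n r (2 * pi) = W n r 0" "\<And>n r. r \<in> {a..b} \<Longrightarrow> Wr n r (2 * pi) = Wr n r 0"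
    and boundary: "\<And>n t. W n a t = of_real a * cis t" "\<And>n t. W n b t = of_real b * cis t"
    and lim: "AE z in polar_rect a b. (\<lambda>n. W n (fst z) (snd z)) \<longlonglongrightarrow> V z \<and>
      (\<lambda>n. Wr n (fst z) (snd z)) \<longlonglongrightarrow> Vr z \<and> (\<lambda>n. Wt n (fst z) (snd z)) \<longlonglongrightarrow> Vt z"
    and dom: "AE z in polar_rect a b. \<forall>n. norm (W n (fst z) (snd z)) \<le> M z \<and>
      norm (Wr n (fst z) (snd z)) \<le> M z \<and> norm (Wt n (fst z) (snd z)) \<le> M z"
    and M2: "integrable (polar_rect a b) (\<lambda>z. (M z)\<^sup>2)"
    and det: "AE z in polar_rect a b. Im (cnj (Vr z) * Vt z) = fst z"
    and nz: "AE z in polar_rect a b. V z \<noteq> 0"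
    and fin: "integrable (polar_rect a b) (\<lambda>z. (norm (Vr z / V z))\<^sup>2)"
      "integrable (polar_rect a b) (\<lambda>z. (norm (Vt z / V z))\<^sup>2)"
begin

lemma sigma_fin: "sigma_finite_measure (seg a b)" "sigma_finite_measure (seg 0 (2 * pi))"
  by (intro finite_measure.axioms(1) finite_measure_seg)+

lemma W_continuous:
  "r \<in> {a..b} \<Longrightarrow> continuous_on S (\<lambda>t. W n r t)" "r \<in> {a..b} \<Longrightarrow> continuous_on S (\<lambda>t. Wt n r t)"
  "r \<in> {a..b} \<Longrightarrow> continuous_on S (\<lambda>t. Wr n r t)"
  "continuous_on {a..b} (\<lambda>r. W n r t)" "continuous_on {a..b} (\<lambda>r. Wr n r t)"
proof -
  have row: "continuous_on S (\<lambda>t. h r t)" if "continuous_on ({a..b} \<times> UNIV) (\<lambda>z. h (fst z) (snd z))" "r \<in> {a..b}"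
    for h :: "real \<Rightarrow> real \<Rightarrow> complex" and r S
  proof -
    have "(\<lambda>t. (r, t)) ` S \<subseteq> {a..b} \<times> UNIV" using that(2) by auto
    from continuous_on_compose2[OF that(1) continuous_on_Pair[OF continuous_on_const continuous_on_id] this]
    show ?thesis by simp
  qed
  have col: "continuous_on {a..b} (\<lambda>r. h r t)" if "continuous_on ({a..b} \<times> UNIV) (\<lambda>z. h (fst z) (snd z))"
    for h :: "real \<Rightarrow> real \<Rightarrow> complex" and t
  proof -
    have "(\<lambda>r. (r, t)) ` {a..b} \<subseteq> {a..b} \<times> UNIV" by auto
    from continuous_on_compose2[OF that(1) continuous_on_Pair[OF continuous_on_id continuous_on_const] this]
    show ?thesis by simp
  qed
  show "r \<in> {a..b} \<Longrightarrow> continuous_on S (\<lambda>t. W n r t)" "r \<in> {a..b} \<Longrightarrow> continuous_on S (\<lambda>t. Wt n r t)"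
    "r \<in> {a..b} \<Longrightarrow> continuous_on S (\<lambda>t. Wr n r t)"
    "continuous_on {a..b} (\<lambda>r. W n r t)" "continuous_on {a..b} (\<lambda>r. Wr n r t)"
    by (rule row[OF cont(1)] row[OF cont(3)] row[OF cont(2)] col[OF cont(1)] col[OF cont(2)]; assumption?)+
qed

lemma Wt_boundary: "Wt n a t = \<i> * of_real a * cis t" "Wt n b t = \<i> * of_real b * cis t"
proof -
  have D: "((\<lambda>t. of_real c * cis t) has_vector_derivative \<i> * of_real c * cis t) (at t)" for c :: real
  proof -
    have "(cis has_vector_derivative \<i> * cis t) (at t)"
      using has_derivative_cis[OF has_derivative_ident] by (simp add: has_vector_derivative_def)
    from has_vector_derivative_mult_right[OF this, of "of_real c"] show ?thesis by (simp add: mult_ac)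
  qed
  have "W n a = (\<lambda>t. of_real a * cis t)" "W n b = (\<lambda>t. of_real b * cis t)"
    using boundary by auto
  then show "Wt n a t = \<i> * of_real a * cis t" "Wt n b t = \<i> * of_real b * cis t"
    using vector_derivative_unique_at[OF W_t[of a n t]] vector_derivative_unique_at[OF W_t[of b n t]] D ab by auto
qed

section \<open>Stokes' theorem in the limit\<close>

definition curl :: "real \<Rightarrow> nat \<Rightarrow> real \<Rightarrow> real \<Rightarrow> real" where
  "curl e n r t = 2 * e * Im (cnj (Wr n r t) * Wt n r t) / ((norm (W n r t))\<^sup>2 + e)\<^sup>2"

text \<open>The limit of \<open>curl\<close>, with the Jacobian \<open>Im (cnj Vr * Vt)\<close>
  replaced by its value \<open>r\<close> under the constraint.\<close>

definition curl_lim :: "real \<Rightarrow> real \<times> real \<Rightarrow> real" where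
  "curl_lim e z = 2 * e * fst z / ((norm (V z))\<^sup>2 + e)\<^sup>2"

lemma curl_cont: "e > 0 \<Longrightarrow> continuous_on ({a..b} \<times> UNIV) (\<lambda>z. curl e n (fst z) (snd z))"
  unfolding curl_def using norm_sq_plus_pos[of e]
  by (intro continuous_intros cont) (metis less_irrefl power_not_zero)

lemma stokes_W:
  assumes e: "e > 0" and r: "a \<le> r1" "r1 \<le> r2" "r2 \<le> b" and t: "0 \<le> t1" "t1 \<le> t2" "t2 \<le> 2 * pi"
  shows "integral {t1..t2} (\<lambda>t. Im (reg e (W n r2 t) (Wt n r2 t)) - Im (reg e (W n r1 t) (Wt n r1 t)))
    - integral {r1..r2} (\<lambda>r. Im (reg e (W n r t2) (Wr n r t2)) - Im (reg e (W n r t1) (Wr n r t1)))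
    = (LINT z|polar_rect a b. indicator ({r1..r2} \<times> {t1..t2}) z * curl e n (fst z) (snd z))"
proof -
  have sub: "{r1..r2} \<subseteq> {a..b}" using r by auto
  have Rv: "((\<lambda>s. Re (h s)) has_real_derivative Re h') F" "((\<lambda>s. Im (h s)) has_real_derivative Im h') F"
    if "(h has_vector_derivative h') F" for h h' and F :: "real filter"
    using that by (auto simp: has_real_derivative_iff_has_vector_derivative
      intro: bounded_linear.has_vector_derivative[OF bounded_linear_Re] bounded_linear.has_vector_derivative[OF bounded_linear_Im])
  have dr: "(h has_vector_derivative h') (at s within {r1..r2})" if "(h has_vector_derivative h') (at s within {a..b})" for h :: "real \<Rightarrow> complex" and h' s
    using that sub by (rule has_vector_derivative_within_subset)
  have dt: "(h has_vector_derivative h') (at s within {t1..t2})" if "(h has_vector_derivative h') (at s)" for h :: "real \<Rightarrow> complex" and h' s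
    using that by (rule has_vector_derivative_at_within)
  have c: "continuous_on ({r1..r2} \<times> {t1..t2}) (\<lambda>z. Re (h (fst z) (snd z)))" "continuous_on ({r1..r2} \<times> {t1..t2}) (\<lambda>z. Im (h (fst z) (snd z)))"
    if "continuous_on ({a..b} \<times> UNIV) (\<lambda>z. h (fst z) (snd z))" for h :: "real \<Rightarrow> real \<Rightarrow> complex"
    by (intro continuous_intros continuous_on_subset[OF that]; use sub in auto)+
  have "integral {t1..t2} (\<lambda>t. Im (reg e (W n r2 t) (Wt n r2 t)) - Im (reg e (W n r1 t) (Wt n r1 t)))
    - integral {r1..r2} (\<lambda>r. Im (reg e (W n r t2) (Wr n r t2)) - Im (reg e (W n r t1) (Wr n r t1)))
    = integral {r1..r2} (\<lambda>r. integral {t1..t2} (\<lambda>t. 2 * e * (Re (Wr n r t) * Im (Wt n r t) - Im (Wr n r t) * Re (Wt n r t))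
        / ((Re (W n r t))\<^sup>2 + (Im (W n r t))\<^sup>2 + e)\<^sup>2))"
    unfolding Im_reg
    by (rule stokes_regularised[where xrt = "\<lambda>r t. Re (Wrt n r t)" and yrt = "\<lambda>r t. Im (Wrt n r t)", OF r(2) t(2) e])
       (use sub in \<open>auto intro!: Rv dr dt W_r W_t Wr_t Wt_r c cont\<close>)
  also have "\<dots> = integral {r1..r2} (\<lambda>r. integral {t1..t2} (curl e n r))"
    by (simp add: curl_def[abs_def] cmod_power2)
  also have "\<dots> = (LINT z|polar_rect a b. indicator ({r1..r2} \<times> {t1..t2}) z * curl e n (fst z) (snd z))"
    by (rule LINT_polar_rect_cont[symmetric]) (use r t in \<open>auto intro!: continuous_on_subset[OF curl_cont[OF e]]\<close>)
  finally show ?thesis .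
qed

lemma W_measurable:
  "(\<lambda>z. W n (fst z) (snd z)) \<in> borel_measurable (polar_rect a b)"
  "(\<lambda>z. Wr n (fst z) (snd z)) \<in> borel_measurable (polar_rect a b)"
  "(\<lambda>z. Wt n (fst z) (snd z)) \<in> borel_measurable (polar_rect a b)"
  by (intro measurable_polar_rect_cont continuous_on_subset[OF cont(1)] continuous_on_subset[OF cont(2)]
      continuous_on_subset[OF cont(3)]; auto)+

lemma fst_measurable [measurable]: "fst \<in> borel_measurable (polar_rect a b)"
  by (rule measurable_polar_rect) measurable

lemma rect_measurable: "indicator ({r1..r2} \<times> {t1..t2}) \<in> borel_measurable (polar_rect a b)"
  by (rule measurable_polar_rect) (intro borel_measurable_indicator borel_closed closed_Times; simp)

lemma curl_tendsto:
  assumes e: "e > 0"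
  shows "(\<lambda>n. LINT z|polar_rect a b. indicator ({r1..r2} \<times> {t1..t2}) z * curl e n (fst z) (snd z))
    \<longlonglongrightarrow> (LINT z|polar_rect a b. indicator ({r1..r2} \<times> {t1..t2}) z * curl_lim e z)"
proof (rule integral_dominated_convergence[where w = "\<lambda>z. 2 * (M z)\<^sup>2 / e"])
  note W_measurable[measurable] rect_measurable[measurable] meas[measurable]
  show "(\<lambda>z. indicator ({r1..r2} \<times> {t1..t2}) z * curl_lim e z) \<in> borel_measurable (polar_rect a b)"
    unfolding curl_lim_def by measurable
  show "(\<lambda>z. indicator ({r1..r2} \<times> {t1..t2}) z * curl e n (fst z) (snd z)) \<in> borel_measurable (polar_rect a b)" for n
    unfolding curl_def by measurable
  show "integrable (polar_rect a b) (\<lambda>z. 2 * (M z)\<^sup>2 / e)" using M2 by simp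
  show "AE z in polar_rect a b. (\<lambda>n. indicator ({r1..r2} \<times> {t1..t2}) z * curl e n (fst z) (snd z))
      \<longlonglongrightarrow> indicator ({r1..r2} \<times> {t1..t2}) z * curl_lim e z"
    using lim det
  proof eventually_elim
    case (elim z)
    have "(\<lambda>n. curl e n (fst z) (snd z)) \<longlonglongrightarrow> 2 * e * Im (cnj (Vr z) * Vt z) / ((norm (V z))\<^sup>2 + e)\<^sup>2"
      unfolding curl_def using elim norm_sq_plus_pos[OF e, of "V z"] by (intro tendsto_intros) auto
    then show ?case unfolding curl_lim_def elim(2) by (intro tendsto_intros)
  qed
  show "AE z in polar_rect a b. norm (indicator ({r1..r2} \<times> {t1..t2}) z * curl e n (fst z) (snd z)) \<le> 2 * (M z)\<^sup>2 / e" for n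
    using dom
  proof eventually_elim
    case (elim z)
    let ?w = "W n (fst z) (snd z)" and ?r = "Wr n (fst z) (snd z)" and ?t = "Wt n (fst z) (snd z)"
    have M0: "0 \<le> M z" using elim order_trans[OF norm_ge_zero] by blast
    have "\<bar>Im (cnj ?r * ?t)\<bar> \<le> norm ?r * norm ?t"
      using abs_Im_le_cmod[of "cnj ?r * ?t"] by (simp add: norm_mult)
    also have "\<dots> \<le> M z * M z" using elim M0 by (intro mult_mono) auto
    finally have 1: "\<bar>Im (cnj ?r * ?t)\<bar> \<le> (M z)\<^sup>2" by (simp add: power2_eq_square)
    \<comment> \<open>At fixed \<open>e\<close> the denominator is at least \<open>e^2\<close>, so
      zeros of the approximations do no harm.\<close>
    have "e\<^sup>2 \<le> ((norm ?w)\<^sup>2 + e)\<^sup>2" using e by (intro power_mono) auto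
    then have "\<bar>curl e n (fst z) (snd z)\<bar> \<le> 2 * e * (M z)\<^sup>2 / e\<^sup>2"
      unfolding curl_def abs_divide abs_mult using e 1 by (intro frac_le mult_mono) auto
    also have "\<dots> = 2 * (M z)\<^sup>2 / e" using e by (simp add: power2_eq_square)
    finally have "\<bar>curl e n (fst z) (snd z)\<bar> \<le> 2 * (M z)\<^sup>2 / e" .
    then show ?case using e by (auto split: split_indicator)
  qed
qed

text \<open>This is where the constraint enters: as the Jacobian determinant is bounded by half the energy
  density, \<open>1 / |V|\<^sup>2\<close> is integrable.\<close>

lemma curl_lim_tendsto_0:
  assumes e: "\<And>j. e j > 0" "e \<longlonglongrightarrow> 0"
  shows "(\<lambda>j. LINT z|polar_rect a b. indicator ({r1..r2} \<times> {t1..t2}) z * curl_lim (e j) z) \<longlonglongrightarrow> 0"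
proof -
  note rect_measurable[measurable] meas[measurable]
  have "(\<lambda>j. LINT z|polar_rect a b. indicator ({r1..r2} \<times> {t1..t2}) z * curl_lim (e j) z) \<longlonglongrightarrow> (LINT z|polar_rect a b. 0)"
  proof (rule integral_dominated_convergence[where w = "\<lambda>z. (norm (Vr z / V z))\<^sup>2 + (norm (Vt z / V z))\<^sup>2"])
    show "(\<lambda>z. indicator ({r1..r2} \<times> {t1..t2}) z * curl_lim (e j) z) \<in> borel_measurable (polar_rect a b)" for j
      unfolding curl_lim_def by measurable
    show "integrable (polar_rect a b) (\<lambda>z. (norm (Vr z / V z))\<^sup>2 + (norm (Vt z / V z))\<^sup>2)" using fin by simp
    show "AE z in polar_rect a b. (\<lambda>j. indicator ({r1..r2} \<times> {t1..t2}) z * curl_lim (e j) z) \<longlonglongrightarrow> 0"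
      using nz
    proof eventually_elim
      case (elim z)
      have "(\<lambda>j. indicator ({r1..r2} \<times> {t1..t2}) z * curl_lim (e j) z)
          \<longlonglongrightarrow> indicator ({r1..r2} \<times> {t1..t2}) z * (2 * 0 * fst z / ((norm (V z))\<^sup>2 + 0)\<^sup>2)"
        unfolding curl_lim_def using elim by (intro tendsto_intros e) auto
      then show ?case by simp
    qed
    show "AE z in polar_rect a b. norm (indicator ({r1..r2} \<times> {t1..t2}) z * curl_lim (e j) z)
        \<le> (norm (Vr z / V z))\<^sup>2 + (norm (Vt z / V z))\<^sup>2" for j
      using nz det AE_polar_rect[of a b 0 "2 * pi"]
    proof eventually_elim
      case (elim z)
      let ?v = "(norm (V z))\<^sup>2"
      have v: "?v > 0" using elim by simp
      have f: "0 \<le> fst z" using elim ab by simp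
      have "fst z \<le> norm (Vr z) * norm (Vt z)"
        using elim abs_Im_le_cmod[of "cnj (Vr z) * Vt z"] by (simp add: norm_mult)
      also have "\<dots> \<le> (norm (Vr z))\<^sup>2 + (norm (Vt z))\<^sup>2"
        using sum_squares_bound[of "norm (Vr z)" "norm (Vt z)"] mult_nonneg_nonneg[OF norm_ge_zero[of "Vr z"] norm_ge_zero[of "Vt z"]] by linarith
      finally have 1: "fst z \<le> (norm (Vr z))\<^sup>2 + (norm (Vt z))\<^sup>2" .
      \<comment> \<open>This turns the factor \<open>2 e / (v + e)^2\<close> into at most
        \<open>1 / v\<close>, uniformly in \<open>e\<close>; the constraint then pays for
        \<open>r / v\<close> with the logarithmic derivatives.\<close>
      have "2 * e j * ?v \<le> (?v + e j)\<^sup>2"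
        using e(1)[of j] by (simp add: power2_sum)
      moreover have "(?v + e j)\<^sup>2 > 0" using norm_sq_plus_pos[OF e(1)[of j], of "V z"] by simp
      ultimately have "2 * e j / (?v + e j)\<^sup>2 \<le> 1 / ?v"
        using v by (simp only: pos_divide_le_eq times_divide_eq_left pos_le_divide_eq mult_1)
      then have "fst z * (2 * e j / (?v + e j)\<^sup>2) \<le> fst z * (1 / ?v)" using f by (rule mult_left_mono)
      also have "\<dots> \<le> ((norm (Vr z))\<^sup>2 + (norm (Vt z))\<^sup>2) * (1 / ?v)" using 1 v by (intro mult_right_mono) auto
      also have "\<dots> = (norm (Vr z / V z))\<^sup>2 + (norm (Vt z / V z))\<^sup>2"
        by (simp add: norm_divide power_divide add_divide_distrib)
      finally have 2: "curl_lim (e j) z \<le> (norm (Vr z / V z))\<^sup>2 + (norm (Vt z / V z))\<^sup>2"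
        by (simp add: curl_lim_def mult_ac)
      have "0 \<le> curl_lim (e j) z" using f e(1)[of j] by (simp add: curl_lim_def)
      then show ?case using 2 by (auto split: split_indicator)
    qed
  qed auto
  then show ?thesis by simp
qed

end

section \<open>The energy lower bound\<close>

text \<open>The energy density in polar coordinates, without the factor \<open>1 / 2\<close>: the
  squared gradient is \<open>|Vr|^2 + |Vt|^2 / r^2\<close>, and area contributes a factor
  \<open>r\<close>.\<close>

abbreviation polar_density :: "(real \<times> real \<Rightarrow> complex) \<Rightarrow> (real \<times> real \<Rightarrow> complex) \<Rightarrow> (real \<times> real \<Rightarrow> complex) \<Rightarrow> real \<times> real \<Rightarrow> real" where
  "polar_density V Vr Vt z \<equiv> fst z * (norm (Vr z / V z))\<^sup>2 + (norm (Vt z / V z))\<^sup>2 / fst z"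

lemma integrable_if_square_integrable:
  fixes f :: "'a \<Rightarrow> 'b::euclidean_space"
  assumes "finite_measure N" "f \<in> borel_measurable N" "integrable N (\<lambda>s. (norm (f s))\<^sup>2)"
  shows "integrable N f"
proof -
  interpret finite_measure N by fact
  have "integrable N (\<lambda>s. 1 + (norm (f s))\<^sup>2)" using assms by simp
  then show ?thesis
  proof (rule Bochner_Integration.integrable_bound[OF _ assms(2)])
    have "norm (f s) \<le> 1 + (norm (f s))\<^sup>2" for s
      using zero_le_power2[of "norm (f s) - 1"] norm_ge_zero[of "f s"] by (simp only: power2_diff power_one mult_1_right)
    then show "AE s in N. norm (f s) \<le> norm (1 + (norm (f s))\<^sup>2)"
      by (auto intro: order_trans[OF _ abs_ge_self])
  qed
qed

lemma integral_Im_continuous: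
  fixes h :: "real \<Rightarrow> complex"
  assumes "continuous_on {c..d} h"
  shows "integral {c..d} (\<lambda>s. Im (h s)) = Im (LINT s|seg c d. h s)"
proof -
  have "continuous_on {c..d} (\<lambda>s. Im (h s))" by (intro continuous_intros assms)
  then have "integral {c..d} (\<lambda>s. Im (h s)) = (LINT s|seg c d. Im (h s))"
    by (rule integrable_seg_continuous(2)[symmetric])
  also have "\<dots> = Im (LINT s|seg c d. h s)"
    by (rule integral_bounded_linear[OF bounded_linear_Im integrable_seg_continuous(1)[OF assms]])
  finally show ?thesis .
qed

lemma prim_end: "prim a b y b = (LINT s|seg a b. y s)"
  unfolding prim_def by (rule Bochner_Integration.integral_cong) (auto simp: space_restrict_space)

lemma ex_AE_seg:
  assumes "AE t in seg c d. P t" "c < d"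
  shows "\<exists>t\<in>{c..d}. P t"
proof -
  have "ae_filter (seg c d) \<noteq> bot"
    using assms(2) by (subst ae_filter_eq_bot_iff) (simp add: space_restrict_space emeasure_restrict_space)
  then show ?thesis
    using eventually_happens'[OF _ eventually_conj[OF assms(1) AE_seg]] by auto
qed

lemma Im_reg_boundary:
  "c > 0 \<Longrightarrow> Im (reg e (of_real c * cis t) (\<i> * of_real c * cis t)) = c\<^sup>2 / (c\<^sup>2 + e)"
proof -
  have "cnj (of_real c * cis t) * (\<i> * of_real c * cis t) = \<i> * of_real (c\<^sup>2) * (cnj (cis t) * cis t)"
    by (simp add: power2_eq_square)
  also have "cnj (cis t) * cis t = 1" by (simp add: cis_cnj cis_mult)
  finally have 1: "cnj (of_real c * cis t) * (\<i> * of_real c * cis t) = \<i> * of_real (c\<^sup>2)" by simp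
  have 2: "(norm (of_real c * cis t))\<^sup>2 = c\<^sup>2" by (simp add: norm_mult)
  show ?thesis unfolding reg_def 1 2 Im_divide_of_real by simp
qed

section \<open>Almost every ray and almost every circle\<close>

context polar_map
begin

text \<open>What Fubini's theorem grants for almost every angle and the locale \<open>ray\<close>
  asks for on a single ray.\<close>

definition good_ray :: "real \<Rightarrow> bool" where
  "good_ray t \<longleftrightarrow> t \<in> {0..2 * pi} \<and>
    (\<lambda>r. V (r, t)) \<in> borel_measurable (seg a b) \<and> (\<lambda>r. Vr (r, t)) \<in> borel_measurable (seg a b) \<and> (\<lambda>r. M (r, t)) \<in> borel_measurable (seg a b) \<and>
    (AE r in seg a b. (\<lambda>n. W n r t) \<longlonglongrightarrow> V (r, t) \<and> (\<lambda>n. Wr n r t) \<longlonglongrightarrow> Vr (r, t)) \<and>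
    (AE r in seg a b. \<forall>n. norm (W n r t) \<le> M (r, t) \<and> norm (Wr n r t) \<le> M (r, t)) \<and>
    integrable (seg a b) (\<lambda>r. (M (r, t))\<^sup>2) \<and> (AE r in seg a b. V (r, t) \<noteq> 0) \<and>
    integrable (seg a b) (\<lambda>r. (norm (Vr (r, t) / V (r, t)))\<^sup>2)"

definition good_circle :: "real \<Rightarrow> bool" where
  "good_circle r \<longleftrightarrow> r \<in> {a..b} \<and>
    (\<lambda>t. V (r, t)) \<in> borel_measurable (seg 0 (2 * pi)) \<and> (\<lambda>t. Vt (r, t)) \<in> borel_measurable (seg 0 (2 * pi)) \<and>
    (AE t in seg 0 (2 * pi). (\<lambda>n. W n r t) \<longlonglongrightarrow> V (r, t) \<and> (\<lambda>n. Wt n r t) \<longlonglongrightarrow> Vt (r, t)) \<and>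
    (AE t in seg 0 (2 * pi). \<forall>n. norm (W n r t) \<le> M (r, t) \<and> norm (Wt n r t) \<le> M (r, t)) \<and>
    integrable (seg 0 (2 * pi)) (\<lambda>t. (M (r, t))\<^sup>2) \<and> (AE t in seg 0 (2 * pi). V (r, t) \<noteq> 0) \<and>
    integrable (seg 0 (2 * pi)) (\<lambda>t. (norm (Vt (r, t) / V (r, t)))\<^sup>2)"

lemma AE_good_ray: "AE t in seg 0 (2 * pi). good_ray t"
  using AE_pair_swap[OF sigma_fin lim] AE_pair_swap[OF sigma_fin dom] AE_pair_swap[OF sigma_fin nz]
    AE_integrable_slice[OF sigma_fin M2] AE_integrable_slice[OF sigma_fin fin(1)] AE_space
proof eventually_elim
  case (elim t)
  have t: "t \<in> space (seg 0 (2 * pi))" by fact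
  note m = measurable_compose[OF measurable_Pair2'[OF t] meas(1)] measurable_compose[OF measurable_Pair2'[OF t] meas(2)]
    measurable_compose[OF measurable_Pair2'[OF t] meas(4)]
  have "AE r in seg a b. (\<lambda>n. W n r t) \<longlonglongrightarrow> V (r, t) \<and> (\<lambda>n. Wr n r t) \<longlonglongrightarrow> Vr (r, t)"
    using elim(1) by eventually_elim auto
  moreover have "AE r in seg a b. \<forall>n. norm (W n r t) \<le> M (r, t) \<and> norm (Wr n r t) \<le> M (r, t)"
    using elim(2) by eventually_elim auto
  ultimately show ?case
    unfolding good_ray_def using elim(3-5) t m by (simp add: space_restrict_space)
qed

lemma AE_good_circle: "AE r in seg a b. good_circle r"
proof -
  interpret pair_sigma_finite "seg a b" "seg 0 (2 * pi)" by (rule pair_sigma_finite_seg)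
  show ?thesis
    using AE_pair[OF lim] AE_pair[OF dom] AE_pair[OF nz]
      AE_integrable_fst'[OF M2] AE_integrable_fst'[OF fin(2)] AE_space
  proof eventually_elim
    case (elim r)
    have r: "r \<in> space (seg a b)" by fact
    note m = measurable_compose[OF measurable_Pair1'[OF r] meas(1)] measurable_compose[OF measurable_Pair1'[OF r] meas(3)]
    have "AE t in seg 0 (2 * pi). (\<lambda>n. W n r t) \<longlonglongrightarrow> V (r, t) \<and> (\<lambda>n. Wt n r t) \<longlonglongrightarrow> Vt (r, t)"
      using elim(1) by eventually_elim auto
    moreover have "AE t in seg 0 (2 * pi). \<forall>n. norm (W n r t) \<le> M (r, t) \<and> norm (Wt n r t) \<le> M (r, t)"
      using elim(2) by eventually_elim auto
    ultimately show ?case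
      unfolding good_circle_def using elim(3-5) r m by (simp add: space_restrict_space)
  qed
qed

lemma integrable_log_deriv_ray: "good_ray t \<Longrightarrow> integrable (seg a b) (\<lambda>r. Vr (r, t) / V (r, t))"
  unfolding good_ray_def
  by (rule integrable_if_square_integrable[OF finite_measure_seg borel_measurable_divide]) blast+

lemma integrable_log_deriv_circle: "good_circle r \<Longrightarrow> integrable (seg 0 (2 * pi)) (\<lambda>t. Vt (r, t) / V (r, t))"
  unfolding good_circle_def
  by (rule integrable_if_square_integrable[OF finite_measure_seg borel_measurable_divide]) blast+

lemma ray_good_ray:
  assumes "good_ray t"
  shows "ray a b (\<lambda>n r. W n r t) (\<lambda>n r. Wr n r t) (\<lambda>r. V (r, t)) (\<lambda>r. Vr (r, t)) (\<lambda>r. M (r, t)) (of_real a * cis t) (of_real b * cis t)"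
proof
  note g = assms[unfolded good_ray_def]
  show "integrable (seg a b) (\<lambda>r. M (r, t))"
    by (rule integrable_if_square_integrable[OF finite_measure_seg]) (use g in \<open>simp_all\<close>)
  show "AE r in seg a b. (\<lambda>n. W n r t) \<longlonglongrightarrow> V (r, t) \<and> (\<lambda>n. Wr n r t) \<longlonglongrightarrow> Vr (r, t)"
    "AE r in seg a b. \<forall>n. norm (W n r t) \<le> M (r, t) \<and> norm (Wr n r t) \<le> M (r, t)"
    "AE r in seg a b. V (r, t) \<noteq> 0" "integrable (seg a b) (\<lambda>r. (M (r, t))\<^sup>2)"
    "(\<lambda>r. V (r, t)) \<in> borel_measurable (seg a b)" "(\<lambda>r. Vr (r, t)) \<in> borel_measurable (seg a b)"
    using g by blast+
  show "integrable (seg a b) (\<lambda>r. Vr (r, t) / V (r, t))" by (rule integrable_log_deriv_ray[OF assms])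
qed (use ab boundary W_r W_continuous(5) in auto)

definition log_change :: "real \<Rightarrow> complex" where
  "log_change t = (LINT r|seg a b. Vr (r, t) / V (r, t))"

text \<open>Both ends of the ray lie on the boundary, where the approximations are the identity, so
  the lift at \<open>b\<close> compares \<open>b cis t\<close> with \<open>a cis t\<close>.\<close>

lemma exp_log_change:
  assumes "good_ray t"
  shows "exp (log_change t) = of_real (b / a)"
proof -
  note ab' = ab
  interpret ray a b "\<lambda>n r. W n r t" "\<lambda>n r. Wr n r t" "\<lambda>r. V (r, t)" "\<lambda>r. Vr (r, t)" "\<lambda>r. M (r, t)" "of_real a * cis t" "of_real b * cis t"
    by (rule ray_good_ray[OF assms])
  have "f b = of_real a * cis t * exp (log_change t)"
    using lift[of "f b = of_real a * cis t * exp (log_change t)"] ab unfolding log_change_def prim_end[symmetric] by force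
  then have "of_real b * cis t = of_real a * exp (log_change t) * cis t" using f_ends by (simp add: mult_ac)
  then show ?thesis using ab' by (simp add: field_simps)
qed

definition eps :: "nat \<Rightarrow> real" where "eps j = inverse (real (Suc j))"

lemma eps: "eps j > 0" "eps \<longlonglongrightarrow> 0"
proof -
  show "eps j > 0" by (simp add: eps_def)
  have "eps = (\<lambda>j. inverse (real (Suc j)))" by (rule ext) (rule eps_def)
  then show "eps \<longlonglongrightarrow> 0" using LIMSEQ_inverse_real_of_nat by simp
qed

text \<open>Stokes' theorem on the sector between the two rays. As \<open>e -> 0\<close> the outer
  and the inner arc contribute \<open>t2 - t1\<close> each, with opposite signs, and the curl term
  vanishes; so the two radial edges contribute equally.\<close>

lemma Im_log_change_const:
  assumes t: "good_ray t1" "good_ray t2" "t1 \<le> t2"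
  shows "Im (log_change t1) = Im (log_change t2)"
proof -
  define X where "X e t = (LINT r|seg a b. reg e (V (r, t)) (Vr (r, t)))" for e t
  define Xn where "Xn e n t = (LINT r|seg a b. reg e (W n r t) (Wr n r t))" for e n t
  define K where "K e = (LINT z|polar_rect a b. indicator ({a..b} \<times> {t1..t2}) z * curl_lim e z)" for e
  define Kn where "Kn e n = (LINT z|polar_rect a b. indicator ({a..b} \<times> {t1..t2}) z * curl e n (fst z) (snd z))" for e n
  define c where "c e = (t2 - t1) * (b\<^sup>2 / (b\<^sup>2 + e) - a\<^sup>2 / (a\<^sup>2 + e))" for e
  have n: "c e - (Im (Xn e n t2) - Im (Xn e n t1)) = Kn e n" if e: "e > 0" for e n
  proof -
    have ci: "continuous_on {a..b} (\<lambda>r. reg e (W n r t) (Wr n r t))" for t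
      by (rule continuous_on_reg[OF e W_continuous(4) W_continuous(5)])
    have 1: "integral {t1..t2} (\<lambda>t. Im (reg e (W n b t) (Wt n b t)) - Im (reg e (W n a t) (Wt n a t))) = c e"
      using ab t by (simp add: boundary Wt_boundary Im_reg_boundary c_def)
    have "integral {a..b} (\<lambda>r. Im (reg e (W n r t2) (Wr n r t2)) - Im (reg e (W n r t1) (Wr n r t1)))
        = integral {a..b} (\<lambda>r. Im (reg e (W n r t2) (Wr n r t2))) - integral {a..b} (\<lambda>r. Im (reg e (W n r t1) (Wr n r t1)))"
      by (intro Henstock_Kurzweil_Integration.integral_diff integrable_continuous_real[OF continuous_on_Im[OF ci]])
    also have "\<dots> = Im (Xn e n t2) - Im (Xn e n t1)"
      unfolding Xn_def integral_Im_continuous[OF ci] ..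
    finally show ?thesis
      using stokes_W[OF e, of a b t1 t2 n] t ab unfolding Kn_def 1 by (simp add: good_ray_def)
  qed
  have lim_n: "(\<lambda>n. Xn e n t) \<longlonglongrightarrow> X e t" if e: "e > 0" and g: "good_ray t" for e t
    unfolding X_def Xn_def
    by (rule LINT_reg_tendsto[OF e, where M = "\<lambda>r. M (r, t)"])
       (use g measurable_seg_continuous[OF W_continuous(4)] measurable_seg_continuous[OF W_continuous(5)]
         in \<open>simp_all add: good_ray_def\<close>)
  have e: "c e - (Im (X e t2) - Im (X e t1)) = K e" if e: "e > 0" for e
  proof -
    have "(\<lambda>n. Kn e n) \<longlonglongrightarrow> c e - (Im (X e t2) - Im (X e t1))"
      unfolding n[OF e, symmetric] by (intro tendsto_intros lim_n e t)
    moreover have "(\<lambda>n. Kn e n) \<longlonglongrightarrow> K e"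
      unfolding K_def Kn_def by (rule curl_tendsto[OF e])
    ultimately show ?thesis by (rule LIMSEQ_unique)
  qed
  have lim_e: "(\<lambda>j. X (eps j) t) \<longlonglongrightarrow> log_change t" if g: "good_ray t" for t
    unfolding X_def log_change_def
    by (rule LINT_reg_tendsto_0[OF eps]) (use g integrable_log_deriv_ray[OF g] in \<open>auto simp: good_ray_def\<close>)
  have "(\<lambda>j. c (eps j)) \<longlonglongrightarrow> (t2 - t1) * (b\<^sup>2 / (b\<^sup>2 + 0) - a\<^sup>2 / (a\<^sup>2 + 0))"
    unfolding c_def using ab by (intro tendsto_intros eps) auto
  then have "(\<lambda>j. c (eps j)) \<longlonglongrightarrow> 0" using ab by simp
  then have "(\<lambda>j. c (eps j) - (Im (X (eps j) t2) - Im (X (eps j) t1))) \<longlonglongrightarrow> 0 - (Im (log_change t2) - Im (log_change t1))"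
    by (intro tendsto_intros lim_e t)
  then have "(\<lambda>j. K (eps j)) \<longlonglongrightarrow> 0 - (Im (log_change t2) - Im (log_change t1))"
    by (simp add: e[OF eps(1)])
  moreover have "(\<lambda>j. K (eps j)) \<longlonglongrightarrow> 0"
    unfolding K_def by (rule curl_lim_tendsto_0[OF eps])
  ultimately have "0 - (Im (log_change t2) - Im (log_change t1)) = 0" by (rule LIMSEQ_unique)
  then show ?thesis by simp
qed

text \<open>Stokes' theorem on the ring between the radii \<open>a\<close> and
  \<open>\<rho>\<close>. The edges at the angles 0 and \<open>2 pi\<close> cancel by periodicity,
  and the inner circle contributes \<open>2 pi\<close> in the limit because the approximations are
  the identity there.\<close>

lemma Im_circle:
  assumes g: "good_circle \<rho>"
  shows "Im (LINT t|seg 0 (2 * pi). Vt (\<rho>, t) / V (\<rho>, t)) = 2 * pi"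
proof -
  have \<rho>: "\<rho> \<in> {a..b}" using g unfolding good_circle_def by blast
  define X where "X e = (LINT t|seg 0 (2 * pi). reg e (V (\<rho>, t)) (Vt (\<rho>, t)))" for e
  define Xn where "Xn e n = (LINT t|seg 0 (2 * pi). reg e (W n \<rho> t) (Wt n \<rho> t))" for e n
  define K where "K e = (LINT z|polar_rect a b. indicator ({a..\<rho>} \<times> {0..2 * pi}) z * curl_lim e z)" for e
  define Kn where "Kn e n = (LINT z|polar_rect a b. indicator ({a..\<rho>} \<times> {0..2 * pi}) z * curl e n (fst z) (snd z))" for e n
  define c where "c e = 2 * pi * (a\<^sup>2 / (a\<^sup>2 + e))" for e
  have n: "Im (Xn e n) - c e = Kn e n" if e: "e > 0" for e n
  proof -
    have ci: "continuous_on {0..2 * pi} (\<lambda>t. reg e (W n \<rho> t) (Wt n \<rho> t))"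
      by (rule continuous_on_reg[OF e W_continuous(1)[OF \<rho>] W_continuous(2)[OF \<rho>]])
    have "integral {0..2 * pi} (\<lambda>t. Im (reg e (W n \<rho> t) (Wt n \<rho> t)) - Im (reg e (W n a t) (Wt n a t)))
        = integral {0..2 * pi} (\<lambda>t. Im (reg e (W n \<rho> t) (Wt n \<rho> t))) - integral {0..2 * pi} (\<lambda>t. a\<^sup>2 / (a\<^sup>2 + e))"
      using ab unfolding boundary Wt_boundary Im_reg_boundary[OF ab(1)]
      by (intro Henstock_Kurzweil_Integration.integral_diff integrable_continuous_real[OF continuous_on_Im[OF ci]]
          integrable_continuous_real[OF continuous_on_const])
    also have "\<dots> = Im (Xn e n) - c e"
      unfolding Xn_def integral_Im_continuous[OF ci] by (simp add: c_def)
    finally have 1: "integral {0..2 * pi} (\<lambda>t. Im (reg e (W n \<rho> t) (Wt n \<rho> t)) - Im (reg e (W n a t) (Wt n a t))) = Im (Xn e n) - c e" .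
    have "integral {a..\<rho>} (\<lambda>r. Im (reg e (W n r (2 * pi)) (Wr n r (2 * pi))) - Im (reg e (W n r 0) (Wr n r 0))) = integral {a..\<rho>} (\<lambda>r. 0)"
      using \<rho> by (intro integral_cong) (simp add: periodic)
    then show ?thesis
      using stokes_W[OF e, of a \<rho> 0 "2 * pi" n] \<rho> ab unfolding Kn_def 1 by simp
  qed
  have lim_n: "(\<lambda>n. Xn e n) \<longlonglongrightarrow> X e" if e: "e > 0" for e
    unfolding X_def Xn_def
    by (rule LINT_reg_tendsto[OF e, where M = "\<lambda>t. M (\<rho>, t)"])
       (use g measurable_seg_continuous[OF W_continuous(1)[OF \<rho>]] measurable_seg_continuous[OF W_continuous(2)[OF \<rho>]]
         in \<open>simp_all add: good_circle_def\<close>)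
  have e: "Im (X e) - c e = K e" if e: "e > 0" for e
  proof -
    have "(\<lambda>n. Kn e n) \<longlonglongrightarrow> Im (X e) - c e"
      unfolding n[OF e, symmetric] by (intro tendsto_intros lim_n e)
    moreover have "(\<lambda>n. Kn e n) \<longlonglongrightarrow> K e"
      unfolding K_def Kn_def by (rule curl_tendsto[OF e])
    ultimately show ?thesis by (rule LIMSEQ_unique)
  qed
  let ?C = "LINT t|seg 0 (2 * pi). Vt (\<rho>, t) / V (\<rho>, t)"
  have lim_e: "(\<lambda>j. X (eps j)) \<longlonglongrightarrow> ?C"
    unfolding X_def
  proof (rule LINT_reg_tendsto_0[OF eps _ _ _ integrable_log_deriv_circle[OF g]])
    show "AE t in seg 0 (2 * pi). V (\<rho>, t) \<noteq> 0" using g unfolding good_circle_def by blast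
  qed (use g[unfolded good_circle_def] in blast)+
  have "(\<lambda>j. c (eps j)) \<longlonglongrightarrow> 2 * pi * (a\<^sup>2 / (a\<^sup>2 + 0))"
    unfolding c_def using ab by (intro tendsto_intros eps) auto
  then have "(\<lambda>j. c (eps j)) \<longlonglongrightarrow> 2 * pi" using ab by simp
  then have "(\<lambda>j. Im (X (eps j)) - c (eps j)) \<longlonglongrightarrow> Im ?C - 2 * pi"
    by (intro tendsto_intros lim_e)
  then have "(\<lambda>j. K (eps j)) \<longlonglongrightarrow> Im ?C - 2 * pi"
    by (simp add: e[OF eps(1)])
  moreover have "(\<lambda>j. K (eps j)) \<longlonglongrightarrow> 0"
    unfolding K_def by (rule curl_lim_tendsto_0[OF eps])
  ultimately have "Im ?C - 2 * pi = 0" by (rule LIMSEQ_unique)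
  then show ?thesis by simp
qed

text \<open>The exponential of \<open>log_change t\<close> is \<open>b / a\<close>, so on each good
  ray the imaginary part is a multiple of \<open>2 pi\<close>; by Stokes' theorem it is the same
  multiple on all of them.\<close>

lemma log_change_winding: "\<exists>m::int. \<forall>t. good_ray t \<longrightarrow> log_change t = Complex (ln (b / a)) (2 * pi * of_int m)"
proof -
  have "\<exists>t\<in>{0..2 * pi}. good_ray t" by (rule ex_AE_seg[OF AE_good_ray]) simp
  then obtain t0 where t0: "good_ray t0" by blast
  have E: "\<exists>m::int. log_change t = Complex (ln (b / a)) (2 * pi * of_int m)" if "good_ray t" for t
  proof -
    have "exp (log_change t) = exp (of_real (ln (b / a)))"
      using exp_log_change[OF that] ab by (simp add: exp_of_real)
    then obtain m :: int where "log_change t = of_real (ln (b / a)) + of_int (2 * m) * of_real pi * \<i>"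
      unfolding exp_eq by auto
    then show ?thesis by (intro exI[of _ m]) (simp add: complex_eq_iff)
  qed
  obtain m :: int where m: "log_change t0 = Complex (ln (b / a)) (2 * pi * of_int m)" using E[OF t0] by blast
  have "log_change t = Complex (ln (b / a)) (2 * pi * of_int m)" if t: "good_ray t" for t
  proof -
    have "Im (log_change t) = Im (log_change t0)"
    proof (cases "t \<le> t0")
      case True
      then show ?thesis by (rule Im_log_change_const[OF t t0])
    next
      case False
      then have "t0 \<le> t" by simp
      then show ?thesis by (rule Im_log_change_const[OF t0 t, symmetric])
    qed
    moreover have "Re (log_change t) = ln (b / a)" using E[OF t] by (metis complex.sel(1))
    ultimately show ?thesis using m by (simp add: complex_eq_iff)
  qed
  then show ?thesis by blast
qed

text \<open>The degree as seen by the weak derivatives, so that it makes sense before any continuous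
  representative is named. Good rays exist, hence the number is determined.\<close>

definition winding :: int where
  "winding = (SOME m. \<forall>t. good_ray t \<longrightarrow> log_change t = Complex (ln (b / a)) (2 * pi * of_int m))"

lemma log_change_eq: "good_ray t \<Longrightarrow> log_change t = Complex (ln (b / a)) (2 * pi * of_int winding)"
  unfolding winding_def using someI_ex[OF log_change_winding] by blast

lemma integrable_log_deriv: "integrable (polar_rect a b) (\<lambda>z. Vr z / V z)" "integrable (polar_rect a b) (\<lambda>z. Vt z / V z)"
  using integrable_if_square_integrable[OF finite_measure_polar_rect _ fin(1)] integrable_if_square_integrable[OF finite_measure_polar_rect _ fin(2)]
    borel_measurable_divide[OF meas(2) meas(1)] borel_measurable_divide[OF meas(3) meas(1)] by blast+

lemma measure_seg: "measure (seg 0 (2 * pi)) (space (seg 0 (2 * pi))) = 2 * pi"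
  by (simp add: space_restrict_space measure_restrict_space)

lemma LINT_log_deriv_r:
  "(LINT z|polar_rect a b. Vr z / V z) = of_real (2 * pi) * Complex (ln (b / a)) (2 * pi * of_int winding)"
proof -
  interpret pair_sigma_finite "seg a b" "seg 0 (2 * pi)" by (rule pair_sigma_finite_seg)
  have "(LINT z|polar_rect a b. Vr z / V z) = (LINT t|seg 0 (2 * pi). LINT r|seg a b. Vr (r, t) / V (r, t))"
    using integral_snd[of "\<lambda>r t. Vr (r, t) / V (r, t)"] integrable_log_deriv(1) by (simp add: case_prod_unfold)
  also have "\<dots> = (LINT t|seg 0 (2 * pi). Complex (ln (b / a)) (2 * pi * of_int winding))"
  proof (rule integral_cong_AE)
    show "(\<lambda>t. LINT r|seg a b. Vr (r, t) / V (r, t)) \<in> borel_measurable (seg 0 (2 * pi))"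
      using integrable_snd[of "\<lambda>r t. Vr (r, t) / V (r, t)"] integrable_log_deriv(1) by (simp add: case_prod_unfold borel_measurable_integrable)
    show "AE t in seg 0 (2 * pi). (LINT r|seg a b. Vr (r, t) / V (r, t)) = Complex (ln (b / a)) (2 * pi * of_int winding)"
      using AE_good_ray by eventually_elim (drule log_change_eq, simp only: log_change_def)
  qed simp
  also have "\<dots> = of_real (2 * pi) * Complex (ln (b / a)) (2 * pi * of_int winding)"
    unfolding lebesgue_integral_const measure_seg by (simp add: scaleR_conv_of_real)
  finally show ?thesis .
qed

lemma LINT_inverse_r: "(LINT r|seg a b. 1 / r) = ln (b / a)"
proof -
  have c: "continuous_on {a..b} (\<lambda>r. 1 / r)" using ab by (intro continuous_intros) auto
  have "((\<lambda>r. 1 / r) has_integral ln b - ln a) {a..b}"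
    by (rule fundamental_theorem_of_calculus)
       (use ab in \<open>auto intro!: derivative_eq_intros simp: has_real_derivative_iff_has_vector_derivative[symmetric]\<close>)
  then show ?thesis using ab by (simp add: integrable_seg_continuous(2)[OF c] integral_unique ln_div)
qed

lemma LINT_log_deriv_t:
  "integrable (polar_rect a b) (\<lambda>z. Im (Vt z / V z) / fst z)"
  "(LINT z|polar_rect a b. Im (Vt z / V z) / fst z) = 2 * pi * ln (b / a)"
proof -
  interpret pair_sigma_finite "seg a b" "seg 0 (2 * pi)" by (rule pair_sigma_finite_seg)
  note meas[measurable]
  show i: "integrable (polar_rect a b) (\<lambda>z. Im (Vt z / V z) / fst z)"
  proof (rule Bochner_Integration.integrable_bound)
    show "integrable (polar_rect a b) (\<lambda>z. norm (Vt z / V z) * (1 / a))"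
      by (intro integrable_mult_left integrable_norm integrable_log_deriv)
    show "(\<lambda>z. Im (Vt z / V z) / fst z) \<in> borel_measurable (polar_rect a b)" by measurable
    show "AE z in polar_rect a b. norm (Im (Vt z / V z) / fst z) \<le> norm (norm (Vt z / V z) * (1 / a))"
      using AE_polar_rect
    proof eventually_elim
      case (elim z)
      have "\<bar>Im (Vt z / V z)\<bar> * (1 / fst z) \<le> norm (Vt z / V z) * (1 / a)"
        using elim ab by (intro mult_mono abs_Im_le_cmod divide_left_mono) auto
      then show ?case using elim ab by simp
    qed
  qed
  have "(LINT z|polar_rect a b. Im (Vt z / V z) / fst z) = (LINT r|seg a b. LINT t|seg 0 (2 * pi). Im (Vt (r, t) / V (r, t)) / r)"
    using integral_fst'[OF i] by simp
  also have "\<dots> = (LINT r|seg a b. 2 * pi * (1 / r))"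
  proof (rule integral_cong_AE)
    show "(\<lambda>r. LINT t|seg 0 (2 * pi). Im (Vt (r, t) / V (r, t)) / r) \<in> borel_measurable (seg a b)"
      using integrable_fst'[OF i] by (simp add: borel_measurable_integrable)
    show "(\<lambda>r. 2 * pi * (1 / r)) \<in> borel_measurable (seg a b)"
      by (rule measurable_restrict_space1) simp
    show "AE r in seg a b. (LINT t|seg 0 (2 * pi). Im (Vt (r, t) / V (r, t)) / r) = 2 * pi * (1 / r)"
      using AE_good_circle
    proof eventually_elim
      case (elim r)
      have "(LINT t|seg 0 (2 * pi). Im (Vt (r, t) / V (r, t)) / r) = (LINT t|seg 0 (2 * pi). Im (Vt (r, t) / V (r, t))) / r"
        by simp
      also have "(LINT t|seg 0 (2 * pi). Im (Vt (r, t) / V (r, t))) = Im (LINT t|seg 0 (2 * pi). Vt (r, t) / V (r, t))"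
        by (rule integral_bounded_linear[OF bounded_linear_Im integrable_log_deriv_circle[OF elim]])
      also have "\<dots> = 2 * pi" by (rule Im_circle[OF elim])
      finally show ?case by simp
    qed
  qed
  also have "\<dots> = 2 * pi * ln (b / a)"
    using LINT_inverse_r by (simp del: times_divide_eq_right)
  finally show "(LINT z|polar_rect a b. Im (Vt z / V z) / fst z) = 2 * pi * ln (b / a)" .
qed

text \<open>Since \<open>|y - p / r|\<^sup>2 \<ge> 0\<close>, the density is bounded below by terms that are linear in the logarithmic
  derivatives; equality holds for the twist of rate \<open>c\<close>, whose radial logarithmic derivative is
  \<open>(1 + \<i> c) / r\<close>.\<close>

lemma twist_energy_le:
  "2 * twist_energy a b winding \<le> (LINT z|polar_rect a b. polar_density V Vr Vt z)"
proof -
  interpret pair_sigma_finite "seg a b" "seg 0 (2 * pi)" by (rule pair_sigma_finite_seg)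
  note meas[measurable]
  define c where "c = twist_rate a b winding"
  define L where "L = ln (b / a)"
  have L: "L > 0" unfolding L_def using ab by simp
  have cL: "c * L = 2 * pi * of_int winding" using L by (simp add: c_def twist_rate_def L_def)
  define p where "p = Complex 1 c"
  have i1: "integrable (polar_rect a b) (\<lambda>z. 2 * Re (cnj p * (Vr z / V z)))"
    by (intro integrable_mult_right integrable_bounded_linear[OF bounded_linear_Re] integrable_log_deriv)
  have "continuous_on ({a..b} \<times> {0..2*pi}) (\<lambda>z. 1 / fst z)" using ab by (intro continuous_intros) auto
  then have i3: "integrable (polar_rect a b) (\<lambda>z. 1 / fst z)" by (rule integrable_polar_rect_cont)
  have I3: "(LINT z|polar_rect a b. 1 / fst z) = 2 * pi * L"
  proof -
    have "(LINT z|polar_rect a b. 1 / fst z) = (LINT r|seg a b. LINT t|seg 0 (2 * pi). 1 / r)"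
      unfolding integral_fst'[OF i3, symmetric] by simp
    also have "\<dots> = (LINT r|seg a b. 2 * pi * (1 / r))"
      unfolding lebesgue_integral_const measure_seg by (simp only: real_scaleR_def)
    also have "\<dots> = 2 * pi * (LINT r|seg a b. 1 / r)" by (rule integral_mult_right_zero)
    finally show ?thesis unfolding L_def LINT_inverse_r .
  qed
  have I1: "(LINT z|polar_rect a b. 2 * Re (cnj p * (Vr z / V z))) = 4 * pi * L * (1 + c\<^sup>2)"
  proof -
    have "(LINT z|polar_rect a b. 2 * Re (cnj p * (Vr z / V z))) = 2 * (LINT z|polar_rect a b. Re (cnj p * (Vr z / V z)))"
      by simp
    also have "(LINT z|polar_rect a b. Re (cnj p * (Vr z / V z))) = Re (cnj p * (LINT z|polar_rect a b. Vr z / V z))"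
      by (rule integral_bounded_linear[OF bounded_linear_compose[OF bounded_linear_Re bounded_linear_mult_right] integrable_log_deriv(1)])
    also have "\<dots> = 2 * pi * (L + c * (c * L))"
      unfolding LINT_log_deriv_r cL by (simp add: p_def L_def algebra_simps)
    finally show ?thesis by (simp add: power2_eq_square algebra_simps)
  qed
  note i2 = LINT_log_deriv_t(1) and I2 = LINT_log_deriv_t(2)[folded L_def]
  let ?low = "\<lambda>z. (2 * Re (cnj p * (Vr z / V z)) + 2 * (Im (Vt z / V z) / fst z)) - (2 + c\<^sup>2) * (1 / fst z)"
  have ilow: "integrable (polar_rect a b) ?low"
    using i1 i2 i3 by (intro Bochner_Integration.integrable_diff Bochner_Integration.integrable_add integrable_mult_right) auto
  have "(LINT z|polar_rect a b. ?low z) = 4 * pi * L * (1 + c\<^sup>2) + 2 * (2 * pi * L) - (2 + c\<^sup>2) * (2 * pi * L)"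
  proof -
    have j2: "integrable (polar_rect a b) (\<lambda>z. 2 * (Im (Vt z / V z) / fst z))"
      and j3: "integrable (polar_rect a b) (\<lambda>z. (2 + c\<^sup>2) * (1 / fst z))"
      by (intro integrable_mult_right i2 i3)+
    show ?thesis
      unfolding Bochner_Integration.integral_diff[OF Bochner_Integration.integrable_add[OF i1 j2] j3]
        Bochner_Integration.integral_add[OF i1 j2] integral_mult_right_zero[of _ 2 "\<lambda>z. Im (Vt z / V z) / fst z"]
        integral_mult_right_zero[of _ "2 + c\<^sup>2"] I1 I2 I3 ..
  qed
  also have "\<dots> = 2 * twist_energy a b winding"
    by (simp add: twist_energy_def c_def[symmetric] L_def[symmetric] algebra_simps)
  finally have low: "(LINT z|polar_rect a b. ?low z) = 2 * twist_energy a b winding" .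
  have iup: "integrable (polar_rect a b) (\<lambda>z. polar_density V Vr Vt z)"
  proof (rule Bochner_Integration.integrable_bound)
    show "integrable (polar_rect a b) (\<lambda>z. b * (norm (Vr z / V z))\<^sup>2 + (1 / a) * (norm (Vt z / V z))\<^sup>2)"
      using fin by simp
    show "AE z in polar_rect a b. norm (polar_density V Vr Vt z)
        \<le> norm (b * (norm (Vr z / V z))\<^sup>2 + (1 / a) * (norm (Vt z / V z))\<^sup>2)"
      using AE_polar_rect
    proof eventually_elim
      case (elim z)
      have "fst z * (norm (Vr z / V z))\<^sup>2 \<le> b * (norm (Vr z / V z))\<^sup>2" using elim by (intro mult_right_mono) auto
      moreover have "1 / fst z * (norm (Vt z / V z))\<^sup>2 \<le> 1 / a * (norm (Vt z / V z))\<^sup>2"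
        using elim ab by (intro mult_right_mono divide_left_mono) auto
      moreover have "0 \<le> fst z * (norm (Vr z / V z))\<^sup>2" "0 \<le> 1 / fst z * (norm (Vt z / V z))\<^sup>2"
        using elim ab by auto
      ultimately show ?case by simp
    qed
  qed measurable
  have "(LINT z|polar_rect a b. ?low z) \<le> (LINT z|polar_rect a b. polar_density V Vr Vt z)"
  proof (rule integral_mono_AE[OF ilow iup])
    show "AE z in polar_rect a b. ?low z \<le> polar_density V Vr Vt z"
      using AE_polar_rect
    proof eventually_elim
      case (elim z)
      define r where "r = fst z"
      define y x where "y = Vr z / V z" and "x = Vt z / V z"
      have r: "r > 0" using elim ab by (simp add: r_def)
      have "0 \<le> ((r * Re y - 1)\<^sup>2 + (r * Im y - c)\<^sup>2) / r" using r by simp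
      also have "\<dots> = r * ((Re y)\<^sup>2 + (Im y)\<^sup>2) - 2 * (Re y + c * Im y) + (1 + c\<^sup>2) * (1 / r)"
        using r by (simp add: field_simps power2_eq_square)
      finally have 1: "2 * (Re y + c * Im y) - (1 + c\<^sup>2) * (1 / r) \<le> r * (norm y)\<^sup>2" by (simp add: cmod_power2)
      \<comment> \<open>The angular square is expanded around \<open>\<i>\<close>, the value of
        \<open>Vt / V\<close> for a twist, which rotates every circle rigidly.\<close>
      have "0 \<le> ((Im x - 1)\<^sup>2 + (Re x)\<^sup>2) / r" using r by simp
      also have "\<dots> = ((Re x)\<^sup>2 + (Im x)\<^sup>2) / r - 2 * (Im x / r) + 1 / r"
        using r by (simp add: field_simps power2_eq_square)
      finally have 2: "2 * (Im x / r) - 1 / r \<le> (norm x)\<^sup>2 / r" by (simp add: cmod_power2)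
      have "Re (cnj p * y) = Re y + c * Im y" by (simp add: p_def)
      then show ?case using 1 2 unfolding r_def[symmetric] y_def[symmetric] x_def[symmetric]
        by (simp add: algebra_simps)
    qed
  qed
  then show ?thesis unfolding low .
qed

end

section \<open>Degree and stability of the winding number\<close>

lemma continuous_AE_eq_on_seg:
  fixes g h :: "real \<Rightarrow> complex"
  assumes ab: "a < b" and c: "continuous_on {a..b} g" "continuous_on {a..b} h"
    and eq: "AE r in seg a b. g r = h r" and r: "r \<in> {a..b}"
  shows "g r = h r"
proof -
  have cn: "continuous_on {a..b} (\<lambda>r. norm (g r - h r))" by (intro continuous_intros c)
  have "(LINT r|seg a b. norm (g r - h r)) = (LINT r|seg a b. 0)"
    by (rule integral_cong_AE) (use eq in \<open>auto intro!: measurable_seg_continuous[OF cn] elim: eventually_mono\<close>)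
  then have "integral {a..b} (\<lambda>r. norm (g r - h r)) = 0"
    using integrable_seg_continuous(2)[OF cn] by simp
  then have "norm (g r - h r) = 0"
    using integral_eq_0_iff[OF cn ab] r by auto
  then show ?thesis by simp
qed

context polar_map
begin

text \<open>On almost every ray the continuous map \<open>f\<close> agrees almost everywhere, hence
  everywhere, with the absolutely continuous representative. The imaginary part of the lifted
  logarithm is then a continuous phase of \<open>f\<close>, and one such ray is enough.\<close>

lemma degree_eq_winding:
  assumes f: "continuous_on {x. a \<le> norm x \<and> norm x \<le> b} f"
    and V: "AE z in polar_rect a b. V z = to_complex (f (polar (fst z) (snd z)))"
  shows "\<exists>t. degree_on_ray a b f t = of_int winding"
proof -
  have "AE t in seg 0 (2 * pi). good_ray t \<and> (AE r in seg a b. V (r, t) = to_complex (f (polar r t)))"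
    using AE_good_ray AE_pair_swap[OF sigma_fin V] by eventually_elim simp
  then have "\<exists>t\<in>{0..2 * pi}. good_ray t \<and> (AE r in seg a b. V (r, t) = to_complex (f (polar r t)))"
    by (rule ex_AE_seg) simp
  then obtain t where t: "good_ray t" "AE r in seg a b. V (r, t) = to_complex (f (polar r t))" by blast
  note ab' = ab
  interpret R: ray a b "\<lambda>n r. W n r t" "\<lambda>n r. Wr n r t" "\<lambda>r. V (r, t)" "\<lambda>r. Vr (r, t)" "\<lambda>r. M (r, t)" "of_real a * cis t" "of_real b * cis t"
    by (rule ray_good_ray[OF t(1)])
  let ?y = "\<lambda>r. Vr (r, t) / V (r, t)"
  obtain yn H where L: "\<And>n. continuous_on {a..b} (yn n)" "integrable (seg a b) H"
    "AE r in seg a b. (\<lambda>n. yn n r) \<longlonglongrightarrow> ?y r \<and> (\<forall>n. norm (yn n r) \<le> H r)"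
    "\<And>r. r \<in> {a..b} \<Longrightarrow> R.f r = of_real a * cis t * exp (prim a b ?y r)"
    by (rule R.lift) (rule that, assumption+)
  have ym: "?y \<in> borel_measurable (seg a b)" using R.fin by (rule borel_measurable_integrable)
  note P = exp_prim_chain(2,3)[OF less_imp_le[OF ab(2)] ym L(1-3)]
  have pc: "continuous_on {a..b} (\<lambda>r. polar r t)"
    unfolding polar_def vector_2_eq by (intro continuous_intros)
  have pol: "continuous_on {a..b} (\<lambda>r. to_complex (f (polar r t)))"
    by (intro bounded_linear.continuous_on[OF bounded_linear_to_complex] continuous_on_compose2[OF f pc])
       (use ab in \<open>auto simp: norm_polar\<close>)
  have eq: "to_complex (f (polar r t)) = of_real a * cis t * exp (prim a b ?y r)" if r: "r \<in> {a..b}" for r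
  proof -
    have "AE r in seg a b. to_complex (f (polar r t)) = R.f r"
      using t(2) R.f_eq_v by eventually_elim simp
    then have "to_complex (f (polar r t)) = R.f r"
      using continuous_AE_eq_on_seg[OF ab(2) pol R.f_cont _ r] by blast
    then show ?thesis using L(4)[OF r] by simp
  qed
  have "degree_on_ray a b f t = of_real (((t + Im (prim a b ?y b)) - (t + Im (prim a b ?y a))) / (2 * pi))"
  proof (rule degree_on_ray_eq[OF ab(2)])
    show "continuous_on {a..b} (\<lambda>r. t + Im (prim a b ?y r))" by (intro continuous_intros P)
    show "0 < a * exp (Re (prim a b ?y r))" for r using ab' by simp
    show "to_complex (f (polar r t)) = of_real (a * exp (Re (prim a b ?y r))) * cis (t + Im (prim a b ?y r))" if "r \<in> {a..b}" for r
      unfolding eq[OF that] exp_eq_polar by (simp add: cis_mult[symmetric] mult_ac)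
  qed
  moreover have "Im (prim a b ?y b) = 2 * pi * of_int winding"
    unfolding prim_end using log_change_eq[OF t(1)] by (simp add: log_change_def)
  ultimately show ?thesis using P(2) by (intro exI[of _ t]) simp
qed

end

lemma power2_sum_le: "(p + q)\<^sup>2 \<le> 2 * (p\<^sup>2 + q\<^sup>2)" for p q :: real
  using sum_squares_bound[of p q] by (simp add: power2_sum)

text \<open>The law of cosines: \<open>s\<close> and \<open>u\<close> are two moduli,
  \<open>c\<close> is the cosine of the angle between the points, \<open>d\<close> their distance.
  The distance is at least \<open>u\<close> times the sine for an angle up to a right one, and at
  least \<open>u\<close> beyond; both are at least \<open>u (1 - c) / 2\<close>.\<close>

lemma angle_le_distance:
  fixes s u c :: real
  assumes "s \<ge> 0" "u > 0" "-1 \<le> c" "c \<le> 1" "d \<ge> 0" "d\<^sup>2 = s\<^sup>2 - 2 * s * u * c + u\<^sup>2"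
  shows "(1 - c)\<^sup>2 \<le> 4 * d / u"
proof -
  have "(u * (1 - c) / 2)\<^sup>2 \<le> d\<^sup>2"
  proof (cases "c \<ge> 0")
    case True
    have "(u * (1 - c) / 2)\<^sup>2 \<le> u\<^sup>2 * ((1 - c) * (1 + c))"
    proof -
      have "(1 - c) * (1 - c) \<le> (1 - c) * (4 * (1 + c))" using assms True by (intro mult_left_mono) auto
      then have "u\<^sup>2 * ((1 - c) * (1 - c)) \<le> u\<^sup>2 * ((1 - c) * (4 * (1 + c)))"
        by (rule mult_left_mono) simp
      moreover have "(u * (1 - c) / 2)\<^sup>2 = u\<^sup>2 * ((1 - c) * (1 - c)) / 4"
        by (simp add: power2_eq_square)
      moreover have "u\<^sup>2 * ((1 - c) * (4 * (1 + c))) = 4 * (u\<^sup>2 * ((1 - c) * (1 + c)))" by simp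
      ultimately show ?thesis by linarith
    qed
    also have "\<dots> \<le> u\<^sup>2 * ((1 - c) * (1 + c)) + (s - u * c)\<^sup>2" by simp
    also have "\<dots> = d\<^sup>2" unfolding assms(6) by (simp add: power2_eq_square algebra_simps)
    finally show ?thesis .
  next
    case False
    have "u * (1 - c) / 2 \<le> u" using assms by (simp add: mult_left_le)
    moreover have "0 \<le> u * (1 - c) / 2" using assms by simp
    ultimately have "(u * (1 - c) / 2)\<^sup>2 \<le> u\<^sup>2" by (intro power_mono) auto
    also have "\<dots> \<le> d\<^sup>2"
    proof -
      have "s * u * c \<le> 0" using assms False by (intro mult_nonneg_nonpos) auto
      then show ?thesis unfolding assms(6) using zero_le_power2[of s] by linarith
    qed
    finally show ?thesis .
  qed
  then have 1: "u * (1 - c) / 2 \<le> d" using assms(5) by (rule power2_le_imp_le)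
  have "(1 - c)\<^sup>2 \<le> 2 * (1 - c)" unfolding power2_eq_square using assms by (intro mult_right_mono) auto
  also have "\<dots> \<le> 4 * d / u" using 1 assms(2) by (simp add: field_simps)
  finally show ?thesis .
qed

text \<open>Along a ray, the phase difference \<open>\<psi>\<close> of two maps runs from \<open>0\<close> to \<open>2 \<pi> (m - k)\<close>, and \<open>cos \<psi>\<close> has
  mean zero with respect to \<open>d\<psi>\<close>. If \<open>m \<noteq> k\<close> then \<open>1 - cos \<psi>\<close>, which the distance of the maps
  controls, cannot be small.\<close>

lemma ray_phase_difference:
  assumes R1: "ray a b w1 w1' v1 v1' M1 \<alpha> \<beta>" and R2: "ray a b w2 w2' v2 v2' M2 \<alpha> \<beta>"
    and i: "integrable (seg a b) (\<lambda>r. (norm (v1' r / v1 r))\<^sup>2)" "integrable (seg a b) (\<lambda>r. (norm (v2' r / v2 r))\<^sup>2)"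
      "integrable (seg a b) (\<lambda>r. norm (v1 r - v2 r))"
    and low: "AE r in seg a b. norm (v2 r) \<ge> c" and c: "c > 0"
    and m: "Im (LINT r|seg a b. v1' r / v1 r) - Im (LINT r|seg a b. v2' r / v2 r) = 2 * pi * of_int m" "m \<noteq> 0"
    and \<mu>: "\<mu> > 0"
  shows "2 * pi \<le> (LINT r|seg a b. 2 * \<mu> / c * norm (v1 r - v2 r) + 1 / \<mu> * ((norm (v1' r / v1 r))\<^sup>2 + (norm (v2' r / v2 r))\<^sup>2))"
proof -
  interpret R1: ray a b w1 w1' v1 v1' M1 \<alpha> \<beta> by fact
  interpret R2: ray a b w2 w2' v2 v2' M2 \<alpha> \<beta> by fact
  let ?y1 = "\<lambda>r. v1' r / v1 r" and ?y2 = "\<lambda>r. v2' r / v2 r"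
  obtain y1n H1 where L1: "\<And>n. continuous_on {a..b} (y1n n)" "integrable (seg a b) H1"
    "AE r in seg a b. (\<lambda>n. y1n n r) \<longlonglongrightarrow> ?y1 r \<and> (\<forall>n. norm (y1n n r) \<le> H1 r)"
    "\<And>r. r \<in> {a..b} \<Longrightarrow> R1.f r = \<alpha> * exp (prim a b ?y1 r)"
    by (rule R1.lift) (rule that, assumption+)
  obtain y2n H2 where L2: "\<And>n. continuous_on {a..b} (y2n n)" "integrable (seg a b) H2"
    "AE r in seg a b. (\<lambda>n. y2n n r) \<longlonglongrightarrow> ?y2 r \<and> (\<forall>n. norm (y2n n r) \<le> H2 r)"
    "\<And>r. r \<in> {a..b} \<Longrightarrow> R2.f r = \<alpha> * exp (prim a b ?y2 r)"
    by (rule R2.lift) (rule that, assumption+)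
  define p where "p r = Im (?y1 r - ?y2 r)" for r
  define \<psi> where "\<psi> r = Im (prim a b ?y1 r - prim a b ?y2 r)" for r
  \<comment> \<open>\<open>p\<close> is the derivative of the phase difference
    \<open>\<psi>\<close>. Multiplied by \<open>\<i>\<close> it has a primitive whose exponential is
    \<open>cis \<psi>\<close>, so that the chain rule for exponentials applies to the phase factor
    alone.\<close>
  define z where "z r = \<i> * of_real (p r)" for r
  define zn where "zn n r = \<i> * of_real (Im (y1n n r - y2n n r))" for n r
  have pi: "integrable (seg a b) p"
    unfolding p_def by (intro integrable_bounded_linear[OF bounded_linear_Im] Bochner_Integration.integrable_diff R1.fin R2.fin)
  have zm: "z \<in> borel_measurable (seg a b)" unfolding z_def using pi by measurable
  have znc: "continuous_on {a..b} (zn n)" for n unfolding zn_def by (intro continuous_intros L1 L2)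
  have H: "integrable (seg a b) (\<lambda>r. H1 r + H2 r)" using L1 L2 by simp
  have zl: "AE r in seg a b. (\<lambda>n. zn n r) \<longlonglongrightarrow> z r \<and> (\<forall>n. norm (zn n r) \<le> H1 r + H2 r)"
    using L1(3) L2(3)
  proof eventually_elim
    case (elim r)
    have "(\<lambda>n. zn n r) \<longlonglongrightarrow> z r" unfolding zn_def z_def p_def using elim by (intro tendsto_intros) auto
    moreover have "norm (zn n r) \<le> H1 r + H2 r" for n
    proof -
      have "norm (zn n r) = \<bar>Im (y1n n r - y2n n r)\<bar>" by (simp only: zn_def norm_mult norm_ii norm_of_real mult_1)
      also have "\<dots> \<le> norm (y1n n r) + norm (y2n n r)"
        using abs_Im_le_cmod norm_triangle_ineq4 by (rule order_trans)
      also have "\<dots> \<le> H1 r + H2 r" using elim by (intro add_mono) auto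
      finally show ?thesis .
    qed
    ultimately show ?case by blast
  qed
  have pz: "prim a b z r = \<i> * of_real (\<psi> r)" for r
  proof -
    let ?I = "\<lambda>s. indicator {a..r} s"
    have j: "integrable (seg a b) (\<lambda>s. ?I s *\<^sub>R ?y1 s)" "integrable (seg a b) (\<lambda>s. ?I s *\<^sub>R ?y2 s)"
      by (intro integrable_seg_mult_indicator R1.fin R2.fin; simp)+
    have bl: "bounded_linear (\<lambda>x :: complex. \<i> * of_real (Im x))"
      by (intro bounded_linear_compose[OF bounded_linear_mult_right] bounded_linear_compose[OF bounded_linear_of_real] bounded_linear_Im)
    have "prim a b z r = (LINT s|seg a b. \<i> * of_real (Im (?I s *\<^sub>R ?y1 s - ?I s *\<^sub>R ?y2 s)))"
      unfolding prim_def z_def p_def by (intro Bochner_Integration.integral_cong) (auto simp: scaleR_conv_of_real algebra_simps split: split_indicator)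
    also have "\<dots> = \<i> * of_real (Im (LINT s|seg a b. ?I s *\<^sub>R ?y1 s - ?I s *\<^sub>R ?y2 s))"
      by (rule integral_bounded_linear[OF bl Bochner_Integration.integrable_diff[OF j]])
    also have "(LINT s|seg a b. ?I s *\<^sub>R ?y1 s - ?I s *\<^sub>R ?y2 s) = prim a b ?y1 r - prim a b ?y2 r"
      unfolding prim_def by (rule Bochner_Integration.integral_diff[OF j])
    finally show ?thesis by (simp add: \<psi>_def)
  qed
  note chain = exp_prim_chain[OF less_imp_le[OF R1.ab] zm znc H zl]
  have \<psi>b: "\<psi> b = 2 * pi * of_int m" using m(1) by (simp add: \<psi>_def prim_end)
  \<comment> \<open>The phase difference ends at a multiple of \<open>2 pi\<close>, so the integral
    of \<open>cis \<psi>\<close> times \<open>\<i> p\<close> is zero; its imaginary part is the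
    integral of \<open>cos \<psi>\<close> times \<open>p\<close>.\<close>
  have "exp (prim a b z b) = 1"
    unfolding pz \<psi>b by (subst exp_eq_1) (auto intro!: exI[of _ m])
  then have "(LINT s|seg a b. exp (prim a b z s) * z s) = 0" using chain(1) by simp
  then have 0: "(LINT s|seg a b. cis (\<psi> s) * z s) = 0" by (simp add: pz cis_conv_exp)
  have \<psi>c: "continuous_on {a..b} \<psi>"
  proof -
    have "continuous_on {a..b} (\<lambda>r. Im (prim a b z r))" by (intro continuous_intros chain)
    then show ?thesis by (simp add: pz)
  qed
  have ci: "integrable (seg a b) (\<lambda>s. cos (\<psi> s) * p s)"
  proof (rule Bochner_Integration.integrable_bound[OF pi])
    show "(\<lambda>s. cos (\<psi> s) * p s) \<in> borel_measurable (seg a b)"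
      by (rule borel_measurable_times[OF measurable_seg_continuous[OF continuous_on_cos[OF \<psi>c]] borel_measurable_integrable[OF pi]])
    show "AE s in seg a b. norm (cos (\<psi> s) * p s) \<le> norm (p s)"
      by (auto simp: abs_mult intro!: mult_left_le_one_le)
  qed
  have czi: "integrable (seg a b) (\<lambda>s. cis (\<psi> s) * z s)"
  proof (rule Bochner_Integration.integrable_bound[OF pi])
    show "(\<lambda>s. cis (\<psi> s) * z s) \<in> borel_measurable (seg a b)"
      by (rule borel_measurable_times[OF measurable_seg_continuous[OF continuous_on_cis[OF \<psi>c]] zm])
  qed (auto simp: norm_mult z_def)
  have "(LINT s|seg a b. Im (cis (\<psi> s) * z s)) = 0"
    using integral_bounded_linear[OF bounded_linear_Im czi] 0 by simp
  then have c0: "(LINT s|seg a b. cos (\<psi> s) * p s) = 0" by (simp add: z_def)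
  have "(LINT s|seg a b. p s) = 2 * pi * of_int m"
    using integral_bounded_linear[OF bounded_linear_Im Bochner_Integration.integrable_diff[OF R1.fin R2.fin]]
      Bochner_Integration.integral_diff[OF R1.fin R2.fin] m(1) by (simp add: p_def)
  then have eq: "(LINT s|seg a b. p s - cos (\<psi> s) * p s) = 2 * pi * of_int m"
    using pi ci c0 by simp
  let ?rhs = "\<lambda>r. 2 * \<mu> / c * norm (v1 r - v2 r) + 1 / \<mu> * ((norm (?y1 r))\<^sup>2 + (norm (?y2 r))\<^sup>2)"
  have "1 \<le> \<bar>real_of_int m\<bar>" using m(2) by linarith
  then have "2 * pi \<le> \<bar>2 * pi * of_int m\<bar>" by (simp add: abs_mult)
  also have "\<dots> \<le> (LINT s|seg a b. \<bar>p s - cos (\<psi> s) * p s\<bar>)"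
    unfolding eq[symmetric] by (rule integral_abs_bound)
  also have "\<dots> \<le> (LINT r|seg a b. ?rhs r)"
  proof (rule integral_mono_AE)
    show "integrable (seg a b) (\<lambda>s. \<bar>p s - cos (\<psi> s) * p s\<bar>)" using pi ci by simp
    show "integrable (seg a b) ?rhs"
      by (intro Bochner_Integration.integrable_add integrable_mult_right i)
    show "AE s in seg a b. \<bar>p s - cos (\<psi> s) * p s\<bar> \<le> ?rhs s"
      using R1.f_eq_v R2.f_eq_v low AE_seg
    proof eventually_elim
      case (elim s)
      have s: "s \<in> {a..b}" using elim by simp
      have v1: "v1 s = \<alpha> * exp (prim a b ?y1 s)" and v2: "v2 s = \<alpha> * exp (prim a b ?y2 s)"
        using L1(4)[OF s] L2(4)[OF s] elim by simp_all
      have v20: "norm (v2 s) > 0" using elim c by linarith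
      have ip: "Re (v1 s * cnj (v2 s)) = norm (v1 s) * norm (v2 s) * cos (\<psi> s)"
      proof -
        have "v1 s * cnj (v2 s) = of_real ((norm \<alpha>)\<^sup>2) * exp (prim a b ?y1 s + cnj (prim a b ?y2 s))"
          unfolding v1 v2 complex_norm_square by (simp add: exp_add exp_cnj mult_ac)
        then have "Re (v1 s * cnj (v2 s)) = (norm \<alpha>)\<^sup>2 * (exp (Re (prim a b ?y1 s) + Re (prim a b ?y2 s)) * cos (\<psi> s))"
          by (simp add: Re_exp \<psi>_def del: of_real_power)
        also have "\<dots> = norm (v1 s) * norm (v2 s) * cos (\<psi> s)"
          unfolding v1 v2 by (simp add: norm_mult norm_exp_eq_Re exp_add power2_eq_square)
        finally show ?thesis .
      qed
      have d: "(norm (v1 s - v2 s))\<^sup>2 = (norm (v1 s))\<^sup>2 - 2 * norm (v1 s) * norm (v2 s) * cos (\<psi> s) + (norm (v2 s))\<^sup>2"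
      proof -
        have "(norm (v1 s - v2 s))\<^sup>2 = (norm (v1 s))\<^sup>2 - 2 * Re (v1 s * cnj (v2 s)) + (norm (v2 s))\<^sup>2"
          unfolding cmod_power2 by (simp add: power2_eq_square algebra_simps)
        then show ?thesis unfolding ip by simp
      qed
      let ?q = "1 - cos (\<psi> s)"
      have q: "?q\<^sup>2 \<le> 4 * norm (v1 s - v2 s) / norm (v2 s)"
        by (rule angle_le_distance[OF _ v20 _ _ _ d]) auto
      also have "\<dots> \<le> 4 * norm (v1 s - v2 s) / c"
        using elim c v20 by (intro divide_left_mono) auto
      finally have q: "\<mu> / 2 * ?q\<^sup>2 \<le> \<mu> / 2 * (4 * norm (v1 s - v2 s) / c)"
        using \<mu> by (intro mult_left_mono) auto
      have "\<bar>p s\<bar> \<le> norm (?y1 s) + norm (?y2 s)"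
        unfolding p_def using abs_Im_le_cmod norm_triangle_ineq4 by (rule order_trans)
      then have "(p s)\<^sup>2 \<le> (norm (?y1 s) + norm (?y2 s))\<^sup>2" by (simp add: abs_le_square_iff[symmetric])
      also have "\<dots> \<le> 2 * ((norm (?y1 s))\<^sup>2 + (norm (?y2 s))\<^sup>2)"
        by (rule power2_sum_le)
      finally have p2: "1 / (2 * \<mu>) * (p s)\<^sup>2 \<le> 1 / (2 * \<mu>) * (2 * ((norm (?y1 s))\<^sup>2 + (norm (?y2 s))\<^sup>2))"
        using \<mu> by (intro mult_left_mono) auto
      have half: "1 / (2 * \<mu>) * (2 * X) = 1 / \<mu> * X" for X using \<mu> by (simp add: field_simps)
      \<comment> \<open>Young's inequality with weight \<open>\<mu>\<close> separates the factor
        controlled by the distance of the maps from the one controlled by the energies.\<close>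
      have "0 \<le> (\<mu> * ?q - \<bar>p s\<bar>)\<^sup>2 / (2 * \<mu>)" using \<mu> by simp
      also have "\<dots> = \<mu> / 2 * ?q\<^sup>2 - ?q * \<bar>p s\<bar> + 1 / (2 * \<mu>) * (p s)\<^sup>2"
        using \<mu> by (simp add: power2_diff field_simps power2_eq_square)
      finally have "?q * \<bar>p s\<bar> \<le> \<mu> / 2 * ?q\<^sup>2 + 1 / (2 * \<mu>) * (p s)\<^sup>2" by simp
      moreover have "\<bar>p s - cos (\<psi> s) * p s\<bar> = ?q * \<bar>p s\<bar>"
        using abs_mult[of ?q "p s"] by (simp add: left_diff_distrib)
      moreover have "\<mu> / 2 * (4 * norm (v1 s - v2 s) / c) = 2 * \<mu> / c * norm (v1 s - v2 s)" by simp
      moreover have "1 / (2 * \<mu>) * (2 * ((norm (?y1 s))\<^sup>2 + (norm (?y2 s))\<^sup>2)) = 1 / \<mu> * ((norm (?y1 s))\<^sup>2 + (norm (?y2 s))\<^sup>2)"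
        by (rule half)
      ultimately show ?case using q p2 by linarith
    qed
  qed
  finally show ?thesis .
qed

context polar_map
begin

lemma integrable_V: "integrable (polar_rect a b) V"
proof (rule integrable_if_square_integrable[OF finite_measure_polar_rect meas(1)])
  note meas[measurable]
  show "integrable (polar_rect a b) (\<lambda>z. (norm (V z))\<^sup>2)"
  proof (rule Bochner_Integration.integrable_bound[OF M2])
    show "AE z in polar_rect a b. norm ((norm (V z))\<^sup>2) \<le> norm ((M z)\<^sup>2)"
      using lim dom
    proof eventually_elim
      case (elim z)
      have "(\<lambda>n. norm (W n (fst z) (snd z))) \<longlonglongrightarrow> norm (V z)" using elim by (intro tendsto_intros) auto
      then have "norm (V z) \<le> M z" using elim by (intro LIMSEQ_le_const2) auto
      then show ?case by (simp add: power_mono)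
    qed
  qed measurable
qed

end

text \<open>The inequality on single rays is integrated over the angle. Of the two maps only the
  second, later the minimiser, is bounded away from 0.\<close>

lemma winding_eq_if_close:
  assumes P1: "polar_map a b V1 Vr1 Vt1 W1 Wr1 Wt1 Wrt1 M1" and P2: "polar_map a b V2 Vr2 Vt2 W2 Wr2 Wt2 Wrt2 M2"
    and low: "AE z in polar_rect a b. norm (V2 z) \<ge> c" and c: "c > 0"
    and S: "(LINT z|polar_rect a b. (norm (Vr1 z / V1 z))\<^sup>2) + (LINT z|polar_rect a b. (norm (Vr2 z / V2 z))\<^sup>2) \<le> S" "S > 0"
    and close: "(LINT z|polar_rect a b. norm (V1 z - V2 z)) < 2 * pi ^ 4 * c / S"
  shows "polar_map.winding a b V1 Vr1 W1 Wr1 M1 = polar_map.winding a b V2 Vr2 W2 Wr2 M2"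
proof (rule ccontr)
  interpret P1: polar_map a b V1 Vr1 Vt1 W1 Wr1 Wt1 Wrt1 M1 by fact
  interpret P2: polar_map a b V2 Vr2 Vt2 W2 Wr2 Wt2 Wrt2 M2 by fact
  interpret pair_sigma_finite "seg a b" "seg 0 (2 * pi)" by (rule pair_sigma_finite_seg)
  assume ne: "P1.winding \<noteq> P2.winding"
  \<comment> \<open>This weight makes the energy term at most \<open>2 pi^2\<close>, and the assumed
    closeness makes the distance term less than \<open>2 pi^2\<close>. Together they stay below
    \<open>4 pi^2\<close>, which is \<open>2 pi\<close> integrated over all angles.\<close>
  define \<mu> where "\<mu> = S / (2 * pi\<^sup>2)"
  have \<mu>: "\<mu> > 0" using S by (simp add: \<mu>_def)
  let ?F = "\<lambda>z. 2 * \<mu> / c * norm (V1 z - V2 z) + 1 / \<mu> * ((norm (Vr1 z / V1 z))\<^sup>2 + (norm (Vr2 z / V2 z))\<^sup>2)"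
  have d: "integrable (polar_rect a b) (\<lambda>z. norm (V1 z - V2 z))"
    by (intro integrable_norm Bochner_Integration.integrable_diff P1.integrable_V P2.integrable_V)
  have F: "integrable (polar_rect a b) ?F"
    by (intro Bochner_Integration.integrable_add integrable_mult_right d P1.fin P2.fin)
  have "4 * pi\<^sup>2 = (LINT t|seg 0 (2 * pi). 2 * pi)"
    unfolding lebesgue_integral_const P1.measure_seg by (simp add: power2_eq_square)
  also have "\<dots> \<le> (LINT t|seg 0 (2 * pi). LINT r|seg a b. ?F (r, t))"
  proof (rule integral_mono_AE)
    show "integrable (seg 0 (2 * pi)) (\<lambda>t. 2 * pi)" by (rule integrable_seg_continuous(1)) (rule continuous_on_const)
    show "integrable (seg 0 (2 * pi)) (\<lambda>t. LINT r|seg a b. ?F (r, t))"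
      using integrable_snd[of "\<lambda>r t. ?F (r, t)"] F by (simp only: case_prod_unfold prod.collapse)
    show "AE t in seg 0 (2 * pi). 2 * pi \<le> (LINT r|seg a b. ?F (r, t))"
      using P1.AE_good_ray P2.AE_good_ray AE_integrable_slice[OF P1.sigma_fin d] AE_pair_swap[OF P1.sigma_fin low]
    proof eventually_elim
      case (elim t)
      have "Im (LINT r|seg a b. Vr1 (r, t) / V1 (r, t)) - Im (LINT r|seg a b. Vr2 (r, t) / V2 (r, t)) = 2 * pi * of_int (P1.winding - P2.winding)"
        using P1.log_change_eq[OF elim(1)] P2.log_change_eq[OF elim(2)]
        by (simp add: P1.log_change_def P2.log_change_def algebra_simps)
      note phase = ray_phase_difference[OF P1.ray_good_ray[OF elim(1)] P2.ray_good_ray[OF elim(2)] _ _ elim(3) elim(4) c this _ \<mu>]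
      show ?case
      proof (rule phase)
        show "integrable (seg a b) (\<lambda>r. (norm (Vr1 (r, t) / V1 (r, t)))\<^sup>2)"
          using elim(1) unfolding P1.good_ray_def by blast
        show "integrable (seg a b) (\<lambda>r. (norm (Vr2 (r, t) / V2 (r, t)))\<^sup>2)"
          using elim(2) unfolding P2.good_ray_def by blast
        show "P1.winding - P2.winding \<noteq> 0" using ne by simp
      qed
    qed
  qed
  also have "\<dots> = (LINT z|polar_rect a b. ?F z)"
    using integral_snd[of "\<lambda>r t. ?F (r, t)"] F by (simp only: case_prod_unfold prod.collapse)
  also have "\<dots> = 2 * \<mu> / c * (LINT z|polar_rect a b. norm (V1 z - V2 z)) +
      1 / \<mu> * ((LINT z|polar_rect a b. (norm (Vr1 z / V1 z))\<^sup>2) + (LINT z|polar_rect a b. (norm (Vr2 z / V2 z))\<^sup>2))"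
  proof -
    have i: "integrable (polar_rect a b) (\<lambda>z. (norm (Vr1 z / V1 z))\<^sup>2 + (norm (Vr2 z / V2 z))\<^sup>2)"
      by (intro Bochner_Integration.integrable_add P1.fin P2.fin)
    show ?thesis
      unfolding Bochner_Integration.integral_add[OF integrable_mult_right[OF d] integrable_mult_right[OF i]]
        integral_mult_right_zero Bochner_Integration.integral_add[OF P1.fin(1) P2.fin(1)] ..
  qed
  also have "\<dots> \<le> 2 * \<mu> / c * (LINT z|polar_rect a b. norm (V1 z - V2 z)) + 1 / \<mu> * S"
    using S \<mu> by (intro add_left_mono mult_left_mono) auto
  also have "\<dots> < 2 * \<mu> / c * (2 * pi ^ 4 * c / S) + 1 / \<mu> * S"
    using \<mu> c by (intro add_strict_right_mono mult_strict_left_mono close) auto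
  also have "\<dots> = 4 * pi\<^sup>2"
    using S(2) c by (simp add: \<mu>_def field_simps power2_eq_square eval_nat_numeral)
  finally show False by simp
qed

section \<open>Regularity of smooth maps in polar coordinates\<close>

text \<open>The second difference of \<open>G\<close> over the square of side \<open>h\<close> is
  \<open>h^2\<close> times either mixed derivative at some point of the square, by the mean value
  theorem used twice in either order. Continuity at the corner gives the limit.\<close>

lemma mixed_partials_eq:
  fixes G Gs Gt Gst Gts :: "real \<Rightarrow> real \<Rightarrow> real"
  assumes s: "\<And>s t. ((\<lambda>s. G s t) has_real_derivative Gs s t) (at s)" and t: "\<And>s t. ((\<lambda>t. G s t) has_real_derivative Gt s t) (at t)"
    and st: "\<And>s t. ((\<lambda>t. Gs s t) has_real_derivative Gst s t) (at t)" and ts: "\<And>s t. ((\<lambda>s. Gt s t) has_real_derivative Gts s t) (at s)"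
    and cont: "isCont (\<lambda>z. Gst (fst z) (snd z)) (0, 0)" "isCont (\<lambda>z. Gts (fst z) (snd z)) (0, 0)"
  shows "Gst 0 0 = Gts 0 0"
proof -
  have "\<exists>x y x' y'. x \<in> {0..h} \<and> y \<in> {0..h} \<and> x' \<in> {0..h} \<and> y' \<in> {0..h} \<and> Gst x y = Gts x' y'" if h: "h > 0" for h
  proof -
    obtain x where x: "0 < x" "x < h" "(G h h - G h 0) - (G 0 h - G 0 0) = (h - 0) * (Gs x h - Gs x 0)"
      using MVT2[OF h DERIV_diff[OF s[of h] s[of 0]]] by blast
    obtain y where y: "0 < y" "y < h" "Gs x h - Gs x 0 = (h - 0) * Gst x y"
      using MVT2[OF h st[of x]] by blast
    obtain y' where y': "0 < y'" "y' < h" "(G h h - G 0 h) - (G h 0 - G 0 0) = (h - 0) * (Gt h y' - Gt 0 y')"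
      using MVT2[OF h DERIV_diff[OF t[of h] t[of 0]]] by blast
    obtain x' where x': "0 < x'" "x' < h" "Gt h y' - Gt 0 y' = (h - 0) * Gts x' y'"
      using MVT2[OF h ts[of y']] by blast
    have "(G h h - G h 0) - (G 0 h - G 0 0) = (G h h - G 0 h) - (G h 0 - G 0 0)" by simp
    then have "Gst x y = Gts x' y'"
      unfolding x(3)[unfolded y(3)] y'(3)[unfolded x'(3)] using h by simp
    then show ?thesis using x y x' y' by (intro exI[of _ x] exI[of _ y] exI[of _ x'] exI[of _ y']) auto
  qed
  then obtain x y x' y' where P: "\<And>h. h > 0 \<Longrightarrow> x h \<in> {0..h} \<and> y h \<in> {0..h} \<and> x' h \<in> {0..h} \<and> y' h \<in> {0..h} \<and> Gst (x h) (y h) = Gts (x' h) (y' h)"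
    by metis
  define h where "h n = inverse (real (Suc n))" for n
  have h: "h n > 0" "h \<longlonglongrightarrow> 0" for n unfolding h_def[abs_def] using LIMSEQ_inverse_real_of_nat by simp_all
  have z: "(\<lambda>n. q (h n)) \<longlonglongrightarrow> 0" if "\<And>h. h > 0 \<Longrightarrow> q h \<in> {0..h}" for q :: "real \<Rightarrow> real"
    by (rule tendsto_sandwich[OF _ _ tendsto_const h(2)]) (use that h(1) in \<open>auto intro!: always_eventually\<close>)
  have "(\<lambda>n. Gst (x (h n)) (y (h n))) \<longlonglongrightarrow> Gst 0 0"
    using isCont_tendsto_compose[OF cont(1), of "\<lambda>n. (x (h n), y (h n))" sequentially] z[of x] z[of y] P
    by (simp add: tendsto_Pair)
  moreover have "(\<lambda>n. Gts (x' (h n)) (y' (h n))) \<longlonglongrightarrow> Gts 0 0"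
    using isCont_tendsto_compose[OF cont(2), of "\<lambda>n. (x' (h n), y' (h n))" sequentially] z[of x'] z[of y'] P
    by (simp add: tendsto_Pair)
  moreover have "Gst (x (h n)) (y (h n)) = Gts (x' (h n)) (y' (h n))" for n using P[OF h(1)] by blast
  ultimately show ?thesis using LIMSEQ_unique by auto
qed

abbreviation D\<^sub>i :: "2 \<Rightarrow> (real^2 \<Rightarrow> real^2) \<Rightarrow> real^2 \<Rightarrow> real^2" where
  "D\<^sub>i i f x \<equiv> frechet_derivative f (at x) (axis i 1)"

text \<open>Lets one function serve as both mixed derivatives of a smooth map in polar coordinates,
  as Stokes' theorem requires.\<close>

lemma smooth_partials_commute:
  assumes f: "smooth f"
  shows "D\<^sub>i 1 (D\<^sub>i 2 f) x = D\<^sub>i 2 (D\<^sub>i 1 f) x"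
proof -
  let ?X = "\<lambda>s t. x + s *\<^sub>R axis 1 1 + t *\<^sub>R axis 2 1 :: real^2"
  have d: "((\<lambda>s. g (?X s t) $ j) has_real_derivative D\<^sub>i 1 g (?X s t) $ j) (at s)"
    "((\<lambda>t. g (?X s t) $ j) has_real_derivative D\<^sub>i 2 g (?X s t) $ j) (at t)" if g: "smooth g" for g s t and j :: 2
  proof -
    have l: "((\<lambda>s. ?X s t) has_derivative (\<lambda>h. h *\<^sub>R axis 1 1)) (at s)" "((\<lambda>t. ?X s t) has_derivative (\<lambda>h. h *\<^sub>R axis 2 1)) (at t)"
      by (auto intro!: derivative_eq_intros)
    have sc: "frechet_derivative g (at y) (h *\<^sub>R v) $ j = frechet_derivative g (at y) v $ j * h" for y h v
      using linear_scale[OF has_derivative_linear[OF smooth_has_derivative[OF g]]] by simp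
    show "((\<lambda>s. g (?X s t) $ j) has_real_derivative D\<^sub>i 1 g (?X s t) $ j) (at s)"
      using bounded_linear.has_derivative[OF bounded_linear_vec_nth has_derivative_compose[OF l(1) smooth_has_derivative[OF g]], of j]
      unfolding has_field_derivative_def sc .
    show "((\<lambda>t. g (?X s t) $ j) has_real_derivative D\<^sub>i 2 g (?X s t) $ j) (at t)"
      using bounded_linear.has_derivative[OF bounded_linear_vec_nth has_derivative_compose[OF l(2) smooth_has_derivative[OF g]], of j]
      unfolding has_field_derivative_def sc .
  qed
  have c: "isCont (\<lambda>z. g (?X (fst z) (snd z)) $ j) (0, 0)" if "smooth g" for g :: "real^2 \<Rightarrow> real^2" and j
  proof -
    have "continuous_on UNIV (\<lambda>z. g (?X (fst z) (snd z)) $ j)"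
      by (intro continuous_intros continuous_on_compose2[OF smooth_continuous_on[OF that]]) auto
    then show ?thesis by (simp add: continuous_on_eq_continuous_at)
  qed
  note s1 = smooth_derivative[OF f]
  have "D\<^sub>i 2 (D\<^sub>i 1 f) (?X 0 0) $ j = D\<^sub>i 1 (D\<^sub>i 2 f) (?X 0 0) $ j" for j
    by (rule mixed_partials_eq[where G = "\<lambda>s t. f (?X s t) $ j" and Gst = "\<lambda>s t. D\<^sub>i 2 (D\<^sub>i 1 f) (?X s t) $ j"
         and Gts = "\<lambda>s t. D\<^sub>i 1 (D\<^sub>i 2 f) (?X s t) $ j"])
       (rule d f s1 c smooth_derivative[OF s1])+
  then show ?thesis by (simp add: vec_eq_iff)
qed

text \<open>What \<open>polar_map\<close> asks of each approximation apart from the boundary values.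
  Unlike smoothness on the plane, it survives multiplication by a radial function that is merely
  continuously differentiable.\<close>

definition polar_regular ::
    "real \<Rightarrow> real \<Rightarrow> (real \<Rightarrow> real \<Rightarrow> complex) \<Rightarrow> (real \<Rightarrow> real \<Rightarrow> complex) \<Rightarrow> (real \<Rightarrow> real \<Rightarrow> complex) \<Rightarrow> (real \<Rightarrow> real \<Rightarrow> complex) \<Rightarrow> bool" where
  "polar_regular a b p pr pt prt \<longleftrightarrow>
    (\<forall>r\<in>{a..b}. \<forall>t. ((\<lambda>r. p r t) has_vector_derivative pr r t) (at r within {a..b}) \<and>
      ((\<lambda>t. p r t) has_vector_derivative pt r t) (at t) \<and>
      ((\<lambda>t. pr r t) has_vector_derivative prt r t) (at t) \<and>
      ((\<lambda>r. pt r t) has_vector_derivative prt r t) (at r within {a..b})) \<and>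
    continuous_on ({a..b} \<times> UNIV) (\<lambda>z. p (fst z) (snd z)) \<and>
    continuous_on ({a..b} \<times> UNIV) (\<lambda>z. pr (fst z) (snd z)) \<and>
    continuous_on ({a..b} \<times> UNIV) (\<lambda>z. pt (fst z) (snd z)) \<and>
    continuous_on ({a..b} \<times> UNIV) (\<lambda>z. prt (fst z) (snd z)) \<and>
    (\<forall>r\<in>{a..b}. p r (2 * pi) = p r 0 \<and> pr r (2 * pi) = pr r 0)"

definition pol :: "(real^2 \<Rightarrow> real^2) \<Rightarrow> real \<Rightarrow> real \<Rightarrow> complex" where
  "pol w r t = to_complex (w (polar r t))"

definition pol_r :: "(real^2 \<Rightarrow> real^2) \<Rightarrow> real \<Rightarrow> real \<Rightarrow> complex" where
  "pol_r w r t = of_real (cos t) * pol (D\<^sub>i 1 w) r t + of_real (sin t) * pol (D\<^sub>i 2 w) r t"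

definition pol_t :: "(real^2 \<Rightarrow> real^2) \<Rightarrow> real \<Rightarrow> real \<Rightarrow> complex" where
  "pol_t w r t = of_real (- r * sin t) * pol (D\<^sub>i 1 w) r t + of_real (r * cos t) * pol (D\<^sub>i 2 w) r t"

definition pol_rt :: "(real^2 \<Rightarrow> real^2) \<Rightarrow> real \<Rightarrow> real \<Rightarrow> complex" where
  "pol_rt w r t = (of_real (- sin t) * pol (D\<^sub>i 1 w) r t + of_real (cos t) * pol_t (D\<^sub>i 1 w) r t)
    + (of_real (cos t) * pol (D\<^sub>i 2 w) r t + of_real (sin t) * pol_t (D\<^sub>i 2 w) r t)"

lemma frechet_derivative_vector_2:
  assumes "smooth w"
  shows "frechet_derivative w (at x) (vector [p, q]) = p *\<^sub>R D\<^sub>i 1 w x + q *\<^sub>R D\<^sub>i 2 w x"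
proof -
  have l: "linear (frechet_derivative w (at x))" by (rule has_derivative_linear[OF smooth_has_derivative[OF assms]])
  show ?thesis unfolding vector_2_eq by (simp add: linear_add[OF l] linear_scale[OF l])
qed

lemma pol_deriv:
  assumes w: "smooth w"
  shows "((\<lambda>r. pol w r t) has_vector_derivative pol_r w r t) (at r within S)"
    "((\<lambda>t. pol w r t) has_vector_derivative pol_t w r t) (at t within S)"
proof -
  have pr: "((\<lambda>r. polar r t) has_derivative (\<lambda>h. vector [h * cos t, h * sin t])) (at r within S)"
    unfolding polar_def by (rule has_derivative_vector_2) (auto intro!: derivative_eq_intros)
  have pt: "((\<lambda>t. polar r t) has_derivative (\<lambda>h. vector [- r * sin t * h, r * cos t * h])) (at t within S)"
    unfolding polar_def by (rule has_derivative_vector_2) (auto intro!: derivative_eq_intros simp: fun_eq_iff)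
  have e: "to_complex (p *\<^sub>R x + q *\<^sub>R y) = of_real p * to_complex x + of_real q * to_complex y" for p q x y
    using linear_add[OF bounded_linear.linear[OF bounded_linear_to_complex], of "p *\<^sub>R x" "q *\<^sub>R y"]
      linear_scale[OF bounded_linear.linear[OF bounded_linear_to_complex]]
    by (simp only: scaleR_conv_of_real[symmetric])
  have 1: "((\<lambda>r. pol w r t) has_derivative (\<lambda>h. to_complex (frechet_derivative w (at (polar r t)) (vector [h * cos t, h * sin t])))) (at r within S)"
    unfolding pol_def
    by (rule bounded_linear.has_derivative[OF bounded_linear_to_complex has_derivative_compose[OF pr smooth_has_derivative[OF w]]])
  show "((\<lambda>r. pol w r t) has_vector_derivative pol_r w r t) (at r within S)"
    unfolding has_vector_derivative_def
    by (rule has_derivative_eq_rhs[OF 1], simp only: fun_eq_iff frechet_derivative_vector_2[OF w] e)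
       (simp add: pol_r_def pol_def scaleR_conv_of_real algebra_simps)
  have 2: "((\<lambda>t. pol w r t) has_derivative (\<lambda>h. to_complex (frechet_derivative w (at (polar r t)) (vector [- r * sin t * h, r * cos t * h])))) (at t within S)"
    unfolding pol_def
    by (rule bounded_linear.has_derivative[OF bounded_linear_to_complex has_derivative_compose[OF pt smooth_has_derivative[OF w]]])
  show "((\<lambda>t. pol w r t) has_vector_derivative pol_t w r t) (at t within S)"
    unfolding has_vector_derivative_def
    by (rule has_derivative_eq_rhs[OF 2], simp only: fun_eq_iff frechet_derivative_vector_2[OF w] e)
       (simp add: pol_t_def pol_def scaleR_conv_of_real algebra_simps)
qed

lemma pol_continuous:
  assumes "smooth w"
  shows "continuous_on S (\<lambda>z. pol w (fst z) (snd z))"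
proof -
  have "continuous_on S (\<lambda>z. polar (fst z) (snd z))"
    unfolding polar_def vector_2_eq by (intro continuous_intros)
  then show ?thesis unfolding pol_def
    by (intro bounded_linear.continuous_on[OF bounded_linear_to_complex] continuous_on_compose2[OF smooth_continuous_on[OF assms]]) auto
qed

lemma has_vector_derivative_of_real_mult:
  fixes g :: "real \<Rightarrow> complex"
  assumes "(f has_real_derivative f') (at x within S)" "(g has_vector_derivative g') (at x within S)"
  shows "((\<lambda>x. of_real (f x) * g x) has_vector_derivative (of_real f' * g x + of_real (f x) * g')) (at x within S)"
  using has_vector_derivative_mult[OF bounded_linear.has_vector_derivative[OF bounded_linear_of_real assms(1)[unfolded has_real_derivative_iff_has_vector_derivative]] assms(2)]
  by (simp add: add.commute)

lemma polar_regular_pol: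
  assumes w: "smooth w"
  shows "polar_regular a b (pol w) (pol_r w) (pol_t w) (pol_rt w)"
proof -
  note s1 = smooth_derivative[OF w]
  have sym: "pol (D\<^sub>i 1 (D\<^sub>i 2 w)) = pol (D\<^sub>i 2 (D\<^sub>i 1 w))"
    by (simp add: fun_eq_iff pol_def smooth_partials_commute[OF w])
  have d1: "((\<lambda>t. pol_r w r t) has_vector_derivative pol_rt w r t) (at t)" for r t
    unfolding pol_r_def pol_rt_def
    by (intro has_vector_derivative_add has_vector_derivative_of_real_mult pol_deriv s1) (auto intro!: derivative_eq_intros)
  have d2: "((\<lambda>r. pol_t w r t) has_vector_derivative pol_rt w r t) (at r within S)" for r t S
  proof -
    have "((\<lambda>r. pol_t w r t) has_vector_derivative
       (of_real (- sin t) * pol (D\<^sub>i 1 w) r t + of_real (- r * sin t) * pol_r (D\<^sub>i 1 w) r t)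
       + (of_real (cos t) * pol (D\<^sub>i 2 w) r t + of_real (r * cos t) * pol_r (D\<^sub>i 2 w) r t)) (at r within S)"
      unfolding pol_t_def
      by (intro has_vector_derivative_add has_vector_derivative_of_real_mult pol_deriv s1) (auto intro!: derivative_eq_intros)
    also have "(of_real (- sin t) * pol (D\<^sub>i 1 w) r t + of_real (- r * sin t) * pol_r (D\<^sub>i 1 w) r t)
       + (of_real (cos t) * pol (D\<^sub>i 2 w) r t + of_real (r * cos t) * pol_r (D\<^sub>i 2 w) r t)
       = (of_real (- sin t) * pol (D\<^sub>i 1 w) r t + of_real (cos t) * pol (D\<^sub>i 2 w) r t)
         + of_real r * (- of_real (sin t) * of_real (cos t) * pol (D\<^sub>i 1 (D\<^sub>i 1 w)) r t + of_real (sin t) * of_real (cos t) * pol (D\<^sub>i 2 (D\<^sub>i 2 w)) r t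
         + ((of_real (cos t))\<^sup>2 - (of_real (sin t))\<^sup>2) * pol (D\<^sub>i 2 (D\<^sub>i 1 w)) r t)"
      unfolding pol_r_def sym by (simp add: algebra_simps power2_eq_square)
    also have "\<dots> = pol_rt w r t"
      unfolding pol_rt_def pol_t_def sym by (simp add: algebra_simps power2_eq_square)
    finally show ?thesis .
  qed
  have ct: "continuous_on S (\<lambda>z. pol_t g (fst z) (snd z))" "continuous_on S (\<lambda>z. pol_r g (fst z) (snd z))" if "smooth g" for g S
    unfolding pol_t_def pol_r_def by (intro continuous_intros pol_continuous smooth_derivative that)+
  have crt: "continuous_on S (\<lambda>z. pol_rt w (fst z) (snd z))" for S
    unfolding pol_rt_def by (intro continuous_intros pol_continuous ct s1)
  have per: "pol g r (2 * pi) = pol g r 0" for g r by (simp add: pol_def polar_def)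
  have perr: "pol_r g r (2 * pi) = pol_r g r 0" for g r by (simp add: pol_r_def per)
  show ?thesis
    unfolding polar_regular_def per perr
    by (intro conjI ballI allI pol_deriv[OF w] d1 d2 pol_continuous[OF w] ct[OF w] crt refl)
qed

section \<open>Approximation with exact boundary values\<close>

lemma polar_regularD:
  assumes "polar_regular a b p pr pt prt" "r \<in> {a..b}"
  shows "((\<lambda>r. p r t) has_vector_derivative pr r t) (at r within {a..b})"
    "((\<lambda>t. p r t) has_vector_derivative pt r t) (at t)"
    "((\<lambda>t. pr r t) has_vector_derivative prt r t) (at t)"
    "((\<lambda>r. pt r t) has_vector_derivative prt r t) (at r within {a..b})"
    "p r (2 * pi) = p r 0" "pr r (2 * pi) = pr r 0"
  using assms unfolding polar_regular_def by blast+

lemma polar_regular_continuous: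
  assumes "polar_regular a b p pr pt prt"
  shows "continuous_on ({a..b} \<times> UNIV) (\<lambda>z. p (fst z) (snd z))"
    "continuous_on ({a..b} \<times> UNIV) (\<lambda>z. pr (fst z) (snd z))"
    "continuous_on ({a..b} \<times> UNIV) (\<lambda>z. pt (fst z) (snd z))"
    "continuous_on ({a..b} \<times> UNIV) (\<lambda>z. prt (fst z) (snd z))"
  using assms unfolding polar_regular_def by blast+

lemma polar_regularI:
  assumes "\<And>r t. r \<in> {a..b} \<Longrightarrow> ((\<lambda>r. p r t) has_vector_derivative pr r t) (at r within {a..b})"
    "\<And>r t. r \<in> {a..b} \<Longrightarrow> ((\<lambda>t. p r t) has_vector_derivative pt r t) (at t)"
    "\<And>r t. r \<in> {a..b} \<Longrightarrow> ((\<lambda>t. pr r t) has_vector_derivative prt r t) (at t)"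
    "\<And>r t. r \<in> {a..b} \<Longrightarrow> ((\<lambda>r. pt r t) has_vector_derivative prt r t) (at r within {a..b})"
    "continuous_on ({a..b} \<times> UNIV) (\<lambda>z. p (fst z) (snd z))"
    "continuous_on ({a..b} \<times> UNIV) (\<lambda>z. pr (fst z) (snd z))"
    "continuous_on ({a..b} \<times> UNIV) (\<lambda>z. pt (fst z) (snd z))"
    "continuous_on ({a..b} \<times> UNIV) (\<lambda>z. prt (fst z) (snd z))"
    "\<And>r. r \<in> {a..b} \<Longrightarrow> p r (2 * pi) = p r 0" "\<And>r. r \<in> {a..b} \<Longrightarrow> pr r (2 * pi) = pr r 0"
  shows "polar_regular a b p pr pt prt"
  unfolding polar_regular_def by (intro conjI ballI allI assms)

lemma polar_regular_add:
  assumes p: "polar_regular a b p pr pt prt" and q: "polar_regular a b q qr qt qrt"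
  shows "polar_regular a b (\<lambda>r t. p r t + q r t) (\<lambda>r t. pr r t + qr r t) (\<lambda>r t. pt r t + qt r t) (\<lambda>r t. prt r t + qrt r t)"
  by (rule polar_regularI)
     (intro has_vector_derivative_add polar_regularD[OF p] polar_regularD[OF q] continuous_on_add
        polar_regular_continuous[OF p] polar_regular_continuous[OF q]; assumption |
      simp add: polar_regularD(5,6)[OF p] polar_regularD(5,6)[OF q])+

lemma polar_regular_diff:
  assumes p: "polar_regular a b p pr pt prt" and q: "polar_regular a b q qr qt qrt"
  shows "polar_regular a b (\<lambda>r t. p r t - q r t) (\<lambda>r t. pr r t - qr r t) (\<lambda>r t. pt r t - qt r t) (\<lambda>r t. prt r t - qrt r t)"
  by (rule polar_regularI)
     (intro has_vector_derivative_diff polar_regularD[OF p] polar_regularD[OF q] continuous_on_diff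
        polar_regular_continuous[OF p] polar_regular_continuous[OF q]; assumption |
      simp add: polar_regularD(5,6)[OF p] polar_regularD(5,6)[OF q])+

lemma has_vector_derivative_const_mult:
  fixes g :: "real \<Rightarrow> complex"
  shows "(g has_vector_derivative g') F \<Longrightarrow> ((\<lambda>x. c * g x) has_vector_derivative c * g') F"
  by (rule bounded_linear.has_vector_derivative[OF bounded_linear_mult_right])

text \<open>The mixed derivative contains a single radial derivative, so the second derivative of
  \<open>\<zeta>\<close> does not appear and a \<open>C^1\<close> cutoff suffices.\<close>

lemma polar_regular_mult:
  assumes p: "polar_regular a b p pr pt prt"
    and z: "\<And>r. (\<zeta> has_real_derivative \<zeta>' r) (at r)" and z': "continuous_on UNIV \<zeta>'"
  shows "polar_regular a b (\<lambda>r t. of_real (\<zeta> r) * p r t) (\<lambda>r t. of_real (\<zeta>' r) * p r t + of_real (\<zeta> r) * pr r t)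
    (\<lambda>r t. of_real (\<zeta> r) * pt r t) (\<lambda>r t. of_real (\<zeta>' r) * pt r t + of_real (\<zeta> r) * prt r t)"
proof -
  have zU: "continuous_on UNIV \<zeta>" by (rule DERIV_continuous_on[OF z])
  have zc: "continuous_on ({a..b} \<times> UNIV) (\<lambda>z :: real \<times> real. \<zeta> (fst z))" "continuous_on ({a..b} \<times> UNIV) (\<lambda>z :: real \<times> real. \<zeta>' (fst z))"
    by (intro continuous_on_compose2[OF zU] continuous_on_compose2[OF z'] continuous_intros; simp)+
  note zw = DERIV_subset[OF z subset_UNIV]
  show ?thesis
    by (rule polar_regularI)
       (intro has_vector_derivative_add has_vector_derivative_of_real_mult zw has_vector_derivative_const_mult polar_regularD[OF p]
          continuous_on_add continuous_on_mult continuous_on_of_real zc polar_regular_continuous[OF p]; assumption |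
        simp add: polar_regularD(5,6)[OF p])+
qed

lemma polar_regular_identity:
  "polar_regular a b (\<lambda>r t. of_real r * cis t) (\<lambda>r t. cis t) (\<lambda>r t. \<i> * of_real r * cis t) (\<lambda>r t. \<i> * cis t)"
proof -
  have c: "(cis has_vector_derivative \<i> * cis t) (at t)" for t
    using has_derivative_cis[OF has_derivative_ident] by (simp add: has_vector_derivative_def)
  have r: "((\<lambda>r. of_real r * z) has_vector_derivative z) (at r within S)" for z :: complex and r S
    using has_vector_derivative_of_real_mult[OF DERIV_ident has_vector_derivative_const[of z]] by simp
  show ?thesis
  proof (rule polar_regularI)
    show "((\<lambda>t. of_real r * cis t) has_vector_derivative \<i> * of_real r * cis t) (at t)" for r t
      using has_vector_derivative_const_mult[OF c[of t], of "of_real r"] by (simp add: mult_ac)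
    show "((\<lambda>r. \<i> * of_real r * cis t) has_vector_derivative \<i> * cis t) (at r within {a..b})" for r t
      using has_vector_derivative_const_mult[OF r[of "cis t" r], of \<i>] by (simp add: mult_ac)
  qed (auto intro!: r c continuous_intros)
qed

section \<open>A radial cutoff and estimates on the collars\<close>

definition pos_part_sq :: "real \<Rightarrow> real" where "pos_part_sq x = (max 0 x)\<^sup>2"

lemma pos_part_sq_deriv: "(pos_part_sq has_real_derivative 2 * max 0 x) (at x)"
proof -
  consider "x > 0" | "x < 0" | "x = 0" by linarith
  then show ?thesis
  proof cases
    case 1
    have "((\<lambda>x. x\<^sup>2) has_real_derivative 2 * max 0 x) (at x)" using 1 by (auto intro!: derivative_eq_intros)
    then show ?thesis
      by (rule has_field_derivative_transform_within_open[of _ _ _ "{0<..}"]) (use 1 in \<open>auto simp: pos_part_sq_def\<close>)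
  next
    case 2
    have "((\<lambda>x. 0) has_real_derivative 2 * max 0 x) (at x)" using 2 by simp
    then show ?thesis
      by (rule has_field_derivative_transform_within_open[of _ _ _ "{..<0}"]) (use 2 in \<open>auto simp: pos_part_sq_def\<close>)
  next
    case 3
    have "((\<lambda>h. pos_part_sq h / h) \<longlongrightarrow> 0) (at 0)"
    proof (rule Lim_null_comparison)
      show "\<forall>\<^sub>F h in at 0. norm (pos_part_sq h / h) \<le> norm h"
        by (rule always_eventually) (auto simp: pos_part_sq_def max_def power2_eq_square)
      show "((\<lambda>h. norm h) \<longlongrightarrow> (0::real)) (at 0)" by (intro tendsto_eq_intros) auto
    qed
    then show ?thesis using 3 by (simp add: DERIV_def pos_part_sq_def)
  qed
qed

text \<open>For \<open>2 h < b - a\<close> it is 0 on both circles and 1 at distance at least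
  \<open>h\<close> from them. On each collar it is one minus the square of a linear function, so its
  derivative is at most \<open>2 / h\<close>.\<close>

definition cutoff :: "real \<Rightarrow> real \<Rightarrow> real \<Rightarrow> real \<Rightarrow> real" where
  "cutoff a b h r = 1 - pos_part_sq (1 - (r - a) / h) - pos_part_sq (1 - (b - r) / h)"

definition cutoff' :: "real \<Rightarrow> real \<Rightarrow> real \<Rightarrow> real \<Rightarrow> real" where
  "cutoff' a b h r = 2 * max 0 (1 - (r - a) / h) / h - 2 * max 0 (1 - (b - r) / h) / h"

lemma cutoff_deriv: "h > 0 \<Longrightarrow> (cutoff a b h has_real_derivative cutoff' a b h r) (at r)"
  unfolding cutoff_def[abs_def] cutoff'_def
  by (auto intro!: derivative_eq_intros DERIV_chain2[OF pos_part_sq_deriv])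

lemma cutoff'_cont: "continuous_on UNIV (cutoff' a b h)"
  unfolding cutoff'_def[abs_def] divide_inverse by (intro continuous_intros)

definition shell :: "real \<Rightarrow> real \<Rightarrow> real \<Rightarrow> real set" where
  "shell a b h = {..a + h} \<union> {b - h..}"

lemma cutoff_bounds:
  assumes h: "h > 0" "2 * h < b - a" and r: "r \<in> {a..b}"
  shows "0 \<le> cutoff a b h r" "cutoff a b h r \<le> 1" "r \<notin> shell a b h \<Longrightarrow> cutoff a b h r = 1"
    "\<bar>cutoff' a b h r\<bar> \<le> 2 / h * indicator (shell a b h) r"
proof -
  define x y where "x = max 0 (1 - (r - a) / h)" and "y = max 0 (1 - (b - r) / h)"
  have x: "0 \<le> x" "x \<le> 1" and y: "0 \<le> y" "y \<le> 1" using r h by (auto simp: x_def y_def)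
  \<comment> \<open>The two collars do not overlap.\<close>
  have 0: "x = 0 \<or> y = 0"
  proof (cases "r \<ge> a + h")
    case True
    then show ?thesis using h by (simp add: x_def max_def field_simps)
  next
    case False
    then have "b - r \<ge> h" using h by linarith
    then show ?thesis using h by (simp add: y_def max_def field_simps)
  qed
  have c: "cutoff a b h r = 1 - x\<^sup>2 - y\<^sup>2" "cutoff' a b h r = 2 / h * (x - y)"
    by (simp_all add: cutoff_def cutoff'_def pos_part_sq_def x_def y_def diff_divide_distrib right_diff_distrib)
  have x2: "x\<^sup>2 \<le> 1" "y\<^sup>2 \<le> 1" using x y by (simp_all add: power_le_one)
  show "0 \<le> cutoff a b h r" "cutoff a b h r \<le> 1" unfolding c using 0 x2 by auto
  have out: "x = 0 \<and> y = 0" if "r \<notin> shell a b h"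
    using that h by (auto simp: shell_def x_def y_def max_def field_simps)
  then show "r \<notin> shell a b h \<Longrightarrow> cutoff a b h r = 1" unfolding c by auto
  have "\<bar>x - y\<bar> \<le> indicator (shell a b h) r"
    using out x y by (auto split: split_indicator)
  then have "2 / h * \<bar>x - y\<bar> \<le> 2 / h * indicator (shell a b h) r"
    using h by (intro mult_left_mono) auto
  then show "\<bar>cutoff' a b h r\<bar> \<le> 2 / h * indicator (shell a b h) r"
    unfolding c abs_mult using h by simp
qed

lemma cutoff_ends: "h > 0 \<Longrightarrow> 2 * h < b - a \<Longrightarrow> cutoff a b h a = 0" "h > 0 \<Longrightarrow> 2 * h < b - a \<Longrightarrow> cutoff a b h b = 0"
  by (auto simp: cutoff_def pos_part_sq_def max_def field_simps)

text \<open>The Cauchy-Schwarz inequality against a constant, obtained by integrating the squared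
  deviation of \<open>g\<close> from its mean \<open>m\<close>.\<close>

lemma integral_square_le:
  fixes g :: "real \<Rightarrow> real"
  assumes cd: "c < d" and g: "continuous_on {c..d} g"
  shows "(integral {c..d} g)\<^sup>2 \<le> (d - c) * integral {c..d} (\<lambda>r. (g r)\<^sup>2)"
proof -
  define m where "m = integral {c..d} g / (d - c)"
  have i: "integral {c..d} g = (d - c) * m" using cd by (simp add: m_def)
  have I: "((\<lambda>r. (g r)\<^sup>2 - (2 * m) * g r + m\<^sup>2) has_integral
      integral {c..d} (\<lambda>r. (g r)\<^sup>2) - (2 * m) * integral {c..d} g + (d - c) *\<^sub>R m\<^sup>2) {c..d}"
    by (intro has_integral_add has_integral_diff has_integral_mult_right has_integral_const_real[of _ c d, THEN has_integral_eq_rhs]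
        integrable_integral integrable_continuous_real continuous_intros g) (use cd in auto)
  have "0 \<le> integral {c..d} (\<lambda>r. (g r)\<^sup>2) - (2 * m) * integral {c..d} g + (d - c) *\<^sub>R m\<^sup>2"
  proof (rule has_integral_nonneg[OF I])
    fix r
    have "(g r)\<^sup>2 - (2 * m) * g r + m\<^sup>2 = (g r - m)\<^sup>2" by (simp add: power2_diff)
    then show "0 \<le> (g r)\<^sup>2 - (2 * m) * g r + m\<^sup>2" by simp
  qed
  then have "(d - c) * m\<^sup>2 \<le> integral {c..d} (\<lambda>r. (g r)\<^sup>2)"
    unfolding i by (simp add: power2_eq_square algebra_simps)
  then have "(d - c) * ((d - c) * m\<^sup>2) \<le> (d - c) * integral {c..d} (\<lambda>r. (g r)\<^sup>2)"
    using cd by (intro mult_left_mono) auto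
  then show ?thesis unfolding i by (simp add: power2_eq_square mult_ac)
qed

text \<open>The weight \<open>4 / h^2\<close> is the squared bound for the derivative of the cutoff.
  On an interval of length \<open>h\<close>, \<open>|g|^2\<close> is at most
  \<open>2 |g x|^2\<close> plus \<open>2 h\<close> times the integral of \<open>|g'|^2\<close>;
  integrating once more leaves the factor \<open>1 / h\<close> only on the term at \<open>x\<close>,
  which will be a boundary point.\<close>

lemma shell_estimate:
  fixes g g' :: "real \<Rightarrow> complex"
  assumes g: "\<And>r. r \<in> {a..b} \<Longrightarrow> (g has_vector_derivative g' r) (at r within {a..b})" and g': "continuous_on {a..b} g'"
    and cd: "c < d" "{c..d} \<subseteq> {a..b}" and x: "x \<in> {c..d}" and h: "h = d - c"
  shows "(\<integral>\<^sup>+r. ennreal (4 / h\<^sup>2 * (indicator {c..d} r * (norm (g r))\<^sup>2)) \<partial>seg a b)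
    \<le> ennreal (8 / h * (norm (g x))\<^sup>2) + (\<integral>\<^sup>+r. ennreal (8 * (indicator {c..d} r * (norm (g' r))\<^sup>2)) \<partial>seg a b)"
proof -
  have h0: "h > 0" using h cd by simp
  have g'c: "continuous_on {c..d} g'" by (rule continuous_on_subset[OF g' cd(2)])
  define m where "m = integral {c..d} (\<lambda>r. norm (g' r))"
  define J where "J = integral {c..d} (\<lambda>r. (norm (g' r))\<^sup>2)"
  have m2: "m\<^sup>2 \<le> h * J"
    unfolding m_def J_def h by (rule integral_square_le[OF cd(1)]) (intro continuous_intros g'c)
  have diff: "norm (g q - g p) \<le> m" if "c \<le> p" "p \<le> q" "q \<le> d" for p q
  proof -
    have sub: "{p..q} \<subseteq> {c..d}" using that by auto
    have "(g' has_integral g q - g p) {p..q}"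
      by (rule fundamental_theorem_of_calculus)
         (use that cd sub in \<open>auto intro!: has_vector_derivative_within_subset[OF g]\<close>)
    then have "norm (g q - g p) = norm (integral {p..q} g')" by (simp add: integral_unique)
    also have "\<dots> \<le> integral {p..q} (\<lambda>r. norm (g' r))"
      by (rule integral_norm_bound_integral) (auto intro!: integrable_continuous_real continuous_intros continuous_on_subset[OF g'c sub])
    also have "\<dots> \<le> m" unfolding m_def
      by (rule integral_subset_le[OF sub]) (auto intro!: integrable_continuous_real continuous_intros continuous_on_subset[OF g'c sub] g'c)
    finally show ?thesis .
  qed
  have bd: "(norm (g r))\<^sup>2 \<le> 2 * (norm (g x))\<^sup>2 + 2 * (h * J)" if "r \<in> {c..d}" for r
  proof -
    have "norm (g r - g x) \<le> m"
      using diff[of x r] diff[of r x] that x by (cases "x \<le> r") (auto simp: norm_minus_commute)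
    then have "(norm (g r - g x))\<^sup>2 \<le> m\<^sup>2" by (intro power_mono) auto
    then have 1: "(norm (g r - g x))\<^sup>2 \<le> h * J" using m2 by linarith
    have "norm (g r) \<le> norm (g x) + norm (g r - g x)" by (metis add.commute diff_add_cancel norm_triangle_ineq)
    then have "(norm (g r))\<^sup>2 \<le> (norm (g x) + norm (g r - g x))\<^sup>2" by (intro power_mono) auto
    also have "\<dots> \<le> 2 * ((norm (g x))\<^sup>2 + (norm (g r - g x))\<^sup>2)" by (rule power2_sum_le)
    finally show ?thesis using 1 by (simp add: algebra_simps)
  qed
  have J0: "0 \<le> J" unfolding J_def by (rule integral_nonneg) (auto intro!: integrable_continuous_real continuous_intros g'c)
  let ?C = "4 / h\<^sup>2 * (2 * (norm (g x))\<^sup>2 + 2 * (h * J))"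
  have C0: "0 \<le> ?C" using h0 J0 by simp
  have em: "emeasure (seg a b) {c..d} = ennreal h"
    using cd h by (subst emeasure_restrict_space) (auto simp: sets_restrict_space)
  have "(\<integral>\<^sup>+r. ennreal (4 / h\<^sup>2 * (indicator {c..d} r * (norm (g r))\<^sup>2)) \<partial>seg a b) \<le> (\<integral>\<^sup>+r. ennreal ?C * indicator {c..d} r \<partial>seg a b)"
  proof (rule nn_integral_mono)
    fix r
    show "ennreal (4 / h\<^sup>2 * (indicator {c..d} r * (norm (g r))\<^sup>2)) \<le> ennreal ?C * indicator {c..d} r"
    proof (cases "r \<in> {c..d}")
      case True
      have "4 / h\<^sup>2 * (norm (g r))\<^sup>2 \<le> ?C" by (rule mult_left_mono[OF bd[OF True]]) simp
      from ennreal_leI[OF this] show ?thesis using True by simp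
    qed simp
  qed
  also have "\<dots> = ennreal ?C * ennreal h"
    using cd by (subst nn_integral_cmult_indicator) (auto simp: em sets_restrict_space)
  also have "\<dots> = ennreal (?C * h)"
    by (rule ennreal_mult[symmetric]) (use C0 h0 in auto)
  also have "?C * h = 8 / h * (norm (g x))\<^sup>2 + 8 * J" using h0 by (simp add: field_simps power2_eq_square)
  also have "ennreal (8 / h * (norm (g x))\<^sup>2 + 8 * J) = ennreal (8 / h * (norm (g x))\<^sup>2) + ennreal (8 * J)"
    using h0 J0 by (intro ennreal_plus) auto
  also have "ennreal (8 * J) = (\<integral>\<^sup>+r. ennreal (8 * (indicator {c..d} r * (norm (g' r))\<^sup>2)) \<partial>seg a b)"
  proof -
    have cn: "continuous_on {a..b} (\<lambda>r. 8 * (norm (g' r))\<^sup>2)" by (intro continuous_intros g')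
    have i: "integrable (seg a b) (\<lambda>r. indicator {c..d} r *\<^sub>R (8 * (norm (g' r))\<^sup>2))"
      by (intro integrable_seg_mult_indicator integrable_seg_continuous(1)[OF cn]) simp
    have "(\<integral>\<^sup>+r. ennreal (indicator {c..d} r *\<^sub>R (8 * (norm (g' r))\<^sup>2)) \<partial>seg a b) = ennreal (LINT r|seg a b. indicator {c..d} r *\<^sub>R (8 * (norm (g' r))\<^sup>2))"
      by (rule nn_integral_eq_integral[OF i]) (auto split: split_indicator)
    also have "(LINT r|seg a b. indicator {c..d} r *\<^sub>R (8 * (norm (g' r))\<^sup>2)) = 8 * J"
      using cd x by (subst LINT_seg_indicator[OF cn]) (auto simp: J_def subset_iff)
    finally show ?thesis by (simp add: mult_ac)
  qed
  finally show ?thesis .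
qed

lemma nn_integral_polar_rect_snd:
  assumes "f \<in> borel_measurable (polar_rect a b)"
  shows "(\<integral>\<^sup>+z. f z \<partial>polar_rect a b) = (\<integral>\<^sup>+t. (\<integral>\<^sup>+r. f (r, t) \<partial>seg a b) \<partial>seg 0 (2 * pi))"
proof -
  interpret pair_sigma_finite "seg a b" "seg 0 (2 * pi)" by (rule pair_sigma_finite_seg)
  show ?thesis using nn_integral_snd[of f] assms by simp
qed

lemma shell_estimate_2D:
  assumes p: "polar_regular a b p pr pt prt"
    and cd: "c < d" "{c..d} \<subseteq> {a..b}" and x: "x \<in> {c..d}" and h: "h = d - c"
  shows "(\<integral>\<^sup>+z. ennreal (4 / h\<^sup>2 * (indicator {c..d} (fst z) * (norm (p (fst z) (snd z)))\<^sup>2)) \<partial>polar_rect a b)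
    \<le> ennreal (8 / h) * (\<integral>\<^sup>+t. ennreal ((norm (p x t))\<^sup>2) \<partial>seg 0 (2 * pi))
      + (\<integral>\<^sup>+z. ennreal (8 * (indicator {c..d} (fst z) * (norm (pr (fst z) (snd z)))\<^sup>2)) \<partial>polar_rect a b)"
proof -
  note c = polar_regular_continuous[OF p]
  have sub: "{a..b} \<times> {0..2 * pi} \<subseteq> {a..b} \<times> UNIV" by auto
  have [measurable]: "(\<lambda>z. p (fst z) (snd z)) \<in> borel_measurable (polar_rect a b)" "(\<lambda>z. pr (fst z) (snd z)) \<in> borel_measurable (polar_rect a b)"
    by (intro measurable_polar_rect_cont continuous_on_subset[OF c(1) sub] continuous_on_subset[OF c(2) sub])+
  have [measurable]: "(\<lambda>z. indicator {c..d} (fst z) :: real) \<in> borel_measurable (polar_rect a b)"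
    by (rule measurable_polar_rect) measurable
  have prc: "continuous_on {a..b} (\<lambda>r. pr r t)" for t
  proof -
    have "(\<lambda>r. (r, t)) ` {a..b} \<subseteq> {a..b} \<times> UNIV" by auto
    from continuous_on_compose2[OF c(2) continuous_on_Pair[OF continuous_on_id continuous_on_const] this] show ?thesis by simp
  qed
  have xr: "x \<in> {a..b}" using x cd by auto
  have pxc: "continuous_on {0..2 * pi} (\<lambda>t. p x t)"
  proof -
    have "(\<lambda>t. (x, t)) ` {0..2 * pi} \<subseteq> {a..b} \<times> UNIV" using xr by auto
    from continuous_on_compose2[OF c(1) continuous_on_Pair[OF continuous_on_const continuous_on_id] this] show ?thesis by simp
  qed
  have [measurable]: "(\<lambda>t. p x t) \<in> borel_measurable (seg 0 (2 * pi))" by (rule measurable_seg_continuous[OF pxc])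
  have h0: "h > 0" using h cd by simp
  have m1: "(\<lambda>z. ennreal (4 / h\<^sup>2 * (indicator {c..d} (fst z) * (norm (p (fst z) (snd z)))\<^sup>2))) \<in> borel_measurable (polar_rect a b)"
    by measurable
  have m2: "(\<lambda>z. ennreal (8 * (indicator {c..d} (fst z) * (norm (pr (fst z) (snd z)))\<^sup>2))) \<in> borel_measurable (polar_rect a b)"
    by measurable
  have "(\<integral>\<^sup>+z. ennreal (4 / h\<^sup>2 * (indicator {c..d} (fst z) * (norm (p (fst z) (snd z)))\<^sup>2)) \<partial>polar_rect a b)
      = (\<integral>\<^sup>+t. (\<integral>\<^sup>+r. ennreal (4 / h\<^sup>2 * (indicator {c..d} r * (norm (p r t))\<^sup>2)) \<partial>seg a b) \<partial>seg 0 (2 * pi))"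
    unfolding nn_integral_polar_rect_snd[OF m1] by simp
  also have "\<dots> \<le> (\<integral>\<^sup>+t. (ennreal (8 / h * (norm (p x t))\<^sup>2) + (\<integral>\<^sup>+r. ennreal (8 * (indicator {c..d} r * (norm (pr r t))\<^sup>2)) \<partial>seg a b)) \<partial>seg 0 (2 * pi))"
    by (intro nn_integral_mono shell_estimate polar_regularD[OF p] prc cd x h)
  also have "\<dots> = (\<integral>\<^sup>+t. ennreal (8 / h * (norm (p x t))\<^sup>2) \<partial>seg 0 (2 * pi))
      + (\<integral>\<^sup>+t. (\<integral>\<^sup>+r. ennreal (8 * (indicator {c..d} r * (norm (pr r t))\<^sup>2)) \<partial>seg a b) \<partial>seg 0 (2 * pi))"
  proof (rule nn_integral_add)
    interpret pair_sigma_finite "seg a b" "seg 0 (2 * pi)" by (rule pair_sigma_finite_seg)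
    from m2 have "(\<lambda>z. ennreal (8 * (indicator {c..d} (snd z) * (norm (pr (snd z) (fst z)))\<^sup>2))) \<in> borel_measurable (seg 0 (2 * pi) \<Otimes>\<^sub>M seg a b)"
      using measurable_pair_swap[of "\<lambda>z. ennreal (8 * (indicator {c..d} (fst z) * (norm (pr (fst z) (snd z)))\<^sup>2))" "seg a b" "seg 0 (2 * pi)" borel]
      by (simp add: case_prod_unfold)
    from M1.borel_measurable_nn_integral_fst[OF this]
    show "(\<lambda>t. \<integral>\<^sup>+r. ennreal (8 * (indicator {c..d} r * (norm (pr r t))\<^sup>2)) \<partial>seg a b) \<in> borel_measurable (seg 0 (2 * pi))"
      by simp
  qed measurable
  also have "(\<integral>\<^sup>+t. ennreal (8 / h * (norm (p x t))\<^sup>2) \<partial>seg 0 (2 * pi)) = ennreal (8 / h) * (\<integral>\<^sup>+t. ennreal ((norm (p x t))\<^sup>2) \<partial>seg 0 (2 * pi))"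
  proof -
    have "(\<integral>\<^sup>+t. ennreal (8 / h * (norm (p x t))\<^sup>2) \<partial>seg 0 (2 * pi)) = (\<integral>\<^sup>+t. ennreal (8 / h) * ennreal ((norm (p x t))\<^sup>2) \<partial>seg 0 (2 * pi))"
      by (intro nn_integral_cong ennreal_mult) (use h0 in auto)
    also have "\<dots> = ennreal (8 / h) * (\<integral>\<^sup>+t. ennreal ((norm (p x t))\<^sup>2) \<partial>seg 0 (2 * pi))"
      by (rule nn_integral_cmult) measurable
    finally show ?thesis .
  qed
  also have "(\<integral>\<^sup>+t. (\<integral>\<^sup>+r. ennreal (8 * (indicator {c..d} r * (norm (pr r t))\<^sup>2)) \<partial>seg a b) \<partial>seg 0 (2 * pi))
      = (\<integral>\<^sup>+z. ennreal (8 * (indicator {c..d} (fst z) * (norm (pr (fst z) (snd z)))\<^sup>2)) \<partial>polar_rect a b)"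
    unfolding nn_integral_polar_rect_snd[OF m2] by simp
  finally show ?thesis .
qed

definition polar_err ::
    "(real \<times> real \<Rightarrow> complex) \<Rightarrow> (real \<times> real \<Rightarrow> complex) \<Rightarrow> (real \<times> real \<Rightarrow> complex) \<Rightarrow>
     (real \<Rightarrow> real \<Rightarrow> complex) \<Rightarrow> (real \<Rightarrow> real \<Rightarrow> complex) \<Rightarrow> (real \<Rightarrow> real \<Rightarrow> complex) \<Rightarrow> real \<times> real \<Rightarrow> real" where
  "polar_err V Vr Vt p pr pt z = (norm (p (fst z) (snd z) - V z))\<^sup>2 + (norm (pr (fst z) (snd z) - Vr z))\<^sup>2
     + (norm (pt (fst z) (snd z) - Vt z))\<^sup>2"

abbreviation "polar_dist a b V Vr Vt p pr pt \<equiv> \<integral>\<^sup>+z. ennreal (polar_err V Vr Vt p pr pt z) \<partial>polar_rect a b"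

abbreviation circle_err :: "(real \<Rightarrow> real \<Rightarrow> complex) \<Rightarrow> real \<Rightarrow> ennreal" where
  "circle_err p r \<equiv> \<integral>\<^sup>+t. ennreal ((norm (p r t - of_real r * cis t))\<^sup>2) \<partial>seg 0 (2 * pi)"

abbreviation "id_err V Vr Vt \<equiv> polar_err V Vr Vt (\<lambda>r t. of_real r * cis t) (\<lambda>r t. cis t) (\<lambda>r t. \<i> * of_real r * cis t)"

lemma norm_sum_sq_le2: "(norm (x + y))\<^sup>2 \<le> 2 * (norm x)\<^sup>2 + 2 * (norm y)\<^sup>2" for x y :: complex
proof -
  have "(norm (x + y))\<^sup>2 \<le> (norm x + norm y)\<^sup>2" by (intro power_mono norm_triangle_ineq) auto
  also have "\<dots> \<le> 2 * ((norm x)\<^sup>2 + (norm y)\<^sup>2)" by (rule power2_sum_le)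
  finally show ?thesis by simp
qed

text \<open>\<open>s\<close> will be the cutoff and \<open>i\<close> the indicator of the shell, off
  which the cutoff is 1 and the second map does not enter.\<close>

lemma norm_mix_le:
  fixes x y :: complex
  assumes "0 \<le> s" "s \<le> 1" "s \<noteq> 1 \<Longrightarrow> i = 1" "0 \<le> (i::real)"
  shows "(norm (of_real s * x + of_real (1 - s) * y))\<^sup>2 \<le> 2 * (norm x)\<^sup>2 + 2 * (i * (norm y)\<^sup>2)"
proof -
  have "(norm (of_real s * x))\<^sup>2 \<le> (norm x)\<^sup>2"
    using assms by (intro power_mono) (auto simp: norm_mult intro!: mult_left_le_one_le)
  moreover have "(norm (of_real (1 - s) * y))\<^sup>2 \<le> i * (norm y)\<^sup>2"
  proof (cases "s = 1")
    case True then show ?thesis using assms by simp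
  next
    case False
    have "norm (of_real (1 - s) * y) \<le> norm y"
      unfolding norm_mult norm_of_real using assms by (intro mult_left_le_one_le) auto
    then show ?thesis using assms(3)[OF False] by (simp add: power_mono)
  qed
  ultimately show ?thesis using norm_sum_sq_le2[of "of_real s * x" "of_real (1 - s) * y"] by linarith
qed

text \<open>Gluing to the identity near the boundary: the bound involves the distance of the boundary values
  with a factor \<open>1 / h\<close>, and the distance of the limit map to the identity on the shell.\<close>

lemma cutoff_error:
  assumes ab: "a < b" and h: "h > 0" "2 * h < b - a"
    and m: "V \<in> borel_measurable (polar_rect a b)" "Vr \<in> borel_measurable (polar_rect a b)" "Vt \<in> borel_measurable (polar_rect a b)"
    and p: "polar_regular a b p pr pt prt"
  shows "\<exists>q qr qt qrt. polar_regular a b q qr qt qrt \<and> (\<forall>t. q a t = of_real a * cis t) \<and> (\<forall>t. q b t = of_real b * cis t) \<and>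
    polar_dist a b V Vr Vt q qr qt \<le>
      200 * (polar_dist a b V Vr Vt p pr pt
        + (\<integral>\<^sup>+z. ennreal (indicator (shell a b h) (fst z) * id_err V Vr Vt z) \<partial>polar_rect a b))
      + ennreal (16 / h) * (circle_err p a
        + circle_err p b)"
proof -
  define \<zeta> where "\<zeta> = cutoff a b h"
  define \<zeta>' where "\<zeta>' = cutoff' a b h"
  define e where "e r t = of_real r * cis t" for r t :: real
  have e: "polar_regular a b e (\<lambda>r t. cis t) (\<lambda>r t. \<i> * of_real r * cis t) (\<lambda>r t. \<i> * cis t)"
    using polar_regular_identity[of a b] by (simp add: e_def[abs_def])
  note d = polar_regular_diff[OF p e]
  note zd = polar_regular_mult[OF d, of \<zeta> \<zeta>', unfolded \<zeta>_def \<zeta>'_def, OF cutoff_deriv[OF h(1)] cutoff'_cont, folded \<zeta>_def \<zeta>'_def]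
  note q = polar_regular_add[OF e zd]
  \<comment> \<open>Equal to \<open>p\<close> outside the collars and to the identity on the two
    circles. Differentiating the cutoff produces the term \<open>\<zeta>' (p - e)\<close> of
    \<open>qr\<close>, the one that has to be controlled by the boundary values.\<close>
  define q where "q r t = e r t + of_real (\<zeta> r) * (p r t - e r t)" for r t
  define qr where "qr r t = cis t + (of_real (\<zeta>' r) * (p r t - e r t) + of_real (\<zeta> r) * (pr r t - cis t))" for r t
  define qt where "qt r t = \<i> * of_real r * cis t + of_real (\<zeta> r) * (pt r t - \<i> * of_real r * cis t)" for r t
  have qreg: "\<exists>qrt. polar_regular a b q qr qt qrt"
    unfolding q_def[abs_def] qr_def[abs_def] qt_def[abs_def] using q by blast
  have ends: "q a t = of_real a * cis t" "q b t = of_real b * cis t" for t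
    using cutoff_ends[OF h] by (simp_all add: q_def \<zeta>_def e_def)
  have sub: "{a..b} \<times> {0..2 * pi} \<subseteq> {a..b} \<times> UNIV" by auto
  note pm = measurable_polar_rect_cont[OF continuous_on_subset[OF polar_regular_continuous(1)[OF p] sub]]
    measurable_polar_rect_cont[OF continuous_on_subset[OF polar_regular_continuous(2)[OF p] sub]]
    measurable_polar_rect_cont[OF continuous_on_subset[OF polar_regular_continuous(3)[OF p] sub]]
    measurable_polar_rect_cont[OF continuous_on_subset[OF polar_regular_continuous(1)[OF e] sub]]
    measurable_polar_rect_cont[OF continuous_on_subset[OF polar_regular_continuous(2)[OF e] sub]]
    measurable_polar_rect_cont[OF continuous_on_subset[OF polar_regular_continuous(3)[OF e] sub]]
  note pm[measurable] m[measurable]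
  have ind[measurable]: "(\<lambda>z. indicator A (fst z) :: real) \<in> borel_measurable (polar_rect a b)" if "A \<in> sets borel" for A
    by (rule measurable_polar_rect) (use that in measurable)
  have shell_m: "shell a b h \<in> sets borel" by (simp add: shell_def)
  note iS = ind[OF shell_m] and ia = ind[of "{a..a + h}"] and ib = ind[of "{b - h..b}"]
  note iS[measurable] ia[measurable] ib[measurable]
  let ?S = "\<lambda>z. indicator (shell a b h) (fst z) :: real"
  let ?E = "polar_err V Vr Vt p pr pt" and ?K = "id_err V Vr Vt"
  let ?A = "\<lambda>z. indicator {a..a + h} (fst z) :: real" and ?B = "\<lambda>z. indicator {b - h..b} (fst z) :: real"
  let ?d = "\<lambda>z. (norm (p (fst z) (snd z) - e (fst z) (snd z)))\<^sup>2"
  let ?dr = "\<lambda>z. (norm (pr (fst z) (snd z) - cis (snd z)))\<^sup>2"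
  have Em[measurable]: "?E \<in> borel_measurable (polar_rect a b)" unfolding polar_err_def by measurable
  have Km[measurable]: "?K \<in> borel_measurable (polar_rect a b)"
    using pm(4-6) unfolding polar_err_def e_def by measurable
  have E0: "0 \<le> ?E z" and K0: "0 \<le> ?K z" for z by (auto simp: polar_err_def)
  have point: "polar_err V Vr Vt q qr qt z \<le> 4 * ?E z + 4 * (?S z * ?K z) + 2 * (4 / h\<^sup>2 * (?A z * ?d z)) + 2 * (4 / h\<^sup>2 * (?B z * ?d z))"
    if z: "fst z \<in> {a..b}" for z
  proof -
    define r t where "r = fst z" and "t = snd z"
    have r: "r \<in> {a..b}" using z by (simp add: r_def)
    note b = cutoff_bounds[OF h r, folded \<zeta>_def \<zeta>'_def]
    have s1: "\<zeta> r \<noteq> 1 \<Longrightarrow> indicator (shell a b h) r = (1::real)" using b(3) by (auto simp: indicator_def)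
    have 1: "(norm (q r t - V z))\<^sup>2 \<le> 2 * (norm (p r t - V z))\<^sup>2 + 2 * (indicator (shell a b h) r * (norm (e r t - V z))\<^sup>2)"
    proof -
      have "q r t - V z = of_real (\<zeta> r) * (p r t - V z) + of_real (1 - \<zeta> r) * (e r t - V z)"
        by (simp add: q_def algebra_simps)
      then show ?thesis using norm_mix_le[OF b(1,2) s1, of "p r t - V z" "e r t - V z"] by simp
    qed
    have 2: "(norm (qt r t - Vt z))\<^sup>2 \<le> 2 * (norm (pt r t - Vt z))\<^sup>2 + 2 * (indicator (shell a b h) r * (norm (\<i> * of_real r * cis t - Vt z))\<^sup>2)"
    proof -
      have "qt r t - Vt z = of_real (\<zeta> r) * (pt r t - Vt z) + of_real (1 - \<zeta> r) * (\<i> * of_real r * cis t - Vt z)"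
        by (simp add: qt_def algebra_simps)
      then show ?thesis using norm_mix_le[OF b(1,2) s1, of "pt r t - Vt z" "\<i> * of_real r * cis t - Vt z"] by simp
    qed
    have 3: "(norm (qr r t - Vr z))\<^sup>2 \<le> 4 * (norm (pr r t - Vr z))\<^sup>2 + 4 * (indicator (shell a b h) r * (norm (cis t - Vr z))\<^sup>2) + 2 * ((\<zeta>' r)\<^sup>2 * (norm (p r t - e r t))\<^sup>2)"
    proof -
      have "qr r t - Vr z = (of_real (\<zeta> r) * (pr r t - Vr z) + of_real (1 - \<zeta> r) * (cis t - Vr z)) + of_real (\<zeta>' r) * (p r t - e r t)"
        by (simp add: qr_def algebra_simps)
      then have "(norm (qr r t - Vr z))\<^sup>2 \<le> 2 * (norm (of_real (\<zeta> r) * (pr r t - Vr z) + of_real (1 - \<zeta> r) * (cis t - Vr z)))\<^sup>2 + 2 * (norm (of_real (\<zeta>' r) * (p r t - e r t)))\<^sup>2"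
        using norm_sum_sq_le2 by metis
      moreover have "(norm (of_real (\<zeta>' r) * (p r t - e r t)))\<^sup>2 = (\<zeta>' r)\<^sup>2 * (norm (p r t - e r t))\<^sup>2"
        by (simp add: norm_mult power_mult_distrib)
      ultimately show ?thesis using norm_mix_le[OF b(1,2) s1, of "pr r t - Vr z" "cis t - Vr z"] by simp
    qed
    have "(\<zeta>' r)\<^sup>2 = \<bar>\<zeta>' r\<bar>\<^sup>2" by simp
    also have "\<dots> \<le> (2 / h * indicator (shell a b h) r)\<^sup>2"
      by (rule power_mono[OF b(4)]) simp
    also have "\<dots> = 4 / h\<^sup>2 * indicator (shell a b h) r" by (simp add: power_mult_distrib power_divide split: split_indicator)
    also have "\<dots> \<le> 4 / h\<^sup>2 * (indicator {a..a + h} r + indicator {b - h..b} r)"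
      using r h by (intro mult_left_mono) (auto simp: shell_def split: split_indicator)
    finally have "(\<zeta>' r)\<^sup>2 * (norm (p r t - e r t))\<^sup>2 \<le> 4 / h\<^sup>2 * (indicator {a..a + h} r + indicator {b - h..b} r) * (norm (p r t - e r t))\<^sup>2"
      by (rule mult_right_mono) simp
    also have "\<dots> = 4 / h\<^sup>2 * (indicator {a..a + h} r * (norm (p r t - e r t))\<^sup>2) + 4 / h\<^sup>2 * (indicator {b - h..b} r * (norm (p r t - e r t))\<^sup>2)"
      by (simp only: distrib_left distrib_right mult.assoc)
    finally have 4: "(\<zeta>' r)\<^sup>2 * (norm (p r t - e r t))\<^sup>2 \<le> \<dots>" .
    have nn: "0 \<le> (norm (p r t - V z))\<^sup>2" "0 \<le> (norm (pt r t - Vt z))\<^sup>2" "0 \<le> indicator (shell a b h) r * (norm (e r t - V z))\<^sup>2"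
      "0 \<le> indicator (shell a b h) r * (norm (\<i> * of_real r * cis t - Vt z))\<^sup>2" by auto
    show ?thesis
      using 1 2 3 4 nn unfolding polar_err_def r_def[symmetric] t_def[symmetric] e_def[symmetric] distrib_left by linarith
  qed
  \<comment> \<open>The radial derivative of \<open>p\<close> minus the identity is split at
    \<open>Vr\<close>: one part is the approximation error, the other the distance of the limit map
    from the identity on the shell.\<close>
  have side: "(\<integral>\<^sup>+z. ennreal (8 * (indicator {c..d} (fst z) * ?dr z)) \<partial>polar_rect a b)
      \<le> 16 * (\<integral>\<^sup>+z. ennreal (?E z) \<partial>polar_rect a b) + 16 * (\<integral>\<^sup>+z. ennreal (?S z * ?K z) \<partial>polar_rect a b)"
    if cd: "{c..d} \<subseteq> shell a b h" for c d
  proof -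
    have "(\<integral>\<^sup>+z. ennreal (8 * (indicator {c..d} (fst z) * ?dr z)) \<partial>polar_rect a b) \<le> (\<integral>\<^sup>+z. 16 * ennreal (?E z) + 16 * ennreal (?S z * ?K z) \<partial>polar_rect a b)"
    proof (rule nn_integral_mono)
      fix z :: "real \<times> real"
      have "?dr z \<le> 2 * (norm (pr (fst z) (snd z) - Vr z))\<^sup>2 + 2 * (norm (Vr z - cis (snd z)))\<^sup>2"
        using norm_sum_sq_le2[of "pr (fst z) (snd z) - Vr z" "Vr z - cis (snd z)"] by simp
      also have "\<dots> \<le> 2 * ?E z + 2 * ?K z"
        unfolding polar_err_def by (simp add: norm_minus_commute)
      finally have "8 * (indicator {c..d} (fst z) * ?dr z) \<le> 16 * ?E z + 16 * (?S z * ?K z)"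
        using cd E0[of z] K0[of z] by (auto split: split_indicator)
      then have "ennreal (8 * (indicator {c..d} (fst z) * ?dr z)) \<le> ennreal (16 * ?E z + 16 * (?S z * ?K z))" by (rule ennreal_leI)
      also have "\<dots> = 16 * ennreal (?E z) + 16 * ennreal (?S z * ?K z)"
        using E0[of z] K0[of z] by (simp add: ennreal_plus ennreal_mult)
      finally show "ennreal (8 * (indicator {c..d} (fst z) * ?dr z)) \<le> 16 * ennreal (?E z) + 16 * ennreal (?S z * ?K z)" .
    qed
    also have "\<dots> = 16 * (\<integral>\<^sup>+z. ennreal (?E z) \<partial>polar_rect a b) + 16 * (\<integral>\<^sup>+z. ennreal (?S z * ?K z) \<partial>polar_rect a b)"
      by (simp add: nn_integral_add nn_integral_cmult)
    finally show ?thesis .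
  qed
  let ?IE = "\<integral>\<^sup>+z. ennreal (?E z) \<partial>polar_rect a b" and ?IK = "\<integral>\<^sup>+z. ennreal (?S z * ?K z) \<partial>polar_rect a b"
  let ?Ba = "circle_err p a"
  let ?Bb = "circle_err p b"
  have A: "(\<integral>\<^sup>+z. ennreal (4 / h\<^sup>2 * (?A z * ?d z)) \<partial>polar_rect a b) \<le> ennreal (8 / h) * ?Ba + (16 * ?IE + 16 * ?IK)"
  proof -
    have "{a..a + h} \<subseteq> shell a b h" "{a..a + h} \<subseteq> {a..b}" "a < a + h" "a \<in> {a..a + h}" "h = a + h - a"
      using h by (auto simp: shell_def)
    then show ?thesis
      using order_trans[OF shell_estimate_2D[OF d, of a "a + h" a h] add_left_mono[OF side[of a "a + h"]]] unfolding e_def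
      by blast
  qed
  have B: "(\<integral>\<^sup>+z. ennreal (4 / h\<^sup>2 * (?B z * ?d z)) \<partial>polar_rect a b) \<le> ennreal (8 / h) * ?Bb + (16 * ?IE + 16 * ?IK)"
  proof -
    have "{b - h..b} \<subseteq> shell a b h" "{b - h..b} \<subseteq> {a..b}" "b - h < b" "b \<in> {b - h..b}" "h = b - (b - h)"
      using h by (auto simp: shell_def)
    then show ?thesis
      using order_trans[OF shell_estimate_2D[OF d, of "b - h" b b h] add_left_mono[OF side[of "b - h" b]]] unfolding e_def
      by blast
  qed
  have "polar_dist a b V Vr Vt q qr qt
      \<le> (\<integral>\<^sup>+z. 4 * ennreal (?E z) + 4 * ennreal (?S z * ?K z) + 2 * ennreal (4 / h\<^sup>2 * (?A z * ?d z)) + 2 * ennreal (4 / h\<^sup>2 * (?B z * ?d z)) \<partial>polar_rect a b)"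
  proof (rule nn_integral_mono)
    fix z assume "z \<in> space (polar_rect a b)"
    then have "fst z \<in> {a..b}" by (auto simp: space_pair_measure space_restrict_space)
    from point[OF this]
    have "ennreal (polar_err V Vr Vt q qr qt z) \<le> ennreal (4 * ?E z + 4 * (?S z * ?K z) + 2 * (4 / h\<^sup>2 * (?A z * ?d z)) + 2 * (4 / h\<^sup>2 * (?B z * ?d z)))"
      by (rule ennreal_leI)
    also have "\<dots> = ennreal (4 * ?E z) + ennreal (4 * (?S z * ?K z)) + ennreal (2 * (4 / h\<^sup>2 * (?A z * ?d z))) + ennreal (2 * (4 / h\<^sup>2 * (?B z * ?d z)))"
      using E0[of z] K0[of z] by (subst ennreal_plus; (subst ennreal_plus)?; (subst ennreal_plus)?) auto
    also have "\<dots> = 4 * ennreal (?E z) + 4 * ennreal (?S z * ?K z) + 2 * ennreal (4 / h\<^sup>2 * (?A z * ?d z)) + 2 * ennreal (4 / h\<^sup>2 * (?B z * ?d z))"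
      by (simp only: ennreal_mult' ennreal_numeral)
    finally show "ennreal (polar_err V Vr Vt q qr qt z) \<le> 4 * ennreal (?E z) + 4 * ennreal (?S z * ?K z) + 2 * ennreal (4 / h\<^sup>2 * (?A z * ?d z)) + 2 * ennreal (4 / h\<^sup>2 * (?B z * ?d z))" .
  qed
  also have "\<dots> = 4 * ?IE + 4 * ?IK + 2 * (\<integral>\<^sup>+z. ennreal (4 / h\<^sup>2 * (?A z * ?d z)) \<partial>polar_rect a b) + 2 * (\<integral>\<^sup>+z. ennreal (4 / h\<^sup>2 * (?B z * ?d z)) \<partial>polar_rect a b)"
    by (simp add: nn_integral_add nn_integral_cmult)
  also have "\<dots> \<le> 4 * ?IE + 4 * ?IK + 2 * (ennreal (8 / h) * ?Ba + (16 * ?IE + 16 * ?IK)) + 2 * (ennreal (8 / h) * ?Bb + (16 * ?IE + 16 * ?IK))"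
    by (intro add_mono mult_left_mono A B order.refl) auto
  also have "\<dots> = (4 + 2 * 16 + 2 * 16) * (?IE + ?IK) + 2 * ennreal (8 / h) * (?Ba + ?Bb)"
    by (simp only: distrib_left distrib_right mult.assoc add_ac)
  \<comment> \<open>The coefficient is 68, rounded up generously.\<close>
  also have "\<dots> \<le> 200 * (?IE + ?IK) + ennreal (16 / h) * (?Ba + ?Bb)"
  proof (intro add_mono mult_right_mono)
    show "4 + 2 * 16 + 2 * 16 \<le> (200 :: ennreal)" by simp
  next
    have "2 * ennreal (8 / h) = ennreal 2 * ennreal (8 / h)" by simp
    also have "\<dots> = ennreal (16 / h)" using h by (subst ennreal_mult[symmetric]) auto
    finally show "2 * ennreal (8 / h) \<le> ennreal (16 / h)" by simp
  qed auto
  finally show ?thesis using qreg ends by blast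
qed

text \<open>The order of choices matters: the collar width is fixed first, so thin that the limit
  map is close to the identity on the shell in the integrated sense; only then is the index
  \<open>n\<close> taken large, when the factor \<open>1 / h\<close> on the boundary error is a
  constant.\<close>

lemma exact_approximation:
  assumes ab: "a < b"
    and m: "V \<in> borel_measurable (polar_rect a b)" "Vr \<in> borel_measurable (polar_rect a b)" "Vt \<in> borel_measurable (polar_rect a b)"
    and fin: "(\<integral>\<^sup>+z. ennreal (id_err V Vr Vt z) \<partial>polar_rect a b) < \<infinity>"
    and p: "\<And>n. polar_regular a b (p n) (pr n) (pt n) (prt n)"
    and lim: "(\<lambda>n. polar_dist a b V Vr Vt (p n) (pr n) (pt n)) \<longlonglongrightarrow> 0"
    and bdry: "(\<lambda>n. circle_err (p n) a) \<longlonglongrightarrow> 0"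
      "(\<lambda>n. circle_err (p n) b) \<longlonglongrightarrow> 0"
    and \<epsilon>: "\<epsilon> > 0"
  shows "\<exists>q qr qt qrt. polar_regular a b q qr qt qrt \<and> (\<forall>t. q a t = of_real a * cis t) \<and> (\<forall>t. q b t = of_real b * cis t) \<and>
    polar_dist a b V Vr Vt q qr qt \<le> ennreal \<epsilon>"
proof -
  \<comment> \<open>Starting from index 2 makes even the widest collars disjoint.\<close>
  define h where "h j = (b - a) / 2 * inverse (real (Suc (Suc j)))" for j
  have h: "h j > 0" "2 * h j < b - a" for j
  proof -
    show "h j > 0" using ab by (simp add: h_def)
    have "2 * h j = (b - a) * inverse (real (Suc (Suc j)))" by (simp add: h_def)
    also have "\<dots> < (b - a) * 1"
      using ab by (intro mult_strict_left_mono) (auto simp: inverse_eq_divide divide_less_eq)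
    finally show "2 * h j < b - a" by simp
  qed
  have h0: "h \<longlonglongrightarrow> 0"
  proof -
    have "(\<lambda>j. (b - a) / 2 * inverse (real (Suc (Suc j)))) \<longlonglongrightarrow> (b - a) / 2 * 0"
      by (intro tendsto_intros LIMSEQ_Suc[OF LIMSEQ_inverse_real_of_nat])
    then show ?thesis unfolding h_def by simp
  qed
  let ?K = "id_err V Vr Vt"
  note m[measurable]
  have sub: "{a..b} \<times> {0..2 * pi} \<subseteq> {a..b} \<times> UNIV" by auto
  note e = polar_regular_identity[of a b]
  note em = measurable_polar_rect_cont[OF continuous_on_subset[OF polar_regular_continuous(1)[OF e] sub]]
    measurable_polar_rect_cont[OF continuous_on_subset[OF polar_regular_continuous(2)[OF e] sub]]
    measurable_polar_rect_cont[OF continuous_on_subset[OF polar_regular_continuous(3)[OF e] sub]]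
  have Km[measurable]: "?K \<in> borel_measurable (polar_rect a b)"
    using em unfolding polar_err_def by measurable
  have shm[measurable]: "(\<lambda>z. indicator (shell a b (h j)) (fst z) :: real) \<in> borel_measurable (polar_rect a b)" for j
    by (rule measurable_polar_rect) (simp add: shell_def)
  have K0: "0 \<le> ?K z" for z by (auto simp: polar_err_def)
  have "(\<lambda>j. \<integral>\<^sup>+z. ennreal (indicator (shell a b (h j)) (fst z) * ?K z) \<partial>polar_rect a b) \<longlonglongrightarrow> (\<integral>\<^sup>+z. 0 \<partial>polar_rect a b)"
  proof (rule nn_integral_dominated_convergence[where w = "\<lambda>z. ennreal (?K z)"])
    show "AE z in polar_rect a b. ennreal (indicator (shell a b (h j)) (fst z) * ?K z) \<le> ennreal (?K z)" for j
      using K0 by (intro AE_I2 ennreal_leI) (auto split: split_indicator)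
    show "AE z in polar_rect a b. (\<lambda>j. ennreal (indicator (shell a b (h j)) (fst z) * ?K z)) \<longlonglongrightarrow> 0"
      using AE_polar_rect_neq[where c = a] AE_polar_rect_neq[where c = b] AE_polar_rect[of a b 0 "2 * pi"]
    proof eventually_elim
      case (elim z)
      then have "0 < min (fst z - a) (b - fst z)" by auto
      then have "\<forall>\<^sub>F j in sequentially. h j < min (fst z - a) (b - fst z)" by (rule order_tendstoD(2)[OF h0])
      then have "\<forall>\<^sub>F j in sequentially. ennreal (indicator (shell a b (h j)) (fst z) * ?K z) = 0"
        by eventually_elim (auto simp: shell_def indicator_def)
      then show ?case by (rule tendsto_eventually)
    qed
  qed (use fin in measurable)
  then have K: "(\<lambda>j. 200 * (\<integral>\<^sup>+z. ennreal (indicator (shell a b (h j)) (fst z) * ?K z) \<partial>polar_rect a b)) \<longlonglongrightarrow> 200 * 0"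
    by (intro ennreal_tendsto_cmult) auto
  then have "\<forall>\<^sub>F j in sequentially. 200 * (\<integral>\<^sup>+z. ennreal (indicator (shell a b (h j)) (fst z) * ?K z) \<partial>polar_rect a b) < ennreal \<epsilon>"
    by (rule order_tendstoD(2)) (use \<epsilon> in auto)
  then obtain j where j: "200 * (\<integral>\<^sup>+z. ennreal (indicator (shell a b (h j)) (fst z) * ?K z) \<partial>polar_rect a b) < ennreal \<epsilon>"
    using eventually_happens'[OF sequentially_bot] by blast
  let ?IK = "\<integral>\<^sup>+z. ennreal (indicator (shell a b (h j)) (fst z) * ?K z) \<partial>polar_rect a b"
  have "(\<lambda>n. 200 * (polar_dist a b V Vr Vt (p n) (pr n) (pt n) + ?IK)
      + ennreal (16 / h j) * (circle_err (p n) a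
        + circle_err (p n) b))
      \<longlonglongrightarrow> 200 * (0 + ?IK) + ennreal (16 / h j) * (0 + 0)"
    by (intro tendsto_add ennreal_tendsto_cmult lim bdry tendsto_const) auto
  then have "\<forall>\<^sub>F n in sequentially. 200 * (polar_dist a b V Vr Vt (p n) (pr n) (pt n) + ?IK)
      + ennreal (16 / h j) * (circle_err (p n) a
        + circle_err (p n) b) < ennreal \<epsilon>"
    by (rule order_tendstoD(2)) (use j in simp)
  then obtain n where n: "200 * (polar_dist a b V Vr Vt (p n) (pr n) (pt n) + ?IK)
      + ennreal (16 / h j) * (circle_err (p n) a
        + circle_err (p n) b) < ennreal \<epsilon>"
    using eventually_happens'[OF sequentially_bot] by blast
  obtain q qr qt qrt where Q: "polar_regular a b q qr qt qrt" "\<forall>t. q a t = of_real a * cis t" "\<forall>t. q b t = of_real b * cis t"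
    and le: "polar_dist a b V Vr Vt q qr qt \<le>
      200 * (polar_dist a b V Vr Vt (p n) (pr n) (pt n) + ?IK)
      + ennreal (16 / h j) * (circle_err (p n) a
        + circle_err (p n) b)"
    using cutoff_error[OF ab h m p[of n], of j] by blast
  show ?thesis using Q order_trans[OF le less_imp_le[OF n]] by blast
qed

text \<open>Approximating with errors \<open>2\<^sup>-\<^sup>n\<close> makes the sum of the errors integrable, which gives both almost
  everywhere convergence and a square integrable dominating function.\<close>

lemma polar_map_exists:
  assumes ab: "0 < a" "a < b"
    and m: "V \<in> borel_measurable (polar_rect a b)" "Vr \<in> borel_measurable (polar_rect a b)" "Vt \<in> borel_measurable (polar_rect a b)"
    and L2: "integrable (polar_rect a b) (\<lambda>z. (norm (V z))\<^sup>2)" "integrable (polar_rect a b) (\<lambda>z. (norm (Vr z))\<^sup>2)" "integrable (polar_rect a b) (\<lambda>z. (norm (Vt z))\<^sup>2)"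
    and p: "\<And>n. polar_regular a b (p n) (pr n) (pt n) (prt n)"
    and lim: "(\<lambda>n. polar_dist a b V Vr Vt (p n) (pr n) (pt n)) \<longlonglongrightarrow> 0"
    and bdry: "(\<lambda>n. circle_err (p n) a) \<longlonglongrightarrow> 0"
      "(\<lambda>n. circle_err (p n) b) \<longlonglongrightarrow> 0"
    and det: "AE z in polar_rect a b. Im (cnj (Vr z) * Vt z) = fst z"
    and nz: "AE z in polar_rect a b. V z \<noteq> 0"
    and fin: "integrable (polar_rect a b) (\<lambda>z. (norm (Vr z / V z))\<^sup>2)" "integrable (polar_rect a b) (\<lambda>z. (norm (Vt z / V z))\<^sup>2)"
  shows "\<exists>W Wr Wt Wrt M. polar_map a b V Vr Vt W Wr Wt Wrt M"
proof -
  note m[measurable]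
  interpret finite_measure "polar_rect a b" by (rule finite_measure_polar_rect)
  have sub: "{a..b} \<times> {0..2 * pi} \<subseteq> {a..b} \<times> UNIV" by auto
  have err_m: "polar_err V Vr Vt q qr qt \<in> borel_measurable (polar_rect a b)" if "polar_regular a b q qr qt qrt" for q qr qt qrt
  proof -
    note [measurable] = measurable_polar_rect_cont[OF continuous_on_subset[OF polar_regular_continuous(1)[OF that] sub]]
      measurable_polar_rect_cont[OF continuous_on_subset[OF polar_regular_continuous(2)[OF that] sub]]
      measurable_polar_rect_cont[OF continuous_on_subset[OF polar_regular_continuous(3)[OF that] sub]]
    show ?thesis unfolding polar_err_def by measurable
  qed
  have id_fin: "(\<integral>\<^sup>+z. ennreal (id_err V Vr Vt z) \<partial>polar_rect a b) < \<infinity>"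
  proof -
    let ?g = "\<lambda>z. 2 * (b\<^sup>2 + 1 + b\<^sup>2) + 2 * ((norm (V z))\<^sup>2 + (norm (Vr z))\<^sup>2 + (norm (Vt z))\<^sup>2)"
    have g: "integrable (polar_rect a b) ?g" using L2 by simp
    have "(\<integral>\<^sup>+z. ennreal (id_err V Vr Vt z) \<partial>polar_rect a b) \<le> (\<integral>\<^sup>+z. ennreal (?g z) \<partial>polar_rect a b)"
    proof (rule nn_integral_mono_AE)
      show "AE z in polar_rect a b. ennreal (id_err V Vr Vt z) \<le> ennreal (?g z)"
        using AE_polar_rect
      proof eventually_elim
        case (elim z)
        let ?e = "of_real (fst z) * cis (snd z)"
        have r: "(fst z)\<^sup>2 \<le> b\<^sup>2" using elim ab by (intro power_mono) auto
        have "(norm (?e - V z))\<^sup>2 \<le> 2 * (fst z)\<^sup>2 + 2 * (norm (V z))\<^sup>2"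
          using norm_sum_sq_le2[of ?e "- V z"] by (simp add: norm_mult)
        moreover have "(norm (cis (snd z) - Vr z))\<^sup>2 \<le> 2 + 2 * (norm (Vr z))\<^sup>2"
          using norm_sum_sq_le2[of "cis (snd z)" "- Vr z"] by simp
        moreover have "(norm (\<i> * ?e - Vt z))\<^sup>2 \<le> 2 * (fst z)\<^sup>2 + 2 * (norm (Vt z))\<^sup>2"
          using norm_sum_sq_le2[of "\<i> * ?e" "- Vt z"] by (simp add: norm_mult)
        ultimately show ?case unfolding polar_err_def using r by (intro ennreal_leI) (simp add: mult.assoc)
      qed
    qed
    also have "\<dots> < \<infinity>" using g unfolding integrable_iff_bounded
      by (auto intro: le_less_trans[OF nn_integral_mono])
    finally show ?thesis .
  qed
  have "\<forall>n. \<exists>q qr qt qrt. polar_regular a b q qr qt qrt \<and> (\<forall>t. q a t = of_real a * cis t) \<and> (\<forall>t. q b t = of_real b * cis t) \<and>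
    polar_dist a b V Vr Vt q qr qt \<le> ennreal ((1 / 2) ^ n)"
    using exact_approximation[OF ab(2) m id_fin p lim bdry] by simp
  then obtain W Wr Wt Wrt where W: "\<And>n. polar_regular a b (W n) (Wr n) (Wt n) (Wrt n)"
      "\<And>n t. W n a t = of_real a * cis t" "\<And>n t. W n b t = of_real b * cis t"
    and le: "\<And>n. polar_dist a b V Vr Vt (W n) (Wr n) (Wt n) \<le> ennreal ((1 / 2) ^ n)"
    unfolding choice_iff by (elim exE, unfold all_conj_distrib) blast
  define err where "err n = polar_err V Vr Vt (W n) (Wr n) (Wt n)" for n
  have errm[measurable]: "err n \<in> borel_measurable (polar_rect a b)" for n unfolding err_def by (rule err_m[OF W(1)])
  have err0: "0 \<le> err n z" for n z by (auto simp: err_def polar_err_def)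
  define H where "H z = (\<Sum>n. ennreal (err n z))" for z
  have Hm[measurable]: "H \<in> borel_measurable (polar_rect a b)" unfolding H_def by measurable
  have "(\<integral>\<^sup>+z. H z \<partial>polar_rect a b) = (\<Sum>n. \<integral>\<^sup>+z. ennreal (err n z) \<partial>polar_rect a b)"
    unfolding H_def by (rule nn_integral_suminf) measurable
  also have "\<dots> \<le> (\<Sum>n. ennreal ((1 / 2) ^ n))"
    by (intro suminf_le) (use le in \<open>auto simp: err_def\<close>)
  also have "\<dots> = ennreal (\<Sum>n. (1 / 2) ^ n)" by (rule suminf_ennreal2) (auto intro: summable_geometric)
  also have "\<dots> < \<infinity>" by simp
  finally have Hfin: "(\<integral>\<^sup>+z. H z \<partial>polar_rect a b) < \<infinity>" .
  have Hae: "AE z in polar_rect a b. H z \<noteq> \<infinity>"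
    by (rule nn_integral_PInf_AE) (use Hfin in auto)
  define H' where "H' z = enn2real (H z)" for z
  have H'i: "integrable (polar_rect a b) H'"
  proof (rule integrableI_nonneg)
    show "H' \<in> borel_measurable (polar_rect a b)" unfolding H'_def by measurable
    have "(\<integral>\<^sup>+z. ennreal (H' z) \<partial>polar_rect a b) = (\<integral>\<^sup>+z. H z \<partial>polar_rect a b)"
      by (rule nn_integral_cong_AE) (use Hae in \<open>auto elim!: eventually_mono simp: H'_def less_top\<close>)
    then show "(\<integral>\<^sup>+z. ennreal (H' z) \<partial>polar_rect a b) < \<infinity>" using Hfin by simp
  qed (auto simp: H'_def)
  have H'm[measurable]: "H' \<in> borel_measurable (polar_rect a b)" using H'i by auto
  have conv: "AE z in polar_rect a b. (\<lambda>n. err n z) \<longlonglongrightarrow> 0 \<and> (\<forall>n. err n z \<le> H' z)"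
    using Hae
  proof eventually_elim
    case (elim z)
    have s: "summable (\<lambda>n. err n z)"
      by (rule summable_suminf_not_top[OF err0]) (use elim in \<open>simp add: H_def\<close>)
    have "H z = ennreal (\<Sum>n. err n z)" unfolding H_def by (rule suminf_ennreal2[OF err0 s])
    then have H': "H' z = (\<Sum>n. err n z)" using suminf_nonneg[OF s err0] by (simp add: H'_def)
    have "err n z \<le> H' z" for n
      unfolding H' using sum_le_suminf[OF s, of "{n}"] err0 by auto
    then show ?case using summable_LIMSEQ_zero[OF s] by blast
  qed
  \<comment> \<open>Each approximation differs from its limit by at most the square root of its
    error, hence by \<open>sqrt (H' z)\<close>; the square of \<open>M\<close> is integrable because
    \<open>H'\<close> is.\<close>
  define M where "M z = norm (V z) + norm (Vr z) + norm (Vt z) + sqrt (H' z)" for z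
  have H'0: "0 \<le> H' z" for z by (simp add: H'_def)
  have Mm: "M \<in> borel_measurable (polar_rect a b)" unfolding M_def by measurable
  have parts: "(norm (W n (fst z) (snd z) - V z))\<^sup>2 \<le> err n z" "(norm (Wr n (fst z) (snd z) - Vr z))\<^sup>2 \<le> err n z"
    "(norm (Wt n (fst z) (snd z) - Vt z))\<^sup>2 \<le> err n z" for n z
    by (auto simp: err_def polar_err_def)
  have tend: "(\<lambda>n. X n) \<longlonglongrightarrow> Y" if "\<And>n. (norm (X n - Y))\<^sup>2 \<le> err n z" "(\<lambda>n. err n z) \<longlonglongrightarrow> 0" for X :: "nat \<Rightarrow> complex" and Y z
  proof -
    have *: "(\<lambda>n. sqrt (err n z)) \<longlonglongrightarrow> 0" using tendsto_real_sqrt[OF that(2)] by simp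
    have "(\<lambda>n. X n - Y) \<longlonglongrightarrow> 0"
      by (rule Lim_null_comparison[OF always_eventually *]) (use that(1) in \<open>auto intro: real_le_rsqrt\<close>)
    then show ?thesis by (rule LIM_zero_cancel)
  qed
  have bnd: "norm X \<le> norm Y + sqrt (H' z)" if "(norm (X - Y))\<^sup>2 \<le> err n z" "err n z \<le> H' z" for X Y :: complex and n z
  proof -
    have "norm (X - Y) \<le> sqrt (H' z)" by (rule real_le_rsqrt) (use that in linarith)
    then show ?thesis using norm_triangle_ineq2[of X Y] by linarith
  qed
  have "polar_map a b V Vr Vt W Wr Wt Wrt M"
  proof
    show "AE z in polar_rect a b. (\<lambda>n. W n (fst z) (snd z)) \<longlonglongrightarrow> V z \<and>
      (\<lambda>n. Wr n (fst z) (snd z)) \<longlonglongrightarrow> Vr z \<and> (\<lambda>n. Wt n (fst z) (snd z)) \<longlonglongrightarrow> Vt z"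
      using conv
    proof eventually_elim
      case (elim z)
      then have "(\<lambda>n. err n z) \<longlonglongrightarrow> 0" by blast
      note t = tend[OF _ this]
      show ?case by (intro conjI t parts)
    qed
    show "AE z in polar_rect a b. \<forall>n. norm (W n (fst z) (snd z)) \<le> M z \<and>
      norm (Wr n (fst z) (snd z)) \<le> M z \<and> norm (Wt n (fst z) (snd z)) \<le> M z"
      using conv
    proof eventually_elim
      case (elim z)
      show ?case
      proof
        fix n
        have "err n z \<le> H' z" using elim by blast
        from bnd[OF parts(1) this] bnd[OF parts(2) this] bnd[OF parts(3) this]
        show "norm (W n (fst z) (snd z)) \<le> M z \<and> norm (Wr n (fst z) (snd z)) \<le> M z \<and> norm (Wt n (fst z) (snd z)) \<le> M z"
          unfolding M_def by (auto intro: order_trans)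
      qed
    qed
    show "integrable (polar_rect a b) (\<lambda>z. (M z)\<^sup>2)"
    proof (rule Bochner_Integration.integrable_bound)
      show "integrable (polar_rect a b) (\<lambda>z. 8 * ((norm (V z))\<^sup>2 + (norm (Vr z))\<^sup>2 + (norm (Vt z))\<^sup>2 + H' z))"
        using L2 H'i by simp
      show "AE z in polar_rect a b. norm ((M z)\<^sup>2) \<le> norm (8 * ((norm (V z))\<^sup>2 + (norm (Vr z))\<^sup>2 + (norm (Vt z))\<^sup>2 + H' z))"
      proof (rule AE_I2)
        fix z
        have "(M z)\<^sup>2 \<le> 2 * ((norm (V z) + norm (Vr z) + norm (Vt z))\<^sup>2 + (sqrt (H' z))\<^sup>2)"
          unfolding M_def by (rule power2_sum_le)
        moreover have "(norm (V z) + norm (Vr z) + norm (Vt z))\<^sup>2 \<le> 2 * ((norm (V z) + norm (Vr z))\<^sup>2 + (norm (Vt z))\<^sup>2)"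
          by (rule power2_sum_le)
        moreover have "(norm (V z) + norm (Vr z))\<^sup>2 \<le> 2 * ((norm (V z))\<^sup>2 + (norm (Vr z))\<^sup>2)"
          by (rule power2_sum_le)
        moreover have "0 \<le> (norm (Vt z))\<^sup>2" by simp
        ultimately have "(M z)\<^sup>2 \<le> 8 * ((norm (V z))\<^sup>2 + (norm (Vr z))\<^sup>2 + (norm (Vt z))\<^sup>2 + H' z)"
          using H'0[of z] unfolding real_sqrt_pow2[OF H'0] distrib_left by linarith
        then show "norm ((M z)\<^sup>2) \<le> norm (8 * ((norm (V z))\<^sup>2 + (norm (Vr z))\<^sup>2 + (norm (Vt z))\<^sup>2 + H' z))"
          by simp
      qed
    qed (use Mm in measurable)
  qed (fact ab m Mm det nz fin W(2,3) polar_regularD[OF W(1)] polar_regular_continuous[OF W(1)])+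
  then show ?thesis by blast
qed

section \<open>Admissible maps in polar coordinates\<close>

lemma matrix_mult_vector_2: "(A :: real^2^2) *v vector [p, q] = vector [A$1$1 * p + A$1$2 * q, A$2$1 * p + A$2$2 * q]"
  by (simp add: vec_eq_iff forall_2 matrix_vector_mult_def sum_2)

lemma norm_sq_matrix_2: "(norm (A :: real^2^2))\<^sup>2 = (A$1$1)\<^sup>2 + (A$1$2)\<^sup>2 + (A$2$1)\<^sup>2 + (A$2$2)\<^sup>2"
  by (simp add: norm_vec_def L2_set_def sum_2 add_nonneg_nonneg)

lemmas linear_to_complex = bounded_linear.linear[OF bounded_linear_to_complex]

text \<open>\<open>G\<close> applied to the radial derivative of \<open>polar\<close>: together with
  \<open>angular_part\<close> this is the chain rule in polar coordinates, for a matrix field that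
  is only a weak gradient.\<close>

definition radial_part :: "(real^2 \<Rightarrow> real^2^2) \<Rightarrow> real \<times> real \<Rightarrow> complex" where
  "radial_part G z = to_complex (G (polar (fst z) (snd z)) *v vector [cos (snd z), sin (snd z)])"

definition angular_part :: "(real^2 \<Rightarrow> real^2^2) \<Rightarrow> real \<times> real \<Rightarrow> complex" where
  "angular_part G z = to_complex (G (polar (fst z) (snd z)) *v vector [- fst z * sin (snd z), fst z * cos (snd z)])"

text \<open>The derivatives of \<open>polar\<close> are orthogonal of lengths 1 and \<open>r\<close>
  and span a parallelogram of area \<open>r\<close>. The Hilbert-Schmidt norm does not depend on the
  orthonormal frame, and determinants multiply.\<close>

lemma polar_parts:
  "(fst z)\<^sup>2 * (norm (radial_part G z))\<^sup>2 + (norm (angular_part G z))\<^sup>2 = (fst z)\<^sup>2 * (norm (G (polar (fst z) (snd z))))\<^sup>2"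
  "Im (cnj (radial_part G z) * angular_part G z) = fst z * det (G (polar (fst z) (snd z)))"
proof -
  obtain r t where z: "z = (r, t)" by (cases z)
  let ?A = "G (polar r t)" and ?c = "cos t" and ?s = "sin t"
  have 1: "?c * ?c + ?s * ?s = 1" using sin_cos_squared_add3[of t] by simp
  have "(fst z)\<^sup>2 * (norm (radial_part G z))\<^sup>2 + (norm (angular_part G z))\<^sup>2
      = r\<^sup>2 * (norm ?A)\<^sup>2 * (?c * ?c + ?s * ?s)"
    unfolding z radial_part_def angular_part_def norm_sq_matrix_2
    by (simp add: matrix_mult_vector_2 to_complex_def cmod_power2 del: sin_cos_squared_add sin_cos_squared_add2 sin_cos_squared_add3) algebra
  then show "(fst z)\<^sup>2 * (norm (radial_part G z))\<^sup>2 + (norm (angular_part G z))\<^sup>2 = (fst z)\<^sup>2 * (norm (G (polar (fst z) (snd z))))\<^sup>2"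
    by (simp add: z 1 del: sin_cos_squared_add3)
  have "Im (cnj (radial_part G z) * angular_part G z) = r * det ?A * (?c * ?c + ?s * ?s)"
    unfolding z radial_part_def angular_part_def det_2
    by (simp add: matrix_mult_vector_2 to_complex_def del: sin_cos_squared_add sin_cos_squared_add2 sin_cos_squared_add3) algebra
  then show "Im (cnj (radial_part G z) * angular_part G z) = fst z * det (G (polar (fst z) (snd z)))"
    by (simp add: z 1 del: sin_cos_squared_add3)
qed

lemma polar_parts_le:
  assumes "0 < fst z"
  shows "(norm (radial_part G z))\<^sup>2 \<le> (norm (G (polar (fst z) (snd z))))\<^sup>2"
    "(norm (angular_part G z))\<^sup>2 \<le> (fst z)\<^sup>2 * (norm (G (polar (fst z) (snd z))))\<^sup>2"
proof -
  have "(fst z)\<^sup>2 * (norm (radial_part G z))\<^sup>2 \<le> (fst z)\<^sup>2 * (norm (G (polar (fst z) (snd z))))\<^sup>2"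
    using polar_parts(1)[of z G] zero_le_power2[of "norm (angular_part G z)"] by linarith
  then show "(norm (radial_part G z))\<^sup>2 \<le> (norm (G (polar (fst z) (snd z))))\<^sup>2"
    by (rule mult_left_le_imp_le) (use assms in simp)
  have "0 \<le> (fst z)\<^sup>2 * (norm (radial_part G z))\<^sup>2" by simp
  then show "(norm (angular_part G z))\<^sup>2 \<le> (fst z)\<^sup>2 * (norm (G (polar (fst z) (snd z))))\<^sup>2"
    using polar_parts(1)[of z G] by linarith
qed

lemma polar_parts_diff:
  "radial_part (\<lambda>x. F x - G x) z = radial_part F z - radial_part G z"
  "angular_part (\<lambda>x. F x - G x) z = angular_part F z - angular_part G z"
  by (auto simp: radial_part_def angular_part_def matrix_vector_mult_diff_rdistrib
      linear_diff[OF linear_to_complex])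

lemma borel_measurable_to_complex [measurable]: "to_complex \<in> borel_measurable borel"
  by (intro borel_measurable_continuous_onI linear_continuous_on bounded_linear_to_complex)

lemma borel_measurable_polar_parts [measurable]:
  assumes [measurable]: "G \<in> borel_measurable borel"
  shows "radial_part G \<in> borel_measurable borel" "angular_part G \<in> borel_measurable borel"
proof -
  have [measurable]: "(\<lambda>A :: real^2^2. A $ i $ j) \<in> borel_measurable borel" for i j
    by (intro borel_measurable_continuous_onI continuous_intros)
  have [measurable]: "(\<lambda>z :: real \<times> real. cos (snd z)) \<in> borel_measurable borel" "(\<lambda>z :: real \<times> real. sin (snd z)) \<in> borel_measurable borel"
    by (intro borel_measurable_continuous_onI continuous_intros)+
  have [measurable]: "(\<lambda>z. G (polar (fst z) (snd z)) $ i $ j) \<in> borel_measurable borel" for i j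
    by measurable
  show "radial_part G \<in> borel_measurable borel" "angular_part G \<in> borel_measurable borel"
    unfolding radial_part_def[abs_def] angular_part_def[abs_def] matrix_mult_vector_2 by measurable
qed

lemma polar_parts_jacobian:
  assumes "smooth w"
  shows "pol_r w (fst z) (snd z) = radial_part (\<lambda>x. jacobian w (at x)) z"
    "pol_t w (fst z) (snd z) = angular_part (\<lambda>x. jacobian w (at x)) z"
proof -
  have J: "jacobian w (at x) *v vector [p, q] = p *\<^sub>R D\<^sub>i 1 w x + q *\<^sub>R D\<^sub>i 2 w x" for x p q
    unfolding frechet_derivative_vector_2[OF assms, symmetric]
    using frechet_derivative_at[OF jacobian_works[THEN iffD1, OF differentiableI[OF smooth_has_derivative[OF assms]]]]
    by (rule fun_cong)
  have complex_scaleR_of_real: "c *\<^sub>R y = of_real c * y" for c and y :: complex by (rule scaleR_conv_of_real)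
  note l = linear_add[OF linear_to_complex] linear_diff[OF linear_to_complex] linear_scale[OF linear_to_complex]
  show "pol_r w (fst z) (snd z) = radial_part (\<lambda>x. jacobian w (at x)) z"
    "pol_t w (fst z) (snd z) = angular_part (\<lambda>x. jacobian w (at x)) z"
    by (simp_all add: pol_r_def pol_t_def pol_def radial_part_def angular_part_def J l complex_scaleR_of_real)
qed

lemma borel_measurable_jacobian:
  fixes w :: "real^2 \<Rightarrow> real^2"
  assumes "smooth w"
  shows "(\<lambda>x. jacobian w (at x)) \<in> borel_measurable borel"
proof (intro borel_measurable_continuous_onI continuous_on_vec)
  fix i j :: 2
  have *: "(\<lambda>x. jacobian w (at x) $ i $ j) = (\<lambda>x. D\<^sub>i j w x $ i)"
    by (simp add: jacobian_def matrix_def)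
  show "continuous_on UNIV (\<lambda>x. jacobian w (at x) $ i $ j)"
    unfolding * by (intro continuous_intros smooth_continuous_on[OF smooth_derivative[OF assms]])
qed

text \<open>The measure on the rectangle lacks the factor \<open>r\<close> of area; since
  \<open>r\<close> is at least \<open>a\<close>, this costs a factor \<open>1 / a\<close>.\<close>

lemma nn_integral_polar_rect_le:
  assumes ab: "0 < a" "a < b" and F: "F \<in> borel_measurable borel"
    and f: "\<And>z. a \<le> fst z \<Longrightarrow> fst z \<le> b \<Longrightarrow> f z \<le> ennreal C * F (polar (fst z) (snd z))" and C: "0 \<le> C"
  shows "(\<integral>\<^sup>+z. f z \<partial>polar_rect a b) \<le> ennreal (C / a) * (\<integral>\<^sup>+x. F x \<partial>lebesgue_on (annulus a b))"
proof -
  note F[measurable]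
  have "(\<integral>\<^sup>+z. f z \<partial>polar_rect a b) \<le> (\<integral>\<^sup>+z. ennreal (C / a) * (ennreal (fst z) * F (polar (fst z) (snd z))) \<partial>polar_rect a b)"
  proof (rule nn_integral_mono)
    fix z assume "z \<in> space (polar_rect a b)"
    then have z: "a \<le> fst z" "fst z \<le> b" by (auto simp: space_pair_measure space_restrict_space)
    have "C \<le> C / a * fst z" using z C ab by (simp add: field_simps mult_left_mono)
    then have "ennreal C \<le> ennreal (C / a) * ennreal (fst z)"
      using z ab C by (simp add: ennreal_mult[symmetric] ennreal_leI)
    from order_trans[OF f[OF z] mult_right_mono[OF this]]
    show "f z \<le> ennreal (C / a) * (ennreal (fst z) * F (polar (fst z) (snd z)))" by (simp add: mult.assoc)
  qed
  also have "\<dots> = ennreal (C / a) * (\<integral>\<^sup>+z. ennreal (fst z) * F (polar (fst z) (snd z)) \<partial>polar_rect a b)"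
    by (rule nn_integral_cmult) (rule measurable_polar_rect, measurable)
  also have "\<dots> = ennreal (C / a) * (\<integral>\<^sup>+x. F x \<partial>lebesgue_on (annulus a b))"
    by (simp add: nn_integral_annulus_polar[OF ab F])
  finally show ?thesis .
qed

text \<open>The values and the radial derivative are compared without loss; the angular derivative
  carries a factor \<open>r\<close>, at most \<open>b\<close>, whose square enters the
  constant.\<close>

lemma polar_err_le:
  assumes z: "0 < fst z" "fst z \<le> b" and w: "smooth w"
  shows "polar_err (\<lambda>z. to_complex (u (polar (fst z) (snd z)))) (radial_part G) (angular_part G) (pol w) (pol_r w) (pol_t w) z
    \<le> (1 + b\<^sup>2) * ((norm (w (polar (fst z) (snd z)) - u (polar (fst z) (snd z))))\<^sup>2
        + (norm (jacobian w (at (polar (fst z) (snd z))) - G (polar (fst z) (snd z))))\<^sup>2)"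
proof -
  let ?x = "polar (fst z) (snd z)"
  define g d where "g = (norm (jacobian w (at ?x) - G ?x))\<^sup>2" and "d = (norm (w ?x - u ?x))\<^sup>2"
  have 0: "0 \<le> g" "0 \<le> d" by (auto simp: g_def d_def)
  have "(norm (pol w (fst z) (snd z) - to_complex (u ?x)))\<^sup>2 = d"
    by (simp add: pol_def d_def norm_to_complex linear_diff[OF linear_to_complex, symmetric])
  moreover have "(norm (pol_r w (fst z) (snd z) - radial_part G z))\<^sup>2 \<le> g"
    "(norm (pol_t w (fst z) (snd z) - angular_part G z))\<^sup>2 \<le> (fst z)\<^sup>2 * g"
    unfolding polar_parts_jacobian[OF w] polar_parts_diff[symmetric] g_def by (rule polar_parts_le[OF z(1)])+
  moreover have "(fst z)\<^sup>2 * g \<le> b\<^sup>2 * g" using z 0 by (intro mult_right_mono power_mono) auto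
  moreover have "0 \<le> b\<^sup>2 * d" using 0 by simp
  ultimately show ?thesis
    unfolding polar_err_def g_def[symmetric] d_def[symmetric] distrib_left distrib_right by linarith
qed

lemma nn_integral_lebesgue_on_seg:
  assumes [measurable]: "f \<in> borel_measurable borel"
  shows "(\<integral>\<^sup>+t. f t \<partial>lebesgue_on {c..d}) = (\<integral>\<^sup>+t. f t \<partial>seg c d)"
  by (simp add: nn_integral_restrict_space nn_integral_completion)

text \<open>Borel versions of the map and of its gradient are composed with polar coordinates. The
  energy density becomes \<open>polar_density\<close>, and finite energy supplies the square
  integrable logarithmic derivatives.\<close>

lemma admissible_polar_map:
  assumes ab: "0 < a" "a < b" and u: "u \<in> admissible a b" and en: "energy (annulus a b) u < \<infinity>"
  obtains v V Vr Vt W Wr Wt Wrt M where "polar_map a b V Vr Vt W Wr Wt Wrt M"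
    "v \<in> borel_measurable borel" "AE x in lebesgue_on (annulus a b). u x = v x"
    "V = (\<lambda>z. to_complex (v (polar (fst z) (snd z))))"
    "integrable (polar_rect a b) (\<lambda>z. polar_density V Vr Vt z)"
    "energy (annulus a b) u = ennreal ((LINT z|polar_rect a b. polar_density V Vr Vt z) / 2)"
proof -
  let ?X = "lebesgue_on (annulus a b)"
  define g where "g = weak_gradient (annulus a b) u"
  have sq: "square_integrable (annulus a b) u" "square_integrable (annulus a b) g"
    and det: "AE x in ?X. det (g x) = 1" and tr: "has_trace a b u (\<lambda>x. x)"
    using u unfolding admissible_def W12_def g_def by auto
  have Xb: "annulus a b \<in> sets borel" by measurable
  obtain v where v[measurable]: "v \<in> borel_measurable borel" and uv: "AE x in ?X. u x = v x"
    using borel_representative[OF Xb] sq(1) unfolding square_integrable_def by blast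
  obtain G where G[measurable]: "G \<in> borel_measurable borel" and gG: "AE x in ?X. g x = G x"
    using borel_representative[OF Xb] sq(2) unfolding square_integrable_def by blast
  define V where "V = (\<lambda>z. to_complex (v (polar (fst z) (snd z))))"
  define Vr where "Vr = radial_part G"
  define Vt where "Vt = angular_part G"
  have Vb: "V \<in> borel_measurable borel" "Vr \<in> borel_measurable borel" "Vt \<in> borel_measurable borel"
    unfolding V_def Vr_def Vt_def by measurable
  note m = Vb[THEN measurable_polar_rect, of a b 0 "2 * pi"]
  have nV: "norm (V z) = norm (v (polar (fst z) (snd z)))" for z by (simp add: V_def norm_to_complex)
  have vfin: "(\<integral>\<^sup>+x. ennreal ((norm (v x))\<^sup>2) \<partial>?X) < \<infinity>"
  proof -
    have "(\<integral>\<^sup>+x. ennreal ((norm (v x))\<^sup>2) \<partial>?X) = (\<integral>\<^sup>+x. ennreal ((norm (u x))\<^sup>2) \<partial>?X)"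
      by (rule nn_integral_cong_AE) (use uv in \<open>auto elim!: eventually_mono\<close>)
    then show ?thesis using sq(1) unfolding square_integrable_def integrable_iff_bounded by simp
  qed
  have Gfin: "(\<integral>\<^sup>+x. ennreal ((norm (G x))\<^sup>2) \<partial>?X) < \<infinity>"
  proof -
    have "(\<integral>\<^sup>+x. ennreal ((norm (G x))\<^sup>2) \<partial>?X) = (\<integral>\<^sup>+x. ennreal ((norm (g x))\<^sup>2) \<partial>?X)"
      by (rule nn_integral_cong_AE) (use gG in \<open>auto elim!: eventually_mono\<close>)
    then show ?thesis using sq(2) unfolding square_integrable_def integrable_iff_bounded by simp
  qed
  have L2: "integrable (polar_rect a b) (\<lambda>z. (norm (f z))\<^sup>2)"
    if f: "f \<in> borel_measurable (polar_rect a b)"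
      and le: "\<And>z. a \<le> fst z \<Longrightarrow> fst z \<le> b \<Longrightarrow> (norm (f z))\<^sup>2 \<le> C * (norm (F (polar (fst z) (snd z))))\<^sup>2" and C: "0 \<le> C"
      and F: "F \<in> borel_measurable borel" and fin: "(\<integral>\<^sup>+x. ennreal ((norm (F x))\<^sup>2) \<partial>?X) < \<infinity>"
    for f :: "real \<times> real \<Rightarrow> complex" and F :: "real^2 \<Rightarrow> 'c::euclidean_space" and C
  proof (rule integrableI_nonneg)
    note f[measurable] F[measurable]
    show "(\<lambda>z. (norm (f z))\<^sup>2) \<in> borel_measurable (polar_rect a b)" by measurable
    have "(\<integral>\<^sup>+z. ennreal ((norm (f z))\<^sup>2) \<partial>polar_rect a b) \<le> ennreal (C / a) * (\<integral>\<^sup>+x. ennreal ((norm (F x))\<^sup>2) \<partial>?X)"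
    proof (rule nn_integral_polar_rect_le[OF ab _ _ C])
      show "ennreal ((norm (f z))\<^sup>2) \<le> ennreal C * ennreal ((norm (F (polar (fst z) (snd z))))\<^sup>2)" if "a \<le> fst z" "fst z \<le> b" for z
        using le[OF that] C by (simp add: ennreal_mult[symmetric] ennreal_leI)
    qed measurable
    also have "\<dots> < \<infinity>" using fin by (simp add: ennreal_mult_less_top)
    finally show "(\<integral>\<^sup>+z. ennreal ((norm (f z))\<^sup>2) \<partial>polar_rect a b) < \<infinity>" .
  qed auto
  have L2V: "integrable (polar_rect a b) (\<lambda>z. (norm (V z))\<^sup>2)"
    by (rule L2[OF m(1) _ _ v vfin, of 1]) (auto simp: nV)
  have L2Vr: "integrable (polar_rect a b) (\<lambda>z. (norm (Vr z))\<^sup>2)"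
    by (rule L2[OF m(2) _ _ G Gfin, of 1]) (use polar_parts_le(1) ab in \<open>auto simp: Vr_def\<close>)
  have L2Vt: "integrable (polar_rect a b) (\<lambda>z. (norm (Vt z))\<^sup>2)"
  proof (rule L2[OF m(3) _ _ G Gfin, of "b\<^sup>2"])
    fix z :: "real \<times> real" assume z: "a \<le> fst z" "fst z \<le> b"
    have "(norm (Vt z))\<^sup>2 \<le> (fst z)\<^sup>2 * (norm (G (polar (fst z) (snd z))))\<^sup>2"
      unfolding Vt_def by (rule polar_parts_le) (use z ab in simp)
    also have "\<dots> \<le> b\<^sup>2 * (norm (G (polar (fst z) (snd z))))\<^sup>2"
      using z ab by (intro mult_right_mono power_mono) auto
    finally show "(norm (Vt z))\<^sup>2 \<le> b\<^sup>2 * (norm (G (polar (fst z) (snd z))))\<^sup>2" .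
  qed auto

  obtain w where w: "\<And>n. smooth (w n)" and wu: "(\<lambda>n. L2_dist_sq ?X (w n) u) \<longlonglongrightarrow> 0"
    and wg: "(\<lambda>n. L2_dist_sq ?X (\<lambda>x. jacobian (w n) (at x)) g) \<longlonglongrightarrow> 0"
    and wb: "\<And>r. r \<in> {a, b} \<Longrightarrow> (\<lambda>n. L2_dist_sq (lebesgue_on {0..2*pi}) (\<lambda>t. w n (polar r t)) (\<lambda>t. polar r t)) \<longlonglongrightarrow> 0"
    using tr unfolding has_trace_def g_def by blast
  have wm[measurable]: "w n \<in> borel_measurable borel" for n
    by (intro borel_measurable_continuous_onI smooth_continuous_on w)
  have jm[measurable]: "(\<lambda>x. jacobian (w n) (at x)) \<in> borel_measurable borel" for n
    by (rule borel_measurable_jacobian[OF w])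
  have lim: "(\<lambda>n. polar_dist a b V Vr Vt (pol (w n)) (pol_r (w n)) (pol_t (w n))) \<longlonglongrightarrow> 0"
  proof (rule tendsto_sandwich[OF _ _ tendsto_const])
    let ?E = "\<lambda>n. ennreal ((1 + b\<^sup>2) / a) * (L2_dist_sq ?X (w n) u + L2_dist_sq ?X (\<lambda>x. jacobian (w n) (at x)) g)"
    have "?E \<longlonglongrightarrow> ennreal ((1 + b\<^sup>2) / a) * (0 + 0)"
      by (intro ennreal_tendsto_cmult tendsto_add wu wg) auto
    then show "?E \<longlonglongrightarrow> 0" by simp
    show "\<forall>\<^sub>F n in sequentially. polar_dist a b V Vr Vt (pol (w n)) (pol_r (w n)) (pol_t (w n)) \<le> ?E n"
    proof (rule always_eventually, rule allI)
      fix n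
      let ?F = "\<lambda>x. ennreal ((norm (w n x - v x))\<^sup>2) + ennreal ((norm (jacobian (w n) (at x) - G x))\<^sup>2)"
      have "polar_dist a b V Vr Vt (pol (w n)) (pol_r (w n)) (pol_t (w n))
          \<le> ennreal ((1 + b\<^sup>2) / a) * (\<integral>\<^sup>+x. ?F x \<partial>?X)"
      proof (rule nn_integral_polar_rect_le[OF ab])
        fix z :: "real \<times> real" assume "a \<le> fst z" "fst z \<le> b"
        then have "0 < fst z" "fst z \<le> b" using ab by auto
        from ennreal_leI[OF polar_err_le[OF this w, of v G n]]
        show "ennreal (polar_err V Vr Vt (pol (w n)) (pol_r (w n)) (pol_t (w n)) z) \<le> ennreal (1 + b\<^sup>2) * ?F (polar (fst z) (snd z))"
          unfolding V_def Vr_def Vt_def by (simp add: ennreal_mult' ennreal_plus[symmetric] del: ennreal_plus)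
      qed auto
      also have "(\<integral>\<^sup>+x. ?F x \<partial>?X) = (\<integral>\<^sup>+x. ennreal ((norm (w n x - v x))\<^sup>2) \<partial>?X) + (\<integral>\<^sup>+x. ennreal ((norm (jacobian (w n) (at x) - G x))\<^sup>2) \<partial>?X)"
        by (rule nn_integral_add) (rule measurable_restrict_space1, rule measurable_completion, measurable)+
      also have "(\<integral>\<^sup>+x. ennreal ((norm (w n x - v x))\<^sup>2) \<partial>?X) = L2_dist_sq ?X (w n) u"
        unfolding L2_dist_sq_def by (rule nn_integral_cong_AE) (use uv in \<open>auto elim!: eventually_mono\<close>)
      also have "(\<integral>\<^sup>+x. ennreal ((norm (jacobian (w n) (at x) - G x))\<^sup>2) \<partial>?X) = L2_dist_sq ?X (\<lambda>x. jacobian (w n) (at x)) g"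
        unfolding L2_dist_sq_def by (rule nn_integral_cong_AE) (use gG in \<open>auto elim!: eventually_mono\<close>)
      finally show "polar_dist a b V Vr Vt (pol (w n)) (pol_r (w n)) (pol_t (w n)) \<le> ?E n" .
    qed
  qed auto
  have bdry: "(\<lambda>n. circle_err (pol (w n)) r) \<longlonglongrightarrow> 0" if "r \<in> {a, b}" for r
  proof -
    have [measurable]: "(\<lambda>t. polar r t) \<in> borel_measurable borel" unfolding polar_def by measurable
    have "L2_dist_sq (lebesgue_on {0..2*pi}) (\<lambda>t. w n (polar r t)) (\<lambda>t. polar r t)
        = (\<integral>\<^sup>+t. ennreal ((norm (w n (polar r t) - polar r t))\<^sup>2) \<partial>seg 0 (2 * pi))" for n
      unfolding L2_dist_sq_def by (rule nn_integral_lebesgue_on_seg) measurable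
    moreover have "norm (w n (polar r t) - polar r t) = norm (pol (w n) r t - of_real r * cis t)" for n t
      unfolding pol_def to_complex_polar[symmetric] linear_diff[OF linear_to_complex, symmetric] norm_to_complex ..
    ultimately show ?thesis using wb[OF that] by simp
  qed

  have detG: "AE z in polar_rect a b. det (G (polar (fst z) (snd z))) = 1"
    by (rule AE_annulus_polar[OF ab]) (use det gG in eventually_elim, simp)
  have detV: "AE z in polar_rect a b. Im (cnj (Vr z) * Vt z) = fst z"
    using detG by eventually_elim (simp only: Vr_def Vt_def polar_parts(2) mult_1_right)
  let ?e = "\<lambda>x. ennreal ((norm (G x))\<^sup>2) / ennreal ((norm (v x))\<^sup>2)"
  have e: "energy (annulus a b) u = (\<integral>\<^sup>+z. ennreal (fst z) * ?e (polar (fst z) (snd z)) \<partial>polar_rect a b) / 2"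
  proof -
    have "energy (annulus a b) u = (\<integral>\<^sup>+x. ?e x \<partial>?X) / 2"
      unfolding energy_def g_def[symmetric]
      by (rule arg_cong[where f = "\<lambda>x. x / 2"], rule nn_integral_cong_AE) (use uv gG in eventually_elim, simp)
    then show ?thesis by (subst (asm) nn_integral_annulus_polar[OF ab]) measurable
  qed
  have em: "(\<lambda>z. ennreal (fst z) * ?e (polar (fst z) (snd z))) \<in> borel_measurable (polar_rect a b)"
    by (rule measurable_polar_rect) measurable
  have efin: "(\<integral>\<^sup>+z. ennreal (fst z) * ?e (polar (fst z) (snd z)) \<partial>polar_rect a b) < \<infinity>"
    using en unfolding e by (simp add: ennreal_divide_eq_top_iff less_top[symmetric])
  \<comment> \<open>Determinant 1 forces a nonzero gradient, so at a zero of the map the quotient in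
    \<open>ennreal\<close> is infinite. Finite energy admits this only on a null set.\<close>
  have nz: "AE z in polar_rect a b. V z \<noteq> 0"
    using nn_integral_PInf_AE[OF em less_imp_neq[OF efin]] detG AE_polar_rect[of a b 0 "2 * pi"]
  proof eventually_elim
    case (elim z)
    then have "G (polar (fst z) (snd z)) \<noteq> 0" by (auto simp: det_2)
    moreover have "fst z > 0" using elim ab by auto
    ultimately show ?case using elim(1) nV[of z]
      by (auto simp: ennreal_mult_eq_top_iff ennreal_divide_eq_top_iff)
  qed
  let ?f = "\<lambda>z. polar_density V Vr Vt z"
  have fm: "?f \<in> borel_measurable (polar_rect a b)"
    by (rule measurable_polar_rect) (use Vb in measurable)
  have f0: "AE z in polar_rect a b. 0 \<le> ?f z"
    using AE_polar_rect[of a b 0 "2 * pi"] by eventually_elim (use ab in auto)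
  have ef: "AE z in polar_rect a b. ennreal (fst z) * ?e (polar (fst z) (snd z)) = ennreal (?f z)"
    using nz AE_polar_rect[of a b 0 "2 * pi"]
  proof eventually_elim
    case (elim z)
    let ?x = "polar (fst z) (snd z)"
    have p: "fst z > 0" "norm (v ?x) > 0" using elim ab nV[of z] by auto
    have "?f z = ((fst z)\<^sup>2 * (norm (Vr z))\<^sup>2 + (norm (Vt z))\<^sup>2) / (fst z * (norm (v ?x))\<^sup>2)"
      using p by (simp add: norm_divide power_divide nV field_simps power2_eq_square)
    also have "\<dots> = fst z * ((norm (G ?x))\<^sup>2 / (norm (v ?x))\<^sup>2)"
      unfolding Vr_def Vt_def polar_parts(1) using p by (simp add: divide_simps power2_eq_square)
    finally show ?case using p by (simp add: ennreal_mult'[symmetric] divide_ennreal)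
  qed
  have fnn: "(\<integral>\<^sup>+z. ennreal (?f z) \<partial>polar_rect a b) = (\<integral>\<^sup>+z. ennreal (fst z) * ?e (polar (fst z) (snd z)) \<partial>polar_rect a b)"
    by (rule nn_integral_cong_AE) (use ef in eventually_elim, simp)
  have fi: "integrable (polar_rect a b) ?f"
    by (rule integrableI_nonneg[OF fm f0]) (use efin fnn in simp)
  have E: "energy (annulus a b) u = ennreal ((LINT z|polar_rect a b. ?f z) / 2)"
    unfolding e fnn[symmetric] nn_integral_eq_integral[OF fi f0]
    using integral_nonneg_AE[OF f0] by (simp add: ennreal_divide_numeral)
  have fin: "integrable (polar_rect a b) (\<lambda>z. (norm (Vr z / V z))\<^sup>2)" "integrable (polar_rect a b) (\<lambda>z. (norm (Vt z / V z))\<^sup>2)"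
  proof -
    show "integrable (polar_rect a b) (\<lambda>z. (norm (Vr z / V z))\<^sup>2)"
    proof (rule Bochner_Integration.integrable_bound)
      show "integrable (polar_rect a b) (\<lambda>z. ?f z / a)" using fi by simp
      show "(\<lambda>z. (norm (Vr z / V z))\<^sup>2) \<in> borel_measurable (polar_rect a b)"
        by (rule measurable_polar_rect) (use Vb in measurable)
      show "AE z in polar_rect a b. norm ((norm (Vr z / V z))\<^sup>2) \<le> norm (?f z / a)"
        using AE_polar_rect[of a b 0 "2 * pi"]
      proof eventually_elim
        case (elim z)
        have "a * (norm (Vr z / V z))\<^sup>2 \<le> fst z * (norm (Vr z / V z))\<^sup>2" using elim by (intro mult_right_mono) auto
        moreover have "0 \<le> (norm (Vt z / V z))\<^sup>2 / fst z" using elim ab by auto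
        ultimately have "a * (norm (Vr z / V z))\<^sup>2 \<le> ?f z" by linarith
        then have "(norm (Vr z / V z))\<^sup>2 \<le> ?f z / a" using ab by (simp only: pos_le_divide_eq mult.commute)
        also have "\<dots> \<le> \<bar>?f z / a\<bar>" by (rule abs_ge_self)
        finally show ?case by simp
      qed
    qed
    show "integrable (polar_rect a b) (\<lambda>z. (norm (Vt z / V z))\<^sup>2)"
    proof (rule Bochner_Integration.integrable_bound)
      show "integrable (polar_rect a b) (\<lambda>z. b * ?f z)" using fi by simp
      show "(\<lambda>z. (norm (Vt z / V z))\<^sup>2) \<in> borel_measurable (polar_rect a b)"
        by (rule measurable_polar_rect) (use Vb in measurable)
      show "AE z in polar_rect a b. norm ((norm (Vt z / V z))\<^sup>2) \<le> norm (b * ?f z)"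
        using AE_polar_rect[of a b 0 "2 * pi"]
      proof eventually_elim
        case (elim z)
        then have p: "fst z > 0" using ab by auto
        have 0: "0 \<le> (norm (Vt z / V z))\<^sup>2 / fst z" using p by auto
        have "(norm (Vt z / V z))\<^sup>2 = fst z * ((norm (Vt z / V z))\<^sup>2 / fst z)" using p by simp
        also have "\<dots> \<le> b * ((norm (Vt z / V z))\<^sup>2 / fst z)" using elim 0 by (intro mult_right_mono) auto
        also have "\<dots> \<le> b * ?f z" using ab p by (intro mult_left_mono) auto
        also have "\<dots> \<le> \<bar>b * ?f z\<bar>" by (rule abs_ge_self)
        finally show ?case by simp
      qed
    qed
  qed
  obtain W Wr Wt Wrt M where "polar_map a b V Vr Vt W Wr Wt Wrt M"
    using polar_map_exists[OF ab m L2V L2Vr L2Vt polar_regular_pol[OF w] lim bdry[of a] bdry[of b] detV nz fin] by auto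
  from that[OF this v uv V_def fi E] show thesis .
qed

text \<open>The class prescribes the degree on every ray, so one ray on which it equals
  \<open>winding\<close> decides. The lower bound for the modulus holds because the continuous
  representative takes values in the closed annulus.\<close>

lemma homotopy_class_winding:
  assumes ab: "0 < a" "a < b" and u: "u \<in> homotopy_class a b k"
    and P: "polar_map a b V Vr Vt W Wr Wt Wrt M"
    and v: "AE x in lebesgue_on (annulus a b). u x = v x" and V: "V = (\<lambda>z. to_complex (v (polar (fst z) (snd z))))"
  shows "polar_map.winding a b V Vr W Wr M = k" "AE z in polar_rect a b. a \<le> norm (V z)"
proof -
  interpret P: polar_map a b V Vr Vt W Wr Wt Wrt M by (rule P)
  obtain f where f: "continuous_rep a b u f" "\<And>t. degree_on_ray a b f t = of_int k"
    using u unfolding homotopy_class_def by blast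
  have fu: "AE x in lebesgue_on (annulus a b). f x = u x"
    using f(1) unfolding continuous_rep_def by blast
  have "AE x in lebesgue_on (annulus a b). f x = v x"
    using fu v by eventually_elim simp
  from AE_annulus_polar[OF ab this]
  have Vf: "AE z in polar_rect a b. V z = to_complex (f (polar (fst z) (snd z)))"
    by eventually_elim (simp add: V)
  have "continuous_on {x. a \<le> norm x \<and> norm x \<le> b} f"
    using f(1) unfolding continuous_rep_def closure_annulus[OF ab] by blast
  from P.degree_eq_winding[OF this Vf] obtain t where "degree_on_ray a b f t = of_int P.winding" by blast
  then show "P.winding = k" using f(2)[of t] by simp
  show "AE z in polar_rect a b. a \<le> norm (V z)"
    using Vf AE_polar_rect[of a b 0 "2 * pi"]
  proof eventually_elim
    case (elim z)
    have "polar (fst z) (snd z) \<in> closure (annulus a b)"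
      using elim ab by (simp add: closure_annulus[OF ab] norm_polar)
    then have "f (polar (fst z) (snd z)) \<in> closure (annulus a b)"
      using f(1) unfolding continuous_rep_def by blast
    then show ?case using elim by (simp add: closure_annulus[OF ab] norm_to_complex)
  qed
qed

section \<open>The infimum and the stability of minimisers\<close>

lemma twist_energy_le_energy:
  assumes ab: "0 < a" "a < b" and u: "u \<in> homotopy_class a b k"
  shows "ennreal (twist_energy a b k) \<le> energy (annulus a b) u"
proof (cases "energy (annulus a b) u < \<infinity>")
  case True
  have ua: "u \<in> admissible a b" using u by (simp add: homotopy_class_def)
  obtain v V Vr Vt W Wr Wt Wrt M where P: "polar_map a b V Vr Vt W Wr Wt Wrt M"
    and v: "AE x in lebesgue_on (annulus a b). u x = v x" and V: "V = (\<lambda>z. to_complex (v (polar (fst z) (snd z))))"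
    and E: "energy (annulus a b) u = ennreal ((LINT z|polar_rect a b. polar_density V Vr Vt z) / 2)"
    by (rule admissible_polar_map[OF ab ua True]) (rule that; assumption)
  show ?thesis
    unfolding E using polar_map.twist_energy_le[OF P] homotopy_class_winding(1)[OF ab u P v V]
    by (intro ennreal_leI) simp
qed (simp add: less_top[symmetric])

lemma INF_energy_homotopy_class:
  assumes "0 < a" "a < b"
  shows "(INF v \<in> homotopy_class a b k. energy (annulus a b) v) = ennreal (twist_energy a b k)"
proof (rule antisym)
  show "(INF v \<in> homotopy_class a b k. energy (annulus a b) v) \<le> ennreal (twist_energy a b k)"
    using INF_lower[OF minimiser_homotopy_class[OF assms, of k], of "energy (annulus a b)"]
    unfolding energy_minimiser[OF assms] .
qed (intro INF_greatest twist_energy_le_energy assms)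

lemma integral_radial_le:
  assumes P: "polar_map a b V Vr Vt W Wr Wt Wrt M"
    and i: "integrable (polar_rect a b) (\<lambda>z. polar_density V Vr Vt z)"
  shows "a * (LINT z|polar_rect a b. (norm (Vr z / V z))\<^sup>2) \<le> (LINT z|polar_rect a b. polar_density V Vr Vt z)"
proof -
  interpret P: polar_map a b V Vr Vt W Wr Wt Wrt M by (rule P)
  have "(LINT z|polar_rect a b. a * (norm (Vr z / V z))\<^sup>2) \<le> (LINT z|polar_rect a b. polar_density V Vr Vt z)"
  proof (rule integral_mono_AE[OF _ i])
    show "integrable (polar_rect a b) (\<lambda>z. a * (norm (Vr z / V z))\<^sup>2)" using P.fin(1) by simp
    show "AE z in polar_rect a b. a * (norm (Vr z / V z))\<^sup>2 \<le> polar_density V Vr Vt z"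
      using AE_polar_rect[of a b 0 "2 * pi"]
    proof eventually_elim
      case (elim z)
      have "a * (norm (Vr z / V z))\<^sup>2 \<le> fst z * (norm (Vr z / V z))\<^sup>2" using elim by (intro mult_right_mono) auto
      moreover have "0 \<le> (norm (Vt z / V z))\<^sup>2 / fst z" using elim P.ab by auto
      ultimately show ?case by linarith
    qed
  qed
  then show ?thesis by simp
qed

lemma integral_norm_diff_le_L1_dist:
  assumes ab: "0 < a" "a < b" and m: "v1 \<in> borel_measurable borel" "v2 \<in> borel_measurable borel"
    and u: "AE x in lebesgue_on (annulus a b). u1 x = v1 x" "AE x in lebesgue_on (annulus a b). u2 x = v2 x"
    and V: "V1 = (\<lambda>z. to_complex (v1 (polar (fst z) (snd z))))" "V2 = (\<lambda>z. to_complex (v2 (polar (fst z) (snd z))))"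
    and d: "L1_dist (lebesgue_on (annulus a b)) u1 u2 < ennreal (a * d)"
  shows "(LINT z|polar_rect a b. norm (V1 z - V2 z)) < d"
proof -
  note m[measurable]
  let ?D = "LINT z|polar_rect a b. norm (V1 z - V2 z)"
  have "(\<integral>\<^sup>+x. ennreal (norm (v1 x - v2 x)) \<partial>lebesgue_on (annulus a b)) = L1_dist (lebesgue_on (annulus a b)) u1 u2"
    unfolding L1_dist_def by (rule nn_integral_cong_AE) (use u in eventually_elim, simp)
  moreover have "(\<integral>\<^sup>+z. ennreal (norm (V1 z - V2 z)) \<partial>polar_rect a b)
      \<le> ennreal (1 / a) * (\<integral>\<^sup>+x. ennreal (norm (v1 x - v2 x)) \<partial>lebesgue_on (annulus a b))"
    by (rule nn_integral_polar_rect_le[OF ab])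
       (auto simp: V norm_to_complex linear_diff[OF linear_to_complex, symmetric])
  ultimately have "(\<integral>\<^sup>+z. ennreal (norm (V1 z - V2 z)) \<partial>polar_rect a b) \<le> ennreal (1 / a) * L1_dist (lebesgue_on (annulus a b)) u1 u2"
    by simp
  also have "\<dots> < ennreal (1 / a) * ennreal (a * d)" using d ab by (intro ennreal_mult_strict_left_mono) auto
  also have "\<dots> = ennreal d" using ab by (simp add: ennreal_mult'[symmetric])
  finally have less: "(\<integral>\<^sup>+z. ennreal (norm (V1 z - V2 z)) \<partial>polar_rect a b) < ennreal d" .
  have "?D = enn2real (\<integral>\<^sup>+z. ennreal (norm (V1 z - V2 z)) \<partial>polar_rect a b)"
    by (rule integral_eq_nn_integral) (auto simp: V intro!: measurable_polar_rect)
  moreover have "enn2real x < d" if "x < ennreal d" for x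
    using that by (cases x) (auto simp: ennreal_less_iff)
  ultimately show ?thesis using less by simp
qed

theorem theorem3p1:
  fixes a b :: real and k :: int
  assumes "0 < a" and "a < b"
  shows "(\<exists>u \<in> homotopy_class a b k.
            energy (annulus a b) u = (INF v \<in> homotopy_class a b k. energy (annulus a b) v)) \<and>
         (\<forall>u \<in> homotopy_class a b k.
            energy (annulus a b) u = (INF v \<in> homotopy_class a b k. energy (annulus a b) v) \<longrightarrow>
            (\<exists>\<delta>::real. \<delta> > 0 \<and>
               (\<forall>v \<in> admissible a b.
                  L1_dist (lebesgue_on (annulus a b)) u v < ennreal \<delta> \<longrightarrow>
                  energy (annulus a b) u \<le> energy (annulus a b) v)))"
proof (intro conjI ballI impI)
  note ab = assms
  show "\<exists>u \<in> homotopy_class a b k. energy (annulus a b) u = (INF v \<in> homotopy_class a b k. energy (annulus a b) v)"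
    using minimiser_homotopy_class[OF ab] energy_minimiser[OF ab] unfolding INF_energy_homotopy_class[OF ab] by blast
  fix u assume u: "u \<in> homotopy_class a b k"
    and "energy (annulus a b) u = (INF v \<in> homotopy_class a b k. energy (annulus a b) v)"
  then have Eu: "energy (annulus a b) u = ennreal (twist_energy a b k)" unfolding INF_energy_homotopy_class[OF ab] by simp
  define E where "E = twist_energy a b k"
  have E: "E > 0"
    unfolding E_def twist_energy_def using ab by (intro mult_pos_pos) (auto simp: add_pos_nonneg)
  \<comment> \<open>The density integrates to twice the energy and dominates \<open>a\<close> times
    the squared radial logarithmic derivative, so each of two maps of energy at most
    \<open>E\<close> contributes at most \<open>2 E / a\<close>.\<close>
  define S where "S = 4 * E / a"
  have S: "S > 0" using E ab by (simp add: S_def)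
  \<comment> \<open>The threshold below which the windings agree, with \<open>a\<close> as the lower
    bound for the modulus of \<open>u\<close>.\<close>
  define d where "d = 2 * pi ^ 4 * a / S"
  have d: "d > 0" using S ab by (simp add: d_def)
  have ua: "u \<in> admissible a b" using u by (simp add: homotopy_class_def)
  have ufin: "energy (annulus a b) u < \<infinity>" unfolding Eu by simp
  obtain u' U Ur Ut W Wr Wt Wrt M where P: "polar_map a b U Ur Ut W Wr Wt Wrt M"
    and u': "u' \<in> borel_measurable borel" "AE x in lebesgue_on (annulus a b). u x = u' x" and U: "U = (\<lambda>z. to_complex (u' (polar (fst z) (snd z))))"
    and Ui: "integrable (polar_rect a b) (\<lambda>z. polar_density U Ur Ut z)"
    and EU: "energy (annulus a b) u = ennreal ((LINT z|polar_rect a b. polar_density U Ur Ut z) / 2)"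
    by (rule admissible_polar_map[OF ab ua ufin]) (rule that; assumption)
  note wu = homotopy_class_winding[OF ab u P u'(2) U]
  show "\<exists>\<delta>::real. \<delta> > 0 \<and> (\<forall>v \<in> admissible a b. L1_dist (lebesgue_on (annulus a b)) u v < ennreal \<delta> \<longrightarrow>
      energy (annulus a b) u \<le> energy (annulus a b) v)"
  \<comment> \<open>The factor \<open>a\<close> converts between integrals over the annulus and over
    the parameter rectangle. The resulting radius depends on \<open>a\<close>, \<open>b\<close> and
    \<open>k\<close> alone.\<close>
  proof (intro exI[of _ "a * d"] conjI ballI impI)
    show "a * d > 0" using d ab by simp
    fix v assume v: "v \<in> admissible a b" and close: "L1_dist (lebesgue_on (annulus a b)) u v < ennreal (a * d)"
    show "energy (annulus a b) u \<le> energy (annulus a b) v"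
    \<comment> \<open>Only a competitor with less energy than \<open>u\<close> has to be excluded,
      and for such a map \<open>E\<close> bounds the energy; this is why \<open>d\<close> could be
      chosen beforehand.\<close>
    proof (rule ccontr)
      assume "\<not> energy (annulus a b) u \<le> energy (annulus a b) v"
      then have less: "energy (annulus a b) v < ennreal E" unfolding Eu E_def by simp
      then have vfin: "energy (annulus a b) v < \<infinity>" by (rule less_trans) simp
      obtain v' V Vr Vt Q Qr Qt Qrt N where P': "polar_map a b V Vr Vt Q Qr Qt Qrt N"
        and v': "v' \<in> borel_measurable borel" "AE x in lebesgue_on (annulus a b). v x = v' x" and V: "V = (\<lambda>z. to_complex (v' (polar (fst z) (snd z))))"
        and Vi: "integrable (polar_rect a b) (\<lambda>z. polar_density V Vr Vt z)"
        and EV: "energy (annulus a b) v = ennreal ((LINT z|polar_rect a b. polar_density V Vr Vt z) / 2)"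
        by (rule admissible_polar_map[OF ab v vfin]) (rule that; assumption)
      have "ennreal ((LINT z|polar_rect a b. polar_density U Ur Ut z) / 2) \<le> ennreal E"
        using EU Eu by (simp add: E_def)
      then have "(LINT z|polar_rect a b. polar_density U Ur Ut z) \<le> 2 * E"
        using E by (simp add: ennreal_le_iff)
      with integral_radial_le[OF P Ui] have 1: "a * (LINT z|polar_rect a b. (norm (Ur z / U z))\<^sup>2) \<le> 2 * E" by linarith
      have LV: "(LINT z|polar_rect a b. polar_density V Vr Vt z) < 2 * E"
      proof (rule ccontr)
        assume "\<not> ?thesis"
        then have "E \<le> (LINT z|polar_rect a b. polar_density V Vr Vt z) / 2" by linarith
        from ennreal_leI[OF this] less show False unfolding EV by simp
      qed
      with integral_radial_le[OF P' Vi] have 2: "a * (LINT z|polar_rect a b. (norm (Vr z / V z))\<^sup>2) \<le> 2 * E" by linarith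
      have "polar_map.winding a b U Ur W Wr M = polar_map.winding a b V Vr Q Qr N"
      proof (rule winding_eq_if_close[OF P' P wu(2) ab(1) _ S, symmetric])
        show "(LINT z|polar_rect a b. (norm (Vr z / V z))\<^sup>2) + (LINT z|polar_rect a b. (norm (Ur z / U z))\<^sup>2) \<le> S"
          using 1 2 ab by (simp add: S_def pos_le_divide_eq algebra_simps)
        have "(LINT z|polar_rect a b. norm (U z - V z)) < d"
          by (rule integral_norm_diff_le_L1_dist[OF ab u'(1) v'(1) u'(2) v'(2) U V close])
        then show "(LINT z|polar_rect a b. norm (V z - U z)) < 2 * pi ^ 4 * a / S"
          by (simp add: d_def norm_minus_commute)
      qed
      then have "polar_map.winding a b V Vr Q Qr N = k" using wu(1) by simp
      with polar_map.twist_energy_le[OF P'] LV show False by (simp add: E_def)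
    qed
  qed
qed

end
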